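(* There exists a polynomial-time $k/2$-approximation algorithm for \textsc{Mono-MSCA}: given a finite set $N$ with $|N|=n$, an integer $k\ge 2$, and monotone submodular functions $f_1,\ldots,f_k:2^N\to\mathbb{R}_+$ with $f_i(\emptyset)=0$ given by evaluation oracles, the algorithm outputs a partition $U_1,\ldots,U_k$ of $N$ (parts possibly empty) with \[ \sum_{i=1}^k f_i(U_i)\le \frac{k}{2}\cdot\min\Big\{\sum_{i=1}^k f_i(X_i)\ \Big|\ X_1,\ldots,X_k \text{ is a partition of } N\Big\}. \]
   Context: $[k]=\{1,\ldots,k\}$. A set function $f$ is submodular if $f(S)+f(T)\ge f(S\cup T)+f(S\cap T)$ for all $S,T\subseteq N$, and monotone if $f(S)\le f(T)$ whenever $S\subseteq T$. An evaluation oracle for $f_i$ returns $f_i(S)$ for any queried $S\subseteq N$. \textsc{Mono-MSCA} (minimum submodular cost allocation with monotone functions) is the problem of finding a partition $X_1,\ldots,X_k$ of $N$ minimizing $\sum_{i=1}^k f_i(X_i)$. *)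

theory Defs
  imports Complex_Main "HOL-Library.Disjoint_Sets" "HOL-Computational_Algebra.Polynomial"
begin

section \<open>Minimum submodular cost allocation\<close>

definition submodular_on :: "'a set \<Rightarrow> ('a set \<Rightarrow> real) \<Rightarrow> bool" where
  "submodular_on N f \<longleftrightarrow> (\<forall>S T. S \<subseteq> N \<and> T \<subseteq> N \<longrightarrow> f S + f T \<ge> f (S \<union> T) + f (S \<inter> T))"

definition mono_msca_instance :: "'a set \<Rightarrow> nat \<Rightarrow> (nat \<Rightarrow> 'a set \<Rightarrow> real) \<Rightarrow> bool" where
  "mono_msca_instance N k f \<longleftrightarrow> finite N \<and> k \<ge> 2 \<and>
     (\<forall>i\<in>{1..k}. (\<forall>S\<subseteq>N. f i S \<ge> 0) \<and> f i {} = 0 \<and> mono_on (Pow N) (f i) \<and> submodular_on N (f i))"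

definition allocation :: "'a set \<Rightarrow> nat \<Rightarrow> (nat \<Rightarrow> 'a set) \<Rightarrow> bool" where
  "allocation N k X \<longleftrightarrow> (\<Union>i\<in>{1..k}. X i) = N \<and> disjoint_family_on X {1..k}"

definition allocation_cost :: "nat \<Rightarrow> (nat \<Rightarrow> 'a set \<Rightarrow> real) \<Rightarrow> (nat \<Rightarrow> 'a set) \<Rightarrow> real" where
  "allocation_cost k f X = (\<Sum>i=1..k. f i (X i))"

definition msca_opt :: "'a set \<Rightarrow> nat \<Rightarrow> (nat \<Rightarrow> 'a set \<Rightarrow> real) \<Rightarrow> real" where
  "msca_opt N k f = Min {allocation_cost k f X | X. allocation N k X}"

section \<open>Algorithms with evaluation oracles\<close>

text \<open>
  The oracles return arbitrary real numbers, so running time is measured in the real RAM model: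
  arithmetic operations and comparisons on reals (without rounding) and oracle calls have unit
  cost. Algorithms are programs of a WHILE language with two disjoint kinds of memory cells,
  holding natural numbers (for control and indexing) and reals. Cells are entries of
  multi-dimensional arrays: a name together with a list of indices, where the empty list of
  indices gives a scalar variable.

  A program is a finite object whose only constants are natural numbers, so that no
  information can be hidden in real constants. Natural numbers have addition and truncated
  subtraction only, so after \<open>t\<close> steps they have \<open>O(t + log (n + k))\<close> bits and the unit cost of operations on
  them is not exploitable.
\<close>

datatype nexp =
    NConst nat
  | NCell string "nexp list"
  | NAdd nexp nexp
  | NSub nexp nexp

datatype rexp =
    RNat nexp
  | RCell string "nexp list"
  | RAdd rexp rexp
  | RSub rexp rexp
  | RMul rexp rexp
  | RDiv rexp rexp

datatype bexp =
    NLess nexp nexp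
  | RLess rexp rexp
  | BNot bexp
  | BAnd bexp bexp

text \<open>
  \<open>Query x as i S bs\<close> stores in the real cell \<open>x[as]\<close> the value of the \<open>i\<close>-th oracle
  on the set of all \<open>j\<close> such that the cell \<open>S[bs, j]\<close> is nonzero.
\<close>

datatype com =
    Skip
  | NAssign string "nexp list" nexp
  | RAssign string "nexp list" rexp
  | Query string "nexp list" nexp string "nexp list"
  | Seq com com
  | If bexp com com
  | While bexp com

type_synonym nmem = "string \<Rightarrow> nat list \<Rightarrow> nat"
type_synonym rmem = "string \<Rightarrow> nat list \<Rightarrow> real"
type_synonym state = "nmem \<times> rmem"
type_synonym eval_oracle = "nat \<Rightarrow> nat set \<Rightarrow> real"

definition upd :: "(string \<Rightarrow> nat list \<Rightarrow> 'v) \<Rightarrow> string \<Rightarrow> nat list \<Rightarrow> 'v \<Rightarrow> string \<Rightarrow> nat list \<Rightarrow> 'v" where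
  "upd m x as v = m(x := (m x)(as := v))"

fun nval :: "nmem \<Rightarrow> nexp \<Rightarrow> nat" where
  "nval m (NConst c) = c"
| "nval m (NCell x es) = m x (map (nval m) es)"
| "nval m (NAdd a b) = nval m a + nval m b"
| "nval m (NSub a b) = nval m a - nval m b"

fun rval :: "state \<Rightarrow> rexp \<Rightarrow> real" where
  "rval s (RNat a) = real (nval (fst s) a)"
| "rval s (RCell x es) = snd s x (map (nval (fst s)) es)"
| "rval s (RAdd a b) = rval s a + rval s b"
| "rval s (RSub a b) = rval s a - rval s b"
| "rval s (RMul a b) = rval s a * rval s b"
| "rval s (RDiv a b) = rval s a / rval s b"

fun bval :: "state \<Rightarrow> bexp \<Rightarrow> bool" where
  "bval s (NLess a b) \<longleftrightarrow> nval (fst s) a < nval (fst s) b"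
| "bval s (RLess a b) \<longleftrightarrow> rval s a < rval s b"
| "bval s (BNot b) \<longleftrightarrow> \<not> bval s b"
| "bval s (BAnd b c) \<longleftrightarrow> bval s b \<and> bval s c"

text \<open>
  \<open>exec F c s t s'\<close>: with oracles \<open>F\<close>, program \<open>c\<close> started in state \<open>s\<close> halts after \<open>t\<close> steps in
  state \<open>s'\<close>. Evaluating one of the finitely many expressions of a program is a
  constant number of operations and counts as one step.
\<close>

inductive exec :: "eval_oracle \<Rightarrow> com \<Rightarrow> state \<Rightarrow> nat \<Rightarrow> state \<Rightarrow> bool" for F :: eval_oracle where
  Skip: "exec F Skip s 1 s"
| NAssign: "exec F (NAssign x es a) (m, r) 1 (upd m x (map (nval m) es) (nval m a), r)"
| RAssign: "exec F (RAssign x es a) (m, r) 1 (m, upd r x (map (nval m) es) (rval (m, r) a))"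
| Query: "exec F (Query x es i S bs) (m, r) 1
            (m, upd r x (map (nval m) es) (F (nval m i) {j. m S (map (nval m) bs @ [j]) \<noteq> 0}))"
| Seq: "exec F c s t s' \<Longrightarrow> exec F d s' t' s'' \<Longrightarrow> exec F (Seq c d) s (t + t') s''"
| IfTrue: "bval s b \<Longrightarrow> exec F c s t s' \<Longrightarrow> exec F (If b c d) s (t + 1) s'"
| IfFalse: "\<not> bval s b \<Longrightarrow> exec F d s t s' \<Longrightarrow> exec F (If b c d) s (t + 1) s'"
| WhileFalse: "\<not> bval s b \<Longrightarrow> exec F (While b c) s 1 s"
| WhileTrue: "bval s b \<Longrightarrow> exec F c s t s' \<Longrightarrow> exec F (While b c) s' t' s'' \<Longrightarrow>
    exec F (While b c) s (t + t' + 1) s''"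

lemma exec_deterministic:
  "exec F c s t s' \<Longrightarrow> exec F c s u s'' \<Longrightarrow> t = u \<and> s' = s''"
proof (induction arbitrary: u s'' rule: exec.induct)
  case (Seq c s t s' d t' s3)
  from Seq.prems show ?case by cases (use Seq.IH in blast)
next
  case (IfTrue s b c t s' d)
  from IfTrue.prems show ?case by cases (use IfTrue in blast)+
next
  case (IfFalse s b d t s' c)
  from IfFalse.prems show ?case by cases (use IfFalse in blast)+
next
  case (WhileFalse s b c)
  from WhileFalse.prems show ?case by cases (use WhileFalse in blast)+
next
  case (WhileTrue s b c t s' t' s3)
  from WhileTrue.prems show ?case by cases (use WhileTrue in blast)+
qed (auto elim: exec.cases)

text \<open>
  The ground set \<open>N\<close> is presented to a program through an enumeration \<open>e\<close> of its elements by
  \<open>0, \<dots>, n - 1\<close>. The program finds \<open>n\<close> and \<open>k\<close> in two scalar variables and has access to the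
  functions \<open>f\<^sub>1, \<dots>, f\<^sub>k\<close> only by queries. It describes its output by an array \<open>U\<close>, where
  \<open>U[i, j]\<close> is nonzero iff the element number \<open>j\<close> belongs to the \<open>i\<close>-th set.
\<close>

definition instance_oracle :: "nat \<Rightarrow> (nat \<Rightarrow> 'a) \<Rightarrow> (nat \<Rightarrow> 'a set \<Rightarrow> real) \<Rightarrow> eval_oracle" where
  "instance_oracle n e f i J = f i (e ` (J \<inter> {..<n}))"

definition input_state :: "nat \<Rightarrow> nat \<Rightarrow> state" where
  "input_state n k = (upd (upd (\<lambda>_ _. 0) ''n'' [] n) ''k'' [] k, \<lambda>_ _. 0)"

definition output_sets :: "nat \<Rightarrow> (nat \<Rightarrow> 'a) \<Rightarrow> state \<Rightarrow> nat \<Rightarrow> 'a set" where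
  "output_sets n e s i = e ` {j. j < n \<and> fst s ''U'' [i, j] \<noteq> 0}"

end

theory Submission
  imports Defs
begin

text \<open>
  The convex relaxation assigns to every element \<open>v\<close> a distribution \<open>x\<^sub>1(v), \<dots>, x\<^sub>k(v)\<close> over the functions
  and has the sum of the Lovasz extensions as its objective. It is a zero-sum game between these distributions and
  vertices of the base polytopes: multiplicative weights against greedy responses solve it up to a
  relative error \<open>1 / poly(n, k)\<close> in polynomially many rounds, without any dependence on the magnitude
  of the values. An approximate solution suffices for exact results.

  For \<open>k \<ge> 3\<close>, the level sets \<open>{v. x\<^sub>i(v) > \<theta>\<^sub>i}\<close> cover all elements whenever the thresholds sum to less than \<open>1\<close>, and
  thresholds that are uniform on \<open>[0, 2/k]\<close> with constant sum lose a factor \<open>k / 2\<close> on average.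
  As the level sets of \<open>x\<^sub>1\<close> change at most \<open>n\<close> times, some interval of values of \<open>\<theta>\<^sub>1\<close> is redundant; the other thresholds
  can be raised there, which gains a factor \<open>1 - 1 / poly(n, k)\<close> and absorbs the error of the
  relaxation. The best thresholds are found by dynamic programming.

  For \<open>k = 2\<close> the problem is minimization of the submodular function \<open>f(X) = f\<^sub>1(X) + f\<^sub>2(N - X)\<close>. An approximate dual
  solution whose entry at \<open>v\<close> exceeds the error in absolute value decides membership of \<open>v\<close> in every minimizer.
  If there is no such entry, \<open>f\<close> is nearly constant on an interval of sets, and an element with the largest marginal
  value yields such an entry after contracting or deleting it, hence an implication
  between two elements that all minimizers satisfy. The function is then restricted to the sets closed under the known
  implications, and after at most \<open>(n + 2)\<^sup>2\<close> rounds it is constant on them.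
\<close>

section \<open>Total correctness with step bounds\<close>

text \<open>Two obstacles shape the proof. Real values have no bit length, so the running time may
  not depend on ratios of values; and the guarantee is exactly k/2, so a fractional solution with a
  relative error would by itself give only k/2 + \<epsilon>. The factor k/2 is the density of a
  threshold that is uniform on [0, 2/k]: its mean is 1/k, so k of them can sum to 1, and the
  expected cost is at most k/2 times the integral of the costs of the level sets. Thresholds live on
  a grid of \<open>q = k * H + 1\<close> values. A block in which the costs of one function do not
  change lets its threshold drop by \<open>l\<close> for free, so that another one can rise by
  \<open>l\<close>. The resulting relative gain is of order l / (N k H), and \<open>m\<close> and
  \<open>l\<close> are chosen such that it outweighs the error of the solver and that of the grid.
  Two thresholds with constant sum determine each other, so the exchange needs k \<ge> 3; for k = 2
  the factor is 1 and the problem has to be solved exactly.\<close>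

fun wr :: "com \<Rightarrow> string set" where
  "wr Skip = {}"
| "wr (NAssign x es a) = {x}"
| "wr (RAssign x es a) = {x}"
| "wr (Query x es i S bs) = {x}"
| "wr (Seq c d) = wr c \<union> wr d"
| "wr (If b c d) = wr c \<union> wr d"
| "wr (While b c) = wr c"

text \<open>Every loop is charged with \<open>Z\<close> iterations, so that the bound is a polynomial in \<open>Z\<close> for each program.\<close>

fun steps_bound :: "nat \<Rightarrow> com \<Rightarrow> nat" where
  "steps_bound Z (Seq c d) = steps_bound Z c + steps_bound Z d"
| "steps_bound Z (If b c d) = steps_bound Z c + steps_bound Z d + 1"
| "steps_bound Z (While b c) = Z * (steps_bound Z c + 1) + 1"
| "steps_bound Z c = 1"

text \<open>\<open>W\<close> consists of names, so a whole array counts as written as soon as one of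
  its cells may be. Frame facts then follow from the program text alone, by
  \<open>wr\<close>.\<close>

definition agree :: "string set \<Rightarrow> state \<Rightarrow> state \<Rightarrow> bool" where
  "agree W s s' \<longleftrightarrow> (\<forall>x. x \<notin> W \<longrightarrow> fst s' x = fst s x \<and> snd s' x = snd s x)"

lemma agree_refl [simp]: "agree W s s"
  by (simp add: agree_def)

lemma agree_mono: "agree W s s' \<Longrightarrow> W \<subseteq> W' \<Longrightarrow> agree W' s s'"
  by (auto simp: agree_def)

lemma exec_agree: "exec F c s t s' \<Longrightarrow> agree (wr c) s s'"
proof (induction rule: exec.induct)
  case (Seq c s t s' d t' s'')
  then show ?case by (auto simp: agree_def)
next
  case (WhileTrue s b c t s' t' s'')
  then show ?case by (auto simp: agree_def)
qed (auto simp: agree_def upd_def)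

text \<open>Termination, step bound and postcondition in one predicate. The bound depends only on
  the program text and on \<open>Z\<close>, so programs are verified below without counting steps;
  only the bounds of loops have to be compared with \<open>Z\<close>.\<close>

definition run :: "eval_oracle \<Rightarrow> nat \<Rightarrow> com \<Rightarrow> state \<Rightarrow> (state \<Rightarrow> bool) \<Rightarrow> bool" where
  "run F Z c s Q \<longleftrightarrow> (\<exists>t s'. exec F c s t s' \<and> t \<le> steps_bound Z c \<and> Q s')"

lemma run_conseq:
  assumes "run F Z c s P" and "\<And>s'. agree (wr c) s s' \<Longrightarrow> P s' \<Longrightarrow> Q s'"
  shows "run F Z c s Q"
  using assms exec_agree unfolding run_def by blast

lemma run_Skip: "Q s \<Longrightarrow> run F Z Skip s Q"
  unfolding run_def using exec.Skip[of F s] by (intro exI[of _ 1] exI[of _ s]) auto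

lemma run_NAssign:
  assumes "Q (upd (fst s) x (map (nval (fst s)) es) (nval (fst s) a), snd s)"
  shows "run F Z (NAssign x es a) s Q"
  unfolding run_def using assms exec.NAssign[of F x es a "fst s" "snd s"] by (intro exI) auto

lemma run_RAssign:
  assumes "Q (fst s, upd (snd s) x (map (nval (fst s)) es) (rval s a))"
  shows "run F Z (RAssign x es a) s Q"
  unfolding run_def using assms exec.RAssign[of F x es a "fst s" "snd s"] by (intro exI) auto

lemma run_Query:
  assumes "Q (fst s, upd (snd s) x (map (nval (fst s)) es)
     (F (nval (fst s) i) {j. fst s S (map (nval (fst s)) bs @ [j]) \<noteq> 0}))"
  shows "run F Z (Query x es i S bs) s Q"
  unfolding run_def using assms exec.Query[of F x es i S bs "fst s" "snd s"] by (intro exI) auto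

lemma run_Seq:
  assumes "run F Z c s (\<lambda>s'. run F Z d s' Q)"
  shows "run F Z (Seq c d) s Q"
proof -
  from assms obtain t s' t' s'' where "exec F c s t s'" "t \<le> steps_bound Z c"
    "exec F d s' t' s''" "t' \<le> steps_bound Z d" "Q s''"
    unfolding run_def by blast
  then show ?thesis unfolding run_def
    by (intro exI[of _ "t + t'"] exI[of _ s'']) (auto intro: exec.Seq)
qed

lemma run_If:
  assumes "bval s b \<Longrightarrow> run F Z c s Q" "\<not> bval s b \<Longrightarrow> run F Z d s Q"
  shows "run F Z (If b c d) s Q"
proof (cases "bval s b")
  case True
  with assms(1) obtain t s' where "exec F c s t s'" "t \<le> steps_bound Z c" "Q s'"
    unfolding run_def by blast
  with exec.IfTrue[OF True] show ?thesis unfolding run_def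
    by (intro exI[of _ "t + 1"] exI[of _ s']) simp
next
  case False
  with assms(2) obtain t s' where "exec F d s t s'" "t \<le> steps_bound Z d" "Q s'"
    unfolding run_def by blast
  with exec.IfFalse[OF False] show ?thesis unfolding run_def
    by (intro exI[of _ "t + 1"] exI[of _ s']) simp
qed

abbreviation ix :: "string \<Rightarrow> nexp" where "ix x \<equiv> NCell x []"

text \<open>The bound \<open>e\<close> is evaluated anew at every test, so a body has to preserve
  its value as well as the counter.\<close>

definition For :: "string \<Rightarrow> nexp \<Rightarrow> com \<Rightarrow> com" where
  "For x e c = Seq (NAssign x [] (NConst 0))
     (While (NLess (ix x) e) (Seq c (NAssign x [] (NAdd (ix x) (NConst 1)))))"

lemma wr_For [simp]: "wr (For x e c) = insert x (wr c)"
  by (auto simp: For_def)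

definition set_scalar :: "string \<Rightarrow> nat \<Rightarrow> state \<Rightarrow> state" where
  "set_scalar x v s = (upd (fst s) x [] v, snd s)"

text \<open>The body establishes \<open>I (Suc j)\<close> before the counter is incremented, so the
  invariant may not depend on the counter (\<open>invx\<close>); the body learns its value
  separately. \<open>bound\<close> asks that \<open>e\<close> keep the value \<open>B\<close> in all
  states that differ only in written names.\<close>

lemma run_For:
  assumes x: "x \<notin> wr c"
    and Z: "B \<le> Z"
    and bound: "\<And>s'. agree (insert x (wr c)) s s' \<Longrightarrow> nval (fst s') e = B"
    and inv0: "I 0 (set_scalar x 0 s)"
    and invx: "\<And>j s' v. I j s' \<Longrightarrow> I j (set_scalar x v s')"
    and body: "\<And>j s'. j < B \<Longrightarrow> agree (insert x (wr c)) s s' \<Longrightarrow> fst s' x [] = j \<Longrightarrow> I j s' \<Longrightarrow>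
       run F Z c s' (I (Suc j))"
  shows "run F Z (For x e c) s (\<lambda>s'. I B s' \<and> fst s' x [] = B)"
proof -
  let ?W = "insert x (wr c)" and ?b = "NLess (ix x) e"
  let ?c = "Seq c (NAssign x [] (NAdd (ix x) (NConst 1)))"
  let ?T = "steps_bound Z c + 1"
  \<comment> \<open>Induction on the number \<open>d\<close> of remaining iterations; each costs a
    test, the body and the increment.\<close>
  have loop: "\<exists>t s''. exec F (While ?b ?c) s' t s'' \<and> t \<le> d * (?T + 1) + 1 \<and> I B s'' \<and> fst s'' x [] = B"
    if "B = j + d" "agree ?W s s'" "fst s' x [] = j" "I j s'" for j d s'
    using that
  proof (induction d arbitrary: j s')
    case 0
    then have "\<not> bval s' ?b" using bound by simp
    then show ?case using 0 exec.WhileFalse by fastforce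
  next
    case (Suc d)
    then have b: "bval s' ?b" using bound by simp
    from body[of j s'] Suc.prems obtain t s1 where s1: "exec F c s' t s1" "t \<le> steps_bound Z c" "I (Suc j) s1"
      unfolding run_def by auto
    have x1: "fst s1 x [] = j"
      using exec_agree[OF s1(1)] x Suc.prems(3) by (simp add: agree_def)
    let ?s2 = "set_scalar x (Suc j) s1"
    have "exec F (NAssign x [] (NAdd (ix x) (NConst 1))) s1 1 ?s2"
      using exec.NAssign[of F x "[]" "NAdd (ix x) (NConst 1)" "fst s1" "snd s1"] x1
      by (simp add: set_scalar_def)
    with s1(1) have e: "exec F ?c s' (t + 1) ?s2" by (rule exec.Seq)
    have "agree ?W s ?s2"
      using exec_agree[OF e] Suc.prems(2) by (auto simp: agree_def)
    moreover have "fst ?s2 x [] = Suc j" by (simp add: set_scalar_def upd_def)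
    moreover have "I (Suc j) ?s2" using invx s1(3) .
    ultimately obtain t' s3 where s3: "exec F (While ?b ?c) ?s2 t' s3" "t' \<le> d * (?T + 1) + 1"
      "I B s3" "fst s3 x [] = B"
      using Suc.IH[of "Suc j" ?s2] Suc.prems(1) by auto
    have "exec F (While ?b ?c) s' (t + 1 + t' + 1) s3" using exec.WhileTrue[OF b e s3(1)] .
    moreover have "t + 1 + t' + 1 \<le> Suc d * (?T + 1) + 1" using s1(2) s3(2) by simp
    ultimately show ?case using s3 by blast
  qed
  have "agree ?W s (set_scalar x 0 s)" "fst (set_scalar x 0 s) x [] = 0"
    by (auto simp: set_scalar_def agree_def upd_def)
  from loop[OF _ this inv0, of B] obtain t s'' where w: "exec F (While ?b ?c) (set_scalar x 0 s) t s''"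
    "t \<le> B * (?T + 1) + 1" "I B s''" "fst s'' x [] = B" by auto
  have "exec F (NAssign x [] (NConst 0)) s 1 (set_scalar x 0 s)"
    using exec.NAssign[of F x "[]" "NConst 0" "fst s" "snd s"] by (simp add: set_scalar_def)
  from exec.Seq[OF this w(1)] have "exec F (For x e c) s (1 + t) s''" by (simp add: For_def)
  moreover have "B * (?T + 1) \<le> Z * (?T + 1)" using Z by (rule mult_right_mono) simp
  then have "1 + t \<le> steps_bound Z (For x e c)" using w(2) by (simp add: For_def)
  ultimately show ?thesis using w unfolding run_def by blast
qed

lemma run_For_conseq:
  assumes "x \<notin> wr c" "B \<le> Z" "\<And>s'. agree (insert x (wr c)) s s' \<Longrightarrow> nval (fst s') e = B"
    and "I 0 (set_scalar x 0 s)"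
    and "\<And>j s' v. I j s' \<Longrightarrow> I j (set_scalar x v s')"
    and "\<And>j s'. j < B \<Longrightarrow> agree (insert x (wr c)) s s' \<Longrightarrow> fst s' x [] = j \<Longrightarrow> I j s' \<Longrightarrow>
       run F Z c s' (I (Suc j))"
    and "\<And>s'. agree (insert x (wr c)) s s' \<Longrightarrow> I B s' \<Longrightarrow> Q s'"
  shows "run F Z (For x e c) s Q"
proof (rule run_conseq)
  show "run F Z (For x e c) s (\<lambda>s'. I B s' \<and> fst s' x [] = B)"
    by (rule run_For) (fact assms)+
  show "Q s'" if "agree (wr (For x e c)) s s'" "I B s' \<and> fst s' x [] = B" for s'
    using assms(7)[of s'] that by simp
qed

text \<open>Each loop multiplies the bound by \<open>Z\<close>, so the degree in \<open>Z\<close> is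
  governed by the nesting depth of the fixed program; \<open>r\<close> expresses \<open>Z\<close> as
  a polynomial in the input size.\<close>

lemma steps_bound_polynomial: "\<exists>p :: nat poly. \<forall>z. steps_bound (poly r z) c \<le> poly p z"
proof (induction c)
  case (Seq c d)
  then obtain p q where "\<forall>z. steps_bound (poly r z) c \<le> poly p z" "\<forall>z. steps_bound (poly r z) d \<le> poly q z" by blast
  then show ?case by (intro exI[of _ "p + q"]) (auto intro: add_mono)
next
  case (If b c d)
  then obtain p q where "\<forall>z. steps_bound (poly r z) c \<le> poly p z" "\<forall>z. steps_bound (poly r z) d \<le> poly q z" by blast
  then show ?case by (intro exI[of _ "p + q + 1"]) (auto intro: add_mono)
next
  case (While b c)
  then obtain p where "\<forall>z. steps_bound (poly r z) c \<le> poly p z" by blast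
  then show ?case by (intro exI[of _ "r * (p + 1) + 1"]) (auto intro: mult_left_mono)
qed (intro exI[of _ 1]; simp)+

section \<open>Greedy vertices of base polytopes\<close>

text \<open>The prefix ending at \<open>v\<close> of the order by decreasing weight, with ties
  broken in favour of the smaller index. The tie rule makes the order linear, so consecutive
  prefixes differ by a single element.\<close>

definition upper :: "nat set \<Rightarrow> (nat \<Rightarrow> real) \<Rightarrow> nat \<Rightarrow> nat set" where
  "upper E p v = {u\<in>E. p v < p u \<or> (p u = p v \<and> u \<le> v)}"

text \<open>Edmonds' greedy vertex: the marginal values of \<open>F\<close> along this order. Only
  differences of \<open>F\<close> occur, so additive constants do not matter.\<close>

definition greedy :: "(nat set \<Rightarrow> real) \<Rightarrow> nat set \<Rightarrow> (nat \<Rightarrow> real) \<Rightarrow> nat \<Rightarrow> real" where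
  "greedy F E p v = (if v \<in> E then F (upper E p v) - F (upper E p v - {v}) else 0)"

lemma last_element:
  fixes p :: "nat \<Rightarrow> real"
  assumes "finite E" "E \<noteq> {}"
  obtains e where "e \<in> E" "upper E p e = E" "\<And>v. v \<in> E \<Longrightarrow> v \<noteq> e \<Longrightarrow> e \<notin> upper E p v"
    "\<And>v. v \<in> E \<Longrightarrow> p e \<le> p v"
proof -
  let ?m = "Min (p ` E)" and ?A = "{v\<in>E. p v = Min (p ` E)}"
  have "?m \<in> p ` E" using assms by simp
  then obtain v where "v \<in> E" "p v = ?m" by auto
  then have A: "finite ?A" "?A \<noteq> {}" using assms(1) by (simp, blast)
  let ?e = "Max ?A"
  have e: "?e \<in> E" "p ?e = ?m" using Max_in[OF A] by auto
  have min: "p ?e \<le> p v" if "v \<in> E" for v using e that assms by simp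
  have max: "v \<le> ?e" if "v \<in> E" "p v = p ?e" for v
    using that e A by (intro Max_ge) auto
  show thesis
  proof (rule that[of ?e])
    show "upper E p ?e = E" using min max by (force simp: upper_def)
    show "?e \<notin> upper E p v" if "v \<in> E" "v \<noteq> ?e" for v
      using that min[of v] max[of v] by (auto simp: upper_def)
  qed (use e min in auto)
qed

lemma upper_remove: "e \<notin> upper E p v \<Longrightarrow> upper (E - {e}) p v = upper E p v"
  by (auto simp: upper_def)

lemma greedy_remove: 
  assumes "v \<in> E" "v \<noteq> e" "e \<notin> upper E p v"
  shows "greedy F (E - {e}) p v = greedy F E p v"
  using assms upper_remove[of e E p v] by (simp add: greedy_def)

lemma submodular_on_subset: "submodular_on E F \<Longrightarrow> E' \<subseteq> E \<Longrightarrow> submodular_on E' F"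
  by (meson order_trans submodular_on_def)

text \<open>Induction along the greedy order, deleting its last element. No other prefix changes, so
  the greedy vector of the smaller set is the restriction of the old one
  (\<open>greedy_remove\<close>) and Edmonds' theorems reduce to one step each.\<close>

lemma peel_induct [consumes 1, case_names empty peel]:
  fixes p :: "nat \<Rightarrow> real"
  assumes "finite E" and "P {}"
    and "\<And>E e. finite E \<Longrightarrow> e \<in> E \<Longrightarrow> upper E p e = E \<Longrightarrow>
      (\<And>v. v \<in> E \<Longrightarrow> v \<noteq> e \<Longrightarrow> e \<notin> upper E p v) \<Longrightarrow> (\<And>v. v \<in> E \<Longrightarrow> p e \<le> p v) \<Longrightarrow> P (E - {e}) \<Longrightarrow> P E"
  shows "P E"
  using assms(1)
proof (induction "card E" arbitrary: E)
  case 0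
  then show ?case using assms(2) by simp
next
  case (Suc c)
  then have "E \<noteq> {}" by auto
  with Suc.prems obtain e where e: "e \<in> E" "upper E p e = E"
    "\<And>v. v \<in> E \<Longrightarrow> v \<noteq> e \<Longrightarrow> e \<notin> upper E p v" "\<And>v. v \<in> E \<Longrightarrow> p e \<le> p v"
    by (metis last_element)
  have "P (E - {e})" using Suc e by (intro Suc.hyps) auto
  then show ?case using assms(3) Suc.prems e by blast
qed

text \<open>Greedy vectors lie in the submodular polyhedron: if \<open>A\<close> contains the last
  element \<open>e\<close>, the entry of \<open>e\<close> is its marginal value at
  \<open>E - {e}\<close>, which is at most the one at the smaller set
  \<open>A - {e}\<close>.\<close>

lemma sum_greedy_le:
  assumes "finite E" "submodular_on E F" "F {} = 0" "A \<subseteq> E"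
  shows "(\<Sum>v\<in>A. greedy F E p v) \<le> F A"
  using assms
proof (induction E arbitrary: A rule: peel_induct[where p = p])
  case empty
  then show ?case by simp
next
  case (peel E e)
  have IH: "(\<Sum>v\<in>B. greedy F E p v) \<le> F B" if "B \<subseteq> E - {e}" for B
  proof -
    have "(\<Sum>v\<in>B. greedy F E p v) = (\<Sum>v\<in>B. greedy F (E - {e}) p v)"
      using that peel.hyps(4) by (intro sum.cong refl greedy_remove[symmetric]) auto
    also have "\<dots> \<le> F B"
      using that peel.prems submodular_on_subset[of E F "E - {e}"] by (intro peel.IH) auto
    finally show ?thesis .
  qed
  show ?case
  proof (cases "e \<in> A")
    case False
    then show ?thesis using IH peel.prems by blast
  next
    case True
    have fin: "finite A" using peel.hyps peel.prems finite_subset by blast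
    have "(\<Sum>v\<in>A. greedy F E p v) = greedy F E p e + (\<Sum>v\<in>A - {e}. greedy F E p v)"
      using True fin by (simp add: sum.remove)
    also have "\<dots> \<le> F E - F (E - {e}) + F (A - {e})"
      using IH[of "A - {e}"] peel.prems peel.hyps by (auto simp: greedy_def)
    also have "\<dots> \<le> F A"
    proof -
      have "A \<union> (E - {e}) = E" "A \<inter> (E - {e}) = A - {e}" using True peel.prems by auto
      then show ?thesis using peel.prems unfolding submodular_on_def
        by (metis Diff_subset add.commute diff_le_eq diff_add_eq)
    qed
    finally show ?thesis .
  qed
qed

text \<open>Marginal values telescope on prefixes, which are thus tight sets of the greedy vector.
  Level sets of \<open>p\<close> are such prefixes; this is what the rounding uses.\<close>

lemma sum_greedy_upset:
  assumes "finite E" "F {} = 0" "U \<subseteq> E" "\<And>u. u \<in> U \<Longrightarrow> upper E p u \<subseteq> U"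
  shows "(\<Sum>v\<in>U. greedy F E p v) = F U"
  using assms
proof (induction E arbitrary: U rule: peel_induct[where p = p])
  case empty
  then show ?case by simp
next
  case (peel E e)
  have IH: "(\<Sum>v\<in>B. greedy F E p v) = F B" if "B \<subseteq> E - {e}" "\<And>u. u \<in> B \<Longrightarrow> upper E p u \<subseteq> B" for B
  proof -
    have "(\<Sum>v\<in>B. greedy F E p v) = (\<Sum>v\<in>B. greedy F (E - {e}) p v)"
      using that peel.hyps(4) by (intro sum.cong refl greedy_remove[symmetric]) auto
    also have "\<dots> = F B"
      using that peel.prems upper_remove peel.hyps(4) by (intro peel.IH) (auto simp: upper_def)
    finally show ?thesis .
  qed
  show ?case
  proof (cases "e \<in> U")
    case False
    then show ?thesis using IH peel.prems by blast
  next
    case True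
    then have U: "U = E" using peel.prems peel.hyps by blast
    have "(\<Sum>v\<in>E. greedy F E p v) = greedy F E p e + (\<Sum>v\<in>E - {e}. greedy F E p v)"
      using peel.hyps by (simp add: sum.remove)
    also have "(\<Sum>v\<in>E - {e}. greedy F E p v) = F (E - {e})"
      using peel.hyps(4) by (intro IH) (auto simp: upper_def)
    finally show ?thesis using U peel.hyps by (simp add: greedy_def)
  qed
qed

lemma sum_greedy_all:
  assumes "finite E" "F {} = 0"
  shows "(\<Sum>v\<in>E. greedy F E p v) = F E"
  using assms by (intro sum_greedy_upset) (auto simp: upper_def)

text \<open>One step of summation by parts: subtracting the weight of \<open>e\<close> splits off a
  multiple of the full sum and leaves a sum over one element fewer.\<close>

lemma weighted_sum_peel:
  fixes p w :: "nat \<Rightarrow> real"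
  assumes "finite E" "e \<in> E"
  shows "(\<Sum>v\<in>E. p v * w v) = p e * (\<Sum>v\<in>E. w v) + (\<Sum>v\<in>E - {e}. (p v - p e) * w v)"
  using assms by (simp add: sum.remove[of E e] algebra_simps sum_subtractf sum_distrib_left)

text \<open>The greedy vector maximizes nonnegative weights over the submodular polyhedron.
  Summation by parts compares the two vectors on prefixes, where the greedy one is tight; the shift
  \<open>c\<close> lets the induction continue with the weights \<open>p v - p e\<close>.\<close>

lemma greedy_optimal:
  fixes p w :: "nat \<Rightarrow> real"
  assumes "finite E" "F {} = 0" "\<And>A. A \<subseteq> E \<Longrightarrow> (\<Sum>v\<in>A. w v) \<le> F A" "\<And>v. v \<in> E \<Longrightarrow> p v \<ge> c" "c \<ge> 0"
  shows "(\<Sum>v\<in>E. (p v - c) * w v) \<le> (\<Sum>v\<in>E. (p v - c) * greedy F E p v)"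
  using assms
proof (induction E arbitrary: c rule: peel_induct[where p = p])
  case empty
  then show ?case by simp
next
  case (peel E e)
  have "(\<Sum>v\<in>E - {e}. (p v - p e) * w v) \<le> (\<Sum>v\<in>E - {e}. (p v - p e) * greedy F (E - {e}) p v)"
    using peel.prems(1,3,4) peel.hyps by (intro peel.IH peel.prems(2)) (auto intro: order_trans)
  also have "\<dots> = (\<Sum>v\<in>E - {e}. (p v - p e) * greedy F E p v)"
    using peel.hyps(4) by (intro sum.cong refl arg_cong2[where f = "(*)"] greedy_remove) auto
  finally have *: "(\<Sum>v\<in>E - {e}. (p v - p e) * w v) \<le> (\<Sum>v\<in>E - {e}. (p v - p e) * greedy F E p v)" .
  have "(p e - c) * (\<Sum>v\<in>E. w v) \<le> (p e - c) * (\<Sum>v\<in>E. greedy F E p v)"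
    using peel.prems peel.hyps by (intro mult_left_mono) (auto simp: sum_greedy_all)
  with * show ?case
    using weighted_sum_peel[of E e "\<lambda>v. p v - c" w] weighted_sum_peel[of E e "\<lambda>v. p v - c" "greedy F E p"]
      peel.hyps by (simp add: algebra_simps)
qed

text \<open>The right-hand side is the Lovasz extension of \<open>F\<close> at \<open>p - c\<close>,
  a nonnegative combination of values of \<open>F\<close> with total coefficient at most
  \<open>d - c\<close>. Each value is at least \<mu>, and \<mu> \<le> 0 accounts for any missing
  coefficient.\<close>

lemma greedy_lower_bound:
  fixes p :: "nat \<Rightarrow> real"
  assumes "finite E" "F {} = 0" "\<And>A. A \<subseteq> E \<Longrightarrow> \<mu> \<le> F A" "\<mu> \<le> 0" "\<And>v. v \<in> E \<Longrightarrow> c \<le> p v \<and> p v \<le> d" "c \<le> d"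
  shows "(d - c) * \<mu> \<le> (\<Sum>v\<in>E. (p v - c) * greedy F E p v)"
  using assms
proof (induction E arbitrary: c rule: peel_induct[where p = p])
  case empty
  then show ?case by (simp add: mult_nonneg_nonpos)
next
  case (peel E e)
  have "(d - p e) * \<mu> \<le> (\<Sum>v\<in>E - {e}. (p v - p e) * greedy F (E - {e}) p v)"
    using peel.prems(1,3,4,5) peel.hyps by (intro peel.IH peel.prems(2)) auto
  also have "\<dots> = (\<Sum>v\<in>E - {e}. (p v - p e) * greedy F E p v)"
    using peel.hyps(4) by (intro sum.cong refl arg_cong2[where f = "(*)"] greedy_remove) auto
  finally have *: "(d - p e) * \<mu> \<le> (\<Sum>v\<in>E - {e}. (p v - p e) * greedy F E p v)" .
  have "(p e - c) * \<mu> \<le> (p e - c) * (\<Sum>v\<in>E. greedy F E p v)"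
    using peel.prems peel.hyps by (intro mult_left_mono) (auto simp: sum_greedy_all)
  with * show ?case
    using weighted_sum_peel[of E e "\<lambda>v. p v - c" "greedy F E p"]
      peel.hyps by (simp add: algebra_simps)
qed

lemma greedy_nonneg:
  assumes "mono_on (Pow E) F"
  shows "0 \<le> greedy F E p v"
  using mono_onD[OF assms, of "upper E p v - {v}" "upper E p v"] by (auto simp: greedy_def upper_def)

text \<open>Diminishing returns: a marginal value is at most the one at the empty set.\<close>

lemma greedy_le_single:
  assumes "submodular_on E F" "F {} = 0" "v \<in> E"
  shows "greedy F E p v \<le> F {v}"
proof -
  have u: "v \<in> upper E p v" using assms by (simp add: upper_def)
  have "{v} \<union> (upper E p v - {v}) = upper E p v" "{v} \<inter> (upper E p v - {v}) = {}" using u by auto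
  moreover have "upper E p v - {v} \<subseteq> E" by (auto simp: upper_def)
  ultimately have "F {v} + F (upper E p v - {v}) \<ge> F (upper E p v) + F {}"
    using assms unfolding submodular_on_def by (metis empty_subsetI insert_subset)
  then show ?thesis using assms by (simp add: greedy_def)
qed

section \<open>Multiplicative weights against greedy responses\<close>

text \<open>Potential argument: in a round with expected loss q the total weight shrinks at least by
  exp (- q / m), while the weight of \<open>i0\<close> shrinks at most by exp (- l / m - 2 / m^2).
  An initial weight 0 excludes an action for good, so bounds on the losses are only asked for
  actions of initial weight 1.\<close>

lemma multiplicative_weights_regret:
  fixes w l :: "nat \<Rightarrow> 'i \<Rightarrow> real" and m :: real
  assumes I: "finite I" "i0 \<in> I" and m: "m \<ge> 2"
    and w0: "\<And>i. i \<in> I \<Longrightarrow> w 0 i \<in> {0, 1}" "w 0 i0 = 1"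
    and step: "\<And>t i. i \<in> I \<Longrightarrow> w (Suc t) i = w t i * (1 - l t i / m)"
    and l: "\<And>t i. i \<in> I \<Longrightarrow> w 0 i = 1 \<Longrightarrow> 0 \<le> l t i \<and> l t i \<le> 1"
  shows "(\<Sum>t<T. \<Sum>i\<in>I. w t i / (\<Sum>j\<in>I. w t j) * l t i) \<le> (\<Sum>t<T. l t i0) + 2 * real T / m + m * real (card I)"
proof -
  have zero: "w t i = 0" if "i \<in> I" "w 0 i = 0" for t i
    using that by (induction t) (auto simp: step)
  have factor: "1 / 2 \<le> 1 - l t i / m \<and> 0 \<le> l t i / m" if "i \<in> I" "w 0 i = 1" for t i
  proof -
    have "l t i / m \<le> 1 / 2" using l[OF that, of t] m by (simp add: divide_simps)
    then show ?thesis using l[OF that, of t] m by simp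
  qed
  have pos: "w t i > 0" if "i \<in> I" "w 0 i = 1" for t i
  proof (induction t)
    case (Suc t)
    have "0 < 1 - l t i / m" using factor[OF that, of t] by linarith
    then show ?case using Suc step[OF that(1)] by simp
  qed (use that in simp)
  have nonneg: "w t i \<ge> 0" if "i \<in> I" for t i
    using pos[OF that, of t] zero[OF that, of t] w0(1)[OF that] by fastforce
  define W where "W t = (\<Sum>j\<in>I. w t j)" for t
  define q where "q t = (\<Sum>i\<in>I. w t i / W t * l t i)" for t
  have Wpos: "W t > 0" for t
    unfolding W_def using I nonneg pos[OF I(2) w0(2)] by (intro sum_pos2[of I i0]) auto
  have Wstep: "W (Suc t) = W t * (1 - q t / m)" for t
  proof -
    have "W (Suc t) = W t - (\<Sum>i\<in>I. w t i * l t i) / m"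
      by (simp add: W_def step algebra_simps sum_subtractf sum_divide_distrib)
    moreover have "W t * q t = (\<Sum>i\<in>I. w t i * l t i)"
      using Wpos[of t] by (simp add: q_def sum_distrib_left)
    ultimately show ?thesis by (simp add: algebra_simps)
  qed
  have upper: "W t \<le> card I * exp (- (\<Sum>\<tau><t. q \<tau>) / m)" for t
  proof (induction t)
    case 0
    have "W 0 \<le> (\<Sum>i\<in>I. 1)" unfolding W_def using w0(1) by (intro sum_mono) fastforce
    then show ?case by simp
  next
    case (Suc t)
    have "W (Suc t) \<le> W t * exp (- q t / m)"
      unfolding Wstep using exp_ge_add_one_self[of "- q t / m"] Wpos[of t] by (intro mult_left_mono) auto
    also have "\<dots> \<le> card I * exp (- (\<Sum>\<tau><t. q \<tau>) / m) * exp (- q t / m)"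
      using Suc by (intro mult_right_mono) auto
    also have "\<dots> = card I * exp (- (\<Sum>\<tau><Suc t. q \<tau>) / m)"
      by (simp add: mult_exp_exp[symmetric] mult.assoc diff_divide_distrib exp_diff exp_minus field_simps)
    finally show ?case .
  qed
  have lower: "exp (- (\<Sum>\<tau><t. l \<tau> i0) / m - 2 * real t / m\<^sup>2) \<le> w t i0" for t
  proof (induction t)
    case 0
    then show ?case using w0 by simp
  next
    case (Suc t)
    let ?x = "l t i0 / m"
    have f: "1/2 \<le> 1 - ?x" "0 \<le> ?x" using factor[OF I(2) w0(2)] by auto
    \<comment> \<open>The bound ln (1 - x) \<ge> - x - 2 x^2 holds for x \<le> 1/2; this is where m
      \<ge> 2 enters.\<close>
    have "- ?x - 2 * ?x\<^sup>2 \<le> ln (1 - ?x)" using f by (intro ln_one_minus_pos_lower_bound) auto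
    moreover have "?x\<^sup>2 \<le> 1 / m\<^sup>2"
    proof -
      have "(l t i0)\<^sup>2 \<le> 1" using l[OF I(2) w0(2), of t] by (simp add: power_le_one)
      then show ?thesis using m by (simp add: power_divide divide_right_mono)
    qed
    ultimately have "- ?x - 2 / m\<^sup>2 \<le> ln (1 - ?x)" by linarith
    moreover have "0 < 1 - ?x" using f by linarith
    ultimately have "exp (- ?x - 2 / m\<^sup>2) \<le> 1 - ?x"
      by (simp only: ln_ge_iff)
    then have "exp (- (\<Sum>\<tau><t. l \<tau> i0) / m - 2 * real t / m\<^sup>2) * exp (- ?x - 2 / m\<^sup>2) \<le> w t i0 * (1 - ?x)"
      using Suc nonneg[OF I(2)] by (intro mult_mono) auto
    moreover have "- (\<Sum>\<tau><t. l \<tau> i0) / m - 2 * real t / m\<^sup>2 + (- ?x - 2 / m\<^sup>2)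
      = - (\<Sum>\<tau><Suc t. l \<tau> i0) / m - 2 * real (Suc t) / m\<^sup>2"
      by (simp add: add_divide_distrib diff_divide_distrib algebra_simps)
    ultimately show ?case using step[OF I(2)] by (simp only: mult_exp_exp)
  qed
  have "exp (- (\<Sum>\<tau><T. l \<tau> i0) / m - 2 * real T / m\<^sup>2) \<le> w T i0" by (rule lower)
  also have "\<dots> \<le> W T" unfolding W_def using I nonneg by (intro member_le_sum) auto
  also have "\<dots> \<le> card I * exp (- (\<Sum>\<tau><T. q \<tau>) / m)" by (rule upper)
  \<comment> \<open>The number of actions is bounded by its exponential instead of taking a
    logarithm. The regret term m * card I is cruder than with ln, but still polynomial.\<close>
  also have "\<dots> \<le> exp (card I) * exp (- (\<Sum>\<tau><T. q \<tau>) / m)"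
    using exp_ge_add_one_self[of "real (card I)"] by (intro mult_right_mono exp_ge_zero) linarith
  finally have "- (\<Sum>\<tau><T. l \<tau> i0) / m - 2 * real T / m\<^sup>2 \<le> card I - (\<Sum>\<tau><T. q \<tau>) / m"
    by (simp add: mult_exp_exp)
  then have "m * (- (\<Sum>\<tau><T. l \<tau> i0) / m - 2 * real T / m\<^sup>2) \<le> m * (card I - (\<Sum>\<tau><T. q \<tau>) / m)"
    using m by (intro mult_left_mono) auto
  then show ?thesis using m unfolding q_def W_def by (simp add: algebra_simps power2_eq_square)
qed

definition share :: "nat \<Rightarrow> (nat \<Rightarrow> nat \<Rightarrow> real) \<Rightarrow> nat \<Rightarrow> nat \<Rightarrow> real" where
  "share K w i v = w i v / (\<Sum>j=1..K. w j v)"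

text \<open>If \<open>c = 0\<close>, all relevant responses vanish and the convention \<open>x / 0 = 0\<close> keeps the weights fixed.\<close>

primrec weights :: "(nat \<Rightarrow> nat set \<Rightarrow> real) \<Rightarrow> nat set \<Rightarrow> nat \<Rightarrow> real \<Rightarrow> (nat \<Rightarrow> nat \<Rightarrow> real) \<Rightarrow> nat
    \<Rightarrow> nat \<Rightarrow> nat \<Rightarrow> real" where
  "weights F E K c w0 0 = w0"
| "weights F E K c w0 (Suc t) = (\<lambda>i v. weights F E K c w0 t i v *
     (1 - greedy (F i) E (share K (weights F E K c w0 t) i) v / c))"

definition play :: "(nat \<Rightarrow> nat set \<Rightarrow> real) \<Rightarrow> nat set \<Rightarrow> nat \<Rightarrow> real \<Rightarrow> (nat \<Rightarrow> nat \<Rightarrow> real) \<Rightarrow> nat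
    \<Rightarrow> nat \<Rightarrow> nat \<Rightarrow> real" where
  "play F E K c w0 t = share K (weights F E K c w0 t)"

definition response :: "(nat \<Rightarrow> nat set \<Rightarrow> real) \<Rightarrow> nat set \<Rightarrow> nat \<Rightarrow> real \<Rightarrow> (nat \<Rightarrow> nat \<Rightarrow> real) \<Rightarrow> nat
    \<Rightarrow> nat \<Rightarrow> nat \<Rightarrow> real" where
  "response F E K c w0 t i = greedy (F i) E (play F E K c w0 t i)"

text \<open>Greedy vectors see only differences of \<open>F\<close>, and by induction over the
  rounds so does the whole game. A program may therefore play with an objective that does not vanish
  on the empty set while the analysis normalizes it.\<close>

lemma weights_cong_const:
  assumes "\<And>i. i \<in> {1..K} \<Longrightarrow> \<exists>a. \<forall>S\<subseteq>E. F' i S = F i S + a"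
  shows "i \<in> {1..K} \<Longrightarrow> weights F' E K c w0 t i v = weights F E K c w0 t i v"
    and "i \<in> {1..K} \<Longrightarrow> response F' E K c w0 t i v = response F E K c w0 t i v"
    and "i \<in> {1..K} \<Longrightarrow> play F' E K c w0 t i v = play F E K c w0 t i v"
proof -
  have gr: "greedy (F' i) E p = greedy (F i) E p" if i: "i \<in> {1..K}" for i p
  proof
    fix v
    obtain a where a: "\<forall>S\<subseteq>E. F' i S = F i S + a" using assms i by blast
    have "upper E p v \<subseteq> E" "upper E p v - {v} \<subseteq> E" by (auto simp: upper_def)
    then show "greedy (F' i) E p v = greedy (F i) E p v" using a by (simp add: greedy_def)
  qed
  have w: "weights F' E K c w0 t i v = weights F E K c w0 t i v" if "i \<in> {1..K}" for i v t
    using that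
  proof (induction t arbitrary: i v)
    case (Suc t)
    have "share K (weights F' E K c w0 t) i = share K (weights F E K c w0 t) i"
      using Suc by (auto simp: share_def fun_eq_iff intro!: arg_cong2[where f = "(/)"] sum.cong)
    then show ?case using Suc gr by simp
  qed simp
  then have p: "play F' E K c w0 t i = play F E K c w0 t i" if "i \<in> {1..K}" for i
    using that by (auto simp: play_def share_def fun_eq_iff intro!: arg_cong2[where f = "(/)"] sum.cong)
  show "i \<in> {1..K} \<Longrightarrow> weights F' E K c w0 t i v = weights F E K c w0 t i v" by (rule w)
  show "i \<in> {1..K} \<Longrightarrow> response F' E K c w0 t i v = response F E K c w0 t i v"
    by (simp add: response_def gr p)
  show "i \<in> {1..K} \<Longrightarrow> play F' E K c w0 t i v = play F E K c w0 t i v" by (simp add: p)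
qed

text \<open>Every element runs its own multiplicative weights over the functions, and each function
  answers with the greedy vertex for its current weights. \<open>w0\<close> marks the admissible
  pairs of function and element; their singleton values bound the losses by \<open>G\<close>, and
  dividing by \<open>m * G\<close> rescales them to the learning rate 1 / m.\<close>

locale game =
  fixes F :: "nat \<Rightarrow> nat set \<Rightarrow> real" and E :: "nat set" and K :: nat and G m :: real and w0 :: "nat \<Rightarrow> nat \<Rightarrow> real"
  assumes fin: "finite E" and m: "m \<ge> 2" and G: "G \<ge> 0"
    and submod: "\<And>i. i \<in> {1..K} \<Longrightarrow> submodular_on E (F i)"
    and mono: "\<And>i. i \<in> {1..K} \<Longrightarrow> mono_on (Pow E) (F i)"
    and empty: "\<And>i. i \<in> {1..K} \<Longrightarrow> F i {} = 0"
    and w0: "\<And>i v. w0 i v \<in> {0, 1}"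
    and allowed: "\<And>v. v \<in> E \<Longrightarrow> \<exists>i\<in>{1..K}. w0 i v = 1"
    and bound: "\<And>i v. i \<in> {1..K} \<Longrightarrow> v \<in> E \<Longrightarrow> w0 i v = 1 \<Longrightarrow> F i {v} \<le> G"
begin

abbreviation "wt \<equiv> weights F E K (m * G) w0"
abbreviation "pl \<equiv> play F E K (m * G) w0"
abbreviation "rs \<equiv> response F E K (m * G) w0"

lemma response_nonneg: "i \<in> {1..K} \<Longrightarrow> 0 \<le> rs t i v"
  unfolding response_def by (rule greedy_nonneg[OF mono])

lemma response_le: "i \<in> {1..K} \<Longrightarrow> v \<in> E \<Longrightarrow> w0 i v = 1 \<Longrightarrow> rs t i v \<le> G"
  unfolding response_def by (rule order_trans[OF greedy_le_single[OF submod empty] bound])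

lemma weights_Suc: "wt (Suc t) i v = wt t i v * (1 - rs t i v / (m * G))"
  by (simp add: response_def play_def)

lemma weights_zero: "w0 i v = 0 \<Longrightarrow> wt t i v = 0"
  by (induction t) auto

lemma weights_pos:
  assumes "i \<in> {1..K}" "v \<in> E" "w0 i v = 1"
  shows "wt t i v > 0"
proof (induction t)
  case (Suc t)
  have "rs t i v / (m * G) < 1"
  proof (cases "G = 0")
    case False
    then have "rs t i v < m * G"
      using response_le[OF assms, of t] m G mult_right_mono[of 2 m G] by linarith
    then show ?thesis using False m G by simp
  qed simp
  then show ?case using Suc by (simp only: weights_Suc mult_pos_pos diff_gt_0_iff_gt)
qed (use assms in simp)

lemma weights_nonneg: "i \<in> {1..K} \<Longrightarrow> v \<in> E \<Longrightarrow> wt t i v \<ge> 0"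
  using weights_pos[of i v t] weights_zero[of i v t] w0[of i v] by fastforce

lemma weights_sum_pos: assumes "v \<in> E" shows "(\<Sum>j=1..K. wt t j v) > 0"
proof -
  obtain i where "i \<in> {1..K}" "w0 i v = 1" using allowed assms by blast
  then show ?thesis using assms weights_pos weights_nonneg by (intro sum_pos2[of _ i]) auto
qed

lemma play_nonneg: "i \<in> {1..K} \<Longrightarrow> v \<in> E \<Longrightarrow> pl t i v \<ge> 0"
  using weights_nonneg weights_sum_pos by (simp add: play_def share_def less_imp_le)

lemma play_zero: "w0 i v = 0 \<Longrightarrow> pl t i v = 0"
  using weights_zero by (simp add: play_def share_def)

lemma play_sum: "v \<in> E \<Longrightarrow> (\<Sum>i=1..K. pl t i v) = 1"
  using weights_sum_pos[of v t] by (simp add: play_def share_def sum_divide_distrib[symmetric])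

text \<open>The regret bound for losses divided by \<open>G\<close>. For G = 0 this scaling is
  impossible, but then all admissible responses vanish and the left-hand side is 0.\<close>

lemma element_regret:
  assumes v: "v \<in> E" and i0: "i0 \<in> {1..K}" "w0 i0 v = 1"
  shows "(\<Sum>t<T. \<Sum>i=1..K. pl t i v * rs t i v) \<le> (\<Sum>t<T. rs t i0 v) + (2 * real T / m + m * real K) * G"
proof (cases "G = 0")
  case True
  have "pl t i v * rs t i v = 0" if "i \<in> {1..K}" for t i
  proof (cases "w0 i v = 1")
    case w: True
    have "rs t i v = 0" using response_le[OF that v w, of t] response_nonneg[OF that, of t v] True by simp
    then show ?thesis by simp
  next
    case False
    then show ?thesis using play_zero w0[of i v] by auto
  qed
  then have "(\<Sum>t<T. \<Sum>i=1..K. pl t i v * rs t i v) = 0" by (intro sum.neutral ballI)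
  moreover have "(\<Sum>t<T. rs t i0 v) \<ge> 0" using response_nonneg i0 by (intro sum_nonneg) auto
  ultimately show ?thesis using True by simp
next
  case False
  then have G0: "G > 0" using G by simp
  have "(\<Sum>t<T. \<Sum>i=1..K. wt t i v / (\<Sum>j=1..K. wt t j v) * (rs t i v / G)) \<le>
     (\<Sum>t<T. rs t i0 v / G) + 2 * real T / m + m * real (card {1..K})"
  proof (rule multiplicative_weights_regret[where w = "\<lambda>t i. wt t i v" and l = "\<lambda>t i. rs t i v / G"])
    show "wt (Suc t) i v = wt t i v * (1 - rs t i v / G / m)" for t i
      using weights_Suc[of t i v] by (simp add: mult.commute)
    show "0 \<le> rs t i v / G \<and> rs t i v / G \<le> 1" if "i \<in> {1..K}" "wt 0 i v = 1" for t i
      using that response_nonneg[OF that(1), of t v] response_le[OF that(1) v, of t] G0 by simp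
  qed (use i0 m w0 in auto)
  then have "G * (\<Sum>t<T. \<Sum>i=1..K. pl t i v * (rs t i v / G)) \<le>
     G * ((\<Sum>t<T. rs t i0 v / G) + 2 * real T / m + m * real K)"
    using G0 by (intro mult_left_mono) (auto simp: play_def share_def)
  then show ?thesis using G0 by (simp add: sum_distrib_left algebra_simps)
qed

text \<open>Adding up the regrets of all elements compares the plays with one integral assignment
  \<sigma>. As responses are greedy, the left-hand side is the sum over the rounds of the Lovasz
  extensions at the current play.\<close>

lemma total_regret:
  assumes \<sigma>: "\<And>v. v \<in> E \<Longrightarrow> \<sigma> v \<in> {1..K} \<and> w0 (\<sigma> v) v = 1"
  shows "(\<Sum>t<T. \<Sum>i=1..K. \<Sum>v\<in>E. pl t i v * rs t i v) \<le>
    (\<Sum>v\<in>E. \<Sum>t<T. rs t (\<sigma> v) v) + real (card E) * ((2 * real T / m + m * real K) * G)"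
proof -
  have "(\<Sum>t<T. \<Sum>i=1..K. \<Sum>v\<in>E. pl t i v * rs t i v) = (\<Sum>v\<in>E. \<Sum>t<T. \<Sum>i=1..K. pl t i v * rs t i v)"
    by (simp only: sum.swap[of _ E])
  also have "\<dots> \<le> (\<Sum>v\<in>E. (\<Sum>t<T. rs t (\<sigma> v) v) + (2 * real T / m + m * real K) * G)"
    using \<sigma> element_regret by (intro sum_mono) blast
  finally show ?thesis by (simp add: sum.distrib)
qed

lemma response_sum_le: "i \<in> {1..K} \<Longrightarrow> A \<subseteq> E \<Longrightarrow> (\<Sum>v\<in>A. rs t i v) \<le> F i A"
  unfolding response_def by (intro sum_greedy_le fin submod empty)

lemma response_sum_all: "i \<in> {1..K} \<Longrightarrow> (\<Sum>v\<in>E. rs t i v) = F i E"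
  unfolding response_def by (intro sum_greedy_all fin empty)

lemma play_response_optimal:
  assumes "i \<in> {1..K}" "\<And>A. A \<subseteq> E \<Longrightarrow> (\<Sum>v\<in>A. w v) \<le> F i A"
  shows "(\<Sum>v\<in>E. pl t i v * w v) \<le> (\<Sum>v\<in>E. pl t i v * rs t i v)"
  using greedy_optimal[of E "F i" w 0 "pl t i"] assms play_nonneg fin empty
  by (simp add: response_def)

end

section \<open>Thresholds and couplings\<close>

lemma double_sum_int_interval:
  fixes a H :: int
  assumes "a \<le> H"
  shows "2 * (\<Sum>j\<in>{a+1..H}. real_of_int j) = real_of_int H * (real_of_int H + 1) - real_of_int a * (real_of_int a + 1)"
  using assms
proof (induction H rule: int_ge_induct)
  case (step i)
  have "{a+1..i+1} = insert (i+1) {a+1..i}" using step by auto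
  then show ?case using step by (simp add: algebra_simps)
qed simp

lemma sum_int_symmetric: "(\<Sum>z\<in>{-H..H::int}. \<phi> (- z)) = (\<Sum>z\<in>{-H..H}. \<phi> z)"
  by (rule sum.reindex_bij_witness[of _ uminus uminus]) auto

text \<open>The hexagonal norm is the density that makes three uniform variables with constant sum spread over the plane.\<close>

definition hex_weight :: "int \<Rightarrow> int \<Rightarrow> int \<Rightarrow> real" where
  "hex_weight H a b = (if \<bar>a + b\<bar> \<le> H then real_of_int (max \<bar>a\<bar> (max \<bar>b\<bar> \<bar>a + b\<bar>)) else 0)"

lemma hex_weight_uminus: "hex_weight H (- a) (- b) = hex_weight H a b"
proof -
  have "\<bar>- a - b\<bar> = \<bar>a + b\<bar>" by arith
  then show ?thesis by (simp add: hex_weight_def)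
qed

text \<open>For a \<ge> 0 the norm is - b, a and a + b on the three ranges of b that lie in the
  hexagon. The two outer ranges both contribute the sum of a + 1, ..., H and the middle one a (a +
  1), which gives H (H + 1) independently of a.\<close>

lemma hex_weight_marginal:
  assumes "\<bar>a\<bar> \<le> H"
  shows "(\<Sum>b\<in>{-H..H}. hex_weight H a b) = real_of_int H * (real_of_int H + 1)"
proof -
  have nonneg: "(\<Sum>b\<in>{-H..H}. hex_weight H a b) = real_of_int H * (real_of_int H + 1)" if "0 \<le> a" "a \<le> H" for a
  proof -
    have "{-H..H} = {-H..-a-1} \<union> ({-a..0} \<union> ({0+1..H-a} \<union> {H-a+1..H}))" using that by auto
    then have "(\<Sum>b\<in>{-H..H}. hex_weight H a b) = (\<Sum>b\<in>{-H..-a-1}. hex_weight H a b) +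
      ((\<Sum>b\<in>{-a..0}. hex_weight H a b) + ((\<Sum>b\<in>{0+1..H-a}. hex_weight H a b) + (\<Sum>b\<in>{H-a+1..H}. hex_weight H a b)))"
      using that by (simp only:) (subst sum.union_disjoint; auto)+
    moreover have "(\<Sum>b\<in>{-H..-a-1}. hex_weight H a b) = (\<Sum>j\<in>{a+1..H}. real_of_int j)"
      using that by (intro sum.reindex_bij_witness[of _ uminus uminus]) (auto simp: hex_weight_def)
    moreover have "(\<Sum>b\<in>{-a..0}. hex_weight H a b) = (\<Sum>b\<in>{-a..0}. real_of_int a)"
      using that by (intro sum.cong) (auto simp: hex_weight_def)
    moreover have "(\<Sum>b\<in>{0+1..H-a}. hex_weight H a b) = (\<Sum>j\<in>{a+1..H}. real_of_int j)"
      using that by (intro sum.reindex_bij_witness[of _ "\<lambda>j. j - a" "\<lambda>b. b + a"]) (auto simp: hex_weight_def)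
    moreover have "(\<Sum>b\<in>{H-a+1..H}. hex_weight H a b) = 0"
      using that by (intro sum.neutral) (auto simp: hex_weight_def)
    ultimately show ?thesis using double_sum_int_interval[OF that(2)] that by (simp add: algebra_simps)
  qed
  show ?thesis
  proof (cases "a \<ge> 0")
    case True
    then show ?thesis using nonneg assms by simp
  next
    case False
    have "(\<Sum>b\<in>{-H..H}. hex_weight H a b) = (\<Sum>b\<in>{-H..H}. hex_weight H (- a) (- b))"
      by (simp add: hex_weight_uminus)
    also have "\<dots> = (\<Sum>b\<in>{-H..H}. hex_weight H (- a) b)" by (rule sum_int_symmetric)
    finally show ?thesis using nonneg[of "- a"] False assms by simp
  qed
qed

lemma hex_weight_commute: "hex_weight H a b = hex_weight H b a"
  by (auto simp: hex_weight_def ac_simps)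

text \<open>The hexagonal norm is symmetric in a, b and - a - b, so the third variable is
  distributed like the other two.\<close>

lemma hex_weight_third:
  assumes "\<bar>a + b\<bar> \<le> H" "\<bar>a\<bar> \<le> H"
  shows "hex_weight H (- a - b) b = hex_weight H a b"
proof -
  have "\<bar>- a - b\<bar> = \<bar>a + b\<bar>" by arith
  then show ?thesis using assms by (simp add: hex_weight_def max.commute max.left_commute)
qed

text \<open>
  The weight \<open>\<mu>\<close> makes every coordinate of the vectors \<open>y\<close> uniform on \<open>{-H..H}\<close>; the spread of the first two
  coordinates lets the second threshold be raised while the first one runs through a redundant interval.
\<close>

definition coupling :: "nat \<Rightarrow> int \<Rightarrow> (int \<times> int \<Rightarrow> real) \<Rightarrow> (int \<times> int \<Rightarrow> nat \<Rightarrow> int) \<Rightarrow> real \<Rightarrow> bool" where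
  "coupling k H \<mu> y W \<longleftrightarrow>
     (\<forall>i<k. \<forall>\<phi> :: int \<Rightarrow> real. (\<Sum>\<omega>\<in>{-H..H} \<times> {-H..H}. \<mu> \<omega> * \<phi> (y \<omega> i)) = W * (\<Sum>z\<in>{-H..H}. \<phi> z)) \<and>
     (\<forall>\<omega>. y \<omega> 0 = fst \<omega> \<and> y \<omega> 1 = snd \<omega> \<and> (\<Sum>i<k. y \<omega> i) = 0) \<and>
     (\<forall>\<omega>\<in>{-H..H} \<times> {-H..H}. \<mu> \<omega> \<ge> 0 \<and> (\<mu> \<omega> > 0 \<longrightarrow> (\<forall>i<k. - H \<le> y \<omega> i))) \<and>
     (\<forall>a b. 0 \<le> - a \<and> - 4 * a \<le> H \<and> 0 \<le> H + a + b \<and> b \<le> H \<longrightarrow> - real_of_int a \<le> \<mu> (a, b)) \<and>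
     0 < W \<and> W \<le> 4 * real_of_int H ^ 2"

lemma couplingD:
  assumes "coupling k H \<mu> y W"
  shows "\<And>i \<phi>. i < k \<Longrightarrow> (\<Sum>\<omega>\<in>{-H..H} \<times> {-H..H}. \<mu> \<omega> * \<phi> (y \<omega> i)) = W * (\<Sum>z\<in>{-H..H}. \<phi> z)"
    and "y \<omega> 0 = fst \<omega>" "y \<omega> 1 = snd \<omega>" "(\<Sum>i<k. y \<omega> i) = 0"
    and "\<omega> \<in> {-H..H} \<times> {-H..H} \<Longrightarrow> \<mu> \<omega> \<ge> 0"
    and "\<omega> \<in> {-H..H} \<times> {-H..H} \<Longrightarrow> \<mu> \<omega> > 0 \<Longrightarrow> \<forall>i<k. - H \<le> y \<omega> i"
    and "0 \<le> - a \<and> - 4 * a \<le> H \<and> 0 \<le> H + a + b \<and> b \<le> H \<Longrightarrow> - real_of_int a \<le> \<mu> (a, b)"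
    and "0 < W" "W \<le> 4 * real_of_int H ^ 2"
  using assms unfolding coupling_def by blast+

lemma sum_alternating:
  fixes a :: int and j k :: nat
  assumes "even (k - j)" "j \<le> k"
  shows "(\<Sum>i\<in>{j..<k}. if even (i - j) then a else - a) = 0"
proof -
  obtain l where "k - j = 2 * l" using assms(1) by (rule evenE)
  then have l: "k = j + 2 * l" using assms(2) by simp
  have "(\<Sum>i\<in>{j..<j + 2 * l}. if even (i - j) then a else - a) = 0"
  proof (induction l)
    case (Suc l)
    have "j + 2 * Suc l = Suc (Suc (j + 2 * l))" by simp
    then show ?case using Suc by (simp only: sum.atLeastLessThan_Suc le_SucI le_add1) simp
  qed simp
  then show ?thesis using l by simp
qed

text \<open>For even k, independent uniform variables give a, b, - a, - b, followed by pairs a, - a.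
  For odd k three coordinates a, b, - a - b remain when the others are paired; with a and b
  independent the third would not be uniform, and the hexagonal weight repairs this.\<close>

lemma coupling_exists:
  assumes k: "k \<ge> 3" and H: "H > 0"
  obtains \<mu> y W where "coupling k H \<mu> y W"
proof (cases "even k")
  case True
  then have k4: "k \<ge> 4" using k by (cases "k = 3") auto
  define y :: "int \<times> int \<Rightarrow> nat \<Rightarrow> int" where
    "y \<omega> i = (if i < 4 then [fst \<omega>, snd \<omega>, - fst \<omega>, - snd \<omega>] ! i else if even (i - 4) then fst \<omega> else - fst \<omega>)" for \<omega> i
  have sum0: "(\<Sum>i<k. y \<omega> i) = 0" for \<omega>
  proof -
    have "(\<Sum>i<k. y \<omega> i) = (\<Sum>i<4. y \<omega> i) + (\<Sum>i\<in>{4..<k}. y \<omega> i)"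
      using sum.atLeastLessThan_concat[of 0 4 k "y \<omega>"] k4 by (simp add: lessThan_atLeast0)
    also have "(\<Sum>i<4. y \<omega> i) = 0" by (simp add: y_def numeral_eq_Suc)
    also have "(\<Sum>i\<in>{4..<k}. y \<omega> i) = (\<Sum>i\<in>{4..<k}. if even (i - 4) then fst \<omega> else - fst \<omega>)"
      by (intro sum.cong) (auto simp: y_def)
    also have "\<dots> = 0" using True k4 by (intro sum_alternating) auto
    finally show ?thesis by simp
  qed
  have cases: "(\<forall>\<omega>. y \<omega> i = fst \<omega>) \<or> (\<forall>\<omega>. y \<omega> i = snd \<omega>) \<or> (\<forall>\<omega>. y \<omega> i = - fst \<omega>) \<or> (\<forall>\<omega>. y \<omega> i = - snd \<omega>)" for i
  proof (cases "i < 4")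
    case True
    then have "i = 0 \<or> i = 1 \<or> i = 2 \<or> i = 3" by auto
    then show ?thesis by (auto simp: y_def)
  next
    case False
    then show ?thesis by (auto simp: y_def)
  qed
  have marg: "(\<Sum>\<omega>\<in>{-H..H} \<times> {-H..H}. real_of_int H * \<phi> (y \<omega> i)) = real_of_int H * (2 * real_of_int H + 1) * (\<Sum>z\<in>{-H..H}. \<phi> z)" for i and \<phi> :: "int \<Rightarrow> real"
  proof -
    have card: "real (card {-H..H}) = 2 * real_of_int H + 1" using H by simp
    have f: "(\<Sum>\<omega>\<in>{-H..H} \<times> {-H..H}. real_of_int H * \<psi> (fst \<omega>)) = real_of_int H * (2 * real_of_int H + 1) * (\<Sum>z\<in>{-H..H}. \<psi> z)"
      and s: "(\<Sum>\<omega>\<in>{-H..H} \<times> {-H..H}. real_of_int H * \<psi> (snd \<omega>)) = real_of_int H * (2 * real_of_int H + 1) * (\<Sum>z\<in>{-H..H}. \<psi> z)" for \<psi> :: "int \<Rightarrow> real"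
    proof -
      show 1: "(\<Sum>\<omega>\<in>{-H..H} \<times> {-H..H}. real_of_int H * \<psi> (fst \<omega>)) = real_of_int H * (2 * real_of_int H + 1) * (\<Sum>z\<in>{-H..H}. \<psi> z)"
        unfolding sum.cartesian_product' using card by (simp add: sum_distrib_left mult.assoc mult.left_commute)
      show "(\<Sum>\<omega>\<in>{-H..H} \<times> {-H..H}. real_of_int H * \<psi> (snd \<omega>)) = real_of_int H * (2 * real_of_int H + 1) * (\<Sum>z\<in>{-H..H}. \<psi> z)"
        unfolding sum.cartesian_product' using card by (simp add: sum_distrib_left mult.assoc mult.left_commute)
    qed
    consider "\<forall>\<omega>. y \<omega> i = fst \<omega>" | "\<forall>\<omega>. y \<omega> i = snd \<omega>" | "\<forall>\<omega>. y \<omega> i = - fst \<omega>" | "\<forall>\<omega>. y \<omega> i = - snd \<omega>"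
      using cases by blast
    then show ?thesis
      using f[of \<phi>] s[of \<phi>] f[of "\<lambda>z. \<phi> (- z)"] s[of "\<lambda>z. \<phi> (- z)"] by cases (simp_all only: sum_int_symmetric[of \<phi> H])
  qed
  \<comment> \<open>The constant weight is H rather than 1 in order to meet the required lower bound
    - a \<le> \<mu> (a, b).\<close>
  have "coupling k H (\<lambda>_. real_of_int H) y (real_of_int H * (2 * real_of_int H + 1))"
    unfolding coupling_def
  proof (intro conjI allI impI ballI)
    show "- H \<le> y \<omega> i" if "\<omega> \<in> {-H..H} \<times> {-H..H}" for \<omega> i
      using cases[of i] that by auto
    have "real_of_int H \<ge> 1" using H by simp
    then have "real_of_int H * 1 \<le> real_of_int H * real_of_int H" by (intro mult_left_mono) auto
    then show "real_of_int H * (2 * real_of_int H + 1) \<le> 4 * (real_of_int H)\<^sup>2"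
      using \<open>real_of_int H \<ge> 1\<close> by (simp add: power2_eq_square distrib_left) 
  qed (use marg sum0 H in \<open>auto simp: y_def\<close>)
  then show thesis by (rule that)
next
  case False
  define y :: "int \<times> int \<Rightarrow> nat \<Rightarrow> int" where
    "y \<omega> i = (if i < 3 then [fst \<omega>, snd \<omega>, - fst \<omega> - snd \<omega>] ! i else if even (i - 3) then fst \<omega> else - fst \<omega>)" for \<omega> i
  define \<mu> where "\<mu> \<omega> = hex_weight H (fst \<omega>) (snd \<omega>)" for \<omega>
  have sum0: "(\<Sum>i<k. y \<omega> i) = 0" for \<omega>
  proof -
    have "(\<Sum>i<k. y \<omega> i) = (\<Sum>i<3. y \<omega> i) + (\<Sum>i\<in>{3..<k}. y \<omega> i)"
      using sum.atLeastLessThan_concat[of 0 3 k "y \<omega>"] k by (simp add: lessThan_atLeast0)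
    also have "(\<Sum>i<3. y \<omega> i) = 0" by (simp add: y_def numeral_eq_Suc)
    also have "(\<Sum>i\<in>{3..<k}. y \<omega> i) = (\<Sum>i\<in>{3..<k}. if even (i - 3) then fst \<omega> else - fst \<omega>)"
      by (intro sum.cong) (auto simp: y_def)
    also have "\<dots> = 0" using False k by (intro sum_alternating) auto
    finally show ?thesis by simp
  qed
  have cases: "(\<forall>\<omega>. y \<omega> i = fst \<omega>) \<or> (\<forall>\<omega>. y \<omega> i = snd \<omega>) \<or> (\<forall>\<omega>. y \<omega> i = - fst \<omega>) \<or> (\<forall>\<omega>. y \<omega> i = - fst \<omega> - snd \<omega>)" for i
  proof (cases "i < 3")
    case True
    then have "i = 0 \<or> i = 1 \<or> i = 2" by auto
    then show ?thesis by (auto simp: y_def)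
  next
    case False
    then show ?thesis by (auto simp: y_def)
  qed
  have marg: "(\<Sum>\<omega>\<in>{-H..H} \<times> {-H..H}. \<mu> \<omega> * \<phi> (y \<omega> i)) = real_of_int H * (real_of_int H + 1) * (\<Sum>z\<in>{-H..H}. \<phi> z)" for i and \<phi> :: "int \<Rightarrow> real"
  proof -
    have f: "(\<Sum>\<omega>\<in>{-H..H} \<times> {-H..H}. \<mu> \<omega> * \<psi> (fst \<omega>)) = real_of_int H * (real_of_int H + 1) * (\<Sum>z\<in>{-H..H}. \<psi> z)" for \<psi> :: "int \<Rightarrow> real"
    proof -
      have "(\<Sum>\<omega>\<in>{-H..H} \<times> {-H..H}. \<mu> \<omega> * \<psi> (fst \<omega>)) = (\<Sum>a\<in>{-H..H}. (\<Sum>b\<in>{-H..H}. hex_weight H a b) * \<psi> a)"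
        unfolding sum.cartesian_product' by (simp add: \<mu>_def sum_distrib_right)
      also have "\<dots> = (\<Sum>a\<in>{-H..H}. real_of_int H * (real_of_int H + 1) * \<psi> a)"
        by (intro sum.cong refl arg_cong2[where f = "(*)"] hex_weight_marginal) auto
      finally show ?thesis by (simp add: sum_distrib_left)
    qed
    have "(\<Sum>\<omega>\<in>{-H..H} \<times> {-H..H}. \<mu> \<omega> * \<phi> (snd \<omega>)) = (\<Sum>\<omega>\<in>{-H..H} \<times> {-H..H}. \<mu> \<omega> * \<phi> (fst \<omega>))"
      by (rule sum.reindex_bij_witness[of _ prod.swap prod.swap]) (auto simp: \<mu>_def hex_weight_commute)
    then have s: "(\<Sum>\<omega>\<in>{-H..H} \<times> {-H..H}. \<mu> \<omega> * \<phi> (snd \<omega>)) = real_of_int H * (real_of_int H + 1) * (\<Sum>z\<in>{-H..H}. \<phi> z)"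
      using f by simp
    \<comment> \<open>The substitution of (- a - b, b) for (a, b) preserves the hexagon but not the
      square, hence the restriction to the support.\<close>
    let ?Hx = "{\<omega> \<in> {-H..H} \<times> {-H..H}. \<bar>fst \<omega> + snd \<omega>\<bar> \<le> H}"
    have restr: "(\<Sum>\<omega>\<in>{-H..H} \<times> {-H..H}. \<mu> \<omega> * g \<omega>) = (\<Sum>\<omega>\<in>?Hx. \<mu> \<omega> * g \<omega>)" for g
      by (intro sum.mono_neutral_right) (auto simp: \<mu>_def hex_weight_def)
    have "(\<Sum>\<omega>\<in>?Hx. \<mu> \<omega> * \<phi> (- fst \<omega> - snd \<omega>)) = (\<Sum>\<omega>\<in>?Hx. \<mu> \<omega> * \<phi> (fst \<omega>))"
      by (rule sum.reindex_bij_witness[of _ "\<lambda>(a, b). (- a - b, b)" "\<lambda>(a, b). (- a - b, b)"])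
        (auto simp: \<mu>_def hex_weight_third)
    then have t: "(\<Sum>\<omega>\<in>{-H..H} \<times> {-H..H}. \<mu> \<omega> * \<phi> (- fst \<omega> - snd \<omega>)) = real_of_int H * (real_of_int H + 1) * (\<Sum>z\<in>{-H..H}. \<phi> z)"
      using f[of \<phi>] by (simp only: restr)
    consider "\<forall>\<omega>. y \<omega> i = fst \<omega>" | "\<forall>\<omega>. y \<omega> i = snd \<omega>" | "\<forall>\<omega>. y \<omega> i = - fst \<omega>" | "\<forall>\<omega>. y \<omega> i = - fst \<omega> - snd \<omega>"
      using cases by blast
    then show ?thesis
      using f[of \<phi>] s f[of "\<lambda>z. \<phi> (- z)"] t by cases (simp_all only: sum_int_symmetric[of \<phi> H])
  qed
  have "coupling k H \<mu> y (real_of_int H * (real_of_int H + 1))"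
    unfolding coupling_def
  proof (intro conjI allI impI ballI)
    show "- H \<le> y \<omega> i" if "\<omega> \<in> {-H..H} \<times> {-H..H}" "\<mu> \<omega> > 0" for \<omega> i
    proof -
      have "\<bar>fst \<omega> + snd \<omega>\<bar> \<le> H" using that(2) by (auto simp: \<mu>_def hex_weight_def split: if_splits)
      then show ?thesis using cases[of i] that(1) by auto
    qed
    have "real_of_int H \<ge> 1" using H by simp
    then have "real_of_int H * 1 \<le> real_of_int H * real_of_int H" by (intro mult_left_mono) auto
    then show "real_of_int H * (real_of_int H + 1) \<le> 4 * (real_of_int H)\<^sup>2"
      using \<open>real_of_int H \<ge> 1\<close> by (simp add: power2_eq_square distrib_left) 
    show "- real_of_int a \<le> \<mu> (a, b)" if "0 \<le> - a \<and> - 4 * a \<le> H \<and> 0 \<le> H + a + b \<and> b \<le> H" for a b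
    proof -
      have "\<bar>a + b\<bar> \<le> H" using that by auto
      then show ?thesis using that by (auto simp: \<mu>_def hex_weight_def)
    qed
    show "0 \<le> \<mu> \<omega>" for \<omega> by (auto simp: \<mu>_def hex_weight_def)
  qed (use marg sum0 H in \<open>auto simp: y_def\<close>)
  then show thesis by (rule that)
qed


section \<open>Averaging over thresholds and exchanging them across a redundant block\<close>

lemma sum_int_shift_telescope:
  fixes g :: "int \<Rightarrow> real"
  assumes "u \<le> v" "0 \<le> l"
  shows "(\<Sum>b\<in>{u..v}. g b - g (b + l)) = (\<Sum>b\<in>{u..u+l-1}. g b) - (\<Sum>b\<in>{v+1..v+l}. g b)"
proof -
  have 1: "(\<Sum>b\<in>{u..v}. g (b + l)) = (\<Sum>b\<in>{u+l..v+l}. g b)"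
    by (rule sum.reindex_bij_witness[of _ "\<lambda>b. b - l" "\<lambda>b. b + l"]) auto
  have "{u..v+l} = {u..v} \<union> {v+1..v+l}" using assms by auto
  moreover have "(\<Sum>b\<in>{u..v} \<union> {v+1..v+l}. g b) = (\<Sum>b\<in>{u..v}. g b) + (\<Sum>b\<in>{v+1..v+l}. g b)"
    by (rule sum.union_disjoint) auto
  moreover have "{u..v+l} = {u..u+l-1} \<union> {u+l..v+l}" using assms by auto
  moreover have "(\<Sum>b\<in>{u..u+l-1} \<union> {u+l..v+l}. g b) = (\<Sum>b\<in>{u..u+l-1}. g b) + (\<Sum>b\<in>{u+l..v+l}. g b)"
    by (rule sum.union_disjoint) auto
  ultimately show ?thesis using 1 by (simp add: sum_subtractf)
qed

lemma sum_first_two: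
  fixes g :: "nat \<Rightarrow> 'a :: comm_monoid_add"
  assumes "k \<ge> 2"
  shows "(\<Sum>i<k. g i) = g 0 + g 1 + (\<Sum>i\<in>{2..<k}. g i)"
  using sum.atLeastLessThan_concat[of 0 2 k g] assms by (simp add: lessThan_atLeast0 numeral_2_eq_2)

text \<open>Thresholds are centred: z = s - H, so uniform thresholds on 0, ..., 2 H become uniform
  on - H, ..., H and have sum 0. \<open>c i\<close> is the cost of the level sets of a function,
  \<open>C\<close> a lower bound on the cost of every admissible threshold vector, and
  \<open>l\<close> the length of a shift. All ranges of the exchange are multiples of
  \<open>l * N\<close> up to terms in \<open>l\<close>, and 16 of them make up H.\<close>

locale covering_thresholds =
  fixes k :: nat and H l N :: int and c :: "nat \<Rightarrow> int \<Rightarrow> real" and C :: real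
  assumes k: "k \<ge> 3" and l: "l > 0" and N: "N > 0" and H: "H = 16 * (l * N)"
    and anti: "\<And>i a b. i < k \<Longrightarrow> a \<le> b \<Longrightarrow> c i b \<le> c i a"
    and nonneg: "\<And>i a. i < k \<Longrightarrow> 0 \<le> c i a"
    and C: "C \<ge> 0"
    and cover: "\<And>z. (\<And>i. i < k \<Longrightarrow> - H \<le> z i) \<Longrightarrow> (\<Sum>i<k. z i) = 0 \<Longrightarrow> C \<le> (\<Sum>i<k. c i (z i))"
begin

lemma lN: "l * N \<ge> 1" "l \<le> l * N"
  using l N by (auto simp: int_one_le_iff_zero_less)

lemma Hpos: "H > 0" using lN H by simp

text \<open>If the first coordinate lies in the second half of a redundant block, it may drop by
  \<open>l\<close> at no cost while the second coordinate rises by \<open>l\<close>. The new vector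
  still costs at least \<open>C\<close>, so the original one costs at least \<open>C\<close> plus
  the decrease of \<open>c 1\<close>. Averaging over the coupling turns this into a gain.\<close>

lemma coupling_gain:
  assumes cpl: "coupling k H \<mu> y W"
    and r: "- 4 * (l * N) \<le> r" "r + 2 * l \<le> - 2 * (l * N)"
    and block: "\<And>a. r + l \<le> a \<Longrightarrow> a < r + 2 * l \<Longrightarrow> c 0 (a - l) = c 0 a"
  shows "W * ((2 * real_of_int H + 1) * C) + real_of_int (2 * l * N * l) * (\<Sum>b\<in>{- 12 * (l * N)..H}. c 1 b - c 1 (b + l))
    \<le> W * (\<Sum>i<k. \<Sum>z\<in>{-H..H}. c i z)"
proof -
  let ?O = "{-H..H} \<times> {-H..H}" and ?O' = "{r+l..r+2*l-1} \<times> {- 12 * (l * N)..H}"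
  \<comment> \<open>The gain is claimed with a smaller, constant weight: on the rectangle \<mu>
    \<ge> - a \<ge> 2 l N by the last property of the coupling. The bound - 12 l N on b keeps H + a
    + b nonnegative, since a \<ge> - 4 l N.\<close>
  define \<nu> where "\<nu> \<omega> = (if \<omega> \<in> ?O' then real_of_int (2 * l * N) else 0)" for \<omega>
  define \<delta> where "\<delta> b = c 1 b - c 1 (b + l)" for b
  have marg: "(\<Sum>\<omega>\<in>?O. \<mu> \<omega> * \<phi> (y \<omega> i)) = W * (\<Sum>z\<in>{-H..H}. \<phi> z)" if "i < k" for i and \<phi> :: "int \<Rightarrow> real"
    using couplingD(1)[OF cpl that] .
  note y = couplingD(2,3,4)[OF cpl]
  have point: "\<mu> \<omega> * C + \<nu> \<omega> * \<delta> (snd \<omega>) \<le> \<mu> \<omega> * (\<Sum>i<k. c i (y \<omega> i))" if \<omega>: "\<omega> \<in> ?O" for \<omega>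
  proof (cases "\<omega> \<in> ?O'")
    case False
    have "\<mu> \<omega> \<ge> 0" "\<mu> \<omega> > 0 \<longrightarrow> (\<forall>i<k. - H \<le> y \<omega> i)" using couplingD(5,6)[OF cpl \<omega>] by auto
    moreover have "C \<le> (\<Sum>i<k. c i (y \<omega> i))" if "\<forall>i<k. - H \<le> y \<omega> i" using that y by (intro cover) auto
    ultimately have "\<mu> \<omega> * C \<le> \<mu> \<omega> * (\<Sum>i<k. c i (y \<omega> i))"
      by (cases "\<mu> \<omega> = 0") (auto intro!: mult_left_mono)
    then show ?thesis using False by (simp add: \<nu>_def)
  next
    case True
    obtain a b where ab: "\<omega> = (a, b)" by (cases \<omega>)
    have a: "r + l \<le> a" "a < r + 2 * l" and b: "- 12 * (l * N) \<le> b" "b \<le> H" using True ab by auto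
    have "0 \<le> - a \<and> - 4 * a \<le> H \<and> 0 \<le> H + a + b \<and> b \<le> H" using a b r l lN H by linarith
    then have "- real_of_int a \<le> \<mu> \<omega>" unfolding ab by (rule couplingD(7)[OF cpl])
    moreover have "real_of_int (2 * l * N) \<le> - real_of_int a" using a r by linarith
    ultimately have \<nu>: "\<nu> \<omega> \<le> \<mu> \<omega>" "\<nu> \<omega> > 0" using True l N by (auto simp: \<nu>_def)
    then have ge: "\<forall>i<k. - H \<le> y \<omega> i" using couplingD(6)[OF cpl \<omega>] by simp
    define z where "z = (y \<omega>)(0 := a - l, 1 := b + l)"
    have S0: "C \<le> (\<Sum>i<k. c i (y \<omega> i))" using ge y by (intro cover) auto
    have "C \<le> (\<Sum>i<k. c i (z i))"
    proof (rule cover)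
      show "- H \<le> z i" if "i < k" for i using ge that a b r l lN H by (auto simp: z_def)
      have "(\<Sum>i<k. z i) = (\<Sum>i<k. y \<omega> i)"
        using k y[of \<omega>] ab by (subst (1 2) sum_first_two) (auto simp: z_def)
      then show "(\<Sum>i<k. z i) = 0" using y by simp
    qed
    also have "(\<Sum>i<k. c i (z i)) = (\<Sum>i<k. c i (y \<omega> i)) - \<delta> b"
    proof -
      have "(\<Sum>i\<in>{2..<k}. c i (z i)) = (\<Sum>i\<in>{2..<k}. c i (y \<omega> i))" by (intro sum.cong) (auto simp: z_def)
      then show ?thesis using k y(1,2)[of \<omega>] ab block[OF a]
        by (subst (1 2) sum_first_two) (auto simp: z_def \<delta>_def)
    qed
    finally have S1: "C + \<delta> b \<le> (\<Sum>i<k. c i (y \<omega> i))" by simp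
    have "(\<mu> \<omega> - \<nu> \<omega>) * C \<le> (\<mu> \<omega> - \<nu> \<omega>) * (\<Sum>i<k. c i (y \<omega> i))"
      using S0 \<nu> by (intro mult_left_mono) auto
    moreover have "\<nu> \<omega> * (C + \<delta> b) \<le> \<nu> \<omega> * (\<Sum>i<k. c i (y \<omega> i))"
      using S1 \<nu> by (intro mult_left_mono) auto
    ultimately show ?thesis using ab by (simp add: algebra_simps)
  qed
  have "(\<Sum>\<omega>\<in>?O. \<mu> \<omega> * C + \<nu> \<omega> * \<delta> (snd \<omega>)) \<le> (\<Sum>\<omega>\<in>?O. \<mu> \<omega> * (\<Sum>i<k. c i (y \<omega> i)))"
    by (rule sum_mono) (rule point)
  also have "\<dots> = (\<Sum>i<k. \<Sum>\<omega>\<in>?O. \<mu> \<omega> * c i (y \<omega> i))"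
    by (subst sum.swap) (simp add: sum_distrib_left)
  also have "\<dots> = W * (\<Sum>i<k. \<Sum>z\<in>{-H..H}. c i z)"
    by (simp add: marg sum_distrib_left)
  finally have "(\<Sum>\<omega>\<in>?O. \<mu> \<omega> * C) + (\<Sum>\<omega>\<in>?O. \<nu> \<omega> * \<delta> (snd \<omega>)) \<le> W * (\<Sum>i<k. \<Sum>z\<in>{-H..H}. c i z)"
    by (simp add: sum.distrib)
  moreover have "(\<Sum>\<omega>\<in>?O. \<mu> \<omega> * C) = W * ((2 * real_of_int H + 1) * C)"
    using marg[of 0 "\<lambda>_. C"] k Hpos by simp
  moreover have "(\<Sum>\<omega>\<in>?O. \<nu> \<omega> * \<delta> (snd \<omega>)) = real_of_int (2 * l * N * l) * (\<Sum>b\<in>{- 12 * (l * N)..H}. \<delta> b)"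
  proof -
    have sub: "?O' \<subseteq> ?O" using r l lN H by auto
    have "(\<Sum>\<omega>\<in>?O. \<nu> \<omega> * \<delta> (snd \<omega>)) = (\<Sum>\<omega>\<in>?O'. \<nu> \<omega> * \<delta> (snd \<omega>))"
      using sub by (intro sum.mono_neutral_right) (auto simp: \<nu>_def)
    also have "\<dots> = (\<Sum>\<omega>\<in>?O'. real_of_int (2 * l * N) * \<delta> (snd \<omega>))"
      by (intro sum.cong refl) (simp add: \<nu>_def)
    also have "\<dots> = (\<Sum>a\<in>{r+l..r+2*l-1}. \<Sum>b\<in>{- 12 * (l * N)..H}. real_of_int (2 * l * N) * \<delta> b)"
      unfolding sum.cartesian_product' by simp
    also have "\<dots> = real_of_int (2 * l * N * l) * (\<Sum>b\<in>{- 12 * (l * N)..H}. \<delta> b)"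
      using l by (simp add: sum_distrib_left[symmetric])
    finally show ?thesis .
  qed
  ultimately show ?thesis by (simp add: \<delta>_def)
qed

text \<open>The upper end (k - 1) H corresponds to the threshold k H. The coupling reaches only - H,
  ..., H; the values beyond form a tail that serves as additional slack.\<close>

definition "level_sum = (\<Sum>i<k. \<Sum>z\<in>{-H..(int k - 1) * H}. c i z)"

lemma level_sum_split: "level_sum = (\<Sum>i<k. \<Sum>z\<in>{-H..H}. c i z) + (\<Sum>i<k. \<Sum>z\<in>{H+1..(int k - 1) * H}. c i z)"
proof -
  have "H \<le> (int k - 1) * H" using mult_right_mono[of 1 "int k - 1" H] k Hpos by simp
  moreover have "{-H..t} = {-H..H} \<union> {H+1..t}" if "H \<le> t" for t using that Hpos by auto
  ultimately have "{-H..(int k - 1) * H} = {-H..H} \<union> {H+1..(int k - 1) * H}" by blast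
  then have "(\<Sum>z\<in>{-H..(int k - 1) * H}. c i z) = (\<Sum>z\<in>{-H..H}. c i z) + (\<Sum>z\<in>{H+1..(int k - 1) * H}. c i z)" for i
    by (simp only:) (rule sum.union_disjoint; auto)
  then show ?thesis by (simp add: level_sum_def sum.distrib)
qed

lemma tail_ge:
  assumes "i < k" "0 \<le> j" "j \<le> H"
  shows "real_of_int j * c i (H + j) \<le> (\<Sum>z\<in>{H+1..H+j}. c i z)"
    and "(\<Sum>z\<in>{H+1..H+j}. c i z) \<le> (\<Sum>i<k. \<Sum>z\<in>{H+1..(int k - 1) * H}. c i z)"
proof -
  have "(\<Sum>z\<in>{H+1..H+j}. c i (H + j)) \<le> (\<Sum>z\<in>{H+1..H+j}. c i z)"
    using assms by (intro sum_mono anti) auto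
  then show "real_of_int j * c i (H + j) \<le> (\<Sum>z\<in>{H+1..H+j}. c i z)" using assms by simp
  have "H * 2 \<le> H * (int k - 1)" using k Hpos by (intro mult_left_mono) auto
  then have "(\<Sum>z\<in>{H+1..H+j}. c i z) \<le> (\<Sum>z\<in>{H+1..(int k - 1) * H}. c i z)"
    using assms nonneg by (intro sum_mono2) (auto simp: mult.commute)
  also have "\<dots> \<le> (\<Sum>i<k. \<Sum>z\<in>{H+1..(int k - 1) * H}. c i z)"
    using assms nonneg by (intro member_le_sum[of i "{..<k}" "\<lambda>i. \<Sum>z\<in>{H+1..(int k - 1) * H}. c i z"]) (auto intro!: sum_nonneg)
  finally show "(\<Sum>z\<in>{H+1..H+j}. c i z) \<le> (\<Sum>i<k. \<Sum>z\<in>{H+1..(int k - 1) * H}. c i z)" .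
qed

text \<open>The differences of \<open>c 1\<close> telescope to at least \<open>l\<close> times one
  value, minus \<open>l\<close> values beyond H. The latter are absorbed by the tail of the level
  sum, because the weight used in the exchange is at most W.\<close>

lemma level_sum_ge_gain:
  assumes r: "- 4 * (l * N) \<le> r" "r + 2 * l \<le> - 2 * (l * N)"
    and block: "\<And>a. r + l \<le> a \<Longrightarrow> a < r + 2 * l \<Longrightarrow> c 0 (a - l) = c 0 a"
  shows "(2 * real_of_int H + 1) * C + real_of_int l / (512 * real_of_int N) * c 1 (- 12 * (l * N) + l) \<le> level_sum"
proof -
  obtain \<mu> y W where cpl: "coupling k H \<mu> y W" using coupling_exists[OF k Hpos] by blast
  have W: "W > 0" "W \<le> 4 * real_of_int H ^ 2" using couplingD(8,9)[OF cpl] .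
  let ?T = "\<Sum>i<k. \<Sum>z\<in>{H+1..(int k - 1) * H}. c i z"
  let ?S = "\<Sum>i<k. \<Sum>z\<in>{-H..H}. c i z" and ?g = "c 1 (- 12 * (l * N) + l)"
  let ?t = "\<Sum>b\<in>{H+1..H+l}. c 1 b" and ?n = "real_of_int (2 * l * N * l)"
  have "real_of_int l * ?g \<le> (\<Sum>b\<in>{- 12 * (l * N)..- 12 * (l * N) + l - 1}. c 1 b)"
  proof -
    have "(\<Sum>b\<in>{- 12 * (l * N)..- 12 * (l * N) + l - 1}. ?g) \<le> (\<Sum>b\<in>{- 12 * (l * N)..- 12 * (l * N) + l - 1}. c 1 b)"
      using k by (intro sum_mono anti) auto
    then show ?thesis using l by simp
  qed
  moreover have "(\<Sum>b\<in>{- 12 * (l * N)..H}. c 1 b - c 1 (b + l)) =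
      (\<Sum>b\<in>{- 12 * (l * N)..- 12 * (l * N) + l - 1}. c 1 b) - ?t"
    using l lN H by (intro sum_int_shift_telescope) auto
  ultimately have "real_of_int l * ?g - ?t \<le> (\<Sum>b\<in>{- 12 * (l * N)..H}. c 1 b - c 1 (b + l))" by linarith
  then have "?n * (real_of_int l * ?g - ?t) \<le> ?n * (\<Sum>b\<in>{- 12 * (l * N)..H}. c 1 b - c 1 (b + l))"
    using l N by (intro mult_left_mono) auto
  then have "W * ((2 * real_of_int H + 1) * C) + ?n * (real_of_int l * ?g) - ?n * ?t \<le> W * ?S"
    using coupling_gain[OF cpl r block] by (simp add: algebra_simps)
  moreover have "?n * ?t \<le> W * ?T"
  proof (rule mult_mono)
    show "?t \<le> ?T" using tail_ge(2)[of 1 l] k l lN H by auto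
    \<comment> \<open>W is read off at the single value - (l N) of the first coordinate, where the
      lower bound on \<mu> gives at least l N for each b from 0 to H.\<close>
    show "?n \<le> W"
    proof -
      have "(\<Sum>\<omega>\<in>{-H..H} \<times> {-H..H}. \<mu> \<omega> * (if y \<omega> 0 = - (l * N) then 1 else 0)) = W * (\<Sum>z\<in>{-H..H}. if z = - (l * N) then 1 else 0)"
        using k by (intro couplingD(1)[OF cpl]) simp
      also have "(\<Sum>z\<in>{-H..H}. if z = - (l * N) then 1 else 0) = (1 :: real)"
        using lN H by (simp add: mult.commute)
      finally have "W = (\<Sum>\<omega>\<in>{-H..H} \<times> {-H..H}. \<mu> \<omega> * (if y \<omega> 0 = - (l * N) then 1 else 0))" by simp
      moreover have "\<dots> \<ge> (\<Sum>\<omega>\<in>{- (l * N)} \<times> {0..H}. \<mu> \<omega> * (if y \<omega> 0 = - (l * N) then 1 else 0))"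
        using couplingD(5)[OF cpl] lN H by (intro sum_mono2) (auto simp: mult.commute)
      moreover have "(\<Sum>\<omega>\<in>{- (l * N)} \<times> {0..H}. \<mu> \<omega> * (if y \<omega> 0 = - (l * N) then 1 else 0)) \<ge> (\<Sum>\<omega>\<in>{- (l * N)} \<times> {0..H}. real_of_int (l * N))"
      proof (rule sum_mono)
        fix \<omega> assume "\<omega> \<in> {- (l * N)} \<times> {0..H}"
        then obtain b where b: "\<omega> = (- (l * N), b)" "0 \<le> b" "b \<le> H" by auto
        have "- real_of_int (- (l * N)) \<le> \<mu> (- (l * N), b)"
          using b lN H by (intro couplingD(7)[OF cpl]) (auto simp: mult.commute)
        moreover have "y \<omega> 0 = - (l * N)" using couplingD(2)[OF cpl, of \<omega>] b by simp
        ultimately show "real_of_int (l * N) \<le> \<mu> \<omega> * (if y \<omega> 0 = - (l * N) then 1 else 0)" using b by simp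
      qed
      moreover have "(\<Sum>\<omega>\<in>{- (l * N)} \<times> {0..H}. real_of_int (l * N)) = real_of_int (l * N) * (real_of_int H + 1)"
        using Hpos by (simp add: card_cartesian_product mult.commute)
      ultimately have "real_of_int (l * N) * (real_of_int H + 1) \<le> W" by linarith
      moreover have "real_of_int (l * N) * real_of_int (2 * l) \<le> real_of_int (l * N) * (real_of_int H + 1)"
      proof (rule mult_left_mono)
        have "2 * l \<le> H + 1" using lN H by linarith
        then show "real_of_int (2 * l) \<le> real_of_int H + 1" by linarith
      qed (use lN in linarith)
      ultimately show ?thesis by (simp add: algebra_simps)
    qed
  qed (use W k nonneg in \<open>auto intro!: sum_nonneg\<close>)
  ultimately have main: "W * ((2 * real_of_int H + 1) * C) + ?n * (real_of_int l * ?g) \<le> W * level_sum"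
    by (simp add: level_sum_split algebra_simps)
  \<comment> \<open>Origin of 512: 2 l^3 N / (4 H^2) = l / (512 N) for H = 16 l N.\<close>
  have "W * (real_of_int l / (512 * real_of_int N)) \<le> 4 * real_of_int H ^ 2 * (real_of_int l / (512 * real_of_int N))"
    using W l N by (intro mult_right_mono) auto
  also have "\<dots> = ?n * real_of_int l" using N by (simp add: H power2_eq_square)
  finally have "W * (real_of_int l / (512 * real_of_int N)) * ?g \<le> ?n * real_of_int l * ?g"
    using nonneg[of 1] k by (intro mult_right_mono) auto
  with main have "W * ((2 * real_of_int H + 1) * C + real_of_int l / (512 * real_of_int N) * ?g) \<le> W * level_sum"
    by (simp add: algebra_simps)
  then show ?thesis using W by simp
qed

lemma level_sum_ge_tail: "(2 * real_of_int H + 1) * C + (\<Sum>i<k. \<Sum>z\<in>{H+1..(int k - 1) * H}. c i z) \<le> level_sum"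
proof -
  obtain \<mu> y W where cpl: "coupling k H \<mu> y W" using coupling_exists[OF k Hpos] by blast
  let ?O = "{-H..H} \<times> {-H..H}"
  have point: "\<mu> \<omega> * C \<le> \<mu> \<omega> * (\<Sum>i<k. c i (y \<omega> i))" if \<omega>: "\<omega> \<in> ?O" for \<omega>
  proof -
    have "\<mu> \<omega> \<ge> 0" "\<mu> \<omega> > 0 \<longrightarrow> (\<forall>i<k. - H \<le> y \<omega> i)" using couplingD(5,6)[OF cpl \<omega>] by auto
    moreover have "C \<le> (\<Sum>i<k. c i (y \<omega> i))" if "\<forall>i<k. - H \<le> y \<omega> i"
      using that couplingD(4)[OF cpl] by (intro cover) auto
    ultimately show ?thesis by (cases "\<mu> \<omega> = 0") (auto intro!: mult_left_mono)
  qed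
  have "(\<Sum>\<omega>\<in>?O. \<mu> \<omega> * C) \<le> (\<Sum>\<omega>\<in>?O. \<mu> \<omega> * (\<Sum>i<k. c i (y \<omega> i)))" by (rule sum_mono) (rule point)
  also have "\<dots> = (\<Sum>i<k. \<Sum>\<omega>\<in>?O. \<mu> \<omega> * c i (y \<omega> i))"
    by (subst sum.swap) (simp add: sum_distrib_left)
  also have "\<dots> = W * (\<Sum>i<k. \<Sum>z\<in>{-H..H}. c i z)"
    by (simp add: couplingD(1)[OF cpl] sum_distrib_left)
  also have "(\<Sum>\<omega>\<in>?O. \<mu> \<omega> * C) = W * ((2 * real_of_int H + 1) * C)"
    using couplingD(1)[OF cpl, of 0 "\<lambda>_. C"] k Hpos by simp
  finally show ?thesis using couplingD(8)[OF cpl] by (simp add: level_sum_split)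
qed

text \<open>The exchange raises coordinate 1. Relabelling puts any h other than 0 into this place,
  while the redundant block stays with coordinate 0.\<close>

lemma covering_thresholds_swap:
  assumes h: "h < k" "h \<noteq> 0"
  defines "\<pi> \<equiv> (\<lambda>i. if i = 1 then h else if i = h then 1 else i)"
  shows "covering_thresholds k H l N (\<lambda>i. c (\<pi> i)) C"
    and "(\<Sum>i<k. \<Sum>z\<in>{-H..(int k - 1) * H}. c (\<pi> i) z) = level_sum"
proof -
  have \<pi>: "\<pi> (\<pi> i) = i" for i by (simp add: \<pi>_def)
  have \<pi>k: "\<pi> i < k" if "i < k" for i using that h k by (simp add: \<pi>_def)
  have perm: "(\<Sum>i<k. g (\<pi> i)) = (\<Sum>i<k. g i)" for g :: "nat \<Rightarrow> 'b :: comm_monoid_add"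
    by (rule sum.reindex_bij_witness[of _ \<pi> \<pi>]) (auto simp: \<pi> \<pi>k)
  show "covering_thresholds k H l N (\<lambda>i. c (\<pi> i)) C"
  proof
    fix z :: "nat \<Rightarrow> int" assume z: "\<And>i. i < k \<Longrightarrow> - H \<le> z i" "(\<Sum>i<k. z i) = 0"
    have "C \<le> (\<Sum>i<k. c i (z (\<pi> i)))" using z \<pi>k perm[of z] by (intro cover) auto
    also have "\<dots> = (\<Sum>i<k. c (\<pi> i) (z i))" using perm[of "\<lambda>i. c i (z (\<pi> i))"] \<pi> by simp
    finally show "C \<le> (\<Sum>i<k. c (\<pi> i) (z i))" .
  qed (use k l N H anti nonneg C \<pi>k in auto)
  show "(\<Sum>i<k. \<Sum>z\<in>{-H..(int k - 1) * H}. c (\<pi> i) z) = level_sum"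
    unfolding level_sum_def by (rule perm)
qed

text \<open>Either \<open>c 0\<close> is still at least C / 2 at H + 4 l N, and its tail alone
  provides the slack. Or the vector with all other coordinates at - 12 l N + l, which costs at least
  C, has half of this cost outside coordinate 0, so some h costs at least C / (2 k) there. This is
  the very value that governs the gain of the exchange with h; 1024 k arises as 512 * 2 k.\<close>

theorem level_sum_ge:
  assumes r: "- 4 * (l * N) \<le> r" "r + 2 * l \<le> - 2 * (l * N)"
    and block: "\<And>a. r + l \<le> a \<Longrightarrow> a < r + 2 * l \<Longrightarrow> c 0 (a - l) = c 0 a"
  shows "(2 * real_of_int H + 1 + real_of_int l / (1024 * real_of_int N * real k)) * C \<le> level_sum"
proof (cases "c 0 (H + 4 * (l * N)) \<ge> C / 2")
  case True
  have "real_of_int (4 * (l * N)) * (C / 2) \<le> real_of_int (4 * (l * N)) * c 0 (H + 4 * (l * N))"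
    using True l N by (intro mult_left_mono) auto
  also have "\<dots> \<le> (\<Sum>i<k. \<Sum>z\<in>{H+1..(int k - 1) * H}. c i z)"
    using tail_ge[of 0 "4 * (l * N)"] k l N H by fastforce
  finally have tail: "real_of_int (4 * (l * N)) * (C / 2) \<le> (\<Sum>i<k. \<Sum>z\<in>{H+1..(int k - 1) * H}. c i z)" .
  have "real_of_int l / (1024 * real_of_int N * real k) \<le> real_of_int (2 * (l * N))"
  proof -
    have N1: "real_of_int N \<ge> 1" and k1: "real k \<ge> 1" using N k by auto
    then have "1024 * real_of_int N * real k \<ge> 1024 * 1 * 1" by (intro mult_mono) auto
    then have "real_of_int l / (1024 * real_of_int N * real k) \<le> real_of_int l / 1"
      using l by (intro divide_left_mono) auto
    also have "\<dots> \<le> 2 * (real_of_int l * real_of_int N)"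
      using N1 l mult_left_mono[of 1 "real_of_int N" "real_of_int l"] by simp
    finally show ?thesis by simp
  qed
  from mult_right_mono[OF this C]
  have "real_of_int l / (1024 * real_of_int N * real k) * C \<le> real_of_int (4 * (l * N)) * (C / 2)"
    by (simp add: mult.commute mult.left_commute)
  then show ?thesis using level_sum_ge_tail tail by (simp add: algebra_simps)
next
  case False
  let ?y = "- 12 * (l * N) + l"
  have "\<exists>h<k. h \<noteq> 0 \<and> C / (2 * real k) \<le> c h ?y"
  proof (rule ccontr)
    assume "\<not> ?thesis"
    then have less: "c i ?y \<le> C / (2 * real k)" if "i < k" "i \<noteq> 0" for i using that by force
    define z where "z i = (if i = 0 then (int k - 1) * (- ?y) else ?y)" for i :: nat
    have split: "(\<Sum>i<k. g i) = g 0 + (\<Sum>i\<in>{1..<k}. g i)" for g :: "nat \<Rightarrow> 'b :: comm_monoid_add"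
      using k by (simp add: lessThan_atLeast0 sum.atLeast_Suc_lessThan)
    \<comment> \<open>Here k \<ge> 3 counts: two other coordinates push z 0 up to 24 l N - 2 l,
      which is at least 20 l N = H + 4 l N.\<close>
    have big: "H + 4 * (l * N) \<le> z 0"
    proof -
      have "2 * (- ?y) \<le> (int k - 1) * (- ?y)" using k lN by (intro mult_right_mono) auto
      then show ?thesis using lN H by (simp add: z_def mult.commute)
    qed
    have "C \<le> (\<Sum>i<k. c i (z i))"
    proof (rule cover)
      have "- H \<le> z 0" using big lN H by linarith
      moreover have "- H \<le> ?y" using lN H l by linarith
      ultimately show "- H \<le> z i" for i by (cases "i = 0") (auto simp: z_def)
      show "(\<Sum>i<k. z i) = 0" using k by (subst split) (simp add: z_def of_nat_diff algebra_simps)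
    qed
    also have "\<dots> = c 0 (z 0) + (\<Sum>i\<in>{1..<k}. c i (z i))" by (rule split)
    also have "(\<Sum>i\<in>{1..<k}. c i (z i)) \<le> (\<Sum>i\<in>{1..<k}. C / (2 * real k))"
    proof (rule sum_mono)
      fix i assume "i \<in> {1..<k}"
      then show "c i (z i) \<le> C / (2 * real k)" using less[of i] by (simp only: z_def) simp
    qed
    also have "\<dots> = real (k - 1) * (C / (2 * real k))" by simp
    also have "\<dots> \<le> real k * (C / (2 * real k))" using C by (intro mult_right_mono) auto
    also have "\<dots> = C / 2" using k by simp
    finally have "C / 2 \<le> c 0 (z 0)" by simp
    also have "\<dots> \<le> c 0 (H + 4 * (l * N))" using big k by (intro anti) auto
    finally show False using False by simp
  qed
  then obtain h where h: "h < k" "h \<noteq> 0" "C / (2 * real k) \<le> c h ?y" by blast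
  let ?\<pi> = "\<lambda>i. if i = 1 then h else if i = h then 1 else i"
  interpret P: covering_thresholds k H l N "\<lambda>i. c (?\<pi> i)" C
    using covering_thresholds_swap(1)[OF h(1,2)] .
  have "(2 * real_of_int H + 1) * C + real_of_int l / (512 * real_of_int N) * c h ?y \<le> P.level_sum"
    using P.level_sum_ge_gain[OF r] block h(2) by simp
  also have "P.level_sum = level_sum"
    unfolding P.level_sum_def by (rule covering_thresholds_swap(2)[OF h(1,2)])
  finally have *: "(2 * real_of_int H + 1) * C + real_of_int l / (512 * real_of_int N) * c h ?y \<le> level_sum" .
  have "real_of_int l / (512 * real_of_int N) * (C / (2 * real k)) \<le> real_of_int l / (512 * real_of_int N) * c h ?y"
    using h(3) l N by (intro mult_left_mono) auto
  then show ?thesis using * by (simp add: algebra_simps)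
qed

end

text \<open>The covering bound for natural thresholds s = z + H and functions 1, ..., k. The
  interval from 12 l N to 14 l N becomes the one from - 4 l N to - 2 l N.\<close>

lemma threshold_slack:
  fixes b :: "nat \<Rightarrow> nat \<Rightarrow> real" and C :: real and k l N r :: nat
  assumes k: "k \<ge> 3" and l: "l > 0" and N: "N > 0" and H: "H = 16 * (l * N)"
    and anti: "\<And>i s t. i \<in> {1..k} \<Longrightarrow> s \<le> t \<Longrightarrow> b i t \<le> b i s"
    and nonneg: "\<And>i s. i \<in> {1..k} \<Longrightarrow> 0 \<le> b i s"
    and C: "C \<ge> 0"
    and cover: "\<And>s. (\<Sum>i=1..k. s i) \<le> k * H \<Longrightarrow> C \<le> (\<Sum>i=1..k. b i (s i))"
    and r: "12 * (l * N) \<le> r" "r + 2 * l \<le> 14 * (l * N)"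
    and block: "\<And>a. r \<le> a \<Longrightarrow> a < r + 2 * l \<Longrightarrow> b 1 a = b 1 r"
  shows "(2 * real H + 1 + real l / (1024 * real N * real k)) * C \<le> (\<Sum>i=1..k. \<Sum>s\<le>k * H. b i s)"
proof -
  have re: "(\<Sum>i=1..k. g i) = (\<Sum>i<k. g (Suc i))" for g :: "nat \<Rightarrow> 'b :: comm_monoid_add"
    by (rule sum.reindex_bij_witness[of _ Suc "\<lambda>i. i - 1"]) auto
  let ?c = "\<lambda>i z. b (Suc i) (nat (z + int H))"
  interpret covering_thresholds k "int H" "int l" "int N" ?c C
  proof
    fix z :: "nat \<Rightarrow> int" assume z: "\<And>i. i < k \<Longrightarrow> - int H \<le> z i" "(\<Sum>i<k. z i) = 0"
    have "int (\<Sum>i<k. nat (z i + int H)) = (\<Sum>i<k. z i + int H)"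
      unfolding of_nat_sum using z(1) by (intro sum.cong) force+
    also have "\<dots> = int (k * H)" using z(2) by (simp add: sum.distrib)
    finally have "(\<Sum>i<k. nat (z i + int H)) = k * H" by (simp only: of_nat_eq_iff)
    then have "(\<Sum>i=1..k. nat (z (i - 1) + int H)) \<le> k * H" unfolding re by simp
    from cover[OF this] show "C \<le> (\<Sum>i<k. ?c i (z i))" unfolding re by simp
  qed (use k l N H C in \<open>auto intro!: anti nonneg\<close>)
  have "(2 * real_of_int (int H) + 1 + real_of_int (int l) / (1024 * real_of_int (int N) * real k)) * C \<le> level_sum"
  proof (rule level_sum_ge[of "int r - int H"])
    have "int (12 * (l * N)) \<le> int r" "int (r + 2 * l) \<le> int (14 * (l * N))" using r by (simp_all only: of_nat_le_iff)
    then show "- 4 * (int l * int N) \<le> int r - int H" "int r - int H + 2 * int l \<le> - 2 * (int l * int N)"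
      using H by (simp_all add: mult.commute)
    fix a assume a: "int r - int H + int l \<le> a" "a < int r - int H + 2 * int l"
    have "b 1 (nat (a - int l + int H)) = b 1 r" "b 1 (nat (a + int H)) = b 1 r"
      using a by (intro block; linarith)+
    then show "?c 0 (a - int l) = ?c 0 a" by simp
  qed
  also have "level_sum = (\<Sum>i=1..k. \<Sum>s\<le>k * H. b i s)"
    unfolding level_sum_def re
  proof (rule sum.cong[OF refl])
    fix i
    show "(\<Sum>z\<in>{- int H..(int k - 1) * int H}. ?c i z) = (\<Sum>s\<le>k * H. b (Suc i) s)"
      using k by (intro sum.reindex_bij_witness[of _ "\<lambda>s. int s - int H" "\<lambda>z. nat (z + int H)"])
        (auto simp: algebra_simps nat_le_iff simp flip: of_nat_mult of_nat_add)
  qed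
  finally show ?thesis by simp
qed

section \<open>Certifying implications between elements of a minimizer\<close>

text \<open>
  A preorder \<open>A\<close> on the nodes \<open>{..<n+2}\<close> records implications \<open>a \<in> X \<Longrightarrow> b \<in> X\<close> that hold for a fixed
  minimizer. Node \<open>n\<close> stands for a member of every set and node \<open>n + 1\<close> for a member of none, so that
  arcs from \<open>n\<close> and to \<open>n + 1\<close> fix elements inside and outside of the minimizer.
\<close>

definition closed_set :: "nat \<Rightarrow> (nat \<times> nat) set \<Rightarrow> nat set \<Rightarrow> bool" where
  "closed_set n A X \<longleftrightarrow> X \<subseteq> {..<n} \<and> (\<forall>a b. (a, b) \<in> A \<longrightarrow> a \<in> insert n X \<longrightarrow> b \<in> insert n X)"

text \<open>For valid arcs this is the least closed set that has \<open>a\<close> as a member, if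
  there is one; for \<open>a = n\<close>, the least closed set altogether.\<close>

definition reach :: "nat \<Rightarrow> (nat \<times> nat) set \<Rightarrow> nat \<Rightarrow> nat set" where
  "reach n A a = {w. w < n \<and> (a, w) \<in> A}"

text \<open>Dually, the largest closed set without \<open>b\<close>; for \<open>b = n + 1\<close>,
  the largest closed set altogether.\<close>

definition avoid :: "nat \<Rightarrow> (nat \<times> nat) set \<Rightarrow> nat \<Rightarrow> nat set" where
  "avoid n A b = {v. v < n \<and> (v, b) \<notin> A}"

text \<open>Closed sets contain such a class entirely or not at all, so steps between closed sets
  add whole classes.\<close>

definition eqclass :: "nat \<Rightarrow> (nat \<times> nat) set \<Rightarrow> nat \<Rightarrow> nat set" where
  "eqclass n A u = {w. w < n \<and> (u, w) \<in> A \<and> (w, u) \<in> A}"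

definition cl_under :: "nat \<Rightarrow> (nat \<times> nat) set \<Rightarrow> nat \<Rightarrow> nat set \<Rightarrow> nat set" where
  "cl_under n A a S = {w. w < n \<and> ((a, w) \<in> A \<or> (\<exists>v\<in>S. (v, w) \<in> A))}"

definition free_node :: "nat \<Rightarrow> (nat \<times> nat) set \<Rightarrow> nat \<Rightarrow> bool" where
  "free_node n A u \<longleftrightarrow> u < n \<and> (n, u) \<notin> A \<and> (u, n + 1) \<notin> A"

definition valid_arcs :: "nat \<Rightarrow> (nat \<times> nat) set \<Rightarrow> bool" where
  "valid_arcs n A \<longleftrightarrow> A \<subseteq> {..<n+2} \<times> {..<n+2} \<and> trans A \<and>
     (\<forall>a<n+2. (a, a) \<in> A \<and> (a, n) \<in> A \<and> (n + 1, a) \<in> A)"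

lemma valid_arcsD:
  assumes "valid_arcs n A"
  shows "(a, b) \<in> A \<Longrightarrow> a < n + 2" "(a, b) \<in> A \<Longrightarrow> b < n + 2"
    "(a, b) \<in> A \<Longrightarrow> (b, d) \<in> A \<Longrightarrow> (a, d) \<in> A"
    "a < n + 2 \<Longrightarrow> (a, a) \<in> A" "a < n + 2 \<Longrightarrow> (a, n) \<in> A" "a < n + 2 \<Longrightarrow> (n + 1, a) \<in> A"
  using assms unfolding valid_arcs_def by (auto dest: transD)

lemma node_cases: "y < n + 2 \<Longrightarrow> y < n \<or> y = n \<or> y = n + (1 :: nat)"
  by auto

context
  fixes n :: nat and A :: "(nat \<times> nat) set"
  assumes A: "valid_arcs n A"
begin

lemma closed_reach:
  assumes "a < n + 2" "(a, n + 1) \<notin> A"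
  shows "closed_set n A (reach n A a)"
  unfolding closed_set_def
proof (intro conjI allI impI)
  fix x y assume xy: "(x, y) \<in> A" "x \<in> insert n (reach n A a)"
  then have "(a, x) \<in> A" using valid_arcsD(5)[OF A assms(1)] by (auto simp: reach_def)
  then have "(a, y) \<in> A" using valid_arcsD(3)[OF A] xy by blast
  then show "y \<in> insert n (reach n A a)" using assms(2) valid_arcsD(2)[OF A] node_cases[of y n]
    by (auto simp: reach_def)
qed (auto simp: reach_def)

lemma closed_avoid:
  assumes "b < n + 2" "(n, b) \<notin> A"
  shows "closed_set n A (avoid n A b)"
  unfolding closed_set_def
proof (intro conjI allI impI)
  fix x y assume xy: "(x, y) \<in> A" "x \<in> insert n (avoid n A b)"
  then have "(x, b) \<notin> A" using assms by (auto simp: avoid_def)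
  then have "(y, b) \<notin> A" using valid_arcsD(3)[OF A] xy by blast
  then show "y \<in> insert n (avoid n A b)" 
    using valid_arcsD(6)[OF A assms(1)] valid_arcsD(2)[OF A xy(1)] node_cases[of y n]
    by (auto simp: avoid_def)
qed (auto simp: avoid_def)

text \<open>Nothing that \<open>u\<close> implies strictly leads back into the class of
  \<open>u\<close>, so removing this class from the least closed set around \<open>u\<close> leaves
  a closed set.\<close>

lemma closed_reach_minus:
  assumes u: "free_node n A u"
  shows "closed_set n A (reach n A u - eqclass n A u)"
  unfolding closed_set_def
proof (intro conjI allI impI)
  fix x y assume xy: "(x, y) \<in> A" "x \<in> insert n (reach n A u - eqclass n A u)"
  have "y \<in> insert n (reach n A u)"
    using closed_reach[of u] u xy unfolding closed_set_def free_node_def by auto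
  moreover have "y \<notin> eqclass n A u"
  proof
    assume "y \<in> eqclass n A u"
    then have "(x, u) \<in> A" using xy valid_arcsD(3)[OF A, of x y u] by (auto simp: eqclass_def)
    then show False using xy u by (auto simp: eqclass_def reach_def free_node_def)
  qed
  ultimately show "y \<in> insert n (reach n A u - eqclass n A u)" by blast
qed (auto simp: reach_def)

lemma closed_avoid_plus:
  assumes u: "free_node n A u"
  shows "closed_set n A (avoid n A u \<union> eqclass n A u)"
  unfolding closed_set_def
proof (intro conjI allI impI)
  fix x y assume xy: "(x, y) \<in> A" "x \<in> insert n (avoid n A u \<union> eqclass n A u)"
  show "y \<in> insert n (avoid n A u \<union> eqclass n A u)"
  proof (cases "x \<in> insert n (avoid n A u)")
    case True
    then show ?thesis
      using closed_avoid[of u] u xy unfolding closed_set_def free_node_def by auto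
  next
    case False
    then have x: "x \<in> eqclass n A u" using xy by auto
    then have uy: "(u, y) \<in> A" using xy valid_arcsD(3)[OF A, of u x y] by (auto simp: eqclass_def)
    have "y < n \<or> y = n" using uy u valid_arcsD(2)[OF A xy(1)] node_cases[of y n] by (auto simp: free_node_def)
    then show ?thesis using uy by (auto simp: avoid_def eqclass_def)
  qed
qed (auto simp: avoid_def eqclass_def)

lemma closed_Un: "closed_set n A X \<Longrightarrow> closed_set n A Y \<Longrightarrow> closed_set n A (X \<union> Y)"
  unfolding closed_set_def by blast

lemma closed_Int: "closed_set n A X \<Longrightarrow> closed_set n A Y \<Longrightarrow> closed_set n A (X \<inter> Y)"
  unfolding closed_set_def by blast

lemma reach_subset_closed: "closed_set n A X \<Longrightarrow> a \<in> insert n X \<Longrightarrow> reach n A a \<subseteq> X"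
  unfolding closed_set_def reach_def by (auto simp: less_imp_neq)

lemma closed_subset_avoid: "closed_set n A X \<Longrightarrow> b \<notin> insert n X \<Longrightarrow> X \<subseteq> avoid n A b"
  unfolding closed_set_def avoid_def by blast

lemma closed_finite: "closed_set n A X \<Longrightarrow> finite X"
  unfolding closed_set_def using finite_subset by blast

end

lemma closed_submodular:
  "submodular_on {..<n} f \<Longrightarrow> closed_set n A X \<Longrightarrow> closed_set n A Y \<Longrightarrow> f (X \<union> Y) + f (X \<inter> Y) \<le> f X + f Y"
  unfolding submodular_on_def closed_set_def by blast

section \<open>Lipschitz constants on closed sets\<close>

definition lipschitz_closed :: "nat \<Rightarrow> (nat set \<Rightarrow> real) \<Rightarrow> (nat \<times> nat) set \<Rightarrow> real \<Rightarrow> bool" where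
  "lipschitz_closed n f A L \<longleftrightarrow> (\<forall>X Y. closed_set n A X \<longrightarrow> closed_set n A Y \<longrightarrow> X \<subseteq> Y \<longrightarrow> \<bar>f Y - f X\<bar> \<le> L * card (Y - X))"

text \<open>By diminishing returns, the marginal value of the class of \<open>u\<close> is largest
  at the earliest possible place, on top of the strict implications of \<open>u\<close>, and
  smallest at the latest, on top of the largest closed set avoiding \<open>u\<close>. Bounds at
  these two places bound every step of a chain of closed sets from \<open>X\<close> to
  \<open>Y\<close>.\<close>

lemma lipschitz_closedI:
  assumes A: "valid_arcs n A" and submod: "submodular_on {..<n} f" and L: "L \<ge> 0"
    and marginal: "\<And>u. free_node n A u \<Longrightarrow> f (reach n A u) - f (reach n A u - eqclass n A u) \<le> L
      \<and> f (avoid n A u) - f (avoid n A u \<union> eqclass n A u) \<le> L"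
  shows "lipschitz_closed n f A L"
  unfolding lipschitz_closed_def
proof (intro allI impI)
  fix X Y
  assume "closed_set n A X" "closed_set n A Y" "X \<subseteq> Y"
  then show "\<bar>f Y - f X\<bar> \<le> L * card (Y - X)"
  proof (induction "card (Y - X)" arbitrary: X rule: less_induct)
    case less
    show ?case
    proof (cases "X = Y")
      case True
      then show ?thesis by simp
    next
      case False
      let ?D = "Y - X"
      have fin: "finite ?D" "?D \<noteq> {}" using False less.prems closed_finite[OF A] by auto
      \<comment> \<open>An element of \<open>Y - X\<close> with the smallest \<open>reach\<close>
        implies, outside its class, only members of \<open>X\<close>; its class can be added
        next.\<close>
      obtain u where u: "u \<in> ?D" "\<And>w. w \<in> ?D \<Longrightarrow> card (reach n A u) \<le> card (reach n A w)"
        using fin arg_min_if_finite[of ?D "\<lambda>w. card (reach n A w)"] by (metis not_le_imp_less)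
      have un: "u < n" using u less.prems unfolding closed_set_def by auto
      have nu: "(n, u) \<notin> A" using u less.prems(1) un unfolding closed_set_def by auto
      have "n + 1 \<notin> insert n Y" using less.prems(2) unfolding closed_set_def by auto
      then have ut: "(u, n + 1) \<notin> A" using u less.prems(2) unfolding closed_set_def by blast
      have free: "free_node n A u" using un nu ut by (simp add: free_node_def)
      have RY: "reach n A u \<subseteq> Y" using u less.prems(2) reach_subset_closed[OF A] by blast
      have RX: "reach n A u - eqclass n A u \<subseteq> X"
      proof (rule ccontr)
        assume "\<not> ?thesis"
        then obtain w where w: "w \<in> reach n A u" "w \<notin> eqclass n A u" "w \<notin> X" by blast
        then have "w \<in> ?D" using RY by auto
        then have "card (reach n A u) \<le> card (reach n A w)" by (rule u(2))
        moreover have "reach n A w \<subset> reach n A u"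
        proof
          show "reach n A w \<subseteq> reach n A u" using w valid_arcsD(3)[OF A] by (auto simp: reach_def)
          have "u \<in> reach n A u" using un valid_arcsD(4)[OF A] by (auto simp: reach_def)
          moreover have "u \<notin> reach n A w" using w by (auto simp: reach_def eqclass_def)
          ultimately show "reach n A w \<noteq> reach n A u" by blast
        qed
        moreover have "finite (reach n A u)" by (simp add: reach_def)
        ultimately show False using psubset_card_mono[of "reach n A u" "reach n A w"] by linarith
      qed
      let ?C = "eqclass n A u"
      have uC: "u \<in> ?C" using un valid_arcsD(4)[OF A] by (auto simp: eqclass_def)
      have CX: "?C \<inter> X = {}"
      proof -
        have "w \<notin> X" if "w \<in> ?C" for w
          using that less.prems(1) u un unfolding closed_set_def eqclass_def by auto
        then show ?thesis by blast
      qed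
      have CY: "?C \<subseteq> Y" using RY by (auto simp: eqclass_def reach_def)
      have CR: "?C \<subseteq> reach n A u" by (auto simp: eqclass_def reach_def)
      have XZ: "X \<subseteq> avoid n A u" using closed_subset_avoid[OF A less.prems(1)] u un by auto
      have CZ: "?C \<inter> avoid n A u = {}" by (auto simp: eqclass_def avoid_def)
      have cR: "closed_set n A (reach n A u)" using closed_reach[OF A] un ut by auto
      have cZ: "closed_set n A (avoid n A u)" using closed_avoid[OF A] un nu by auto
      have eq: "X \<union> reach n A u = X \<union> ?C" using RX CR by blast
      have cXC: "closed_set n A (X \<union> ?C)" using closed_Un[OF A less.prems(1) cR] eq by simp
      have up: "f (X \<union> ?C) - f X \<le> L"
      proof -
        have "X \<inter> reach n A u = reach n A u - ?C" using RX CX by blast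
        then have "f (X \<union> ?C) + f (reach n A u - ?C) \<le> f X + f (reach n A u)"
          using closed_submodular[OF submod less.prems(1) cR] eq by simp
        then show ?thesis using marginal[OF free] by linarith
      qed
      have down: "f X - f (X \<union> ?C) \<le> L"
      proof -
        have "(X \<union> ?C) \<union> avoid n A u = avoid n A u \<union> ?C" "(X \<union> ?C) \<inter> avoid n A u = X" using XZ CZ by auto
        then have "f (avoid n A u \<union> ?C) + f X \<le> f (X \<union> ?C) + f (avoid n A u)"
          using closed_submodular[OF submod cXC cZ] by simp
        then show ?thesis using marginal[OF free] by linarith
      qed
      have lt: "card (Y - (X \<union> ?C)) < card ?D" using uC u fin by (intro psubset_card_mono) auto
      have IH: "\<bar>f Y - f (X \<union> ?C)\<bar> \<le> L * card (Y - (X \<union> ?C))"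
        using less.hyps[OF lt cXC less.prems(2)] CY less.prems(3) by blast
      have "L * (real (card (Y - (X \<union> ?C))) + 1) \<le> L * card ?D" using lt L by (intro mult_left_mono) auto
      then show ?thesis using IH up down by (simp add: algebra_simps)
    qed
  qed
qed

section \<open>Intervals of closed sets as games with two functions\<close>

locale lipschitz_ring =
  fixes n :: nat and f :: "nat set \<Rightarrow> real" and A :: "(nat \<times> nat) set" and L :: real
  assumes A: "valid_arcs n A" and submod: "submodular_on {..<n} f" and L: "L \<ge> 0"
    and lip: "lipschitz_closed n f A L"
begin

abbreviation "closd \<equiv> closed_set n A"

lemmas submodD = closed_submodular[OF submod]

lemma lipschitz: "closd X \<Longrightarrow> closd Y \<Longrightarrow> X \<subseteq> Y \<Longrightarrow> \<bar>f Y - f X\<bar> \<le> L * card (Y - X)"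
  using lip unfolding lipschitz_closed_def by blast

end

text \<open>Adding L per element makes an L-Lipschitz function monotone on closed sets, and the
  closure extends it to all subsets of the interval. The second function charges L for every element
  left out, which on closed sets cancels the penalty up to a constant. Minimizing \<open>f\<close>
  thus becomes an allocation problem for two monotone functions.\<close>

definition sub_objective :: "nat \<Rightarrow> (nat set \<Rightarrow> real) \<Rightarrow> (nat \<times> nat) set \<Rightarrow> real \<Rightarrow> nat \<Rightarrow> nat \<Rightarrow> nat set \<Rightarrow> real" where
  "sub_objective n f A L a i S = (if i = 1 then f (cl_under n A a S) + L * card (cl_under n A a S) else L * card S)"

definition sub_ground :: "nat \<Rightarrow> (nat \<times> nat) set \<Rightarrow> nat \<Rightarrow> nat \<Rightarrow> nat set" where
  "sub_ground n A a b = avoid n A b - reach n A a"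

text \<open>The average response of the first function with the penalty L removed again, a vector in
  the base polytope of \<open>f\<close> on the interval. The factor 2 n L is the bound on singleton
  values in this game.\<close>

definition sub_base :: "nat \<Rightarrow> (nat set \<Rightarrow> real) \<Rightarrow> (nat \<times> nat) set \<Rightarrow> real \<Rightarrow> nat \<Rightarrow> nat \<Rightarrow> nat \<Rightarrow> nat \<Rightarrow> real" where
  "sub_base n f A L m a b v = (\<Sum>t<2 * m\<^sup>2. response (sub_objective n f A L a) (sub_ground n A a b) 2
      (real m * (2 * real n * L)) (\<lambda>_ _. 1) t 1 v) / real (2 * m\<^sup>2) - L"

text \<open>By \<open>ends\<close> the interval is cut at one side at most, so that nonemptiness
  already rules out an arc from \<open>a\<close> to \<open>b\<close>.\<close>

locale subproblem = lipschitz_ring +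
  fixes m a b :: nat
  assumes m: "m \<ge> 2" and ab: "a < n + 2" "b < n + 2" and ends: "a = n \<or> b = n + 1"
    and nonempty: "sub_ground n A a b \<noteq> {}"
begin

abbreviation "P \<equiv> reach n A a"
abbreviation "Q \<equiv> avoid n A b"
abbreviation "E \<equiv> sub_ground n A a b"
abbreviation "base \<equiv> sub_base n f A L m a b"
abbreviation "cl \<equiv> cl_under n A a"

definition "F i S = sub_objective n f A L a i S - sub_objective n f A L a i {}"

lemma finE: "finite E" by (simp add: sub_ground_def avoid_def)

lemma cardE: "card E \<le> n"
  using card_mono[of "{..<n}" E] by (auto simp: sub_ground_def avoid_def)

lemma n0: "n > 0" using nonempty by (auto simp: sub_ground_def avoid_def)

lemma not_a_sink: "(a, n + 1) \<notin> A"
proof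
  assume "(a, n + 1) \<in> A"
  then have "(a, w) \<in> A" if "w < n" for w using that valid_arcsD(6)[OF A, of w] valid_arcsD(3)[OF A, of a "n + 1" w] by simp
  then show False using nonempty by (auto simp: sub_ground_def avoid_def reach_def)
qed

lemma not_source_b: "(n, b) \<notin> A"
proof
  assume "(n, b) \<in> A"
  then have "(w, b) \<in> A" if "w < n" for w using that valid_arcsD(5)[OF A, of w] valid_arcsD(3)[OF A, of w n b] by simp
  then show False using nonempty by (auto simp: sub_ground_def avoid_def)
qed

lemma closed_P: "closd P" by (rule closed_reach[OF A ab(1) not_a_sink])

lemma closed_Q: "closd Q" by (rule closed_avoid[OF A ab(2) not_source_b])

lemma P_subset_Q: "P \<subseteq> Q"
proof -
  have "(a, b) \<notin> A" using ends not_a_sink not_source_b by auto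
  then show ?thesis using valid_arcsD(3)[OF A] by (auto simp: reach_def avoid_def)
qed

lemma E_eq: "E = Q - P" by (simp add: sub_ground_def)

lemma cl_eq: "cl S = P \<union> (\<Union>v\<in>S. reach n A v)"
  by (auto simp: cl_under_def reach_def)

lemma closed_cl: assumes "S \<subseteq> E" shows "closd (cl S)"
proof -
  have fin: "finite S" using assms finE finite_subset by blast
  have "closd (reach n A v)" if "v \<in> E" for v
  proof (rule closed_reach[OF A])
    show "v < n + 2" using that by (auto simp: sub_ground_def avoid_def)
    have "n + 1 \<notin> insert n Q" "v \<in> Q" using that by (auto simp: sub_ground_def avoid_def)
    then show "(v, n + 1) \<notin> A" using closed_Q unfolding closed_set_def by blast
  qed
  note reach_closed = this
  from fin assms have "closd (P \<union> (\<Union>v\<in>S. reach n A v))"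
  proof (induction S rule: finite_induct)
    case empty
    then show ?case using closed_P by simp
  next
    case (insert x S)
    have "P \<union> (\<Union>v\<in>insert x S. reach n A v) = (P \<union> (\<Union>v\<in>S. reach n A v)) \<union> reach n A x" by blast
    moreover have "closd (P \<union> (\<Union>v\<in>S. reach n A v))" "closd (reach n A x)"
      using insert reach_closed by auto
    ultimately show ?case using closed_Un[OF A] by simp
  qed
  then show ?thesis by (simp only: cl_eq)
qed

lemma cl_upper: assumes "S \<subseteq> E" shows "P \<union> S \<subseteq> cl S"
proof -
  have "S \<subseteq> {..<n}" using assms by (auto simp: sub_ground_def avoid_def)
  then have "v \<in> cl S" if "v \<in> S" for v using that valid_arcsD(4)[OF A, of v] by (auto simp: cl_under_def)
  then show ?thesis by (auto simp: cl_eq)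
qed

lemma cl_closed: assumes "closd X" "P \<subseteq> X" shows "cl (X - P) = X"
proof
  show "cl (X - P) \<subseteq> X" using assms reach_subset_closed[OF A assms(1)] by (auto simp: cl_eq)
  have "X \<subseteq> {..<n}" using assms by (simp add: closed_set_def)
  then have "v \<in> cl (X - P)" if "v \<in> X - P" for v using that valid_arcsD(4)[OF A, of v] by (auto simp: cl_under_def)
  then show "X \<subseteq> cl (X - P)" by (auto simp: cl_eq)
qed

lemma cl_empty: "cl {} = P" by (simp add: cl_eq)

lemma finite_cl: "finite (cl S)" by (simp add: cl_under_def)

lemma cl_mono: "S \<subseteq> T \<Longrightarrow> cl S \<subseteq> cl T" by (auto simp: cl_under_def)

lemma penalized_mono:
  assumes "closd X" "closd Y" "X \<subseteq> Y"
  shows "f X + L * card X \<le> f Y + L * card Y"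
proof -
  have "card Y = card X + card (Y - X)"
    using assms closed_finite[OF A] by (metis card_Diff_subset card_mono le_add_diff_inverse)
  then show ?thesis using lipschitz[OF assms] by (simp add: algebra_simps)
qed

lemma F1:
  "F 1 S = f (cl S) - f P + L * (real (card (cl S)) - real (card P))"
  "F (Suc 0) S = f (cl S) - f P + L * (real (card (cl S)) - real (card P))"
  by (simp_all add: F_def sub_objective_def cl_empty algebra_simps)

lemma F2: "F 2 S = L * card S"
  by (simp add: F_def sub_objective_def)

sublocale game F E 2 "2 * real n * L" "real m" "\<lambda>_ _. 1"
proof
  show "finite E" by (rule finE)
  show "submodular_on E (F i)" if "i \<in> {1..2}" for i
  proof -
    have "submodular_on E (F 1)" unfolding submodular_on_def
    proof (intro allI impI, elim conjE)
      fix S T assume ST: "S \<subseteq> E" "T \<subseteq> E"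
      have c: "closd (cl S)" "closd (cl T)" "closd (cl (S \<inter> T))" using ST by (auto intro: closed_cl)
      have un: "cl (S \<union> T) = cl S \<union> cl T" by (auto simp: cl_under_def)
      \<comment> \<open>The closure of an intersection can be smaller than the intersection of the
        closures; monotonicity of the penalized function bridges the gap.\<close>
      have "f (cl (S \<inter> T)) + L * card (cl (S \<inter> T)) \<le> f (cl S \<inter> cl T) + L * card (cl S \<inter> cl T)"
        by (intro penalized_mono c closed_Int[OF A] cl_mono) (auto simp: cl_mono)
      moreover have "real (card (cl S)) + real (card (cl T)) = real (card (cl S \<union> cl T)) + real (card (cl S \<inter> cl T))"
        using card_Un_Int[OF finite_cl finite_cl, of S T] by linarith
      then have "L * real (card (cl S)) + L * real (card (cl T)) = L * real (card (cl S \<union> cl T)) + L * real (card (cl S \<inter> cl T))"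
        by (metis distrib_left)
      ultimately show "F 1 S + F 1 T \<ge> F 1 (S \<union> T) + F 1 (S \<inter> T)"
        using submodD[OF c(1,2)] by (simp add: F1 un algebra_simps)
    qed
    moreover have "submodular_on E (F 2)" unfolding submodular_on_def
    proof (intro allI impI, elim conjE)
      fix S T assume ST: "S \<subseteq> E" "T \<subseteq> E"
      then have "finite S" "finite T" using finE finite_subset by blast+
      from card_Un_Int[OF this] have "real (card S) + real (card T) = real (card (S \<union> T)) + real (card (S \<inter> T))" by linarith
      then show "F 2 S + F 2 T \<ge> F 2 (S \<union> T) + F 2 (S \<inter> T)" by (simp add: F2 flip: distrib_left)
    qed
    moreover have "i = 1 \<or> i = 2" using that by auto
    ultimately show ?thesis by auto
  qed
  show "mono_on (Pow E) (F i)" if "i \<in> {1..2}" for i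
  proof -
    have "mono_on (Pow E) (F 1)"
    proof (rule mono_onI)
      fix S T assume ST: "S \<in> Pow E" "T \<in> Pow E" "S \<subseteq> T"
      have "f (cl S) + L * card (cl S) \<le> f (cl T) + L * card (cl T)"
        using ST by (intro penalized_mono closed_cl cl_mono) auto
      then show "F 1 S \<le> F 1 T" by (simp add: F1 algebra_simps)
    qed
    moreover have "mono_on (Pow E) (F 2)"
    proof (rule mono_onI)
      fix S T assume ST: "S \<in> Pow E" "T \<in> Pow E" "S \<subseteq> T"
      then have "card S \<le> card T" using finE finite_subset by (intro card_mono) auto
      then show "F 2 S \<le> F 2 T" using L by (simp add: F2 mult_left_mono)
    qed
    moreover have "i = 1 \<or> i = 2" using that by auto
    ultimately show ?thesis by auto
  qed
  show "F i {} = 0" for i by (simp add: F_def)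
  show "F i {v} \<le> 2 * real n * L" if "i \<in> {1..2}" "v \<in> E" for i v
  proof -
    \<comment> \<open>Between \<open>P\<close> and the closure of \<open>v\<close>, both
      \<open>f\<close> and the penalty grow by at most n L.\<close>
    have "F 1 {v} \<le> 2 * real n * L"
    proof -
      have c: "closd (cl {v})" "P \<subseteq> cl {v}" using that closed_cl cl_upper[of "{v}"] by auto
      have "card (cl {v} - P) \<le> card {..<n}" by (intro card_mono) (auto simp: cl_under_def)
      then have "L * card (cl {v} - P) \<le> L * n" using L by (intro mult_left_mono) auto
      moreover have "card (cl {v}) = card P + card (cl {v} - P)"
        using c finite_cl by (metis card_Diff_subset card_mono finite_subset le_add_diff_inverse)
      ultimately show ?thesis using lipschitz[OF closed_P c] by (simp add: F1 algebra_simps)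
    qed
    moreover have "F 2 {v} \<le> 2 * real n * L" using L n0 mult_right_mono[of 1 "2 * real n" L] by (simp add: F2)
    moreover have "i = 1 \<or> i = 2" using that by auto
    ultimately show ?thesis by auto
  qed
qed (use m L in auto)

lemma base_eq: "base v = (\<Sum>t<2 * m\<^sup>2. rs t 1 v) / real (2 * m\<^sup>2) - L"
proof -
  have c: "\<exists>d. \<forall>S\<subseteq>E. sub_objective n f A L a i S = F i S + d" for i
    by (rule exI[of _ "sub_objective n f A L a i {}"]) (simp add: F_def)
  have "response (sub_objective n f A L a) E 2 (real m * (2 * real n * L)) (\<lambda>_ _. 1) t 1 v = rs t 1 v" for t
    by (rule weights_cong_const(2)[OF c]) simp
  then show ?thesis by (simp only: sub_base_def)
qed

lemma Tpos: "real (2 * m\<^sup>2) > 0" using m by simp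

lemma sum_base: "(\<Sum>v\<in>S. base v) = (\<Sum>t<2 * m\<^sup>2. \<Sum>v\<in>S. rs t 1 v) / real (2 * m\<^sup>2) - L * card S"
proof -
  have "(\<Sum>v\<in>S. base v) = (\<Sum>v\<in>S. (\<Sum>t<2 * m\<^sup>2. rs t 1 v) / real (2 * m\<^sup>2)) - (\<Sum>v\<in>S. L)"
    unfolding base_eq by (rule sum_subtractf)
  also have "(\<Sum>v\<in>S. (\<Sum>t<2 * m\<^sup>2. rs t 1 v) / real (2 * m\<^sup>2)) = (\<Sum>t<2 * m\<^sup>2. \<Sum>v\<in>S. rs t 1 v) / real (2 * m\<^sup>2)"
    unfolding sum_divide_distrib[symmetric] by (subst sum.swap) (rule refl)
  also have "(\<Sum>v\<in>S. L) = L * card S" by simp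
  finally show ?thesis .
qed

text \<open>Every response lies in the polyhedron of the penalized function, hence so does the
  average. On closed sets the penalty amounts to exactly L per element, which \<open>base\<close>
  subtracts.\<close>

lemma sum_base_le:
  assumes "closd X" "P \<subseteq> X" "X \<subseteq> Q"
  shows "(\<Sum>v\<in>X - P. base v) \<le> f X - f P"
proof -
  have S: "X - P \<subseteq> E" using assms E_eq by auto
  have "(\<Sum>t<2 * m\<^sup>2. \<Sum>v\<in>X - P. rs t 1 v) \<le> (\<Sum>t<2 * m\<^sup>2. F 1 (X - P))"
    by (intro sum_mono response_sum_le S) simp
  also have "\<dots> = real (2 * m\<^sup>2) * F 1 (X - P)" by simp
  finally have "(\<Sum>t<2 * m\<^sup>2. \<Sum>v\<in>X - P. rs t 1 v) / real (2 * m\<^sup>2) \<le> F 1 (X - P)"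
    using Tpos by (simp add: pos_divide_le_eq mult.commute)
  moreover have "F 1 (X - P) = f X - f P + L * card (X - P)"
  proof -
    have "card X = card P + card (X - P)"
      using assms closed_finite[OF A] by (metis card_Diff_subset card_mono finite_subset le_add_diff_inverse)
    then show ?thesis using cl_closed[OF assms(1,2)] by (simp add: F1)
  qed
  ultimately show ?thesis by (simp add: sum_base)
qed

lemma sum_base_E: "(\<Sum>v\<in>E. base v) = f Q - f P"
proof -
  have "(\<Sum>t<2 * m\<^sup>2. \<Sum>v\<in>E. rs t 1 v) / real (2 * m\<^sup>2) = F 1 E"
    using Tpos by (simp add: response_sum_all)
  moreover have "F 1 E = f Q - f P + L * card E"
  proof -
    have "card Q = card P + card (Q - P)"
      using P_subset_Q closed_finite[OF A closed_Q] by (metis card_Diff_subset card_mono finite_subset le_add_diff_inverse)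
    then show ?thesis using cl_closed[OF closed_Q P_subset_Q] by (simp add: F1 E_eq)
  qed
  ultimately show ?thesis by (simp add: sum_base)
qed

text \<open>The regret per round: with T = 2 m^2 rounds and two functions, 2 T / m + 2 m = 3 T / m
  for each of at most n elements, in units of the loss bound 2 n L, and divided by T.\<close>

definition "eps = 3 * real n * (2 * real n * L) / real m"

text \<open>An approximate min-max theorem, for all subsets of the interval and not only for closed
  ones. The value of a round is a Lovasz extension up to the constant L * card E, hence at least the
  value of \<open>M\<close>; the regret bound compares it with giving \<open>S\<close> to the first
  function and the rest to the second.\<close>

lemma minimizer_le_sum_base:
  assumes M: "closd M" "P \<subseteq> M" "M \<subseteq> Q" and min: "\<And>X. closd X \<Longrightarrow> f M \<le> f X" and S: "S \<subseteq> E"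
  shows "f M - f P \<le> (\<Sum>v\<in>S. base v) + eps"
proof -
  let ?T = "2 * m\<^sup>2" and ?\<sigma> = "\<lambda>v. if v \<in> S then 1 else 2 :: nat"
  let ?h = "\<lambda>S. F 1 S - L * card S"
  define \<mu> where "\<mu> = f M - f P"
  have "\<mu> \<le> 0" unfolding \<mu>_def using min[OF closed_P] by linarith
  \<comment> \<open>\<open>?h S'\<close> exceeds \<open>f (cl S') - f P\<close> by L for each
    element that the closure adds, so the minimum \<mu> over closed sets bounds it from below on all
    subsets.\<close>
  have h: "\<mu> \<le> ?h S'" if "S' \<subseteq> E" for S'
  proof -
    have "card (P \<union> S') \<le> card (cl S')" by (rule card_mono[OF finite_cl cl_upper[OF that]])
    moreover have "card (P \<union> S') = card P + card S'"
    proof (rule card_Un_disjoint)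
      show "finite S'" using that finE by (rule finite_subset)
      show "P \<inter> S' = {}" using that unfolding E_eq by blast
    qed (rule closed_finite[OF A closed_P])
    ultimately have "L * card S' \<le> L * (real (card (cl S')) - real (card P))" using L by (intro mult_left_mono) auto
    then show ?thesis using min[OF closed_cl[OF that]] by (simp add: F1 \<mu>_def)
  qed
  have rs2: "rs t 2 v = L" if "v \<in> E" for t v
  proof -
    let ?U = "upper E (pl t 2) v"
    have "finite ?U" "v \<in> ?U" using finE that by (auto simp: upper_def)
    then have "card ?U = Suc (card (?U - {v}))" by (rule card.remove)
    then have "real (card (?U - {v})) = real (card ?U) - 1" by simp
    then show ?thesis using that by (simp add: response_def greedy_def F2 right_diff_distrib)
  qed
  have gr: "greedy ?h E p v = greedy (F 1) E p v - L" if "v \<in> E" for p v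
  proof -
    let ?U = "upper E p v"
    have "finite ?U" "v \<in> ?U" using finE that by (auto simp: upper_def)
    then have "card ?U = Suc (card (?U - {v}))" by (rule card.remove)
    then have "real (card (?U - {v})) = real (card ?U) - 1" by simp
    then show ?thesis using that by (simp add: greedy_def right_diff_distrib)
  qed
  have round: "\<mu> + L * card E \<le> (\<Sum>i=1..2. \<Sum>v\<in>E. pl t i v * rs t i v)" for t
  proof -
    have s2: "(\<Sum>i=1..2. g i) = g 1 + g 2" for g :: "nat \<Rightarrow> real" by (simp add: numeral_2_eq_2)
    have pl2: "pl t 2 v = 1 - pl t 1 v" if "v \<in> E" for v using play_sum[OF that, of t] unfolding s2 by linarith
    have pl01: "0 \<le> pl t 1 v \<and> pl t 1 v \<le> 1" if "v \<in> E" for v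
      using play_nonneg[of 1 v t] play_nonneg[of 2 v t] pl2[OF that] that by simp
    have "(1 - 0) * \<mu> \<le> (\<Sum>v\<in>E. (pl t 1 v - 0) * greedy ?h E (pl t 1) v)"
    proof (rule greedy_lower_bound[OF finE])
      show "?h {} = 0" by (simp add: F_def)
      show "\<mu> \<le> ?h S'" if "S' \<subseteq> E" for S' using h[OF that] .
      show "0 \<le> pl t 1 v \<and> pl t 1 v \<le> 1" if "v \<in> E" for v using pl01[OF that] .
    qed (use \<open>\<mu> \<le> 0\<close> in simp_all)
    also have "\<dots> = (\<Sum>v\<in>E. pl t 1 v * (rs t 1 v - L))"
      by (intro sum.cong refl) (simp only: gr response_def diff_zero)
    finally have "\<mu> + L * card E \<le> (\<Sum>v\<in>E. pl t 1 v * (rs t 1 v - L) + L)" by (simp add: sum.distrib mult.commute)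
    also have "\<dots> = (\<Sum>v\<in>E. pl t 1 v * rs t 1 v + pl t 2 v * rs t 2 v)"
    proof (rule sum.cong[OF refl])
      fix v assume "v \<in> E"
      then show "pl t 1 v * (rs t 1 v - L) + L = pl t 1 v * rs t 1 v + pl t 2 v * rs t 2 v"
        by (simp only: rs2 pl2) (simp add: algebra_simps)
    qed
    finally show ?thesis unfolding s2 by (simp only: sum.distrib)
  qed
  have "real ?T * (\<mu> + L * card E) = (\<Sum>t<?T. \<mu> + L * card E)" by simp
  also have "\<dots> \<le> (\<Sum>t<?T. \<Sum>i=1..2. \<Sum>v\<in>E. pl t i v * rs t i v)" by (rule sum_mono) (rule round)
  also have "\<dots> \<le> (\<Sum>v\<in>E. \<Sum>t<?T. rs t (?\<sigma> v) v) + real (card E) * ((2 * real ?T / real m + real m * real 2) * (2 * real n * L))"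
    by (rule total_regret) auto
  also have "(2 * real ?T / real m + real m * real 2) = 3 * real ?T / real m"
    using m by (simp add: power2_eq_square field_simps)
  also have "(\<Sum>v\<in>E. \<Sum>t<?T. rs t (?\<sigma> v) v) = (\<Sum>v\<in>S. \<Sum>t<?T. rs t 1 v) + (\<Sum>v\<in>E - S. \<Sum>t<?T. rs t 2 v)"
  proof -
    have "(\<Sum>v\<in>E. \<Sum>t<?T. rs t (?\<sigma> v) v) = (\<Sum>v\<in>S. \<Sum>t<?T. rs t (?\<sigma> v) v) + (\<Sum>v\<in>E - S. \<Sum>t<?T. rs t (?\<sigma> v) v)"
      using sum.subset_diff[OF S finE, of "\<lambda>v. \<Sum>t<?T. rs t (?\<sigma> v) v"] by (simp only: add.commute)
    then show ?thesis by simp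
  qed
  also have "(\<Sum>v\<in>S. \<Sum>t<?T. rs t 1 v) = real ?T * ((\<Sum>v\<in>S. base v) + L * card S)"
    using Tpos by (subst sum.swap) (simp add: sum_base)
  also have "(\<Sum>v\<in>E - S. \<Sum>t<?T. rs t 2 v) = real ?T * (L * (real (card E) - real (card S)))"
    using S finE by (simp add: rs2 card_Diff_subset finite_subset card_mono of_nat_diff)
  finally have "real ?T * (\<mu> + L * card E) \<le> real ?T * ((\<Sum>v\<in>S. base v) + L * card S + L * (real (card E) - real (card S))
      + real (card E) * (3 / real m * (2 * real n * L)))"
    by (simp add: algebra_simps)
  then have "\<mu> \<le> (\<Sum>v\<in>S. base v) + real (card E) * (3 / real m * (2 * real n * L))"
    unfolding mult_le_cancel_left_pos[OF Tpos] right_diff_distrib by linarith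
  also have "real (card E) * (3 / real m * (2 * real n * L)) \<le> real n * (3 / real m * (2 * real n * L))"
    using cardE L by (intro mult_right_mono) auto
  finally show ?thesis by (simp add: \<mu>_def eps_def algebra_simps)
qed

text \<open>Approximate complementary slackness: \<open>base\<close> sums to at most
  \<open>f M - f P\<close> on \<open>M - P\<close>, and to at least that minus \<open>eps\<close>
  after \<open>v\<close> is inserted or deleted. The difference is the entry at
  \<open>v\<close>.\<close>

lemma base_minimizer:
  assumes M: "closd M" "P \<subseteq> M" "M \<subseteq> Q" and min: "\<And>X. closd X \<Longrightarrow> f M \<le> f X" and v: "v \<in> E"
  shows "v \<notin> M \<Longrightarrow> - eps \<le> base v" "v \<in> M \<Longrightarrow> base v \<le> eps"
proof -
  have fin: "finite (M - P)" using closed_finite[OF A M(1)] by simp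
  have S: "M - P \<subseteq> E" using M E_eq by auto
  have vP: "v \<notin> P" using v E_eq by simp
  { assume "v \<notin> M"
    then have "(\<Sum>v\<in>insert v (M - P). base v) = base v + (\<Sum>v\<in>M - P. base v)" using fin by simp
    then show "- eps \<le> base v"
      using minimizer_le_sum_base[OF M min, of "insert v (M - P)"] sum_base_le[OF M] S v by simp }
  { assume "v \<in> M"
    then have "(\<Sum>v\<in>M - P. base v) = base v + (\<Sum>v\<in>M - P - {v}. base v)" using fin vP by (simp add: sum.remove)
    then show "base v \<le> eps"
      using minimizer_le_sum_base[OF M min, of "M - P - {v}"] sum_base_le[OF M] S by fastforce }
qed

end

section \<open>Progress and soundness of certified implications\<close>

definition sub_eps :: "nat \<Rightarrow> real \<Rightarrow> nat \<Rightarrow> real" where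
  "sub_eps n L m = 3 * real n * (2 * real n * L) / real m"

lemma (in subproblem) eps_eq: "eps = sub_eps n L m"
  by (simp add: eps_def sub_eps_def)

lemma (in subproblem) sum_base_bounds:
  assumes "S \<subseteq> E" "L > 0"
  shows "(\<And>v. v \<in> E \<Longrightarrow> - eps \<le> base v) \<Longrightarrow> - (real n * eps) \<le> (\<Sum>v\<in>S. base v)"
    and "(\<And>v. v \<in> E \<Longrightarrow> base v \<le> eps) \<Longrightarrow> (\<Sum>v\<in>S. base v) \<le> real n * eps"
proof -
  have eps: "eps \<ge> 0" using L by (simp add: eps_def)
  have "card S \<le> n" using assms cardE finE card_mono by (meson order_trans)
  then have c: "real (card S) * eps \<le> real n * eps" using eps by (intro mult_right_mono) auto
  { assume "\<And>v. v \<in> E \<Longrightarrow> - eps \<le> base v"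
    then have "(\<Sum>v\<in>S. - eps) \<le> (\<Sum>v\<in>S. base v)" using assms by (intro sum_mono) auto
    then show "- (real n * eps) \<le> (\<Sum>v\<in>S. base v)" using c by simp }
  { assume "\<And>v. v \<in> E \<Longrightarrow> base v \<le> eps"
    then have "(\<Sum>v\<in>S. base v) \<le> (\<Sum>v\<in>S. eps)" using assms by (intro sum_mono) auto
    then show "(\<Sum>v\<in>S. base v) \<le> real n * eps" using c by simp }
qed

text \<open>If the whole interval has no certificate, all closed sets have value at least
  \<open>f S.P\<close> - n * eps, and the largest one at most \<open>f S.P\<close> + n * eps. A step
  of size L at \<open>u\<close> lifts \<open>reach n A u\<close> or \<open>avoid n A u\<close>
  almost L above \<open>f S.P\<close>. The base of the interval above the former or below the latter
  then has a total too far from 0 for uncertified entries.\<close>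

lemma arcs_progress:
  assumes A: "valid_arcs n A" and submod: "submodular_on {..<n} f" and L: "L > 0" and lip: "lipschitz_closed n f A L"
    and m: "18 * n ^ 3 < m" "m \<ge> 2"
    and u: "free_node n A u"
    and attained: "f (reach n A u) - f (reach n A u - eqclass n A u) = L
      \<or> f (avoid n A u) - f (avoid n A u \<union> eqclass n A u) = L"
    and no_out: "\<And>a v. a \<le> n \<Longrightarrow> v \<in> sub_ground n A a (n + 1) \<Longrightarrow> - sub_eps n L m \<le> sub_base n f A L m a (n + 1) v"
    and no_in: "\<And>b v. b < n \<or> b = n + 1 \<Longrightarrow> v \<in> sub_ground n A n b \<Longrightarrow> sub_base n f A L m n b v \<le> sub_eps n L m"
  shows False
proof -
  let ?e = "sub_eps n L m"
  have un: "u < n" and nu: "(n, u) \<notin> A" and ut: "(u, n + 1) \<notin> A" using u by (auto simp: free_node_def)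
  have u0: "u \<in> sub_ground n A n (n + 1)" using un nu ut by (auto simp: sub_ground_def avoid_def reach_def)
  interpret R: lipschitz_ring n f A L using A submod L lip by unfold_locales auto
  interpret S: subproblem n f A L m n "n + 1" using m u0 by unfold_locales auto
  have e0: "real n * ?e \<ge> 0" using L by (simp add: sub_eps_def)
  \<comment> \<open>n * eps = 6 n^3 L / m, which is the origin of the condition 18 n^3 < m.\<close>
  have small: "3 * (real n * ?e) < L"
  proof -
    have "real (18 * n ^ 3) < real m" using m by (simp only: of_nat_less_iff)
    then have "18 * real n ^ 3 * L < real m * L" using L by simp
    then show ?thesis using m by (simp add: sub_eps_def field_simps power3_eq_cube)
  qed
  have out0: "- S.eps \<le> S.base v" and in0: "S.base v \<le> S.eps" if "v \<in> S.E" for v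
    using that no_out[of n v] no_in[of "n + 1" v] by (auto simp: S.eps_eq)
  have between: "S.P \<subseteq> X \<and> X \<subseteq> S.Q" if "R.closd X" for X
  proof
    show "S.P \<subseteq> X" using reach_subset_closed[OF A that] by blast
    have "n + 1 \<notin> insert n X" using that by (auto simp: closed_set_def)
    then show "X \<subseteq> S.Q" using closed_subset_avoid[OF A that] by blast
  qed
  have ge: "f S.P - real n * ?e \<le> f X" if "R.closd X" for X
  proof -
    have "X - S.P \<subseteq> S.E" using between[OF that] unfolding S.E_eq by blast
    from S.sum_base_bounds(1)[OF this L out0] have "- (real n * ?e) \<le> (\<Sum>v\<in>X - S.P. S.base v)"
      by (simp only: S.eps_eq)
    also have "\<dots> \<le> f X - f S.P" using between[OF that] by (intro S.sum_base_le that) auto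
    finally show ?thesis by linarith
  qed
  have Q: "f S.Q - f S.P \<le> real n * ?e"
    using S.sum_base_E S.sum_base_bounds(2)[OF order_refl L in0] by (simp add: S.eps_eq)
  have cR: "R.closd (reach n A u)" using closed_reach[OF A] un ut by auto
  have cZ: "R.closd (avoid n A u)" using closed_avoid[OF A] un nu by auto
  from attained show False
  proof
    assume "f (reach n A u) - f (reach n A u - eqclass n A u) = L"
    then have *: "f (reach n A u) \<ge> L + f S.P - real n * ?e"
      using ge[OF closed_reach_minus[OF A u]] by linarith
    show False
    proof (cases "sub_ground n A u (n + 1) = {}")
      \<comment> \<open>If the interval above \<open>u\<close> is empty, its ends coincide and the
        largest closed set itself has too large a value.\<close>
      case True
      then have "S.Q = reach n A u" using between[OF cR] by (auto simp: sub_ground_def)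
      then have "f S.Q = f (reach n A u)" by (rule arg_cong)
      then show False using * Q small e0 by linarith
    next
      case False
      interpret T: subproblem n f A L m u "n + 1" using m un False by unfold_locales auto
      have "- T.eps \<le> T.base v" if "v \<in> T.E" for v using no_out[of u v] that un by (auto simp: T.eps_eq)
      then have "- (real n * ?e) \<le> f S.Q - f (reach n A u)"
        using T.sum_base_bounds(1)[OF order_refl L] T.sum_base_E by (simp add: T.eps_eq)
      then show False using * Q small by linarith
    qed
  next
    assume "f (avoid n A u) - f (avoid n A u \<union> eqclass n A u) = L"
    then have *: "f (avoid n A u) \<ge> L + f S.P - real n * ?e"
      using ge[OF closed_avoid_plus[OF A u]] by linarith
    show False
    proof (cases "sub_ground n A n u = {}")
      case True
      then have "S.P = avoid n A u" using between[OF cZ] by (auto simp: sub_ground_def)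
      then have "f S.P = f (avoid n A u)" by (rule arg_cong)
      then show False using * Q small e0 by linarith
    next
      case False
      interpret T: subproblem n f A L m n u using m un False by unfold_locales auto
      have "T.base v \<le> T.eps" if "v \<in> T.E" for v using no_in[of u v] that un by (auto simp: T.eps_eq)
      then have "f (avoid n A u) - f S.P \<le> real n * ?e"
        using T.sum_base_bounds(2)[OF order_refl L] T.sum_base_E by (simp add: T.eps_eq)
      then show False using * Q small e0 by linarith
    qed
  qed
qed

text \<open>If \<open>a\<close> is in \<open>M\<close>, then \<open>M\<close> lies between
  \<open>reach n A a\<close> and the largest closed set, so the slackness bounds of that interval
  apply to \<open>M\<close> and a large entry decides \<open>v\<close>. The second part is dual,
  with \<open>M\<close> below \<open>avoid n A b\<close> if \<open>b\<close> is not in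
  \<open>M\<close>.\<close>

lemma arc_sound:
  assumes A: "valid_arcs n A" and submod: "submodular_on {..<n} f" and L: "L \<ge> 0" and lip: "lipschitz_closed n f A L"
    and m: "m \<ge> 2" and M: "closed_set n A M" and min: "\<And>X. X \<subseteq> {..<n} \<Longrightarrow> f M \<le> f X"
  shows "a \<le> n \<Longrightarrow> v \<in> sub_ground n A a (n + 1) \<Longrightarrow> sub_base n f A L m a (n + 1) v < - sub_eps n L m \<Longrightarrow>
      a \<in> insert n M \<Longrightarrow> v \<in> M"
    and "b < n \<or> b = n + 1 \<Longrightarrow> v \<in> sub_ground n A n b \<Longrightarrow> sub_eps n L m < sub_base n f A L m n b v \<Longrightarrow>
      v \<in> M \<Longrightarrow> b \<in> insert n M"
proof -
  interpret R: lipschitz_ring n f A L using A submod L lip by unfold_locales auto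
  have min': "f M \<le> f X" if "R.closd X" for X using that min by (auto simp: closed_set_def)
  { assume a: "a \<le> n" "v \<in> sub_ground n A a (n + 1)" "sub_base n f A L m a (n + 1) v < - sub_eps n L m" "a \<in> insert n M"
    interpret S: subproblem n f A L m a "n + 1" using m a by unfold_locales auto
    have "n + 1 \<notin> insert n M" using M by (auto simp: closed_set_def)
    then have "S.P \<subseteq> M" "M \<subseteq> S.Q" using reach_subset_closed[OF A M a(4)] closed_subset_avoid[OF A M] by auto
    from S.base_minimizer(1)[OF M this min' a(2)] show "v \<in> M" using a(3) by (auto simp: S.eps_eq) }
  { assume b: "b < n \<or> b = n + 1" "v \<in> sub_ground n A n b" "sub_eps n L m < sub_base n f A L m n b v" "v \<in> M"
    interpret S: subproblem n f A L m n b using m b by unfold_locales auto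
    show "b \<in> insert n M"
    proof (rule ccontr)
      assume "b \<notin> insert n M"
      then have "S.P \<subseteq> M" "M \<subseteq> S.Q" using reach_subset_closed[OF A M] closed_subset_avoid[OF A M] by auto
      from S.base_minimizer(2)[OF M this min' b(2)] show False using b(3,4) by (auto simp: S.eps_eq)
    qed }
qed

text \<open>For a preorder, composing once through the new arc already yields the transitive
  closure.\<close>

definition add_arc :: "(nat \<times> nat) set \<Rightarrow> nat \<Rightarrow> nat \<Rightarrow> (nat \<times> nat) set" where
  "add_arc A a b = A \<union> {(i, j). (i, a) \<in> A \<and> (b, j) \<in> A}"

lemma add_arc_valid:
  assumes A: "valid_arcs n A" shows "valid_arcs n (add_arc A a b)"
proof -
  have "trans A" using A by (simp add: valid_arcs_def)
  then have "trans (add_arc A a b)" unfolding add_arc_def trans_def by blast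
  then show ?thesis using A by (auto simp: valid_arcs_def add_arc_def)
qed

lemma add_arc_mem: "valid_arcs n A \<Longrightarrow> a < n + 2 \<Longrightarrow> b < n + 2 \<Longrightarrow> (a, b) \<in> add_arc A a b"
  using valid_arcsD(4) by (auto simp: add_arc_def)

lemma add_arc_closed:
  "closed_set n A M \<Longrightarrow> (a \<in> insert n M \<Longrightarrow> b \<in> insert n M) \<Longrightarrow> closed_set n (add_arc A a b) M"
  unfolding closed_set_def add_arc_def by blast

lemma closed_set_antimono: "A \<subseteq> A' \<Longrightarrow> closed_set n A' X \<Longrightarrow> closed_set n A X"
  unfolding closed_set_def by blast

lemma lipschitz_closed_mono: "lipschitz_closed n f A L \<Longrightarrow> A \<subseteq> A' \<Longrightarrow> lipschitz_closed n f A' L"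
  unfolding lipschitz_closed_def using closed_set_antimono by blast

text \<open>A Lipschitz constant 0 makes \<open>f\<close> constant along inclusions, and both sets
  are connected to their intersection, which is closed again.\<close>

lemma lipschitz_zero_const:
  assumes A: "valid_arcs n A" and lip: "lipschitz_closed n f A 0" and X: "closed_set n A X" and Y: "closed_set n A Y"
  shows "f X = f Y"
proof -
  have "f (X \<inter> Y) = f Z" if "closed_set n A Z" "X \<inter> Y \<subseteq> Z" for Z
    using lip[unfolded lipschitz_closed_def, rule_format, OF closed_Int[OF A X Y] that] by simp
  from this[OF X inf_le1] this[OF Y inf_le2] show ?thesis by simp
qed

section \<open>Rounding a fractional allocation\<close>

definition level_set :: "nat \<Rightarrow> (nat \<Rightarrow> real) \<Rightarrow> real \<Rightarrow> nat set" where
  "level_set n x c = {v. v < n \<and> c < x v}"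

lemma submodular_subadditive:
  fixes n :: nat
  assumes sm: "submodular_on {..<n} F" and e: "F {} = 0" and S: "S \<subseteq> {..<n}"
  shows "F S \<le> (\<Sum>v\<in>S. F {v})"
proof -
  have "finite S" using S finite_subset by blast
  then show ?thesis using S
  proof (induction S rule: finite_induct)
    case (insert x S)
    have "{x} \<union> S = insert x S" "{x} \<inter> S = {}" using insert by auto
    then have "F (insert x S) + F {} \<le> F {x} + F S"
      using sm insert.prems unfolding submodular_on_def by (metis insert_subset empty_subsetI)
    then show ?case using insert e by simp
  qed (simp add: e)
qed

text \<open>The summand 1 is the rounding error of the threshold grid; it reappears as the term
  \<open>real n * G\<close> in \<open>sum_lev_le\<close>.\<close>

lemma card_nat_less_real:
  fixes y :: real assumes "y \<ge> 0"
  shows "real (card {s. s < q \<and> real s < y}) \<le> y + 1"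
proof -
  have "{s. s < q \<and> real s < y} \<subseteq> {..<nat \<lceil>y\<rceil>}" by (auto simp: less_ceiling_iff zless_nat_eq_int_zless)
  then have "card {s. s < q \<and> real s < y} \<le> nat \<lceil>y\<rceil>" using card_mono[of "{..<nat \<lceil>y\<rceil>}"] by fastforce
  then have "real (card {s. s < q \<and> real s < y}) \<le> real (nat \<lceil>y\<rceil>)" by simp
  also have "\<dots> \<le> y + 1" using assms by linarith
  finally show ?thesis .
qed

text \<open>\<beta> is the maximum over the elements of their cheapest singleton values. Every
  allocation costs at least \<beta>, and giving each element to its cheapest function costs at most
  n \<beta>, so \<beta> fixes the scale of the optimum up to a factor n. N = n + 1 blocks outnumber
  the n elements. The powers of n + k in \<open>m\<close> and \<open>l\<close> come from the error
  estimates in \<open>best_thresholds\<close>.\<close>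

locale allocation_game =
  fixes n k :: nat and F :: "nat \<Rightarrow> nat set \<Rightarrow> real" and \<beta> :: real and m l N H q T :: nat
  assumes k: "k \<ge> 3"
    and submod: "\<And>i. i \<in> {1..k} \<Longrightarrow> submodular_on {..<n} (F i)"
    and mono: "\<And>i. i \<in> {1..k} \<Longrightarrow> mono_on (Pow {..<n}) (F i)"
    and empty: "\<And>i. i \<in> {1..k} \<Longrightarrow> F i {} = 0"
    and \<beta>_upper: "\<And>v. v < n \<Longrightarrow> \<exists>i\<in>{1..k}. F i {v} \<le> \<beta>"
    and \<beta>_lower: "\<beta> = 0 \<or> (\<exists>v<n. \<forall>i\<in>{1..k}. \<beta> \<le> F i {v})"
    and m_def: "m = 262144 * (n + k) ^ 5" and l_def: "l = 4096 * (n + k) ^ 4" and N_def: "N = n + 1"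
    and H_def: "H = 16 * (l * N)" and q_def: "q = k * H + 1" and T_def: "T = k * m\<^sup>2"
begin

definition "G = real n * \<beta>"
text \<open>By monotonicity, a pair with singleton value above \<open>G\<close> occurs in no
  allocation of cost at most \<open>G\<close>.\<close>

definition "w0 i v = (if F i {v} \<le> G then 1 else 0 :: real)"

lemma F_nonneg: "i \<in> {1..k} \<Longrightarrow> S \<subseteq> {..<n} \<Longrightarrow> 0 \<le> F i S"
  using mono_onD[OF mono[of i], of "{}" S] empty by simp

lemma \<beta>_nonneg: "\<beta> \<ge> 0"
proof (cases "n = 0")
  case True
  then show ?thesis using \<beta>_lower by auto
next
  case False
  then obtain i where "i \<in> {1..k}" "F i {0} \<le> \<beta>" using \<beta>_upper by blast
  then show ?thesis using F_nonneg[of i "{0}"] False by auto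
qed

lemma m_ge: "m \<ge> 2"
proof -
  have "(n + k) ^ 5 \<ge> 1" using k by (simp add: Suc_le_eq)
  then show ?thesis using m_def by linarith
qed

sublocale game F "{..<n}" k G "real m" w0
proof
  show "\<exists>i\<in>{1..k}. w0 i v = 1" if "v \<in> {..<n}" for v
  proof -
    obtain i where i: "i \<in> {1..k}" "F i {v} \<le> \<beta>" using \<beta>_upper \<open>v \<in> {..<n}\<close> by blast
    have "1 * \<beta> \<le> real n * \<beta>" using that \<beta>_nonneg by (intro mult_right_mono) auto
    then have "F i {v} \<le> G" using i unfolding G_def by linarith
    then show ?thesis using i by (intro bexI[of _ i]) (simp_all add: w0_def)
  qed
qed (use m_ge submod mono empty \<beta>_nonneg in \<open>auto simp: w0_def G_def split: if_splits\<close>)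

definition "X i v = (\<Sum>t<T. pl t i v)"
text \<open>The comparison of the average play X / T with the threshold s / q, multiplied
  out.\<close>

definition "lev i s = F i (level_set n (\<lambda>v. real q * X i v) (real s * real T))"

lemma Tpos: "real T > 0" using T_def m_ge k by simp

lemma X_nonneg: "i \<in> {1..k} \<Longrightarrow> v < n \<Longrightarrow> 0 \<le> X i v"
  unfolding X_def by (intro sum_nonneg play_nonneg) auto

lemma X_sum: "v < n \<Longrightarrow> (\<Sum>i=1..k. X i v) = real T"
  unfolding X_def by (subst sum.swap) (simp add: play_sum del: One_nat_def)

lemma X_pos_allowed: "X i v > 0 \<Longrightarrow> F i {v} \<le> G"
  using play_zero[of i v] by (cases "w0 i v = 0") (auto simp: X_def w0_def split: if_splits)

text \<open>If \<open>v\<close> missed every level set, summation over the functions would give q T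
  \<le> k H T, but q = k H + 1.\<close>

lemma cover:
  assumes "(\<Sum>i=1..k. s i) \<le> k * H" "v < n"
  shows "\<exists>i\<in>{1..k}. v \<in> level_set n (\<lambda>v. real q * X i v) (real (s i) * real T)"
proof (rule ccontr)
  assume "\<not> ?thesis"
  then have "(\<Sum>i=1..k. real q * X i v) \<le> (\<Sum>i=1..k. real (s i) * real T)"
    using assms by (intro sum_mono) (auto simp: level_set_def not_less)
  also have "\<dots> = real (\<Sum>i=1..k. s i) * real T" by (simp add: sum_distrib_right)
  also have "\<dots> \<le> real (k * H) * real T" using assms(1) by (intro mult_right_mono) (auto simp only: of_nat_le_iff of_nat_0_le_iff)
  also have "(\<Sum>i=1..k. real q * X i v) = real q * real T" using X_sum[OF assms(2)] by (simp add: sum_distrib_left[symmetric])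
  finally show False using Tpos by (simp add: q_def)
qed

lemma lev_antimono: "i \<in> {1..k} \<Longrightarrow> s \<le> t \<Longrightarrow> lev i t \<le> lev i s"
proof -
  assume i: "i \<in> {1..k}" and st: "s \<le> t"
  have "real s * real T \<le> real t * real T" using st by (intro mult_right_mono) auto
  then have "level_set n (\<lambda>v. real q * X i v) (real t * real T) \<subseteq> level_set n (\<lambda>v. real q * X i v) (real s * real T)"
    by (auto simp: level_set_def)
  then show ?thesis unfolding lev_def by (intro mono_onD[OF mono[OF i]]) (auto simp: level_set_def)
qed

lemma lev_nonneg: "i \<in> {1..k} \<Longrightarrow> 0 \<le> lev i s"
  unfolding lev_def by (intro F_nonneg) (auto simp: level_set_def)

text \<open>Up to the grid error, the level costs add up to q times the Lovasz extension at the
  average play, which by convexity is at most the average over the rounds.\<close>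

lemma sum_lev_le:
  assumes i: "i \<in> {1..k}"
  shows "(\<Sum>s\<le>k * H. lev i s) \<le> real q / real T * (\<Sum>t<T. \<Sum>v<n. pl t i v * rs t i v) + real n * G"
proof -
  \<comment> \<open>All level sets are prefixes of one greedy order, so this single vertex evaluates
    all of them.\<close>
  define w where "w = greedy (F i) {..<n} (X i)"
  \<comment> \<open>The support: other elements lie in no level set, and its elements are admissible
    for function i, which bounds \<open>F i D\<close> by n * G.\<close>
  define D where "D = level_set n (X i) 0"
  have w0: "0 \<le> w v" for v unfolding w_def by (rule greedy_nonneg[OF mono[OF i]])
  have up: "F i (level_set n (X i) c) = (\<Sum>v\<in>level_set n (X i) c. w v)" for c
    unfolding w_def using empty[OF i]
    by (intro sum_greedy_upset[symmetric]) (auto simp: level_set_def upper_def)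
  have lev: "lev i s = (\<Sum>v\<in>D. if real s < real q * X i v / real T then w v else 0)" for s
  proof -
    have "q > 0" by (simp add: q_def)
    then have qpos: "real q > 0" by simp
    have "level_set n (\<lambda>v. real q * X i v) (real s * real T) = level_set n (X i) (real s * real T / real q)"
      using qpos by (auto simp: level_set_def field_simps)
    then have "lev i s = (\<Sum>v\<in>level_set n (X i) (real s * real T / real q). w v)" unfolding lev_def by (simp only: up)
    also have "\<dots> = (\<Sum>v\<in>D. if real s < real q * X i v / real T then w v else 0)"
    proof -
      have "level_set n (X i) (real s * real T / real q) = {v\<in>D. real s < real q * X i v / real T}"
      proof -
        have *: "(real s * real T / real q < x) \<longleftrightarrow> real s < real q * x / real T" for x
          using qpos Tpos by (simp add: field_simps)
        have "0 < x" if "real s * real T / real q < x" for x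
          using that Tpos qpos by (smt (verit) divide_nonneg_nonneg mult_nonneg_nonneg of_nat_0_le_iff)
        then show ?thesis using * by (auto simp: level_set_def D_def)
      qed
      moreover have "finite D" by (simp add: D_def level_set_def)
      ultimately show ?thesis by (simp add: sum.inter_filter)
    qed
    finally show ?thesis .
  qed
  have "(\<Sum>s\<le>k * H. lev i s) = (\<Sum>v\<in>D. \<Sum>s<q. if real s < real q * X i v / real T then w v else 0)"
    unfolding lev by (subst sum.swap) (simp add: q_def lessThan_Suc_atMost)
  also have "\<dots> = (\<Sum>v\<in>D. w v * real (card {s. s < q \<and> real s < real q * X i v / real T}))"
  proof (rule sum.cong[OF refl])
    fix v
    have "(\<Sum>s<q. if real s < real q * X i v / real T then w v else 0) = (\<Sum>s\<in>{s\<in>{..<q}. real s < real q * X i v / real T}. w v)"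
      by (rule sum.inter_filter[symmetric]) simp
    then show "(\<Sum>s<q. if real s < real q * X i v / real T then w v else 0) = w v * real (card {s. s < q \<and> real s < real q * X i v / real T})"
      by (simp add: mult.commute)
  qed
  also have "\<dots> \<le> (\<Sum>v\<in>D. w v * (real q * X i v / real T + 1))"
    using Tpos by (intro sum_mono mult_left_mono card_nat_less_real w0) (auto simp: D_def level_set_def)
  also have "\<dots> = real q / real T * (\<Sum>v\<in>D. X i v * w v) + F i D"
    by (simp add: D_def up sum.distrib distrib_left sum_distrib_left mult.commute mult.left_commute)
  also have "F i D \<le> real n * G"
  proof -
    have "F i D \<le> (\<Sum>v\<in>D. F i {v})"
      by (intro submodular_subadditive[OF submod[OF i] empty[OF i]]) (auto simp: D_def level_set_def)
    also have "\<dots> \<le> (\<Sum>v\<in>D. G)" using X_pos_allowed by (intro sum_mono) (auto simp: D_def level_set_def)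
    also have "\<dots> = real (card D) * G" by simp
    also have "\<dots> \<le> real n * G" 
    proof (rule mult_right_mono)
      have "card D \<le> card {..<n}" by (intro card_mono) (auto simp: D_def level_set_def)
      then show "real (card D) \<le> real n" by simp
    qed (rule G)
    finally show ?thesis .
  qed
  also have "(\<Sum>v\<in>D. X i v * w v) = (\<Sum>v<n. X i v * w v)"
  proof (rule sum.mono_neutral_left)
    show "\<forall>v\<in>{..<n} - D. X i v * w v = 0" using X_nonneg[OF i] by (force simp: D_def level_set_def)
  qed (auto simp: D_def level_set_def)
  also have "\<dots> = (\<Sum>t<T. \<Sum>v<n. pl t i v * w v)"
    unfolding X_def sum_distrib_right by (rule sum.swap)
  \<comment> \<open>Convexity: \<open>w\<close> is feasible in each round, where the response is
    optimal for the play of that round.\<close>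
  also have "real q / real T * (\<Sum>t<T. \<Sum>v<n. pl t i v * w v) \<le> real q / real T * (\<Sum>t<T. \<Sum>v<n. pl t i v * rs t i v)"
  proof (rule mult_left_mono)
    have "(\<Sum>v\<in>S. w v) \<le> F i S" if "S \<subseteq> {..<n}" for S
      unfolding w_def using sum_greedy_le[OF _ submod[OF i] empty[OF i] that] by simp
    then show "(\<Sum>t<T. \<Sum>v<n. pl t i v * w v) \<le> (\<Sum>t<T. \<Sum>v<n. pl t i v * rs t i v)"
      by (intro sum_mono play_response_optimal[OF i]) auto
  qed simp
  finally show ?thesis by simp
qed

text \<open>Pigeonhole: the interval consists of N = n + 1 disjoint blocks of length 2 l. A change
  of \<open>lev 1\<close> inside a block requires an element whose value q X / T lies in it, and
  there are only n elements.\<close>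

lemma constant_block:
  "\<exists>r. 12 * (l * N) \<le> r \<and> r + 2 * l \<le> 14 * (l * N) \<and> (\<forall>a. r \<le> a \<and> a < r + 2 * l \<longrightarrow> lev 1 a = lev 1 r)"
proof (rule ccontr)
  assume neg: "\<not> ?thesis"
  define r where "r j = 12 * (l * N) + 2 * l * j" for j
  have "\<exists>v<n. real (r j) * real T < real q * X 1 v \<and> real q * X 1 v < real (r (Suc j)) * real T" if j: "j \<le> n" for j
  proof -
    have "r j + 2 * l \<le> 14 * (l * N)"
    proof -
      have "l * (j + 1) \<le> l * N" using j N_def by (intro mult_left_mono) auto
      then show ?thesis by (simp add: r_def algebra_simps)
    qed
    moreover have "12 * (l * N) \<le> r j" by (simp add: r_def)
    ultimately obtain a where a: "r j \<le> a" "a < r j + 2 * l" "lev 1 a \<noteq> lev 1 (r j)" using neg by blast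
    then have "level_set n (\<lambda>v. real q * X 1 v) (real a * real T) \<noteq> level_set n (\<lambda>v. real q * X 1 v) (real (r j) * real T)"
      unfolding lev_def by auto
    moreover have le: "real (r j) * real T \<le> real a * real T" using a by (intro mult_right_mono) auto
    ultimately obtain v where "v < n" "real (r j) * real T < real q * X 1 v" "real q * X 1 v \<le> real a * real T"
      by (force simp: level_set_def)
    moreover have "a < r (Suc j)" using a by (simp add: r_def)
    then have "real a * real T < real (r (Suc j)) * real T"
      using Tpos by (intro mult_strict_right_mono) (simp_all only: of_nat_less_iff)
    ultimately show ?thesis by force
  qed
  then obtain g where g: "\<And>j. j \<le> n \<Longrightarrow> g j < n \<and> real (r j) * real T < real q * X 1 (g j)
      \<and> real q * X 1 (g j) < real (r (Suc j)) * real T" by metis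
  have less: "g i \<noteq> g j" if "i < j" "j \<le> n" for i j
  proof
    assume eq: "g i = g j"
    have "real (r j) * real T < real (r (Suc i)) * real T" using g[of i] g[of j] that eq by auto
    then have "r j < r (Suc i)" using Tpos by simp
    moreover have "l * Suc i \<le> l * j" using that by (intro mult_left_mono) auto
    ultimately show False by (simp add: r_def mult.assoc)
  qed
  have "inj_on g {..n}"
  proof (rule inj_onI)
    fix i j assume "i \<in> {..n}" "j \<in> {..n}" "g i = g j"
    then show "i = j" using less[of i j] less[of j i] by (cases i j rule: linorder_cases) auto
  qed
  moreover have "g ` {..n} \<subseteq> {..<n}" using g by auto
  ultimately have "card {..n} \<le> card {..<n}" using card_inj_on_le by blast
  then show False by simp
qed

text \<open>\<open>C\<close> stands for the optimum over threshold vectors. By opt \<le> G, all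
  pairs used by \<sigma> are admissible. Regret and grid error bound the total of the level costs
  from above, \<open>threshold_slack\<close> bounds it from below, and the slack pays for both
  errors.\<close>

theorem best_thresholds:
  assumes \<sigma>: "\<And>v. v < n \<Longrightarrow> \<sigma> v \<in> {1..k}"
    and opt: "opt = (\<Sum>i=1..k. F i {v. v < n \<and> \<sigma> v = i})" "opt \<le> G"
    and C: "C \<ge> 0" "\<And>s. (\<Sum>i=1..k. s i) \<le> k * H \<Longrightarrow> C \<le> (\<Sum>i=1..k. lev i (s i))"
  shows "C \<le> real k / 2 * opt"
proof -
  let ?V = "{..<n}"
  have \<sigma>_le: "F (\<sigma> v) {v} \<le> opt" if "v < n" for v
  proof -
    have "F (\<sigma> v) {v} \<le> F (\<sigma> v) {u. u < n \<and> \<sigma> u = \<sigma> v}"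
      using that by (intro mono_onD[OF mono[OF \<sigma>]]) auto
    also have "\<dots> \<le> opt" unfolding opt(1) using \<sigma>[OF that]
      by (intro member_le_sum[of "\<sigma> v" "{1..k}" "\<lambda>i. F i {v. v < n \<and> \<sigma> v = i}"]) (auto intro!: F_nonneg)
    finally show ?thesis .
  qed
  have opt0: "opt \<ge> 0" unfolding opt(1) by (intro sum_nonneg F_nonneg) auto
  \<comment> \<open>Unless \<beta> = 0, some element costs at least \<beta> under every function. So
    G is at most n * opt, and errors proportional to G become relative errors.\<close>
  have \<beta>_opt: "\<beta> \<le> opt"
    using \<beta>_lower opt0 \<sigma>_le \<sigma> by (metis order_trans)
  have "(\<Sum>t<T. \<Sum>i=1..k. \<Sum>v<n. pl t i v * rs t i v) \<le>
     (\<Sum>v<n. \<Sum>t<T. rs t (\<sigma> v) v) + real (card ?V) * ((2 * real T / real m + real m * real k) * G)"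
    using \<sigma> \<sigma>_le opt(2) by (intro total_regret) (auto simp: w0_def intro: order_trans)
  also have "2 * real T / real m + real m * real k = 3 * real T / real m"
    using m_ge by (simp add: T_def power2_eq_square field_simps)
  also have "(\<Sum>v<n. \<Sum>t<T. rs t (\<sigma> v) v) \<le> real T * opt"
  proof -
    have "(\<Sum>v<n. rs t (\<sigma> v) v) \<le> opt" for t
    proof -
      have "(\<Sum>v<n. rs t (\<sigma> v) v) = (\<Sum>i=1..k. \<Sum>v\<in>{v \<in> ?V. \<sigma> v = i}. rs t (\<sigma> v) v)"
        using \<sigma> by (intro sum.group[symmetric]) auto
      also have "\<dots> = (\<Sum>i=1..k. \<Sum>v\<in>{v \<in> ?V. \<sigma> v = i}. rs t i v)" by (intro sum.cong) auto
      also have "\<dots> \<le> (\<Sum>i=1..k. F i {v \<in> ?V. \<sigma> v = i})" by (intro sum_mono response_sum_le) auto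
      finally show ?thesis by (simp add: opt(1))
    qed
    then have "(\<Sum>t<T. \<Sum>v<n. rs t (\<sigma> v) v) \<le> (\<Sum>t<T. opt)" by (intro sum_mono)
    then show ?thesis by (subst sum.swap) simp
  qed
  finally have regret: "(\<Sum>t<T. \<Sum>i=1..k. \<Sum>v<n. pl t i v * rs t i v) \<le> real T * opt + real n * (3 * real T / real m * G)"
    by simp
  have "(\<Sum>i=1..k. \<Sum>s\<le>k * H. lev i s) \<le> (\<Sum>i=1..k. real q / real T * (\<Sum>t<T. \<Sum>v<n. pl t i v * rs t i v) + real n * G)"
    by (intro sum_mono sum_lev_le)
  also have "\<dots> = real q / real T * (\<Sum>t<T. \<Sum>i=1..k. \<Sum>v<n. pl t i v * rs t i v) + real k * (real n * G)"
    by (subst sum.swap) (simp add: sum.distrib sum_distrib_left)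
  also have "real q / real T * (\<Sum>t<T. \<Sum>i=1..k. \<Sum>v<n. pl t i v * rs t i v)
      \<le> real q / real T * (real T * opt + real n * (3 * real T / real m * G))"
    using regret by (intro mult_left_mono) auto
  also have "\<dots> = real q * opt + 3 * real q * (real n * G) / real m" using Tpos by (simp add: field_simps)
  finally have tot: "(\<Sum>i=1..k. \<Sum>s\<le>k * H. lev i s) \<le> real q * opt + 3 * real q * (real n * G) / real m + real k * (real n * G)"
    by simp
  obtain r where r: "12 * (l * N) \<le> r" "r + 2 * l \<le> 14 * (l * N)" "\<And>a. r \<le> a \<Longrightarrow> a < r + 2 * l \<Longrightarrow> lev 1 a = lev 1 r"
    using constant_block by blast
  have lpos: "l > 0" using k by (simp add: l_def)
  have "(2 * real H + 1 + real l / (1024 * real N * real k)) * C \<le> (\<Sum>i=1..k. \<Sum>s\<le>k * H. lev i s)"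
  proof (rule threshold_slack[OF k lpos _ H_def])
    show "(\<Sum>i=1..k. s i) \<le> k * H \<Longrightarrow> C \<le> (\<Sum>i=1..k. lev i (s i))" for s by (rule C(2))
    show "r \<le> a \<Longrightarrow> a < r + 2 * l \<Longrightarrow> lev 1 a = lev 1 r" for a by (rule r(3))
  qed (use lev_antimono lev_nonneg C(1) r(1,2) in \<open>auto simp: N_def\<close>)
  also note tot
  finally have main: "(2 * real H + 1 + real l / (1024 * real N * real k)) * C
     \<le> real q * opt + 3 * real q * (real n * G) / real m + real k * (real n * G)" .
  let ?z = "real (n + k)"
  have z: "real n \<le> ?z" "real N \<le> ?z" "real k \<le> ?z" "real N > 0" "real k > 0" using k by (auto simp: N_def)
  have nG: "real n * G \<le> real n * real n * opt"
    using \<beta>_opt by (simp add: G_def mult_left_mono mult.assoc)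
  \<comment> \<open>The error of the solver. With q \<le> 17 k l N the claim reduces to 3 * 17 *
    4096 = 208896 times k n^2 N^2 being at most m; 262144 is the next power of two.\<close>
  have e1: "3 * real q * (real n * G) / real m \<le> opt * (real l / (4096 * real N))"
  proof -
    have q: "real q \<le> 17 * (real k * real l * real N)"
    proof -
      have "1 * 1 * 1 \<le> real k * real l * real N" using k lpos N_def by (intro mult_mono) auto
      then show ?thesis by (simp add: q_def H_def mult.commute mult.left_commute)
    qed
    have mm: "208896 * (real k * real n * real n * real N * real N) \<le> real m"
    proof -
      have "real k * real n * real n * real N * real N \<le> ?z * ?z * ?z * ?z * ?z" using z by (intro mult_mono) auto
      also have "\<dots> = ?z ^ 5" by (simp add: power_numeral_reduce)
      finally have "real k * real n * real n * real N * real N \<le> ?z ^ 5" .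
      moreover have "real m = 262144 * ?z ^ 5" by (simp add: m_def)
      moreover have "?z ^ 5 \<ge> 0" by simp
      ultimately show ?thesis by linarith
    qed
    have "3 * real q * (real n * G) \<le> 3 * (17 * (real k * real l * real N)) * (real n * real n * opt)"
    proof (rule mult_mono[OF _ nG])
      show "3 * real q \<le> 3 * (17 * (real k * real l * real N))" using q by linarith
    qed (use G in simp_all)
    also have "\<dots> = opt * real l / (4096 * real N) * (208896 * (real k * real n * real n * real N * real N))"
      using z(4) by (simp add: field_simps)
    also have "\<dots> \<le> opt * real l / (4096 * real N) * real m"
      using mm opt0 by (intro mult_left_mono) auto
    finally show ?thesis using m_ge by (simp add: divide_le_eq)
  qed
  \<comment> \<open>The error of the grid. The fourth power in \<open>l\<close> comes from k n^2 N
    \<le> (n + k)^4.\<close>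
  have e2: "real k * (real n * G) \<le> opt * (real l / (4096 * real N))"
  proof -
    have "real k * real n * real n * real N \<le> ?z * ?z * ?z * ?z" using z by (intro mult_mono) auto
    also have "\<dots> = ?z ^ 4" by (simp add: power_numeral_reduce)
    finally have "4096 * (real k * real n * real n * real N) \<le> real l" by (simp add: l_def)
    then have "real k * real n * real n \<le> real l / (4096 * real N)" using z(4) by (simp add: field_simps)
    then have "opt * (real k * real n * real n) \<le> opt * (real l / (4096 * real N))" using opt0 by (intro mult_left_mono)
    moreover have "real k * (real n * G) \<le> real k * (real n * real n * opt)" using nG by (intro mult_left_mono) auto
    ultimately show ?thesis by (simp add: algebra_simps)
  qed
  \<comment> \<open>q = k H + 1 is at most k / 2 * (2 H + 1) since k / 2 \<ge> 1.\<close>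
  have "real q * opt \<le> (real k * real H + real k / 2) * opt"
    using k opt0 by (intro mult_right_mono) (auto simp: q_def)
  with main e1 e2 have "(2 * real H + 1 + real l / (1024 * real N * real k)) * C
      \<le> (real k * real H + real k / 2) * opt + 2 * (opt * (real l / (4096 * real N)))" by linarith
  \<comment> \<open>The slack l / (1024 N k) times k / 2 is exactly the sum of two errors l / (4096
    N).\<close>
  also have "\<dots> = (2 * real H + 1 + real l / (1024 * real N * real k)) * (real k / 2 * opt)"
    using z(4,5) by (simp add: field_simps)
  finally show ?thesis
    using mult_le_cancel_left_pos[of "2 * real H + 1 + real l / (1024 * real N * real k)"]
    by (simp add: add_pos_nonneg)
qed

end

section \<open>The fractional solver\<close>

lemma upd_apply: "upd m x as v y bs = (if y = x \<and> bs = as then v else m y bs)"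
  by (simp add: upd_def)

abbreviation seq :: "com \<Rightarrow> com \<Rightarrow> com" (infixr ";;" 60) where "c ;; d \<equiv> Seq c d"

abbreviation rx :: "string \<Rightarrow> rexp" where "rx x \<equiv> RCell x []"

definition c_totals :: com where
  "c_totals = For ''v'' (ix ''n'') (RAssign ''tot'' [ix ''v''] (RNat (NConst 0)) ;;
     For ''i'' (ix ''K'') (RAssign ''tot'' [ix ''v'']
       (RAdd (RCell ''tot'' [ix ''v'']) (RCell ''w'' [NAdd (ix ''i'') (NConst 1), ix ''v'']))))"

definition c_shares :: com where
  "c_shares = For ''i'' (ix ''K'') (NAssign ''fi'' [] (NAdd (ix ''i'') (NConst 1)) ;;
     For ''v'' (ix ''n'') (RAssign ''p'' [ix ''fi'', ix ''v''] (RDiv (RCell ''w'' [ix ''fi'', ix ''v'']) (RCell ''tot'' [ix ''v''])) ;;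
       RAssign ''X'' [ix ''fi'', ix ''v''] (RAdd (RCell ''X'' [ix ''fi'', ix ''v'']) (RCell ''p'' [ix ''fi'', ix ''v'']))))"

text \<open>Computes the indicator of \<open>upper\<close> for the current function and element.
  Real tests offer only strict comparison, so the tie rule is expressed by negations:
  \<open>u\<close> is excluded if its weight is smaller, or not larger and its index is
  larger.\<close>

definition c_upper :: com where
  "c_upper = For ''u'' (ix ''n'') (If (BAnd (NLess (NConst 0) (NCell ''E'' [ix ''u'']))
       (BAnd (BNot (RLess (RCell ''p'' [ix ''fi'', ix ''u'']) (RCell ''p'' [ix ''fi'', ix ''v''])))
         (BNot (BAnd (BNot (RLess (RCell ''p'' [ix ''fi'', ix ''v'']) (RCell ''p'' [ix ''fi'', ix ''u'']))) (NLess (ix ''v'') (ix ''u''))))))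
     (NAssign ''S'' [ix ''u''] (NConst 1)) (NAssign ''S'' [ix ''u''] (NConst 0)))"

text \<open>\<open>orc\<close> leaves the value of function \<open>fi\<close> on the set
  \<open>S\<close> in \<open>val\<close>. The marginal value of \<open>v\<close> is the difference
  of two calls, before and after \<open>v\<close> is taken out of \<open>S\<close>.\<close>

definition c_element :: "com \<Rightarrow> com" where
  "c_element orc = c_upper ;; orc ;; RAssign ''l1'' [] (rx ''val'') ;; NAssign ''S'' [ix ''v''] (NConst 0) ;; orc ;;
     RAssign ''l1'' [] (RSub (rx ''l1'') (rx ''val'')) ;;
     RAssign ''W'' [ix ''fi'', ix ''v''] (RAdd (RCell ''W'' [ix ''fi'', ix ''v'']) (rx ''l1'')) ;;
     RAssign ''w'' [ix ''fi'', ix ''v''] (RMul (RCell ''w'' [ix ''fi'', ix ''v''])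
       (RSub (RNat (NConst 1)) (RDiv (rx ''l1'') (RMul (RNat (ix ''mm'')) (rx ''G'')))))"

definition c_respond :: "com \<Rightarrow> com" where
  "c_respond orc = For ''i'' (ix ''K'') (NAssign ''fi'' [] (NAdd (ix ''i'') (NConst 1)) ;;
     For ''v'' (ix ''n'') (If (NLess (NConst 0) (NCell ''E'' [ix ''v''])) (c_element orc) Skip))"

definition c_clear :: com where
  "c_clear = For ''i'' (ix ''K'') (NAssign ''fi'' [] (NAdd (ix ''i'') (NConst 1)) ;;
     For ''v'' (ix ''n'') (RAssign ''W'' [ix ''fi'', ix ''v''] (RNat (NConst 0)) ;; RAssign ''X'' [ix ''fi'', ix ''v''] (RNat (NConst 0))))"

text \<open>\<open>X\<close> and \<open>W\<close> collect the sums of plays and responses over the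
  rounds. The oracle code is a parameter because the solver serves both the allocation game and the
  games on intervals.\<close>

definition c_solve :: "com \<Rightarrow> com" where
  "c_solve orc = c_clear ;; For ''t'' (ix ''T'') (c_totals ;; c_shares ;; c_respond orc)"

lemma wr_parts [simp]:
  "wr c_totals = {''v'', ''tot'', ''i''}"
  "wr c_shares = {''i'', ''fi'', ''v'', ''p'', ''X''}"
  "wr c_upper = {''u'', ''S''}"
  "wr (c_element orc) = {''u'', ''S'', ''l1'', ''W'', ''w''} \<union> wr orc"
  "wr (c_respond orc) = {''i'', ''fi'', ''v'', ''u'', ''S'', ''l1'', ''W'', ''w''} \<union> wr orc"
  "wr c_clear = {''i'', ''fi'', ''v'', ''W'', ''X''}"
  by (auto simp: c_totals_def c_shares_def c_upper_def c_element_def c_respond_def c_clear_def)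

lemma wr_solve [simp]:
  "wr (c_solve orc) = {''t'', ''v'', ''tot'', ''i'', ''fi'', ''p'', ''X'', ''u'', ''S'', ''l1'', ''W'', ''w''} \<union> wr orc"
  by (auto simp: c_solve_def)

lemma run_totals:
  assumes "fst s ''n'' [] = n" "fst s ''K'' [] = K" "n \<le> Z" "K \<le> Z"
  shows "run Fo Z c_totals s (\<lambda>s'. \<forall>v<n. snd s' ''tot'' [v] = (\<Sum>j=1..K. snd s ''w'' [j, v]))"
  unfolding c_totals_def
proof (rule run_For_conseq[where B = n and I = "\<lambda>j s'. \<forall>v<j. snd s' ''tot'' [v] = (\<Sum>j=1..K. snd s ''w'' [j, v])"], goal_cases)
  \<comment> \<open>In this and the following loop proofs, case 6 of \<open>run_For_conseq\<close>
    is the body and case 7 the exit; nested loops repeat the pattern.\<close>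
  case (6 j s')
  then have K: "fst s' ''K'' [] = K" and w: "snd s' ''w'' = snd s ''w''" using assms by (simp_all add: agree_def)
  show ?case
  proof (intro run_Seq run_RAssign, rule run_For_conseq[where B = K and I = "\<lambda>i s''. snd s'' ''tot'' [j] = (\<Sum>i'=1..i. snd s ''w'' [i', j])
       \<and> (\<forall>v<j. snd s'' ''tot'' [v] = snd s' ''tot'' [v])"], goal_cases)
    case (6 i s2)
    then have "fst s2 ''v'' [] = j" "snd s2 ''w'' = snd s ''w''"
      using \<open>fst s' ''v'' [] = j\<close> w by (simp_all add: agree_def upd_def)
    then show ?case using 6 by (intro run_RAssign) (simp add: upd_apply)
  qed (use 6 K assms in \<open>auto simp: agree_def upd_apply set_scalar_def less_Suc_eq\<close>)
qed (use assms in \<open>auto simp: agree_def upd_apply set_scalar_def\<close>)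

lemma run_shares:
  assumes "fst s ''n'' [] = n" "fst s ''K'' [] = K" "n \<le> Z" "K \<le> Z"
  shows "run Fo Z c_shares s (\<lambda>s'. \<forall>i\<in>{1..K}. \<forall>v<n. snd s' ''p'' [i, v] = snd s ''w'' [i, v] / snd s ''tot'' [v]
     \<and> snd s' ''X'' [i, v] = snd s ''X'' [i, v] + snd s ''w'' [i, v] / snd s ''tot'' [v])"
  unfolding c_shares_def
proof (rule run_For_conseq[where B = K and I = "\<lambda>j s'. (\<forall>i\<in>{1..j}. \<forall>v<n. snd s' ''p'' [i, v] = snd s ''w'' [i, v] / snd s ''tot'' [v]
     \<and> snd s' ''X'' [i, v] = snd s ''X'' [i, v] + snd s ''w'' [i, v] / snd s ''tot'' [v])
     \<and> (\<forall>i>j. \<forall>v. snd s' ''X'' [i, v] = snd s ''X'' [i, v])"], goal_cases)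
  case (6 j s')
  then have n: "fst s' ''n'' [] = n" and w: "snd s' ''w'' = snd s ''w''" "snd s' ''tot'' = snd s ''tot''"
    using assms by (simp_all add: agree_def)
  show ?case
  proof (intro run_Seq run_NAssign, rule run_For_conseq[where B = n and I = "\<lambda>v s''.
      (\<forall>v'<v. snd s'' ''p'' [Suc j, v'] = snd s ''w'' [Suc j, v'] / snd s ''tot'' [v']
     \<and> snd s'' ''X'' [Suc j, v'] = snd s ''X'' [Suc j, v'] + snd s ''w'' [Suc j, v'] / snd s ''tot'' [v'])
     \<and> (\<forall>v'\<ge>v. snd s'' ''X'' [Suc j, v'] = snd s ''X'' [Suc j, v'])
     \<and> (\<forall>i v'. i \<noteq> Suc j \<longrightarrow> snd s'' ''X'' [i, v'] = snd s' ''X'' [i, v'] \<and> snd s'' ''p'' [i, v'] = snd s' ''p'' [i, v'])"], goal_cases)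
    case (6 v s2)
    then have "fst s2 ''fi'' [] = Suc j" "snd s2 ''w'' = snd s ''w''" "snd s2 ''tot'' = snd s ''tot''"
      using \<open>fst s' ''i'' [] = j\<close> w by (simp_all add: agree_def upd_def)
    then show ?case using 6 by (intro run_Seq run_RAssign) (auto simp: upd_apply less_Suc_eq)
  next
    case (7 s2)
    then show ?case using 6 by (auto simp: le_Suc_eq)
  qed (use 6 n assms in \<open>auto simp: agree_def upd_apply set_scalar_def\<close>)
qed (use assms in \<open>auto simp: agree_def upd_apply set_scalar_def\<close>)

lemma run_clear:
  assumes "fst s ''n'' [] = n" "fst s ''K'' [] = K" "n \<le> Z" "K \<le> Z"
  shows "run Fo Z c_clear s (\<lambda>s'. \<forall>i\<in>{1..K}. \<forall>v<n. snd s' ''W'' [i, v] = 0 \<and> snd s' ''X'' [i, v] = 0)"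
  unfolding c_clear_def
proof (rule run_For_conseq[where B = K and I = "\<lambda>j s'. \<forall>i\<in>{1..j}. \<forall>v<n. snd s' ''W'' [i, v] = 0 \<and> snd s' ''X'' [i, v] = 0"], goal_cases)
  case (6 j s')
  then have n: "fst s' ''n'' [] = n" using assms by (simp add: agree_def)
  show ?case
  proof (intro run_Seq run_NAssign, rule run_For_conseq[where B = n and I = "\<lambda>v s''.
      (\<forall>v'<v. snd s'' ''W'' [Suc j, v'] = 0 \<and> snd s'' ''X'' [Suc j, v'] = 0)
     \<and> (\<forall>i v'. i \<noteq> Suc j \<longrightarrow> snd s'' ''X'' [i, v'] = snd s' ''X'' [i, v'] \<and> snd s'' ''W'' [i, v'] = snd s' ''W'' [i, v'])"], goal_cases)
    case (6 v s2)
    then have "fst s2 ''fi'' [] = Suc j" using \<open>fst s' ''i'' [] = j\<close> by (simp add: agree_def upd_def)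
    then show ?case using 6 by (intro run_Seq run_RAssign) (auto simp: upd_apply less_Suc_eq)
  next
    case (7 s2)
    then show ?case using 6 by (auto simp: le_Suc_eq)
  qed (use 6 n assms in \<open>auto simp: agree_def upd_apply set_scalar_def\<close>)
qed (use assms in \<open>auto simp: agree_def upd_apply set_scalar_def\<close>)

lemma run_upper:
  assumes "fst s ''n'' [] = n" "n \<le> Z"
  shows "run Fo Z c_upper s (\<lambda>s'. {u. u < n \<and> fst s' ''S'' [u] \<noteq> 0} =
     upper {u. u < n \<and> fst s ''E'' [u] \<noteq> 0} (\<lambda>u. snd s ''p'' [fst s ''fi'' [], u]) (fst s ''v'' []))"
  unfolding c_upper_def
proof (rule run_For_conseq[where B = n and I = "\<lambda>j s'. \<forall>u<j. fst s' ''S'' [u] \<noteq> 0 \<longleftrightarrow>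
     u \<in> upper {u. u < n \<and> fst s ''E'' [u] \<noteq> 0} (\<lambda>u. snd s ''p'' [fst s ''fi'' [], u]) (fst s ''v'' [])"], goal_cases)
  case (6 j s')
  then have "fst s' ''fi'' = fst s ''fi''" "fst s' ''v'' = fst s ''v''" "fst s' ''E'' = fst s ''E''" "snd s' ''p'' = snd s ''p''"
    by (simp_all add: agree_def)
  then show ?case using 6 by (intro run_If run_NAssign) (auto simp: upd_apply less_Suc_eq upper_def)
next
  case (7 s')
  then show ?case by (auto simp: upper_def)
qed (use assms in \<open>auto simp: agree_def upd_apply set_scalar_def\<close>)

text \<open>\<open>Inv\<close> is what the oracle code relies on, and it has to survive changes of
  all names that the solver writes. \<open>orc_frame\<close> is the converse: the oracle code does
  not disturb the solver.\<close>

locale oracle_code =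
  fixes Fo :: eval_oracle and Z :: nat and orc :: com and Inv :: "state \<Rightarrow> bool" and n K :: nat
    and F :: "nat \<Rightarrow> nat set \<Rightarrow> real"
  assumes orc_run: "\<And>s i. Inv s \<Longrightarrow> fst s ''fi'' [] = i \<Longrightarrow> i \<in> {1..K} \<Longrightarrow>
      run Fo Z orc s (\<lambda>s'. snd s' ''val'' [] = F i {u. u < n \<and> fst s ''S'' [u] \<noteq> 0})"
    and orc_frame: "\<forall>x\<in>{''n'', ''K'', ''T'', ''mm'', ''G'', ''E'', ''w'', ''p'', ''W'', ''X'', ''tot'', ''S'',
      ''t'', ''i'', ''fi'', ''v'', ''l1''}. x \<notin> wr orc"
    and Inv_agree: "\<And>s s'. Inv s \<Longrightarrow> agree (wr (c_solve orc)) s s' \<Longrightarrow> Inv s'"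
    and nZ: "n \<le> Z" and KZ: "K \<le> Z"
begin

lemma not_written [simp]: "''n'' \<notin> wr orc" "''K'' \<notin> wr orc" "''T'' \<notin> wr orc" "''mm'' \<notin> wr orc" "''G'' \<notin> wr orc"
  "''E'' \<notin> wr orc" "''w'' \<notin> wr orc" "''p'' \<notin> wr orc" "''W'' \<notin> wr orc" "''X'' \<notin> wr orc" "''tot'' \<notin> wr orc" "''S'' \<notin> wr orc"
  "''t'' \<notin> wr orc" "''i'' \<notin> wr orc" "''fi'' \<notin> wr orc" "''v'' \<notin> wr orc" "''l1'' \<notin> wr orc"
  using orc_frame by simp_all

lemma Inv_agreeI: "Inv s \<Longrightarrow> agree W s s' \<Longrightarrow> W \<subseteq> wr (c_solve orc) \<Longrightarrow> Inv s'"
  using Inv_agree agree_mono by blast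

lemma run_element:
  assumes Inv: "Inv s" and i: "fst s ''fi'' [] = i" "i \<in> {1..K}" and v: "fst s ''v'' [] = v" "v < n" "fst s ''E'' [v] \<noteq> 0"
    and n: "fst s ''n'' [] = n"
  defines "g \<equiv> greedy (F i) {u. u < n \<and> fst s ''E'' [u] \<noteq> 0} (\<lambda>u. snd s ''p'' [i, u]) v"
  shows "run Fo Z (c_element orc) s (\<lambda>s'. snd s' ''W'' = (snd s ''W'')([i, v] := snd s ''W'' [i, v] + g) \<and>
     snd s' ''w'' = (snd s ''w'')([i, v] := snd s ''w'' [i, v] * (1 - g / (real (fst s ''mm'' []) * snd s ''G'' []))))"
  unfolding c_element_def
proof (rule run_Seq, rule run_conseq[OF run_upper[OF n nZ]])
  let ?U = "upper {u. u < n \<and> fst s ''E'' [u] \<noteq> 0} (\<lambda>u. snd s ''p'' [i, u]) v"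
  fix s1 assume ag1: "agree (wr c_upper) s s1" and "{u. u < n \<and> fst s1 ''S'' [u] \<noteq> 0} =
    upper {u. u < n \<and> fst s ''E'' [u] \<noteq> 0} (\<lambda>u. snd s ''p'' [fst s ''fi'' [], u]) (fst s ''v'' [])"
  then have S1: "{u. u < n \<and> fst s1 ''S'' [u] \<noteq> 0} = ?U" using i v by simp
  have Inv1: "Inv s1" by (rule Inv_agreeI[OF Inv ag1]) auto
  have i1: "fst s1 ''fi'' [] = i" using ag1 i by (simp add: agree_def)
  show "run Fo Z (orc ;; RAssign ''l1'' [] (rx ''val'') ;; NAssign ''S'' [ix ''v''] (NConst 0) ;; orc ;;
     RAssign ''l1'' [] (RSub (rx ''l1'') (rx ''val'')) ;;
     RAssign ''W'' [ix ''fi'', ix ''v''] (RAdd (RCell ''W'' [ix ''fi'', ix ''v'']) (rx ''l1'')) ;;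
     RAssign ''w'' [ix ''fi'', ix ''v''] (RMul (RCell ''w'' [ix ''fi'', ix ''v''])
       (RSub (RNat (NConst 1)) (RDiv (rx ''l1'') (RMul (RNat (ix ''mm'')) (rx ''G'')))))) s1
     (\<lambda>s'. snd s' ''W'' = (snd s ''W'')([i, v] := snd s ''W'' [i, v] + g) \<and>
     snd s' ''w'' = (snd s ''w'')([i, v] := snd s ''w'' [i, v] * (1 - g / (real (fst s ''mm'' []) * snd s ''G'' []))))"
  proof (rule run_Seq, rule run_conseq[OF orc_run[OF Inv1 i1 i(2)]], intro run_Seq run_RAssign run_NAssign)
    fix s2 assume ag2: "agree (wr orc) s1 s2" and val2: "snd s2 ''val'' [] = F i {u. u < n \<and> fst s1 ''S'' [u] \<noteq> 0}"
    let ?s3 = "(fst s2, upd (snd s2) ''l1'' (map (nval (fst s2)) []) (rval s2 (rx ''val'')))"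
    let ?s4 = "(upd (fst ?s3) ''S'' (map (nval (fst ?s3)) [ix ''v'']) (nval (fst ?s3) (NConst 0)), snd ?s3)"
    have Inv4: "Inv ?s4" by (rule Inv_agreeI[OF Inv1, of "wr orc \<union> {''S'', ''l1''}"]) (use ag2 in \<open>auto simp: agree_def upd_def\<close>)
    have i4: "fst ?s4 ''fi'' [] = i" using ag2 i1 by (simp add: agree_def upd_def)
    have v2: "fst s2 ''v'' [] = v" using ag1 ag2 v by (simp add: agree_def)
    have S4: "{u. u < n \<and> fst ?s4 ''S'' [u] \<noteq> 0} = ?U - {v}"
    proof -
      have "fst s2 ''S'' = fst s1 ''S''" using ag2 by (simp add: agree_def)
      then show ?thesis unfolding S1[symmetric] using v2 by (auto simp: upd_apply)
    qed
    show "run Fo Z orc ?s4 (\<lambda>s'. run Fo Z (RAssign ''l1'' [] (RSub (rx ''l1'') (rx ''val'')) ;;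
     RAssign ''W'' [ix ''fi'', ix ''v''] (RAdd (RCell ''W'' [ix ''fi'', ix ''v'']) (rx ''l1'')) ;;
     RAssign ''w'' [ix ''fi'', ix ''v''] (RMul (RCell ''w'' [ix ''fi'', ix ''v''])
       (RSub (RNat (NConst 1)) (RDiv (rx ''l1'') (RMul (RNat (ix ''mm'')) (rx ''G'')))))) s'
     (\<lambda>s'. snd s' ''W'' = (snd s ''W'')([i, v] := snd s ''W'' [i, v] + g) \<and>
     snd s' ''w'' = (snd s ''w'')([i, v] := snd s ''w'' [i, v] * (1 - g / (real (fst s ''mm'' []) * snd s ''G'' [])))))"
    proof (rule run_conseq[OF orc_run[OF Inv4 i4 i(2)]], intro run_Seq run_RAssign)
      fix s5 assume ag5: "agree (wr orc) ?s4 s5" and val5: "snd s5 ''val'' [] = F i {u. u < n \<and> fst ?s4 ''S'' [u] \<noteq> 0}"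
      have c: "fst s5 ''fi'' [] = i" "fst s5 ''v'' [] = v" "fst s5 ''mm'' = fst s ''mm''" "snd s5 ''G'' = snd s ''G''"
        "snd s5 ''W'' = snd s ''W''" "snd s5 ''w'' = snd s ''w''"
        using ag5 ag2 ag1 i v by (simp_all add: agree_def upd_def)
      have "snd s5 ''l1'' [] = F i ?U" using ag5 val2 S1 by (simp add: agree_def upd_apply)
      moreover have "snd s5 ''val'' [] = F i (?U - {v})" using val5 S4 by simp
      moreover have "g = F i ?U - F i (?U - {v})" using v by (simp add: g_def greedy_def)
      ultimately have g: "snd s5 ''l1'' [] - snd s5 ''val'' [] = g" by simp
      let ?s6 = "(fst s5, upd (snd s5) ''l1'' (map (nval (fst s5)) []) (rval s5 (RSub (rx ''l1'') (rx ''val''))))"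
      let ?s7 = "(fst ?s6, upd (snd ?s6) ''W'' (map (nval (fst ?s6)) [ix ''fi'', ix ''v'']) (rval ?s6 (RAdd (RCell ''W'' [ix ''fi'', ix ''v'']) (rx ''l1''))))"
      let ?s8 = "(fst ?s7, upd (snd ?s7) ''w'' (map (nval (fst ?s7)) [ix ''fi'', ix ''v'']) (rval ?s7 (RMul (RCell ''w'' [ix ''fi'', ix ''v''])
       (RSub (RNat (NConst 1)) (RDiv (rx ''l1'') (RMul (RNat (ix ''mm'')) (rx ''G'')))))))"
      show "snd ?s8 ''W'' = (snd s ''W'')([i, v] := snd s ''W'' [i, v] + g) \<and>
         snd ?s8 ''w'' = (snd s ''w'')([i, v] := snd s ''w'' [i, v] * (1 - g / (real (fst s ''mm'' []) * snd s ''G'' [])))"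
        using c g by (simp add: upd_def)
    qed
  qed
qed

text \<open>The plays \<open>p\<close> are fixed before any response is computed, so updating
  \<open>w\<close> in place cannot influence later elements. Outside \<open>E\<close> greedy entries
  are 0, and skipping is the right update.\<close>

lemma run_respond:
  assumes Inv: "Inv s" and n: "fst s ''n'' [] = n" and K: "fst s ''K'' [] = K"
  defines "E \<equiv> {u. u < n \<and> fst s ''E'' [u] \<noteq> 0}"
  defines "g \<equiv> (\<lambda>i. greedy (F i) E (\<lambda>u. snd s ''p'' [i, u]))"
  shows "run Fo Z (c_respond orc) s (\<lambda>s'. \<forall>i\<in>{1..K}. \<forall>v<n. snd s' ''W'' [i, v] = snd s ''W'' [i, v] + g i v \<and>
     snd s' ''w'' [i, v] = snd s ''w'' [i, v] * (1 - g i v / (real (fst s ''mm'' []) * snd s ''G'' [])))"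
  unfolding c_respond_def
proof (rule run_For_conseq[where B = K and I = "\<lambda>j s'. (\<forall>i\<in>{1..j}. \<forall>v<n. snd s' ''W'' [i, v] = snd s ''W'' [i, v] + g i v \<and>
     snd s' ''w'' [i, v] = snd s ''w'' [i, v] * (1 - g i v / (real (fst s ''mm'' []) * snd s ''G'' [])))
     \<and> (\<forall>i>j. \<forall>v. snd s' ''W'' [i, v] = snd s ''W'' [i, v] \<and> snd s' ''w'' [i, v] = snd s ''w'' [i, v])"], goal_cases)
  case (6 j s')
  note body = 6
  have Inv': "Inv s'" by (rule Inv_agreeI[OF Inv body(2)]) auto
  have s': "fst s' ''n'' [] = n" "fst s' ''mm'' = fst s ''mm''" "snd s' ''G'' = snd s ''G''" "snd s' ''p'' = snd s ''p''"
    "fst s' ''E'' = fst s ''E''" using body(2) n by (simp_all add: agree_def)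
  show ?case
  proof (intro run_Seq run_NAssign, rule run_For_conseq[where B = n and I = "\<lambda>v s''.
      (\<forall>v'<v. snd s'' ''W'' [Suc j, v'] = snd s ''W'' [Suc j, v'] + g (Suc j) v' \<and>
         snd s'' ''w'' [Suc j, v'] = snd s ''w'' [Suc j, v'] * (1 - g (Suc j) v' / (real (fst s ''mm'' []) * snd s ''G'' [])))
     \<and> (\<forall>v'\<ge>v. snd s'' ''W'' [Suc j, v'] = snd s ''W'' [Suc j, v'] \<and> snd s'' ''w'' [Suc j, v'] = snd s ''w'' [Suc j, v'])
     \<and> (\<forall>i v'. i \<noteq> Suc j \<longrightarrow> snd s'' ''W'' [i, v'] = snd s' ''W'' [i, v'] \<and> snd s'' ''w'' [i, v'] = snd s' ''w'' [i, v'])"], goal_cases)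
    case (6 v s2)
    note inner = 6
    have ag: "agree (wr (c_solve orc)) s' s2" using inner(2) by (auto simp: agree_def upd_def)
    have Inv2: "Inv s2" by (rule Inv_agreeI[OF Inv' ag]) auto
    have s2: "fst s2 ''fi'' [] = Suc j" "Suc j \<in> {1..K}" "fst s2 ''n'' [] = n" "fst s2 ''mm'' = fst s ''mm''" "snd s2 ''G'' = snd s ''G''"
      "snd s2 ''p'' = snd s ''p''" "fst s2 ''E'' = fst s ''E''"
      using inner(2) s' body(1,3) by (simp_all add: agree_def upd_def)
    show ?case
    proof (rule run_If)
      assume "bval s2 (NLess (NConst 0) (NCell ''E'' [ix ''v'']))"
      then have "fst s2 ''E'' [v] \<noteq> 0" using inner(3) by simp
      from run_element[OF Inv2 s2(1,2) inner(3,1) this s2(3)]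
      show "run Fo Z (c_element orc) s2 (\<lambda>s''.
        (\<forall>v'<Suc v. snd s'' ''W'' [Suc j, v'] = snd s ''W'' [Suc j, v'] + g (Suc j) v' \<and>
         snd s'' ''w'' [Suc j, v'] = snd s ''w'' [Suc j, v'] * (1 - g (Suc j) v' / (real (fst s ''mm'' []) * snd s ''G'' [])))
        \<and> (\<forall>v'\<ge>Suc v. snd s'' ''W'' [Suc j, v'] = snd s ''W'' [Suc j, v'] \<and> snd s'' ''w'' [Suc j, v'] = snd s ''w'' [Suc j, v'])
        \<and> (\<forall>i v'. i \<noteq> Suc j \<longrightarrow> snd s'' ''W'' [i, v'] = snd s' ''W'' [i, v'] \<and> snd s'' ''w'' [i, v'] = snd s' ''w'' [i, v']))"
        by (rule run_conseq) (use inner(4) s2 in \<open>auto simp: less_Suc_eq g_def E_def\<close>)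
    next
      assume "\<not> bval s2 (NLess (NConst 0) (NCell ''E'' [ix ''v'']))"
      then have "v \<notin> E" using inner(3) s2 by (simp add: E_def)
      then have "g (Suc j) v = 0" by (simp add: g_def greedy_def)
      then show "run Fo Z Skip s2 (\<lambda>s''.
        (\<forall>v'<Suc v. snd s'' ''W'' [Suc j, v'] = snd s ''W'' [Suc j, v'] + g (Suc j) v' \<and>
         snd s'' ''w'' [Suc j, v'] = snd s ''w'' [Suc j, v'] * (1 - g (Suc j) v' / (real (fst s ''mm'' []) * snd s ''G'' [])))
        \<and> (\<forall>v'\<ge>Suc v. snd s'' ''W'' [Suc j, v'] = snd s ''W'' [Suc j, v'] \<and> snd s'' ''w'' [Suc j, v'] = snd s ''w'' [Suc j, v'])
        \<and> (\<forall>i v'. i \<noteq> Suc j \<longrightarrow> snd s'' ''W'' [i, v'] = snd s' ''W'' [i, v'] \<and> snd s'' ''w'' [i, v'] = snd s' ''w'' [i, v']))"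
        using inner(4) by (intro run_Skip) (auto simp: less_Suc_eq)
    qed
  next
    case (7 s2)
    then show ?case using body(4) by (auto simp: le_Suc_eq)
  qed (use body s' nZ in \<open>auto simp: agree_def upd_apply set_scalar_def\<close>)
qed (use n K KZ in \<open>auto simp: agree_def upd_apply set_scalar_def\<close>)

theorem run_solve:
  assumes Inv: "Inv s" and n: "fst s ''n'' [] = n" and K: "fst s ''K'' [] = K" and T: "fst s ''T'' [] = T" "T \<le> Z"
    and mm: "real (fst s ''mm'' []) * snd s ''G'' [] = c"
    and w: "\<And>i v. i \<in> {1..K} \<Longrightarrow> v < n \<Longrightarrow> snd s ''w'' [i, v] = w0 i v"
    and E: "E = {u. u < n \<and> fst s ''E'' [u] \<noteq> 0}"
  shows "run Fo Z (c_solve orc) s (\<lambda>s'. \<forall>i\<in>{1..K}. \<forall>v<n. snd s' ''W'' [i, v] = (\<Sum>t<T. response F E K c w0 t i v)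
     \<and> snd s' ''X'' [i, v] = (\<Sum>t<T. play F E K c w0 t i v))"
  unfolding c_solve_def
proof (rule run_Seq, rule run_conseq[OF run_clear[OF n K nZ KZ]])
  fix s1 assume ag1: "agree (wr c_clear) s s1" and z1: "\<forall>i\<in>{1..K}. \<forall>v<n. snd s1 ''W'' [i, v] = 0 \<and> snd s1 ''X'' [i, v] = 0"
  have s1: "fst s1 ''n'' [] = n" "fst s1 ''K'' [] = K" "fst s1 ''T'' [] = T" "real (fst s1 ''mm'' []) * snd s1 ''G'' [] = c"
    "snd s1 ''w'' = snd s ''w''" "fst s1 ''E'' = fst s ''E''" using ag1 n K T mm by (simp_all add: agree_def)
  have Inv1: "Inv s1" by (rule Inv_agreeI[OF Inv ag1]) auto
  show "run Fo Z (For ''t'' (ix ''T'') (c_totals ;; c_shares ;; c_respond orc)) s1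
     (\<lambda>s'. \<forall>i\<in>{1..K}. \<forall>v<n. snd s' ''W'' [i, v] = (\<Sum>t<T. response F E K c w0 t i v)
     \<and> snd s' ''X'' [i, v] = (\<Sum>t<T. play F E K c w0 t i v))"
  proof (rule run_For_conseq[where B = T and I = "\<lambda>j s'. \<forall>i\<in>{1..K}. \<forall>v<n. snd s' ''w'' [i, v] = weights F E K c w0 j i v
     \<and> snd s' ''W'' [i, v] = (\<Sum>t<j. response F E K c w0 t i v) \<and> snd s' ''X'' [i, v] = (\<Sum>t<j. play F E K c w0 t i v)"], goal_cases)
    case (6 j s2)
    note body = 6
    have s2: "fst s2 ''n'' [] = n" "fst s2 ''K'' [] = K" "real (fst s2 ''mm'' []) * snd s2 ''G'' [] = c"
      "fst s2 ''E'' = fst s ''E''" using body(2) s1 by (simp_all add: agree_def)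
    have Inv2: "Inv s2" by (rule Inv_agreeI[OF Inv1 body(2)]) auto
    show ?case
    proof (rule run_Seq, rule run_conseq[OF run_totals[OF s2(1,2) nZ KZ]])
      fix s3 assume ag3: "agree (wr c_totals) s2 s3" and t3: "\<forall>v<n. snd s3 ''tot'' [v] = (\<Sum>j=1..K. snd s2 ''w'' [j, v])"
      have s3: "fst s3 ''n'' [] = n" "fst s3 ''K'' [] = K" "real (fst s3 ''mm'' []) * snd s3 ''G'' [] = c"
        "fst s3 ''E'' = fst s ''E''" "snd s3 ''w'' = snd s2 ''w''" "snd s3 ''W'' = snd s2 ''W''" "snd s3 ''X'' = snd s2 ''X''"
        using ag3 s2 by (simp_all add: agree_def)
      have Inv3: "Inv s3" by (rule Inv_agreeI[OF Inv2 ag3]) auto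
      have share: "snd s3 ''w'' [i, v] / snd s3 ''tot'' [v] = play F E K c w0 j i v" if "i \<in> {1..K}" "v < n" for i v
        using t3 s3 body(4) that by (simp add: play_def share_def)
      show "run Fo Z (c_shares ;; c_respond orc) s3 (\<lambda>s'. \<forall>i\<in>{1..K}. \<forall>v<n. snd s' ''w'' [i, v] = weights F E K c w0 (Suc j) i v
       \<and> snd s' ''W'' [i, v] = (\<Sum>t<Suc j. response F E K c w0 t i v) \<and> snd s' ''X'' [i, v] = (\<Sum>t<Suc j. play F E K c w0 t i v))"
      proof (rule run_Seq, rule run_conseq[OF run_shares[OF s3(1,2) nZ KZ]])
        fix s4 assume ag4: "agree (wr c_shares) s3 s4" and p4: "\<forall>i\<in>{1..K}. \<forall>v<n. snd s4 ''p'' [i, v] = snd s3 ''w'' [i, v] / snd s3 ''tot'' [v]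
          \<and> snd s4 ''X'' [i, v] = snd s3 ''X'' [i, v] + snd s3 ''w'' [i, v] / snd s3 ''tot'' [v]"
        have s4: "fst s4 ''n'' [] = n" "fst s4 ''K'' [] = K" "real (fst s4 ''mm'' []) * snd s4 ''G'' [] = c"
          "fst s4 ''E'' = fst s ''E''" "snd s4 ''w'' = snd s2 ''w''" "snd s4 ''W'' = snd s2 ''W''"
          using ag4 s3 by (simp_all add: agree_def)
        have Inv4: "Inv s4" by (rule Inv_agreeI[OF Inv3 ag4]) auto
        \<comment> \<open>\<open>p\<close> is known to agree with the play only at indices below n;
          greedy vectors look at weights inside \<open>E\<close> only.\<close>
        have gr: "greedy (F i) E (\<lambda>u. snd s4 ''p'' [i, u]) = response F E K c w0 j i" if "i \<in> {1..K}" for i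
        proof -
          have "snd s4 ''p'' [i, u] = play F E K c w0 j i u" if "u \<in> E" for u
            using p4 share \<open>i \<in> {1..K}\<close> that E by auto
          then have "upper E (\<lambda>u. snd s4 ''p'' [i, u]) v = upper E (play F E K c w0 j i) v" if "v \<in> E" for v
            using that by (auto simp: upper_def)
          then show ?thesis by (auto simp: response_def greedy_def fun_eq_iff)
        qed
        show "run Fo Z (c_respond orc) s4 (\<lambda>s'. \<forall>i\<in>{1..K}. \<forall>v<n. snd s' ''w'' [i, v] = weights F E K c w0 (Suc j) i v
         \<and> snd s' ''W'' [i, v] = (\<Sum>t<Suc j. response F E K c w0 t i v) \<and> snd s' ''X'' [i, v] = (\<Sum>t<Suc j. play F E K c w0 t i v))"
        proof (rule run_conseq[OF run_respond[OF Inv4 s4(1,2)]], intro ballI allI impI)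
          fix s5 i v assume ag5: "agree (wr (c_respond orc)) s4 s5"
            and r5: "\<forall>i\<in>{1..K}. \<forall>v<n. snd s5 ''W'' [i, v] = snd s4 ''W'' [i, v] + greedy (F i) {u. u < n \<and> fst s4 ''E'' [u] \<noteq> 0} (\<lambda>u. snd s4 ''p'' [i, u]) v \<and>
              snd s5 ''w'' [i, v] = snd s4 ''w'' [i, v] * (1 - greedy (F i) {u. u < n \<and> fst s4 ''E'' [u] \<noteq> 0} (\<lambda>u. snd s4 ''p'' [i, u]) v / (real (fst s4 ''mm'' []) * snd s4 ''G'' []))"
            and iv: "i \<in> {1..K}" "v < n"
          have "{u. u < n \<and> fst s4 ''E'' [u] \<noteq> 0} = E" using s4 E by simp
          then have "snd s5 ''W'' [i, v] = snd s4 ''W'' [i, v] + response F E K c w0 j i v"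
            "snd s5 ''w'' [i, v] = snd s4 ''w'' [i, v] * (1 - response F E K c w0 j i v / c)"
            using r5 iv gr[OF iv(1)] s4(3) by auto
          moreover have "snd s5 ''X'' = snd s4 ''X''" using ag5 by (simp add: agree_def)
          ultimately show "snd s5 ''w'' [i, v] = weights F E K c w0 (Suc j) i v
             \<and> snd s5 ''W'' [i, v] = (\<Sum>t<Suc j. response F E K c w0 t i v) \<and> snd s5 ''X'' [i, v] = (\<Sum>t<Suc j. play F E K c w0 t i v)"
            using body(4) s3 s4 p4 share iv by (simp add: response_def play_def)
        qed
      qed
    qed
  qed (use s1 z1 T w in \<open>auto simp: agree_def upd_apply set_scalar_def\<close>)
qed

end

section \<open>Exact minimization for two functions\<close>

definition arcs :: "nat \<Rightarrow> state \<Rightarrow> (nat \<times> nat) set" where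
  "arcs n s = {(a, b). a < n + 2 \<and> b < n + 2 \<and> fst s ''A'' [a, b] \<noteq> 0}"

definition split_cost :: "eval_oracle \<Rightarrow> nat \<Rightarrow> nat set \<Rightarrow> real" where
  "split_cost Fo n X = Fo 1 X + Fo 2 ({..<n} - X)"

text \<open>The complement needs an array \<open>D\<close> of its own because a query takes the set
  of all nonzero cells. Cells at n and beyond may hold anything, as the oracles considered ignore
  them.\<close>

definition c_f :: com where
  "c_f = For ''x1'' (ix ''n'') (If (NLess (NConst 0) (NCell ''C'' [ix ''x1''])) (NAssign ''D'' [ix ''x1''] (NConst 0)) (NAssign ''D'' [ix ''x1''] (NConst 1))) ;;
     Query ''fv'' [] (NConst 1) ''C'' [] ;; Query ''fw'' [] (NConst 2) ''D'' [] ;; RAssign ''fv'' [] (RAdd (rx ''fv'') (rx ''fw''))"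

definition c_eval :: "bexp \<Rightarrow> com" where
  "c_eval b = For ''y4'' (ix ''n'') (If b (NAssign ''C'' [ix ''y4''] (NConst 1)) (NAssign ''C'' [ix ''y4''] (NConst 0))) ;; c_f"

definition c_closure :: com where
  "c_closure = For ''x2'' (ix ''n'') (NAssign ''C'' [ix ''x2''] (NCell ''A'' [ix ''a'', ix ''x2'']) ;;
     For ''x3'' (ix ''n'') (If (BAnd (NLess (NConst 0) (NCell ''S'' [ix ''x3''])) (NLess (NConst 0) (NCell ''A'' [ix ''x3'', ix ''x2''])))
       (NAssign ''C'' [ix ''x2''] (NConst 1)) Skip))"

definition c_count :: "string \<Rightarrow> com" where
  "c_count S = For ''x4'' (ix ''n'') (If (NLess (NConst 0) (NCell S [ix ''x4''])) (RAssign ''val'' [] (RAdd (rx ''val'') (rx ''L''))) Skip)"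

definition c_orc :: com where
  "c_orc = If (NLess (ix ''fi'') (NConst 2)) (c_closure ;; c_f ;; RAssign ''val'' [] (rx ''fv'') ;; c_count ''C'')
     (RAssign ''val'' [] (RNat (NConst 0)) ;; c_count ''S'')"

lemma wr_orc_parts [simp]:
  "wr c_f = {''x1'', ''D'', ''fv'', ''fw''}"
  "wr (c_eval b) = {''y4'', ''C'', ''x1'', ''D'', ''fv'', ''fw''}"
  "wr c_closure = {''x2'', ''C'', ''x3''}"
  "wr (c_count S) = {''x4'', ''val''}"
  "wr c_orc = {''x1'', ''D'', ''fv'', ''fw'', ''x2'', ''C'', ''x3'', ''x4'', ''val''}"
  by (auto simp: c_f_def c_eval_def c_closure_def c_count_def c_orc_def)

text \<open>\<open>local\<close> reflects that \<open>instance_oracle\<close> cuts its argument down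
  to the indices below n. n + 2 is the number of nodes, through which the loops over arcs
  run.\<close>

locale sfm_program =
  fixes Fo :: eval_oracle and n Z :: nat
  assumes local: "\<And>i J. Fo i (J \<inter> {..<n}) = Fo i J" and nZ: "n + 2 \<le> Z"
begin

abbreviation "f \<equiv> split_cost Fo n"

lemma local_cong: "J \<inter> {..<n} = J' \<inter> {..<n} \<Longrightarrow> Fo i J = Fo i J'"
  using local[of i J] local[of i J'] by simp

lemma run_f:
  assumes n: "fst s ''n'' [] = n"
  shows "run Fo Z c_f s (\<lambda>s'. snd s' ''fv'' [] = f {v. v < n \<and> fst s ''C'' [v] \<noteq> 0})"
  unfolding c_f_def
proof (rule run_Seq, rule run_For_conseq[where B = n and I = "\<lambda>j s'. \<forall>v<j. fst s' ''D'' [v] \<noteq> 0 \<longleftrightarrow> fst s ''C'' [v] = 0"], goal_cases)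
  case (6 j s')
  then have "fst s' ''C'' = fst s ''C''" by (simp add: agree_def)
  then show ?case using 6 by (intro run_If run_NAssign) (auto simp: upd_apply less_Suc_eq)
next
  case (7 s')
  then have C: "fst s' ''C'' = fst s ''C''" by (simp add: agree_def)
  have "Fo 1 {j. fst s' ''C'' [j] \<noteq> 0} = Fo 1 {v. v < n \<and> fst s ''C'' [v] \<noteq> 0}"
    unfolding C by (rule local_cong) auto
  moreover have "Fo 2 {j. fst s' ''D'' [j] \<noteq> 0} = Fo 2 ({..<n} - {v. v < n \<and> fst s ''C'' [v] \<noteq> 0})"
    using 7(2) by (intro local_cong) auto
  ultimately show ?case by (intro run_Seq run_Query run_RAssign) (simp add: upd_apply split_cost_def)
qed (use n nZ in \<open>auto simp: agree_def upd_apply set_scalar_def\<close>)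

lemma run_eval:
  assumes n: "fst s ''n'' [] = n"
    and b: "\<And>y s'. y < n \<Longrightarrow> agree {''y4'', ''C''} s s' \<Longrightarrow> fst s' ''y4'' [] = y \<Longrightarrow> bval s' b \<longleftrightarrow> y \<in> X"
    and X: "X \<subseteq> {..<n}"
  shows "run Fo Z (c_eval b) s (\<lambda>s'. snd s' ''fv'' [] = f X)"
  unfolding c_eval_def
proof (rule run_Seq, rule run_For_conseq[where B = n and I = "\<lambda>j s'. \<forall>v<j. fst s' ''C'' [v] \<noteq> 0 \<longleftrightarrow> v \<in> X"], goal_cases)
  case (6 j s')
  then have "bval s' b \<longleftrightarrow> j \<in> X" by (intro b) (simp_all add: insert_commute)
  then show ?case using 6 by (intro run_If run_NAssign) (auto simp: upd_apply less_Suc_eq)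
next
  case (7 s')
  have "fst s' ''n'' [] = n" using 7(1) n by (simp add: agree_def)
  moreover have "{v. v < n \<and> fst s' ''C'' [v] \<noteq> 0} = X" using 7(2) X by auto
  ultimately show ?case using run_f[of s'] by simp
qed (use n nZ in \<open>auto simp: agree_def upd_apply set_scalar_def\<close>)

lemma run_closure:
  assumes n: "fst s ''n'' [] = n" and a: "fst s ''a'' [] = a" "a < n + 2"
  shows "run Fo Z c_closure s (\<lambda>s'. {v. v < n \<and> fst s' ''C'' [v] \<noteq> 0} =
    cl_under n (arcs n s) a {u. u < n \<and> fst s ''S'' [u] \<noteq> 0})"
  unfolding c_closure_def
proof (rule run_For_conseq[where B = n and I = "\<lambda>j s'. \<forall>v<j. fst s' ''C'' [v] \<noteq> 0 \<longleftrightarrow>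
    fst s ''A'' [a, v] \<noteq> 0 \<or> (\<exists>u<n. fst s ''S'' [u] \<noteq> 0 \<and> fst s ''A'' [u, v] \<noteq> 0)"], goal_cases)
  case (6 j s')
  note body = 6
  have s': "fst s' ''n'' [] = n" "fst s' ''a'' [] = a" "fst s' ''A'' = fst s ''A''" "fst s' ''S'' = fst s ''S''"
    using body(2) n a by (simp_all add: agree_def)
  show ?case
  proof (intro run_Seq run_NAssign, rule run_For_conseq[where B = n and I = "\<lambda>i s''. (fst s'' ''C'' [j] \<noteq> 0 \<longleftrightarrow>
      fst s ''A'' [a, j] \<noteq> 0 \<or> (\<exists>u<i. fst s ''S'' [u] \<noteq> 0 \<and> fst s ''A'' [u, j] \<noteq> 0))
      \<and> (\<forall>v. v \<noteq> j \<longrightarrow> fst s'' ''C'' [v] = fst s' ''C'' [v])"], goal_cases)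
    case (6 i s2)
    then have "fst s2 ''x2'' [] = j" "fst s2 ''A'' = fst s ''A''" "fst s2 ''S'' = fst s ''S''"
      using s' body(3) by (simp_all add: agree_def upd_def)
    then show ?case using 6 by (intro run_If run_NAssign run_Skip) (auto simp: upd_apply less_Suc_eq)
  qed (use body s' nZ in \<open>auto simp: agree_def upd_apply set_scalar_def less_Suc_eq\<close>)
next
  case (7 s')
  then show ?case using a by (auto simp: cl_under_def arcs_def)
qed (use n nZ in \<open>auto simp: agree_def upd_apply set_scalar_def\<close>)

lemma run_count:
  assumes n: "fst s ''n'' [] = n" and S: "S \<notin> {''x4'', ''val''}"
  shows "run Fo Z (c_count S) s (\<lambda>s'. snd s' ''val'' [] = snd s ''val'' [] + snd s ''L'' [] * card {v. v < n \<and> fst s S [v] \<noteq> 0})"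
  unfolding c_count_def
proof (rule run_For_conseq[where B = n and I = "\<lambda>j s'. snd s' ''val'' [] = snd s ''val'' [] + snd s ''L'' [] * card {v. v < j \<and> fst s S [v] \<noteq> 0}"], goal_cases)
  case (6 j s')
  then have s': "fst s' S = fst s S" "snd s' ''L'' = snd s ''L''" using S by (simp_all add: agree_def)
  show ?case
  proof (rule run_If)
    assume "bval s' (NLess (NConst 0) (NCell S [ix ''x4'']))"
    then have "{v. v < Suc j \<and> fst s S [v] \<noteq> 0} = insert j {v. v < j \<and> fst s S [v] \<noteq> 0}"
      using 6 s' by (auto simp: less_Suc_eq)
    then show "run Fo Z (RAssign ''val'' [] (RAdd (rx ''val'') (rx ''L''))) s'
      (\<lambda>s'. snd s' ''val'' [] = snd s ''val'' [] + snd s ''L'' [] * card {v. v < Suc j \<and> fst s S [v] \<noteq> 0})"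
      using 6 s' by (intro run_RAssign) (simp add: upd_apply algebra_simps)
  next
    assume "\<not> bval s' (NLess (NConst 0) (NCell S [ix ''x4'']))"
    then have "{v. v < Suc j \<and> fst s S [v] \<noteq> 0} = {v. v < j \<and> fst s S [v] \<noteq> 0}"
      using 6 s' by (auto simp: less_Suc_eq)
    then show "run Fo Z Skip s' (\<lambda>s'. snd s' ''val'' [] = snd s ''val'' [] + snd s ''L'' [] * card {v. v < Suc j \<and> fst s S [v] \<noteq> 0})"
      using 6 by (intro run_Skip) simp
  qed
qed (use n nZ S in \<open>auto simp: agree_def upd_apply set_scalar_def\<close>)

definition "sub_inv A a L s \<longleftrightarrow> fst s ''n'' [] = n \<and> arcs n s = A \<and> fst s ''a'' [] = a \<and> snd s ''L'' [] = L"

lemma run_orc: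
  assumes inv: "sub_inv A a L s" and a: "a < n + 2" and i: "fst s ''fi'' [] = i" "i \<in> {1..2}"
  shows "run Fo Z c_orc s (\<lambda>s'. snd s' ''val'' [] = sub_objective n f A L a i {u. u < n \<and> fst s ''S'' [u] \<noteq> 0})"
  unfolding c_orc_def
proof (rule run_If)
  have s: "fst s ''n'' [] = n" "arcs n s = A" "fst s ''a'' [] = a" "snd s ''L'' [] = L" using inv by (auto simp: sub_inv_def)
  let ?S = "{u. u < n \<and> fst s ''S'' [u] \<noteq> 0}"
  { assume "bval s (NLess (ix ''fi'') (NConst 2))"
    then have i1: "i = 1" using i by simp
    show "run Fo Z (c_closure ;; c_f ;; RAssign ''val'' [] (rx ''fv'') ;; c_count ''C'') s
       (\<lambda>s'. snd s' ''val'' [] = sub_objective n f A L a i ?S)"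
    proof (rule run_Seq, rule run_conseq[OF run_closure[OF s(1,3) a]])
      fix s1 assume ag1: "agree (wr c_closure) s s1" and C1: "{v. v < n \<and> fst s1 ''C'' [v] \<noteq> 0} = cl_under n (arcs n s) a ?S"
      have s1: "fst s1 ''n'' [] = n" "snd s1 ''L'' [] = L" using ag1 s by (simp_all add: agree_def)
      show "run Fo Z (c_f ;; RAssign ''val'' [] (rx ''fv'') ;; c_count ''C'') s1 (\<lambda>s'. snd s' ''val'' [] = sub_objective n f A L a i ?S)"
      proof (rule run_Seq, rule run_conseq[OF run_f[OF s1(1)]], intro run_Seq run_RAssign)
        fix s2 assume ag2: "agree (wr c_f) s1 s2" and fv: "snd s2 ''fv'' [] = f {v. v < n \<and> fst s1 ''C'' [v] \<noteq> 0}"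
        let ?s3 = "(fst s2, upd (snd s2) ''val'' (map (nval (fst s2)) []) (rval s2 (rx ''fv'')))"
        have s3: "fst ?s3 ''n'' [] = n" "snd ?s3 ''L'' [] = L" "fst ?s3 ''C'' = fst s1 ''C''" "snd ?s3 ''val'' [] = snd s2 ''fv'' []"
          using ag2 s1 by (simp_all add: agree_def upd_def)
        show "run Fo Z (c_count ''C'') ?s3 (\<lambda>s'. snd s' ''val'' [] = sub_objective n f A L a i ?S)"
          by (rule run_conseq[OF run_count[OF s3(1)]])
            (use s3 fv C1 s(2) i1 in \<open>simp_all add: sub_objective_def\<close>)
      qed
    qed }
  { assume "\<not> bval s (NLess (ix ''fi'') (NConst 2))"
    then have i2: "i = 2" using i by simp
    show "run Fo Z (RAssign ''val'' [] (RNat (NConst 0)) ;; c_count ''S'') s (\<lambda>s'. snd s' ''val'' [] = sub_objective n f A L a i ?S)"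
    proof (intro run_Seq run_RAssign, rule run_conseq[OF run_count])
    qed (use s i2 in \<open>auto simp: sub_objective_def upd_apply\<close>) }
qed

lemma oracle_code_orc: 
  assumes "a < n + 2"
  shows "oracle_code Fo Z c_orc (sub_inv A a L) n 2 (sub_objective n f A L a)"
proof
  show "sub_inv A a L s'" if "sub_inv A a L s" "agree (wr (c_solve c_orc)) s s'" for s s'
    using that by (simp add: sub_inv_def arcs_def agree_def)
qed (use assms run_orc nZ in \<open>auto simp del: One_nat_def\<close>)

end

section \<open>Finding implications in one round\<close>

abbreviation arc_b :: "nexp \<Rightarrow> nexp \<Rightarrow> bexp" where
  "arc_b x y \<equiv> NLess (NConst 0) (NCell ''A'' [x, y])"

definition c_ground :: com where
  "c_ground = For ''x5'' (ix ''n'') (If (BAnd (BNot (arc_b (ix ''x5'') (ix ''b''))) (BNot (arc_b (ix ''a'') (ix ''x5''))))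
     (NAssign ''E'' [ix ''x5''] (NConst 1)) (NAssign ''E'' [ix ''x5''] (NConst 0)))"

definition c_ones :: com where
  "c_ones = For ''x6'' (ix ''n'') (RAssign ''w'' [NConst 1, ix ''x6''] (RNat (NConst 1)) ;; RAssign ''w'' [NConst 2, ix ''x6''] (RNat (NConst 1)))"

definition c_arc :: com where
  "c_arc = For ''y1'' (NAdd (ix ''n'') (NConst 2)) (For ''y2'' (NAdd (ix ''n'') (NConst 2))
     (If (BAnd (arc_b (ix ''y1'') (ix ''ra'')) (arc_b (ix ''rb'') (ix ''y2''))) (NAssign ''A'' [ix ''y1'', ix ''y2''] (NConst 1)) Skip))"

definition c_base :: com where
  "c_base = c_ground ;; c_ones ;; c_solve c_orc"

definition c_arcs :: "bexp \<Rightarrow> nexp \<Rightarrow> nexp \<Rightarrow> com" where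
  "c_arcs t x y = c_base ;; For ''x7'' (ix ''n'') (If (BAnd (NLess (NConst 0) (NCell ''E'' [ix ''x7''])) t)
     (NAssign ''ra'' [] x ;; NAssign ''rb'' [] y ;; c_arc) Skip)"

text \<open>W / T - L is the entry of the base vector, so the test is base < - eps,
  rearranged.\<close>

definition c_out :: com where
  "c_out = c_arcs (RLess (RAdd (RDiv (RCell ''W'' [NConst 1, ix ''x7'']) (RNat (ix ''T''))) (rx ''eps'')) (rx ''L'')) (ix ''a'') (ix ''x7'')"

definition c_in :: com where
  "c_in = c_arcs (RLess (RAdd (rx ''L'') (rx ''eps'')) (RDiv (RCell ''W'' [NConst 1, ix ''x7'']) (RNat (ix ''T'')))) (ix ''x7'') (ix ''b'')"

definition c_marginal :: "bexp \<Rightarrow> bexp \<Rightarrow> com" where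
  "c_marginal b b' = c_eval b ;; RAssign ''d1'' [] (rx ''fv'') ;; c_eval b' ;; RAssign ''d1'' [] (RSub (rx ''d1'') (rx ''fv'')) ;;
     If (RLess (rx ''L'') (rx ''d1'')) (RAssign ''L'' [] (rx ''d1'')) Skip"

definition c_lipschitz :: com where
  "c_lipschitz = RAssign ''L'' [] (RNat (NConst 0)) ;; For ''y3'' (ix ''n'')
     (If (BAnd (BNot (arc_b (ix ''n'') (ix ''y3''))) (BNot (arc_b (ix ''y3'') (NAdd (ix ''n'') (NConst 1)))))
       (c_marginal (arc_b (ix ''y3'') (ix ''y4'')) (BAnd (arc_b (ix ''y3'') (ix ''y4'')) (BNot (arc_b (ix ''y4'') (ix ''y3'')))) ;;
        c_marginal (BNot (arc_b (ix ''y4'') (ix ''y3'')))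
          (BNot (BAnd (arc_b (ix ''y4'') (ix ''y3'')) (BNot (arc_b (ix ''y3'') (ix ''y4'')))))) Skip)"

text \<open>The intervals tried are those of the progress argument: above each node up to n, and
  below n + 1 and each element. \<open>L\<close>, \<open>G\<close> and \<open>eps\<close> are
  computed once per round; the Lipschitz bound stays valid because additional arcs only shrink the
  family of closed sets.\<close>

definition c_round :: com where
  "c_round = c_lipschitz ;; RAssign ''G'' [] (RMul (RMul (RNat (NConst 2)) (RNat (ix ''n''))) (rx ''L'')) ;;
     RAssign ''eps'' [] (RDiv (RMul (RMul (RNat (NConst 3)) (RNat (ix ''n''))) (rx ''G'')) (RNat (ix ''mm''))) ;;
     NAssign ''b'' [] (NAdd (ix ''n'') (NConst 1)) ;;
     For ''y5'' (NAdd (ix ''n'') (NConst 1)) (NAssign ''a'' [] (ix ''y5'') ;; c_out) ;;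
     NAssign ''a'' [] (ix ''n'') ;; c_in ;;
     For ''y6'' (ix ''n'') (NAssign ''b'' [] (ix ''y6'') ;; c_in)"

lemma wr_round_parts [simp]:
  "wr c_ground = {''x5'', ''E''}"
  "wr c_ones = {''x6'', ''w''}"
  "wr c_arc = {''y1'', ''y2'', ''A''}"
  "wr (c_marginal b b') = {''y4'', ''C'', ''x1'', ''D'', ''fv'', ''fw'', ''d1'', ''L''}"
  "wr c_lipschitz = {''y3'', ''y4'', ''C'', ''x1'', ''D'', ''fv'', ''fw'', ''d1'', ''L''}"
  by (auto simp: c_ground_def c_ones_def c_arc_def c_marginal_def c_lipschitz_def)

lemma wr_round_composites [simp]:
  "wr c_base = wr c_ground \<union> (wr c_ones \<union> wr (c_solve c_orc))"
  "wr (c_arcs t x y) = wr c_base \<union> insert ''x7'' (insert ''ra'' (insert ''rb'' (wr c_arc)))"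
  "wr c_out = wr c_base \<union> insert ''x7'' (insert ''ra'' (insert ''rb'' (wr c_arc)))"
  "wr c_in = wr c_base \<union> insert ''x7'' (insert ''ra'' (insert ''rb'' (wr c_arc)))"
  "wr c_round = wr c_lipschitz \<union> insert ''G'' (insert ''eps'' (insert ''b'' (insert ''y5'' (insert ''a'' (wr c_out)) \<union>
     insert ''a'' (wr c_in \<union> insert ''y6'' (insert ''b'' (wr c_in))))))"
  by (simp_all only: c_base_def c_arcs_def c_out_def c_in_def c_round_def wr.simps wr_For Un_empty_right Un_insert_left Un_empty_left)

context sfm_program
begin

lemma arcs_cong: "fst s' ''A'' = fst s ''A'' \<Longrightarrow> arcs n s' = arcs n s"
  by (simp add: arcs_def)

lemma run_ground:
  assumes n: "fst s ''n'' [] = n" and a: "fst s ''a'' [] = a" "a < n + 2" and b: "fst s ''b'' [] = b" "b < n + 2"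
  shows "run Fo Z c_ground s (\<lambda>s'. {v. v < n \<and> fst s' ''E'' [v] \<noteq> 0} = sub_ground n (arcs n s) a b)"
  unfolding c_ground_def
proof (rule run_For_conseq[where B = n and I = "\<lambda>j s'. \<forall>v<j. fst s' ''E'' [v] \<noteq> 0 \<longleftrightarrow> fst s ''A'' [v, b] = 0 \<and> fst s ''A'' [a, v] = 0"], goal_cases)
  case (6 j s')
  then have "fst s' ''A'' = fst s ''A''" "fst s' ''a'' [] = a" "fst s' ''b'' [] = b" using a b by (simp_all add: agree_def)
  then show ?case using 6 by (intro run_If run_NAssign) (auto simp: upd_apply less_Suc_eq)
next
  case (7 s')
  then show ?case using a b by (auto simp: sub_ground_def avoid_def reach_def arcs_def)
qed (use n nZ in \<open>auto simp: agree_def upd_apply set_scalar_def\<close>)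

lemma run_ones:
  assumes n: "fst s ''n'' [] = n"
  shows "run Fo Z c_ones s (\<lambda>s'. \<forall>i\<in>{1..2}. \<forall>v<n. snd s' ''w'' [i, v] = 1)"
  unfolding c_ones_def
proof (rule run_For_conseq[where B = n and I = "\<lambda>j s'. \<forall>v<j. snd s' ''w'' [1, v] = 1 \<and> snd s' ''w'' [2, v] = 1"], goal_cases)
  case (6 j s')
  then show ?case by (intro run_Seq run_RAssign) (auto simp: upd_apply less_Suc_eq)
next
  case (7 s')
  show ?case
  proof (intro ballI)
    fix i :: nat assume "i \<in> {1..2}"
    then have "i = 1 \<or> i = 2" by auto
    then show "\<forall>v<n. snd s' ''w'' [i, v] = 1" using 7(2) by auto
  qed
qed (use n nZ in \<open>auto simp: agree_def upd_apply set_scalar_def\<close>)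

lemma run_arc:
  assumes n: "fst s ''n'' [] = n" and a: "fst s ''ra'' [] = a" "a < n + 2" and b: "fst s ''rb'' [] = b" "b < n + 2"
  shows "run Fo Z c_arc s (\<lambda>s'. arcs n s' = add_arc (arcs n s) a b)"
  unfolding c_arc_def
proof (rule run_For_conseq[where B = "n + 2" and I = "\<lambda>j s'. arcs n s \<subseteq> arcs n s' \<and> arcs n s' \<subseteq> add_arc (arcs n s) a b
    \<and> (\<forall>x<j. \<forall>y. (x, y) \<in> add_arc (arcs n s) a b \<longrightarrow> (x, y) \<in> arcs n s')"], goal_cases)
  case (6 j s')
  note body = 6
  have s': "fst s' ''n'' [] = n" "fst s' ''ra'' [] = a" "fst s' ''rb'' [] = b" using body(2) n a b by (simp_all add: agree_def)
  show ?case
  proof (rule run_For_conseq[where B = "n + 2" and I = "\<lambda>i s''. arcs n s' \<subseteq> arcs n s'' \<and> arcs n s'' \<subseteq> add_arc (arcs n s) a b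
    \<and> (\<forall>y<i. (j, y) \<in> add_arc (arcs n s) a b \<longrightarrow> (j, y) \<in> arcs n s'')"], goal_cases)
    case (6 i s2)
    have s2: "fst s2 ''y1'' [] = j" "fst s2 ''ra'' [] = a" "fst s2 ''rb'' [] = b" using 6(2) s' body(3) by (simp_all add: agree_def)
    have cond: "bval s2 (BAnd (arc_b (ix ''y1'') (ix ''ra'')) (arc_b (ix ''rb'') (ix ''y2''))) \<longleftrightarrow> (j, a) \<in> arcs n s2 \<and> (b, i) \<in> arcs n s2"
      using s2 6(1,3) a b body(1) by (simp add: arcs_def)
    \<comment> \<open>The array is modified while it is read. The arcs added so far go from
      predecessors of \<open>a\<close> to successors of \<open>b\<close>, so any of them that ends
      in \<open>a\<close> or starts in \<open>b\<close> was present before.\<close>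
    have eq: "(j, a) \<in> arcs n s2 \<longleftrightarrow> (j, a) \<in> arcs n s" "(b, i) \<in> arcs n s2 \<longleftrightarrow> (b, i) \<in> arcs n s"
      using 6(4) body(4) by (auto simp: add_arc_def)
    show ?case
    proof (rule run_If)
      assume "bval s2 (BAnd (arc_b (ix ''y1'') (ix ''ra'')) (arc_b (ix ''rb'') (ix ''y2'')))"
      then have mem: "(j, i) \<in> add_arc (arcs n s) a b" using cond eq by (auto simp: add_arc_def)
      let ?s3 = "(upd (fst s2) ''A'' (map (nval (fst s2)) [ix ''y1'', ix ''y2'']) (nval (fst s2) (NConst 1)), snd s2)"
      have "arcs n ?s3 = insert (j, i) (arcs n s2)" using s2 6(1,3) body(1) by (auto simp: arcs_def upd_apply)
      then show "run Fo Z (NAssign ''A'' [ix ''y1'', ix ''y2''] (NConst 1)) s2 (\<lambda>s''. arcs n s' \<subseteq> arcs n s'' \<and> arcs n s'' \<subseteq> add_arc (arcs n s) a b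
         \<and> (\<forall>y<Suc i. (j, y) \<in> add_arc (arcs n s) a b \<longrightarrow> (j, y) \<in> arcs n s''))"
        using 6(4) mem by (intro run_NAssign) (auto simp: less_Suc_eq)
    next
      assume "\<not> bval s2 (BAnd (arc_b (ix ''y1'') (ix ''ra'')) (arc_b (ix ''rb'') (ix ''y2'')))"
      then have "(j, i) \<in> add_arc (arcs n s) a b \<Longrightarrow> (j, i) \<in> arcs n s2" using cond eq 6(4) body(4) by (auto simp: add_arc_def)
      then show "run Fo Z Skip s2 (\<lambda>s''. arcs n s' \<subseteq> arcs n s'' \<and> arcs n s'' \<subseteq> add_arc (arcs n s) a b
         \<and> (\<forall>y<Suc i. (j, y) \<in> add_arc (arcs n s) a b \<longrightarrow> (j, y) \<in> arcs n s''))"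
        using 6(4) by (intro run_Skip) (auto simp: less_Suc_eq)
    qed
  next
    case (7 s2)
    have "y < n + 2" if "(x, y) \<in> add_arc (arcs n s) a b" for x y using that by (auto simp: add_arc_def arcs_def)
    then have "(j, y) \<in> arcs n s2" if "(j, y) \<in> add_arc (arcs n s) a b" for y using 7(2) that by blast
    then show ?case using 7(2) body(4) unfolding less_Suc_eq by blast
  qed (use body s' nZ in \<open>auto simp: agree_def set_scalar_def arcs_def upd_apply\<close>)
next
  case (7 s')
  have "x < n + 2" if "(x, y) \<in> add_arc (arcs n s) a b" for x y using that by (auto simp: add_arc_def arcs_def)
  then show ?case using 7(2) by fast
qed (use n nZ in \<open>auto simp: agree_def set_scalar_def arcs_def upd_apply add_arc_def\<close>)

lemma run_base:
  assumes n: "fst s ''n'' [] = n" and K: "fst s ''K'' [] = 2" and T: "fst s ''T'' [] = 2 * m\<^sup>2" "2 * m\<^sup>2 \<le> Z"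
    and mm: "fst s ''mm'' [] = m" and G: "snd s ''G'' [] = 2 * real n * L" and L: "snd s ''L'' [] = L"
    and a: "fst s ''a'' [] = a" "a < n + 2" and b: "fst s ''b'' [] = b" "b < n + 2" and A: "arcs n s = A"
  shows "run Fo Z c_base s (\<lambda>s'. {v. v < n \<and> fst s' ''E'' [v] \<noteq> 0} = sub_ground n A a b \<and>
    (\<forall>v<n. snd s' ''W'' [1, v] / real (2 * m\<^sup>2) - L = sub_base n f A L m a b v))"
  unfolding c_base_def
proof (rule run_Seq, rule run_conseq[OF run_ground[OF n a b]])
  fix s1 assume ag1: "agree (wr c_ground) s s1" and E1: "{v. v < n \<and> fst s1 ''E'' [v] \<noteq> 0} = sub_ground n (arcs n s) a b"
  have n1: "fst s1 ''n'' [] = n" using ag1 n by (simp add: agree_def)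
  show "run Fo Z (c_ones ;; c_solve c_orc) s1 (\<lambda>s'. {v. v < n \<and> fst s' ''E'' [v] \<noteq> 0} = sub_ground n A a b \<and>
    (\<forall>v<n. snd s' ''W'' [1, v] / real (2 * m\<^sup>2) - L = sub_base n f A L m a b v))"
  proof (rule run_Seq, rule run_conseq[OF run_ones[OF n1]])
    fix s2 assume ag2: "agree (wr c_ones) s1 s2" and w: "\<forall>i\<in>{1..2}. \<forall>v<n. snd s2 ''w'' [i, v] = 1"
    interpret O: oracle_code Fo Z c_orc "sub_inv A a L" n 2 "sub_objective n f A L a" by (rule oracle_code_orc[OF a(2)])
    have s2: "fst s2 ''n'' [] = n" "fst s2 ''K'' [] = 2" "fst s2 ''T'' [] = 2 * m\<^sup>2" "fst s2 ''mm'' [] = m" "snd s2 ''G'' [] = 2 * real n * L"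
      "snd s2 ''L'' [] = L" "fst s2 ''a'' [] = a" "fst s2 ''A'' = fst s ''A''" "fst s2 ''E'' = fst s1 ''E''"
      using ag1 ag2 n K T mm G L a by (simp_all add: agree_def)
    have inv: "sub_inv A a L s2" using s2 A arcs_cong[of s2 s] by (simp add: sub_inv_def)
    have mG: "real (fst s2 ''mm'' []) * snd s2 ''G'' [] = real m * (2 * real n * L)" using s2 by simp
    have E: "sub_ground n A a b = {u. u < n \<and> fst s2 ''E'' [u] \<noteq> 0}" using E1 s2 A by simp
    show "run Fo Z (c_solve c_orc) s2 (\<lambda>s'. {v. v < n \<and> fst s' ''E'' [v] \<noteq> 0} = sub_ground n A a b \<and>
      (\<forall>v<n. snd s' ''W'' [1, v] / real (2 * m\<^sup>2) - L = sub_base n f A L m a b v))"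
    proof (rule run_conseq[OF O.run_solve[OF inv s2(1,2,3) T(2) mG _ E, of "\<lambda>_ _. 1"]])
      fix s3 assume ag3: "agree (wr (c_solve c_orc)) s2 s3"
        and W: "\<forall>i\<in>{1..2}. \<forall>v<n. snd s3 ''W'' [i, v] = (\<Sum>t<2 * m\<^sup>2. response (sub_objective n f A L a) (sub_ground n A a b) 2 (real m * (2 * real n * L)) (\<lambda>_ _. 1) t i v)
          \<and> snd s3 ''X'' [i, v] = (\<Sum>t<2 * m\<^sup>2. play (sub_objective n f A L a) (sub_ground n A a b) 2 (real m * (2 * real n * L)) (\<lambda>_ _. 1) t i v)"
      have "fst s3 ''E'' = fst s2 ''E''" using ag3 by (simp add: agree_def)
      then show "{v. v < n \<and> fst s3 ''E'' [v] \<noteq> 0} = sub_ground n A a b \<and>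
        (\<forall>v<n. snd s3 ''W'' [1, v] / real (2 * m\<^sup>2) - L = sub_base n f A L m a b v)"
        using E W[rule_format, of 1] by (simp add: sub_base_def)
    qed (use w in simp)
  qed
qed

text \<open>\<open>M\<close> is a minimizer fixed in the analysis; the program never sees
  it.\<close>

definition "good A M \<longleftrightarrow> valid_arcs n A \<and> closed_set n A M"

definition "sfm_state m L s \<longleftrightarrow> fst s ''n'' [] = n \<and> fst s ''K'' [] = 2 \<and> fst s ''T'' [] = 2 * m\<^sup>2 \<and> fst s ''mm'' [] = m
   \<and> snd s ''G'' [] = 2 * real n * L \<and> snd s ''L'' [] = L \<and> snd s ''eps'' [] = sub_eps n L m"

lemma sfm_state_agree:
  "sfm_state m L s \<Longrightarrow> agree W s s' \<Longrightarrow> {''n'', ''K'', ''T'', ''mm'', ''G'', ''L'', ''eps''} \<inter> W = {} \<Longrightarrow> sfm_state m L s'"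
  by (simp add: sfm_state_def agree_def)

text \<open>The base is computed once, for the arcs on entry. Arcs inserted during the loop do not
  invalidate the remaining certificates, because each of them is a statement about \<open>M\<close>
  alone.\<close>

lemma run_arcs:
  assumes st: "sfm_state m L s" and Tz: "2 * m\<^sup>2 \<le> Z"
    and a: "fst s ''a'' [] = a" "a < n + 2" and b: "fst s ''b'' [] = b" "b < n + 2"
    and A: "arcs n s = A" "good A M"
    and test: "\<And>s' v. sfm_state m L s' \<Longrightarrow> fst s' ''x7'' [] = v \<Longrightarrow>
      snd s' ''W'' [1, v] / real (2 * m\<^sup>2) - L = sub_base n f A L m a b v \<Longrightarrow> bval s' t \<longleftrightarrow> P v"
    and xy: "\<And>(s' :: state) v. fst s' ''a'' [] = a \<Longrightarrow> fst s' ''b'' [] = b \<Longrightarrow> fst s' ''x7'' [] = v \<Longrightarrow> nval (fst s') x = xa v \<and> nval (fst s') y = yb v"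
    and bnd: "\<And>v. v < n \<Longrightarrow> xa v < n + 2 \<and> yb v < n + 2"
    and sound: "\<And>v. v \<in> sub_ground n A a b \<Longrightarrow> P v \<Longrightarrow> xa v \<in> insert n M \<Longrightarrow> yb v \<in> insert n M"
  shows "run Fo Z (c_arcs t x y) s (\<lambda>s'. A \<subseteq> arcs n s' \<and> good (arcs n s') M \<and> (\<forall>v\<in>sub_ground n A a b. P v \<longrightarrow> (xa v, yb v) \<in> arcs n s'))"
  unfolding c_arcs_def
proof (rule run_Seq, rule run_conseq[OF run_base[where m = m and L = L and A = A and a = a and b = b]])
  fix s1 assume ag1: "agree (wr c_base) s s1" and E1: "{v. v < n \<and> fst s1 ''E'' [v] \<noteq> 0} = sub_ground n A a b \<and>
    (\<forall>v<n. snd s1 ''W'' [1, v] / real (2 * m\<^sup>2) - L = sub_base n f A L m a b v)"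
  have st1: "sfm_state m L s1" by (rule sfm_state_agree[OF st ag1]) simp
  have s1: "fst s1 ''a'' [] = a" "fst s1 ''b'' [] = b" "arcs n s1 = A"
    using ag1 a b A arcs_cong[of s1 s] by (simp_all add: agree_def)
  show "run Fo Z (For ''x7'' (ix ''n'') (If (BAnd (NLess (NConst 0) (NCell ''E'' [ix ''x7''])) t)
     (NAssign ''ra'' [] x ;; NAssign ''rb'' [] y ;; c_arc) Skip)) s1
     (\<lambda>s'. A \<subseteq> arcs n s' \<and> good (arcs n s') M \<and> (\<forall>v\<in>sub_ground n A a b. P v \<longrightarrow> (xa v, yb v) \<in> arcs n s'))"
  proof (rule run_For_conseq[where B = n and I = "\<lambda>j s'. A \<subseteq> arcs n s' \<and> good (arcs n s') M \<and>
      (\<forall>v<j. v \<in> sub_ground n A a b \<longrightarrow> P v \<longrightarrow> (xa v, yb v) \<in> arcs n s')"], goal_cases)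
    case (6 j s2)
    have st2: "sfm_state m L s2" by (rule sfm_state_agree[OF st1 6(2)]) simp
    have s2: "fst s2 ''n'' [] = n" "fst s2 ''a'' [] = a" "fst s2 ''b'' [] = b" "snd s2 ''W'' = snd s1 ''W''" "fst s2 ''E'' = fst s1 ''E''"
      using 6(2) s1 st2 by (simp_all add: agree_def sfm_state_def)
    have "j \<in> sub_ground n A a b \<longleftrightarrow> fst s2 ''E'' [j] \<noteq> 0" using E1 6(1) s2 by auto
    moreover have "bval s2 t \<longleftrightarrow> P j" using E1 6(1,3) s2 by (intro test st2) auto
    ultimately have cond: "bval s2 (BAnd (NLess (NConst 0) (NCell ''E'' [ix ''x7''])) t) \<longleftrightarrow> j \<in> sub_ground n A a b \<and> P j"
      using 6(3) by simp
    show ?case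
    proof (rule run_If)
      assume "bval s2 (BAnd (NLess (NConst 0) (NCell ''E'' [ix ''x7''])) t)"
      then have j: "j \<in> sub_ground n A a b" "P j" using cond by auto
      show "run Fo Z (NAssign ''ra'' [] x ;; NAssign ''rb'' [] y ;; c_arc) s2 (\<lambda>s'. A \<subseteq> arcs n s' \<and> good (arcs n s') M \<and>
         (\<forall>v<Suc j. v \<in> sub_ground n A a b \<longrightarrow> P v \<longrightarrow> (xa v, yb v) \<in> arcs n s'))"
      proof (intro run_Seq run_NAssign)
        let ?s3 = "(upd (fst s2) ''ra'' (map (nval (fst s2)) []) (nval (fst s2) x), snd s2)"
        let ?s4 = "(upd (fst ?s3) ''rb'' (map (nval (fst ?s3)) []) (nval (fst ?s3) y), snd ?s3)"
        have "nval (fst s2) x = xa j" using xy[of s2 j] s2 6(3) by simp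
        moreover have "nval (fst ?s3) y = yb j" using xy[of ?s3 j] s2 6(3) by (simp add: upd_apply)
        ultimately have s4: "fst ?s4 ''n'' [] = n" "fst ?s4 ''ra'' [] = xa j" "fst ?s4 ''rb'' [] = yb j" "arcs n ?s4 = arcs n s2"
          using s2 by (simp_all add: upd_apply arcs_def)
        show "run Fo Z c_arc ?s4 (\<lambda>s'. A \<subseteq> arcs n s' \<and> good (arcs n s') M \<and>
         (\<forall>v<Suc j. v \<in> sub_ground n A a b \<longrightarrow> P v \<longrightarrow> (xa v, yb v) \<in> arcs n s'))"
        proof (rule run_conseq[OF run_arc[OF s4(1,2) _ s4(3)]])
          fix s5 assume "arcs n s5 = add_arc (arcs n ?s4) (xa j) (yb j)"
          then have s5: "arcs n s5 = add_arc (arcs n s2) (xa j) (yb j)" using s4 by simp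
          have "good (arcs n s5) M" unfolding s5 good_def
            using 6(4) sound[OF j] by (intro conjI add_arc_valid add_arc_closed) (auto simp: good_def)
          moreover have "(xa j, yb j) \<in> arcs n s5" unfolding s5
            using 6(1,4) bnd by (intro add_arc_mem[of n]) (auto simp: good_def)
          moreover have "arcs n s2 \<subseteq> arcs n s5" unfolding s5 by (auto simp: add_arc_def)
          ultimately show "A \<subseteq> arcs n s5 \<and> good (arcs n s5) M \<and>
            (\<forall>v<Suc j. v \<in> sub_ground n A a b \<longrightarrow> P v \<longrightarrow> (xa v, yb v) \<in> arcs n s5)"
            using 6(4) by (auto simp: less_Suc_eq)
        qed (use bnd 6(1) in auto)
      qed
    next
      assume "\<not> bval s2 (BAnd (NLess (NConst 0) (NCell ''E'' [ix ''x7''])) t)"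
      then show "run Fo Z Skip s2 (\<lambda>s'. A \<subseteq> arcs n s' \<and> good (arcs n s') M \<and>
         (\<forall>v<Suc j. v \<in> sub_ground n A a b \<longrightarrow> P v \<longrightarrow> (xa v, yb v) \<in> arcs n s'))"
        using 6(4) cond by (intro run_Skip) (auto simp: less_Suc_eq)
    qed
  next
    case (7 s2)
    then show ?case by (auto simp: sub_ground_def avoid_def)
  qed (use st1 s1 A nZ in \<open>auto simp: sfm_state_def agree_def set_scalar_def arcs_def upd_apply\<close>)
qed (use st Tz a b A in \<open>auto simp: sfm_state_def\<close>)

text \<open>Elements of the interval are not yet implied by \<open>a\<close>, so every certificate
  adds a new arc. Unchanged arcs therefore mean that no entry was certified.\<close>

lemma run_out:
  assumes st: "sfm_state m L s" and Tz: "2 * m\<^sup>2 \<le> Z" and m: "m \<ge> 2"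
    and a: "fst s ''a'' [] = a" "a \<le> n" and b: "fst s ''b'' [] = n + 1"
    and A: "arcs n s = A" "good A M" and lip: "submodular_on {..<n} f" "L \<ge> 0" "lipschitz_closed n f A L"
    and min: "\<And>X. X \<subseteq> {..<n} \<Longrightarrow> f M \<le> f X"
  shows "run Fo Z c_out s (\<lambda>s'. A \<subseteq> arcs n s' \<and> good (arcs n s') M \<and>
     (arcs n s' = A \<longrightarrow> (\<forall>v\<in>sub_ground n A a (n + 1). - sub_eps n L m \<le> sub_base n f A L m a (n + 1) v)))"
  unfolding c_out_def
proof (rule run_conseq[OF run_arcs[OF st Tz a(1) _ b _ A, where P = "\<lambda>v. sub_base n f A L m a (n + 1) v < - sub_eps n L m"
     and xa = "\<lambda>_. a" and yb = "\<lambda>v. v"]])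
  fix s' assume "A \<subseteq> arcs n s' \<and> good (arcs n s') M \<and>
     (\<forall>v\<in>sub_ground n A a (n + 1). sub_base n f A L m a (n + 1) v < - sub_eps n L m \<longrightarrow> (a, v) \<in> arcs n s')"
  then show "A \<subseteq> arcs n s' \<and> good (arcs n s') M \<and>
     (arcs n s' = A \<longrightarrow> (\<forall>v\<in>sub_ground n A a (n + 1). - sub_eps n L m \<le> sub_base n f A L m a (n + 1) v))"
    by (force simp: sub_ground_def reach_def avoid_def)
next
  show "v \<in> insert n M" if "v \<in> sub_ground n A a (n + 1)" "sub_base n f A L m a (n + 1) v < - sub_eps n L m" "a \<in> insert n M" for v
    using arc_sound(1)[OF _ lip m _ min a(2) that] A(2) by (auto simp: good_def)
qed (use a in \<open>auto simp: sfm_state_def\<close>)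

lemma run_in:
  assumes st: "sfm_state m L s" and Tz: "2 * m\<^sup>2 \<le> Z" and m: "m \<ge> 2"
    and a: "fst s ''a'' [] = n" and b: "fst s ''b'' [] = b" "b < n \<or> b = n + 1"
    and A: "arcs n s = A" "good A M" and lip: "submodular_on {..<n} f" "L \<ge> 0" "lipschitz_closed n f A L"
    and min: "\<And>X. X \<subseteq> {..<n} \<Longrightarrow> f M \<le> f X"
  shows "run Fo Z c_in s (\<lambda>s'. A \<subseteq> arcs n s' \<and> good (arcs n s') M \<and>
     (arcs n s' = A \<longrightarrow> (\<forall>v\<in>sub_ground n A n b. sub_base n f A L m n b v \<le> sub_eps n L m)))"
  unfolding c_in_def
proof (rule run_conseq[OF run_arcs[OF st Tz a _ b(1) _ A, where P = "\<lambda>v. sub_eps n L m < sub_base n f A L m n b v"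
     and xa = "\<lambda>v. v" and yb = "\<lambda>_. b"]])
  fix s' assume "A \<subseteq> arcs n s' \<and> good (arcs n s') M \<and>
     (\<forall>v\<in>sub_ground n A n b. sub_eps n L m < sub_base n f A L m n b v \<longrightarrow> (v, b) \<in> arcs n s')"
  then show "A \<subseteq> arcs n s' \<and> good (arcs n s') M \<and>
     (arcs n s' = A \<longrightarrow> (\<forall>v\<in>sub_ground n A n b. sub_base n f A L m n b v \<le> sub_eps n L m))"
    by (force simp: sub_ground_def reach_def avoid_def)
next
  show "b \<in> insert n M" if v: "v \<in> sub_ground n A n b" "sub_eps n L m < sub_base n f A L m n b v" "v \<in> insert n M" for v
  proof -
    have "v \<in> M" using v by (auto simp: sub_ground_def avoid_def)
    then show ?thesis using arc_sound(2)[OF _ lip m _ min b(2) v(1,2)] A(2) by (auto simp: good_def)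
  qed
next
  show "bval s' (RLess (RAdd (rx ''L'') (rx ''eps'')) (RDiv (RCell ''W'' [NConst 1, ix ''x7'']) (RNat (ix ''T'')))) \<longleftrightarrow>
      sub_eps n L m < sub_base n f A L m n b v"
    if "sfm_state m L s'" "fst s' ''x7'' [] = v" "snd s' ''W'' [1, v] / real (2 * m\<^sup>2) - L = sub_base n f A L m n b v" for s' v
    using that by (auto simp: sfm_state_def)
qed (use b in auto)

lemma run_marginal:
  assumes n: "fst s ''n'' [] = n"
    and b: "\<And>y s'. y < n \<Longrightarrow> agree {''y4'', ''C'', ''x1'', ''D'', ''fv'', ''fw'', ''d1''} s s' \<Longrightarrow> fst s' ''y4'' [] = y \<Longrightarrow> bval s' b \<longleftrightarrow> y \<in> X"
    and b': "\<And>y s'. y < n \<Longrightarrow> agree {''y4'', ''C'', ''x1'', ''D'', ''fv'', ''fw'', ''d1''} s s' \<Longrightarrow> fst s' ''y4'' [] = y \<Longrightarrow> bval s' b' \<longleftrightarrow> y \<in> X'"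
    and X: "X \<subseteq> {..<n}" "X' \<subseteq> {..<n}"
  shows "run Fo Z (c_marginal b b') s (\<lambda>s'. snd s' ''L'' [] = max (snd s ''L'' []) (f X - f X'))"
  unfolding c_marginal_def
proof (rule run_Seq, rule run_conseq[OF run_eval[OF n _ X(1)]])
  show "bval s' b \<longleftrightarrow> y \<in> X" if "y < n" "agree {''y4'', ''C''} s s'" "fst s' ''y4'' [] = y" for y s'
    by (rule b[OF that(1) agree_mono[OF that(2)] that(3)]) auto
  fix s1 assume ag1: "agree (wr (c_eval b)) s s1" and fv1: "snd s1 ''fv'' [] = f X"
  show "run Fo Z (RAssign ''d1'' [] (rx ''fv'') ;; c_eval b' ;; RAssign ''d1'' [] (RSub (rx ''d1'') (rx ''fv'')) ;;
     If (RLess (rx ''L'') (rx ''d1'')) (RAssign ''L'' [] (rx ''d1'')) Skip) s1 (\<lambda>s'. snd s' ''L'' [] = max (snd s ''L'' []) (f X - f X'))"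
  proof (rule run_Seq, rule run_RAssign, rule run_Seq, rule run_conseq[OF run_eval[OF _ _ X(2)]])
    let ?s2 = "(fst s1, upd (snd s1) ''d1'' (map (nval (fst s1)) []) (rval s1 (rx ''fv'')))"
    have ag2: "agree {''y4'', ''C'', ''x1'', ''D'', ''fv'', ''fw'', ''d1''} s ?s2" using ag1 by (simp add: agree_def upd_def)
    show "bval s' b' \<longleftrightarrow> y \<in> X'" if "y < n" "agree {''y4'', ''C''} ?s2 s'" "fst s' ''y4'' [] = y" for y s'
      using that ag2 by (intro b') (auto simp: agree_def)
    show "fst ?s2 ''n'' [] = n" using ag2 n by (simp add: agree_def)
    fix s3 assume ag3: "agree (wr (c_eval b')) ?s2 s3" and fv3: "snd s3 ''fv'' [] = f X'"
    have "snd s3 ''L'' = snd s ''L''" "snd s3 ''d1'' [] = f X" using ag3 ag2 fv1 by (simp_all add: agree_def upd_def)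
    then show "run Fo Z (RAssign ''d1'' [] (RSub (rx ''d1'') (rx ''fv'')) ;;
       If (RLess (rx ''L'') (rx ''d1'')) (RAssign ''L'' [] (rx ''d1'')) Skip) s3 (\<lambda>s'. snd s' ''L'' [] = max (snd s ''L'' []) (f X - f X'))"
      using fv3 by (intro run_Seq run_RAssign run_If run_Skip) (simp_all add: upd_apply)
  qed
qed

end

section \<open>The complete minimization program\<close>

definition c_init_arcs :: com where
  "c_init_arcs = For ''y7'' (NAdd (ix ''n'') (NConst 2)) (For ''y8'' (NAdd (ix ''n'') (NConst 2))
     (If (BAnd (BNot (BAnd (BNot (NLess (ix ''y7'') (ix ''y8''))) (BNot (NLess (ix ''y8'') (ix ''y7'')))))
        (BAnd (BNot (BAnd (BNot (NLess (ix ''n'') (ix ''y8''))) (BNot (NLess (ix ''y8'') (ix ''n'')))))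
          (NLess (ix ''y7'') (NAdd (ix ''n'') (NConst 1)))))
       (NAssign ''A'' [ix ''y7'', ix ''y8''] (NConst 0)) (NAssign ''A'' [ix ''y7'', ix ''y8''] (NConst 1))))"

definition c_output2 :: com where
  "c_output2 = For ''y7'' (ix ''n'') (If (arc_b (ix ''n'') (ix ''y7''))
     (NAssign ''U'' [NConst 1, ix ''y7''] (NConst 1)) (NAssign ''U'' [NConst 2, ix ''y7''] (NConst 1)))"

definition c_sfm :: com where
  "c_sfm = c_init_arcs ;; For ''y9'' (ix ''mm'') c_round ;; c_output2"

lemma wr_sfm_parts [simp]:
  "wr c_init_arcs = {''y7'', ''y8'', ''A''}"
  "wr c_output2 = {''y7'', ''U''}"
  by (auto simp: c_init_arcs_def c_output2_def)

context sfm_program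
begin

text \<open>The maximum is recorded together with a node that attains it unless it is 0, since
  progress argues from a step of size exactly L.\<close>

lemma run_lipschitz:
  assumes n: "fst s ''n'' [] = n" and A: "arcs n s = A" "valid_arcs n A"
  shows "run Fo Z c_lipschitz s (\<lambda>s'. \<exists>L. snd s' ''L'' [] = L \<and> L \<ge> 0 \<and>
    (\<forall>u. free_node n A u \<longrightarrow> f (reach n A u) - f (reach n A u - eqclass n A u) \<le> L \<and>
        f (avoid n A u) - f (avoid n A u \<union> eqclass n A u) \<le> L) \<and>
    (L = 0 \<or> (\<exists>u. free_node n A u \<and> (f (reach n A u) - f (reach n A u - eqclass n A u) = L \<or>
        f (avoid n A u) - f (avoid n A u \<union> eqclass n A u) = L))))"
  unfolding c_lipschitz_def
proof (intro run_Seq run_RAssign, rule run_For_conseq[where B = n and I = "\<lambda>j s'. snd s' ''L'' [] \<ge> 0 \<and>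
    (\<forall>u<j. free_node n A u \<longrightarrow> f (reach n A u) - f (reach n A u - eqclass n A u) \<le> snd s' ''L'' [] \<and>
        f (avoid n A u) - f (avoid n A u \<union> eqclass n A u) \<le> snd s' ''L'' []) \<and>
    (snd s' ''L'' [] = 0 \<or> (\<exists>u. free_node n A u \<and> (f (reach n A u) - f (reach n A u - eqclass n A u) = snd s' ''L'' [] \<or>
        f (avoid n A u) - f (avoid n A u \<union> eqclass n A u) = snd s' ''L'' [])))"], goal_cases)
  case (6 j s')
  note body = 6
  let ?X1 = "reach n A j" and ?X2 = "reach n A j - eqclass n A j" and ?X3 = "avoid n A j" and ?X4 = "avoid n A j \<union> eqclass n A j"
  let ?W = "{''y4'', ''C'', ''x1'', ''D'', ''fv'', ''fw'', ''d1'', ''L''}"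
  have s': "fst s' ''n'' [] = n" "fst s' ''A'' = fst s ''A''" using body(2) n by (simp_all add: agree_def upd_def)
  have mem: "(x, y) \<in> A \<longleftrightarrow> fst s ''A'' [x, y] \<noteq> 0" if "x < n + 2" "y < n + 2" for x y
    using A(1) that by (auto simp: arcs_def)
  have bR: "bval s2 (arc_b (ix ''y3'') (ix ''y4'')) \<longleftrightarrow> (j, y) \<in> A" "bval s2 (arc_b (ix ''y4'') (ix ''y3'')) \<longleftrightarrow> (y, j) \<in> A"
    if "agree ?W s' s2" "fst s2 ''y4'' [] = y" "y < n" for s2 y
  proof -
    have "fst s2 ''A'' = fst s ''A''" "fst s2 ''y3'' [] = j" using that(1) s' body(3) by (simp_all add: agree_def)
    then show "bval s2 (arc_b (ix ''y3'') (ix ''y4'')) \<longleftrightarrow> (j, y) \<in> A" "bval s2 (arc_b (ix ''y4'') (ix ''y3'')) \<longleftrightarrow> (y, j) \<in> A"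
      using that body(1) by (simp_all add: mem)
  qed
  have cond: "bval s' (BAnd (BNot (arc_b (ix ''n'') (ix ''y3''))) (BNot (arc_b (ix ''y3'') (NAdd (ix ''n'') (NConst 1))))) \<longleftrightarrow> free_node n A j"
    using s' body(1,3) by (simp add: free_node_def mem)
  show ?case
  proof (rule run_If)
    assume "bval s' (BAnd (BNot (arc_b (ix ''n'') (ix ''y3''))) (BNot (arc_b (ix ''y3'') (NAdd (ix ''n'') (NConst 1)))))"
    then have free: "free_node n A j" using cond by simp
    have sub: "?X1 \<subseteq> {..<n}" "?X2 \<subseteq> {..<n}" "?X3 \<subseteq> {..<n}" "?X4 \<subseteq> {..<n}" by (auto simp: reach_def avoid_def eqclass_def)
    show "run Fo Z (c_marginal (arc_b (ix ''y3'') (ix ''y4'')) (BAnd (arc_b (ix ''y3'') (ix ''y4'')) (BNot (arc_b (ix ''y4'') (ix ''y3'')))) ;;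
        c_marginal (BNot (arc_b (ix ''y4'') (ix ''y3'')))
          (BNot (BAnd (arc_b (ix ''y4'') (ix ''y3'')) (BNot (arc_b (ix ''y3'') (ix ''y4'')))))) s'
      (\<lambda>s'. snd s' ''L'' [] \<ge> 0 \<and>
    (\<forall>u<Suc j. free_node n A u \<longrightarrow> f (reach n A u) - f (reach n A u - eqclass n A u) \<le> snd s' ''L'' [] \<and>
        f (avoid n A u) - f (avoid n A u \<union> eqclass n A u) \<le> snd s' ''L'' []) \<and>
    (snd s' ''L'' [] = 0 \<or> (\<exists>u. free_node n A u \<and> (f (reach n A u) - f (reach n A u - eqclass n A u) = snd s' ''L'' [] \<or>
        f (avoid n A u) - f (avoid n A u \<union> eqclass n A u) = snd s' ''L'' []))))"
    proof (rule run_Seq, rule run_conseq[OF run_marginal[OF s'(1) _ _ sub(1,2)]])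
      fix s1 assume ag1: "agree (wr (c_marginal (arc_b (ix ''y3'') (ix ''y4'')) (BAnd (arc_b (ix ''y3'') (ix ''y4'')) (BNot (arc_b (ix ''y4'') (ix ''y3'')))))) s' s1"
        and L1: "snd s1 ''L'' [] = max (snd s' ''L'' []) (f ?X1 - f ?X2)"
      have ag1': "agree ?W s' s1" using ag1 by simp
      have n1: "fst s1 ''n'' [] = n" using ag1' s' by (simp add: agree_def)
      show "run Fo Z (c_marginal (BNot (arc_b (ix ''y4'') (ix ''y3'')))
          (BNot (BAnd (arc_b (ix ''y4'') (ix ''y3'')) (BNot (arc_b (ix ''y3'') (ix ''y4'')))))) s1
        (\<lambda>s'. snd s' ''L'' [] \<ge> 0 \<and>
        (\<forall>u<Suc j. free_node n A u \<longrightarrow> f (reach n A u) - f (reach n A u - eqclass n A u) \<le> snd s' ''L'' [] \<and>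
            f (avoid n A u) - f (avoid n A u \<union> eqclass n A u) \<le> snd s' ''L'' []) \<and>
        (snd s' ''L'' [] = 0 \<or> (\<exists>u. free_node n A u \<and> (f (reach n A u) - f (reach n A u - eqclass n A u) = snd s' ''L'' [] \<or>
            f (avoid n A u) - f (avoid n A u \<union> eqclass n A u) = snd s' ''L'' []))))"
      proof (rule run_conseq[OF run_marginal[OF n1 _ _ sub(3,4)]])
        fix s2 assume "snd s2 ''L'' [] = max (snd s1 ''L'' []) (f ?X3 - f ?X4)"
        then have L2: "snd s2 ''L'' [] = max (max (snd s' ''L'' []) (f ?X1 - f ?X2)) (f ?X3 - f ?X4)" using L1 by simp
        consider "snd s2 ''L'' [] = snd s' ''L'' []" | "snd s2 ''L'' [] = f ?X1 - f ?X2" | "snd s2 ''L'' [] = f ?X3 - f ?X4"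
          using L2 by linarith
        then show "snd s2 ''L'' [] \<ge> 0 \<and>
          (\<forall>u<Suc j. free_node n A u \<longrightarrow> f (reach n A u) - f (reach n A u - eqclass n A u) \<le> snd s2 ''L'' [] \<and>
              f (avoid n A u) - f (avoid n A u \<union> eqclass n A u) \<le> snd s2 ''L'' []) \<and>
          (snd s2 ''L'' [] = 0 \<or> (\<exists>u. free_node n A u \<and> (f (reach n A u) - f (reach n A u - eqclass n A u) = snd s2 ''L'' [] \<or>
              f (avoid n A u) - f (avoid n A u \<union> eqclass n A u) = snd s2 ''L'' [])))"
        proof cases
          case 1
          then show ?thesis using body(4) L2 by (auto simp: less_Suc_eq)
        next
          case 2
          have "\<forall>u<Suc j. free_node n A u \<longrightarrow> f (reach n A u) - f (reach n A u - eqclass n A u) \<le> snd s2 ''L'' [] \<and>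
              f (avoid n A u) - f (avoid n A u \<union> eqclass n A u) \<le> snd s2 ''L'' []"
            using body(4) L2 by (auto simp: less_Suc_eq le_max_iff_disj)
          then show ?thesis using body(4) L2 2 free by (auto simp: le_max_iff_disj)
        next
          case 3
          have "\<forall>u<Suc j. free_node n A u \<longrightarrow> f (reach n A u) - f (reach n A u - eqclass n A u) \<le> snd s2 ''L'' [] \<and>
              f (avoid n A u) - f (avoid n A u \<union> eqclass n A u) \<le> snd s2 ''L'' []"
            using body(4) L2 by (auto simp: less_Suc_eq le_max_iff_disj)
          then show ?thesis using body(4) L2 3 free by (auto simp: le_max_iff_disj)
        qed
      next
        fix y s2 assume y: "y < n" "agree {''y4'', ''C'', ''x1'', ''D'', ''fv'', ''fw'', ''d1''} s1 s2" "fst s2 ''y4'' [] = y"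
        have "agree ?W s' s2" using ag1' y(2) by (simp add: agree_def)
        note b = bR[OF this y(3,1)]
        show "bval s2 (BNot (arc_b (ix ''y4'') (ix ''y3''))) \<longleftrightarrow> y \<in> ?X3" using b y(1) by (simp add: avoid_def)
        show "bval s2 (BNot (BAnd (arc_b (ix ''y4'') (ix ''y3'')) (BNot (arc_b (ix ''y3'') (ix ''y4''))))) \<longleftrightarrow> y \<in> ?X4"
          using b y(1) by (auto simp: avoid_def eqclass_def)
      qed
    next
      fix y s2 assume y: "y < n" "agree {''y4'', ''C'', ''x1'', ''D'', ''fv'', ''fw'', ''d1''} s' s2" "fst s2 ''y4'' [] = y"
      have "agree ?W s' s2" using y(2) by (simp add: agree_def)
      note b = bR[OF this y(3,1)]
      show "bval s2 (arc_b (ix ''y3'') (ix ''y4'')) \<longleftrightarrow> y \<in> ?X1" using b y(1) by (simp add: reach_def)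
      show "bval s2 (BAnd (arc_b (ix ''y3'') (ix ''y4'')) (BNot (arc_b (ix ''y4'') (ix ''y3'')))) \<longleftrightarrow> y \<in> ?X2"
        using b y(1) by (auto simp: reach_def eqclass_def)
    qed
  next
    assume "\<not> bval s' (BAnd (BNot (arc_b (ix ''n'') (ix ''y3''))) (BNot (arc_b (ix ''y3'') (NAdd (ix ''n'') (NConst 1)))))"
    then show "run Fo Z Skip s' (\<lambda>s'. snd s' ''L'' [] \<ge> 0 \<and>
    (\<forall>u<Suc j. free_node n A u \<longrightarrow> f (reach n A u) - f (reach n A u - eqclass n A u) \<le> snd s' ''L'' [] \<and>
        f (avoid n A u) - f (avoid n A u \<union> eqclass n A u) \<le> snd s' ''L'' []) \<and>
    (snd s' ''L'' [] = 0 \<or> (\<exists>u. free_node n A u \<and> (f (reach n A u) - f (reach n A u - eqclass n A u) = snd s' ''L'' [] \<or>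
        f (avoid n A u) - f (avoid n A u \<union> eqclass n A u) = snd s' ''L'' []))))"
      using body(4) cond by (intro run_Skip) (auto simp: less_Suc_eq)
  qed
next
  case (7 s')
  have "u < n" if "free_node n A u" for u using that by (simp add: free_node_def)
  then show ?case using 7(2) by blast
qed (use n nZ in \<open>auto simp: agree_def set_scalar_def upd_apply\<close>)

definition "grown A M s \<longleftrightarrow> A \<subseteq> arcs n s \<and> good (arcs n s) M"

text \<open>Either an arc is gained, or no entry was certified in any interval. In the latter case L
  > 0 contradicts \<open>arcs_progress\<close>, and L = 0 makes \<open>f\<close> constant on the
  closed sets.\<close>

lemma run_round:
  assumes st: "fst s ''n'' [] = n" "fst s ''K'' [] = 2" "fst s ''T'' [] = 2 * m\<^sup>2" "fst s ''mm'' [] = m"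
    and Tz: "2 * m\<^sup>2 \<le> Z" and m: "m \<ge> 2" "18 * n ^ 3 < m"
    and A: "arcs n s = A" "good A M" and sm: "submodular_on {..<n} f"
    and min: "\<And>X. X \<subseteq> {..<n} \<Longrightarrow> f M \<le> f X"
  shows "run Fo Z c_round s (\<lambda>s'. grown A M s' \<and> (arcs n s' = A \<longrightarrow> (\<forall>X. closed_set n A X \<longrightarrow> f X = f M)))"
  unfolding c_round_def
proof (rule run_Seq, rule run_conseq[OF run_lipschitz[OF st(1) A(1)]])
  have vA: "valid_arcs n A" using A by (simp add: good_def)
  then show "valid_arcs n A" .
  let ?rest = "\<lambda>s'. grown A M s' \<and> (arcs n s' = A \<longrightarrow> (\<forall>X. closed_set n A X \<longrightarrow> f X = f M))"
  fix s1 assume ag1: "agree (wr c_lipschitz) s s1" and "\<exists>L. snd s1 ''L'' [] = L \<and> L \<ge> 0 \<and>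
    (\<forall>u. free_node n A u \<longrightarrow> f (reach n A u) - f (reach n A u - eqclass n A u) \<le> L \<and>
        f (avoid n A u) - f (avoid n A u \<union> eqclass n A u) \<le> L) \<and>
    (L = 0 \<or> (\<exists>u. free_node n A u \<and> (f (reach n A u) - f (reach n A u - eqclass n A u) = L \<or>
        f (avoid n A u) - f (avoid n A u \<union> eqclass n A u) = L)))"
  then obtain L where L: "snd s1 ''L'' [] = L" "L \<ge> 0"
    and marg: "\<And>u. free_node n A u \<Longrightarrow> f (reach n A u) - f (reach n A u - eqclass n A u) \<le> L \<and>
        f (avoid n A u) - f (avoid n A u \<union> eqclass n A u) \<le> L"
    and att: "L = 0 \<or> (\<exists>u. free_node n A u \<and> (f (reach n A u) - f (reach n A u - eqclass n A u) = L \<or>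
        f (avoid n A u) - f (avoid n A u \<union> eqclass n A u) = L))" by blast
  have lip: "lipschitz_closed n f A L" by (rule lipschitz_closedI[OF vA sm L(2) marg])
  \<comment> \<open>Within a round the arcs may already have grown. The bounds on uncertified
    entries are kept only for the case that they have not, which is the case in which progress is at
    stake.\<close>
  let ?outs = "\<lambda>j s'. grown A M s' \<and> (arcs n s' = A \<longrightarrow>
    (\<forall>a<j. \<forall>v\<in>sub_ground n A a (n + 1). - sub_eps n L m \<le> sub_base n f A L m a (n + 1) v))"
  let ?ins = "\<lambda>B s'. ?outs (n + 1) s' \<and> (arcs n s' = A \<longrightarrow>
    (\<forall>b\<in>B. \<forall>v\<in>sub_ground n A n b. sub_base n f A L m n b v \<le> sub_eps n L m))"
  have out: "run Fo Z c_out s' (?outs (Suc j))"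
    if "sfm_state m L s'" "fst s' ''a'' [] = j" "j \<le> n" "fst s' ''b'' [] = n + 1" "?outs j s'" for s' j
  proof (rule run_conseq[OF run_out[OF that(1) Tz m(1) that(2,3,4) refl _ sm L(2) _ min]])
    show "lipschitz_closed n f (arcs n s') L" using lipschitz_closed_mono[OF lip] that(5) by (simp add: grown_def)
  qed (use that(5) in \<open>auto simp: grown_def less_Suc_eq\<close>)
  have inn: "run Fo Z c_in s' (?ins (insert b B))"
    if "sfm_state m L s'" "fst s' ''a'' [] = n" "fst s' ''b'' [] = b" "b < n \<or> b = n + 1" "?ins B s'" for s' b B
  proof (rule run_conseq[OF run_in[OF that(1) Tz m(1) that(2,3,4) refl _ sm L(2) _ min]])
    show "lipschitz_closed n f (arcs n s') L" using lipschitz_closed_mono[OF lip] that(5) by (simp add: grown_def)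
  qed (use that(5) in \<open>auto simp: grown_def\<close>)
  have final: "?rest s'" if "?ins (insert (n + 1) {..<n}) s'" for s'
  proof (intro conjI impI allI)
    show "grown A M s'" using that by blast
    fix X assume eq: "arcs n s' = A" and X: "closed_set n A X"
    have "L = 0"
    proof (rule ccontr)
      assume "L \<noteq> 0"
      then obtain u where u: "free_node n A u" "f (reach n A u) - f (reach n A u - eqclass n A u) = L \<or>
        f (avoid n A u) - f (avoid n A u \<union> eqclass n A u) = L" using att by blast
      show False
      proof (rule arcs_progress[OF vA sm _ lip m(2,1) u])
        show "L > 0" using \<open>L \<noteq> 0\<close> L(2) by simp
        show "- sub_eps n L m \<le> sub_base n f A L m a (n + 1) v" if "a \<le> n" "v \<in> sub_ground n A a (n + 1)" for a v
          using \<open>?ins (insert (n + 1) {..<n}) s'\<close> eq that by auto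
        show "sub_base n f A L m n b v \<le> sub_eps n L m" if "b < n \<or> b = n + 1" "v \<in> sub_ground n A n b" for b v
          using \<open>?ins (insert (n + 1) {..<n}) s'\<close> eq that by auto
      qed
    qed
    then show "f X = f M" using lipschitz_zero_const[OF vA _ X] lip A(2) by (simp add: good_def)
  qed
  show "run Fo Z (RAssign ''G'' [] (RMul (RMul (RNat (NConst 2)) (RNat (ix ''n''))) (rx ''L'')) ;;
     RAssign ''eps'' [] (RDiv (RMul (RMul (RNat (NConst 3)) (RNat (ix ''n''))) (rx ''G'')) (RNat (ix ''mm''))) ;;
     NAssign ''b'' [] (NAdd (ix ''n'') (NConst 1)) ;;
     For ''y5'' (NAdd (ix ''n'') (NConst 1)) (NAssign ''a'' [] (ix ''y5'') ;; c_out) ;;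
     NAssign ''a'' [] (ix ''n'') ;; c_in ;;
     For ''y6'' (ix ''n'') (NAssign ''b'' [] (ix ''y6'') ;; c_in)) s1 ?rest"
  proof (rule run_Seq, rule run_RAssign, rule run_Seq, rule run_RAssign, rule run_Seq, rule run_NAssign)
    let ?s2 = "(fst s1, upd (snd s1) ''G'' (map (nval (fst s1)) []) (rval s1 (RMul (RMul (RNat (NConst 2)) (RNat (ix ''n''))) (rx ''L''))))"
    let ?s3 = "(fst ?s2, upd (snd ?s2) ''eps'' (map (nval (fst ?s2)) []) (rval ?s2 (RDiv (RMul (RMul (RNat (NConst 3)) (RNat (ix ''n''))) (rx ''G'')) (RNat (ix ''mm'')))))"
    let ?s4 = "(upd (fst ?s3) ''b'' (map (nval (fst ?s3)) []) (nval (fst ?s3) (NAdd (ix ''n'') (NConst 1))), snd ?s3)"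
    have s1: "fst s1 ''n'' [] = n" "fst s1 ''K'' [] = 2" "fst s1 ''T'' [] = 2 * m\<^sup>2" "fst s1 ''mm'' [] = m" "fst s1 ''A'' = fst s ''A''"
      using ag1 st by (simp_all add: agree_def)
    have st4: "sfm_state m L ?s4" using s1 L by (simp add: sfm_state_def upd_apply sub_eps_def)
    have b4: "fst ?s4 ''b'' [] = n + 1" using s1 by (simp add: upd_apply)
    have A4: "arcs n ?s4 = A" using s1 A(1) arcs_cong[of ?s4 s] by (simp add: upd_def)
    show "run Fo Z (For ''y5'' (NAdd (ix ''n'') (NConst 1)) (NAssign ''a'' [] (ix ''y5'') ;; c_out) ;;
       NAssign ''a'' [] (ix ''n'') ;; c_in ;; For ''y6'' (ix ''n'') (NAssign ''b'' [] (ix ''y6'') ;; c_in)) ?s4 ?rest"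
    proof (rule run_Seq, rule run_For_conseq[where B = "n + 1" and I = ?outs], goal_cases)
      case (6 j s5)
      have st5: "sfm_state m L s5" by (rule sfm_state_agree[OF st4 6(2)]) simp
      have b5: "fst s5 ''b'' [] = n + 1" using 6(2) b4 by (simp add: agree_def)
      let ?s6 = "(upd (fst s5) ''a'' (map (nval (fst s5)) []) (nval (fst s5) (ix ''y5'')), snd s5)"
      have "sfm_state m L ?s6" using st5 by (simp add: sfm_state_def upd_apply)
      moreover have "?outs j ?s6" using 6(4) arcs_cong[of ?s6 s5] by (simp add: upd_def grown_def)
      ultimately show ?case using 6(1,3) b5 by (intro run_Seq run_NAssign out) (auto simp: upd_apply)
    next
      case (7 s5)
      have st5: "sfm_state m L s5" by (rule sfm_state_agree[OF st4 7(1)]) simp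
      have b5: "fst s5 ''b'' [] = n + 1" using 7(1) b4 by (simp add: agree_def)
      let ?s6 = "(upd (fst s5) ''a'' (map (nval (fst s5)) []) (nval (fst s5) (ix ''n'')), snd s5)"
      have st6: "sfm_state m L ?s6" using st5 by (simp add: sfm_state_def upd_apply)
      have a6: "fst ?s6 ''a'' [] = n" "fst ?s6 ''b'' [] = n + 1" using st5 b5 by (simp_all add: sfm_state_def upd_apply)
      have o6: "?ins {} ?s6" using 7(2) arcs_cong[of ?s6 s5] by (simp add: upd_def grown_def)
      show ?case
      proof (rule run_Seq, rule run_NAssign, rule run_Seq, rule run_conseq[OF inn[OF st6 a6 disjI2[OF refl] o6]])
        fix s7 assume ag7: "agree (wr c_in) ?s6 s7" and i7: "?ins {n + 1} s7"
        have st7: "sfm_state m L s7" by (rule sfm_state_agree[OF st6 ag7]) simp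
        have a7: "fst s7 ''a'' [] = n" using ag7 a6 by (simp add: agree_def)
        show "run Fo Z (For ''y6'' (ix ''n'') (NAssign ''b'' [] (ix ''y6'') ;; c_in)) s7 ?rest"
        proof (rule run_For_conseq[where B = n and I = "\<lambda>j. ?ins (insert (n + 1) {..<j})"], goal_cases)
          case (6 j s8)
          have st8: "sfm_state m L s8" by (rule sfm_state_agree[OF st7 6(2)]) simp
          have a8: "fst s8 ''a'' [] = n" using 6(2) a7 by (simp add: agree_def)
          let ?s9 = "(upd (fst s8) ''b'' (map (nval (fst s8)) []) (nval (fst s8) (ix ''y6'')), snd s8)"
          have st9: "sfm_state m L ?s9" using st8 by (simp add: sfm_state_def upd_apply)
          have ab9: "fst ?s9 ''a'' [] = n" "fst ?s9 ''b'' [] = j" using a8 6(3) by (simp_all add: upd_apply)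
          have "?ins (insert (n + 1) {..<j}) ?s9" using 6(4) arcs_cong[of ?s9 s8] by (simp add: upd_def grown_def)
          from inn[OF st9 ab9 disjI1[OF 6(1)] this]
          show ?case by (intro run_Seq run_NAssign) (simp add: lessThan_Suc insert_commute)
        next
          case (7 s8)
          then show ?case by (intro final)
        next
          case 4
          then show ?case using i7 arcs_cong[of "set_scalar ''y6'' 0 s7" s7] by (simp add: set_scalar_def upd_def grown_def)
        next
          case (5 j s' v)
          then show ?case using arcs_cong[of "set_scalar ''y6'' v s'" s'] by (simp add: set_scalar_def upd_def grown_def)
        qed (use st7 nZ in \<open>auto simp: sfm_state_def agree_def\<close>)
      qed
    next
      case 4
      then show ?case using A4 A(2) arcs_cong[of "set_scalar ''y5'' 0 ?s4" ?s4] by (simp add: set_scalar_def upd_def grown_def)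
    next
      case (5 j s' v)
      then show ?case using arcs_cong[of "set_scalar ''y5'' v s'" s'] by (simp add: set_scalar_def upd_def grown_def)
    qed (use st4 nZ in \<open>auto simp: sfm_state_def agree_def\<close>)
  qed
qed

definition "initial_arcs = {(x, y). x < n + 2 \<and> y < n + 2 \<and> (x = y \<or> y = n \<or> x = n + 1)}"

lemma run_init_arcs:
  assumes n: "fst s ''n'' [] = n"
  shows "run Fo Z c_init_arcs s (\<lambda>s'. arcs n s' = initial_arcs)"
  unfolding c_init_arcs_def
proof (rule run_For_conseq[where B = "n + 2" and I = "\<lambda>j s'. \<forall>x<j. \<forall>y<n+2. fst s' ''A'' [x, y] \<noteq> 0 \<longleftrightarrow> x = y \<or> y = n \<or> x = n + 1"], goal_cases)
  case (6 j s')
  note body = 6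
  have s': "fst s' ''n'' [] = n" using body(2) n by (simp add: agree_def)
  show ?case
  proof (rule run_For_conseq[where B = "n + 2" and I = "\<lambda>i s''. (\<forall>y<i. fst s'' ''A'' [j, y] \<noteq> 0 \<longleftrightarrow> j = y \<or> y = n \<or> j = n + 1)
      \<and> (\<forall>x y. x \<noteq> j \<longrightarrow> fst s'' ''A'' [x, y] = fst s' ''A'' [x, y])"], goal_cases)
    case (6 i s2)
    have "fst s2 ''n'' [] = n" "fst s2 ''y7'' [] = j" using 6(2) s' body(3) by (simp_all add: agree_def)
    then show ?case using 6(1,3,4) body(1) by (intro run_If run_NAssign) (auto simp: upd_apply less_Suc_eq)
  next
    case (7 s2)
    show ?case
    proof (intro allI impI)
      fix x y assume "x < Suc j" "y < n + 2"
      then show "fst s2 ''A'' [x, y] \<noteq> 0 \<longleftrightarrow> x = y \<or> y = n \<or> x = n + 1"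
        using 7(2) body(4) by (cases "x = j") simp_all
    qed
  qed (use body s' nZ in \<open>auto simp: agree_def set_scalar_def upd_apply\<close>)
next
  case (7 s')
  then show ?case by (auto simp: arcs_def initial_arcs_def)
qed (use n nZ in \<open>auto simp: agree_def set_scalar_def upd_apply\<close>)

lemma initial_arcs_good: "M \<subseteq> {..<n} \<Longrightarrow> good initial_arcs M"
  unfolding good_def valid_arcs_def closed_set_def initial_arcs_def by (auto intro!: transI)

lemma run_output2:
  assumes n: "fst s ''n'' [] = n" and U: "\<And>as. fst s ''U'' as = 0"
  shows "run Fo Z c_output2 s (\<lambda>s'. {v. v < n \<and> fst s' ''U'' [1, v] \<noteq> 0} = reach n (arcs n s) n
    \<and> {v. v < n \<and> fst s' ''U'' [2, v] \<noteq> 0} = {..<n} - reach n (arcs n s) n)"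
  unfolding c_output2_def
proof (rule run_For_conseq[where B = n and I = "\<lambda>j s'. \<forall>v. (fst s' ''U'' [1, v] \<noteq> 0 \<longleftrightarrow> v < j \<and> fst s ''A'' [n, v] \<noteq> 0)
    \<and> (fst s' ''U'' [2, v] \<noteq> 0 \<longleftrightarrow> v < j \<and> fst s ''A'' [n, v] = 0)"], goal_cases)
  case (6 j s')
  then have "fst s' ''n'' [] = n" "fst s' ''A'' = fst s ''A''" using n by (simp_all add: agree_def)
  then show ?case using 6 by (intro run_If run_NAssign) (auto simp: upd_apply less_Suc_eq)
next
  case (7 s')
  have r: "reach n (arcs n s) n = {v. v < n \<and> fst s ''A'' [n, v] \<noteq> 0}" by (auto simp: reach_def arcs_def)
  have "{v. v < n \<and> fst s' ''U'' [1, v] \<noteq> 0} = {v. v < n \<and> fst s ''A'' [n, v] \<noteq> 0}" using 7(2) by blast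
  moreover have "{v. v < n \<and> fst s' ''U'' [2, v] \<noteq> 0} = {..<n} - {v. v < n \<and> fst s ''A'' [n, v] \<noteq> 0}" using 7(2) by blast
  ultimately show ?case unfolding r by blast
qed (use n U nZ in \<open>auto simp: agree_def set_scalar_def upd_apply\<close>)

theorem run_sfm:
  assumes st: "fst s ''n'' [] = n" "fst s ''K'' [] = 2" "fst s ''T'' [] = 2 * m\<^sup>2" "fst s ''mm'' [] = m" "\<And>as. fst s ''U'' as = 0"
    and Tz: "2 * m\<^sup>2 \<le> Z" and m: "m \<ge> 2" "18 * n ^ 3 < m" "(n + 2)\<^sup>2 < m" and sm: "submodular_on {..<n} f"
  shows "run Fo Z c_sfm s (\<lambda>s'. \<exists>X\<subseteq>{..<n}. (\<forall>Y\<subseteq>{..<n}. f X \<le> f Y) \<and> {v. v < n \<and> fst s' ''U'' [1, v] \<noteq> 0} = X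
    \<and> {v. v < n \<and> fst s' ''U'' [2, v] \<noteq> 0} = {..<n} - X)"
  unfolding c_sfm_def
proof (rule run_Seq, rule run_conseq[OF run_init_arcs[OF st(1)]])
  have "m \<le> m\<^sup>2" by (simp add: power2_eq_square)
  then have mZ: "m \<le> Z" using Tz by linarith
  \<comment> \<open>Soundness holds with respect to any minimizer; one is fixed here, and the
    invariant states that it stays closed under all arcs.\<close>
  have "Min (f ` Pow {..<n}) \<in> f ` Pow {..<n}" by (intro Min_in) auto
  then obtain M where M: "M \<subseteq> {..<n}" "f M = Min (f ` Pow {..<n})" by auto
  have min: "f M \<le> f X" if "X \<subseteq> {..<n}" for X unfolding M(2) using that by (intro Min_le) auto
  fix s1 assume ag1: "agree (wr c_init_arcs) s s1" and A1: "arcs n s1 = initial_arcs"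
  have s1: "fst s1 ''n'' [] = n" "fst s1 ''K'' [] = 2" "fst s1 ''T'' [] = 2 * m\<^sup>2" "fst s1 ''mm'' [] = m" "\<And>as. fst s1 ''U'' as = 0"
    using ag1 st by (simp_all add: agree_def)
  show "run Fo Z (For ''y9'' (ix ''mm'') c_round ;; c_output2) s1 (\<lambda>s'. \<exists>X\<subseteq>{..<n}. (\<forall>Y\<subseteq>{..<n}. f X \<le> f Y) \<and> {v. v < n \<and> fst s' ''U'' [1, v] \<noteq> 0} = X
    \<and> {v. v < n \<and> fst s' ''U'' [2, v] \<noteq> 0} = {..<n} - X)"
  proof (rule run_Seq, rule run_For_conseq[where B = m and I = "\<lambda>j s'. good (arcs n s') M \<and>
      (j \<le> card (arcs n s') \<or> (\<forall>X. closed_set n (arcs n s') X \<longrightarrow> f X = f M))"], goal_cases)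
    case (6 j s2)
    have s2: "fst s2 ''n'' [] = n" "fst s2 ''K'' [] = 2" "fst s2 ''T'' [] = 2 * m\<^sup>2" "fst s2 ''mm'' [] = m"
      using 6(2) s1 by (simp_all add: agree_def)
    have good2: "good (arcs n s2) M" using 6(4) by blast
    show ?case
    proof (rule run_conseq[OF run_round[OF s2 Tz m(1,2) refl good2 sm min]])
      fix s3 assume g: "grown (arcs n s2) M s3 \<and> (arcs n s3 = arcs n s2 \<longrightarrow> (\<forall>X. closed_set n (arcs n s2) X \<longrightarrow> f X = f M))"
      have "Suc j \<le> card (arcs n s3) \<or> (\<forall>X. closed_set n (arcs n s3) X \<longrightarrow> f X = f M)"
      proof (cases "arcs n s3 = arcs n s2")
        case True
        then show ?thesis using g by simp
      next
        case False
        then have sub: "arcs n s2 \<subset> arcs n s3" using g by (auto simp: grown_def)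
        have "finite (arcs n s3)" by (rule finite_subset[of _ "{..<n+2} \<times> {..<n+2}"]) (auto simp: arcs_def)
        then have "card (arcs n s2) < card (arcs n s3)" using sub by (rule psubset_card_mono)
        moreover have "\<forall>X. closed_set n (arcs n s3) X \<longrightarrow> f X = f M" if "\<forall>X. closed_set n (arcs n s2) X \<longrightarrow> f X = f M"
          using that closed_set_antimono[of "arcs n s2" "arcs n s3"] sub by blast
        moreover from 6(4) have "j \<le> card (arcs n s2) \<or> (\<forall>X. closed_set n (arcs n s2) X \<longrightarrow> f X = f M)" by (rule conjunct2)
        ultimately show ?thesis by (meson Suc_leI le_less_trans)
      qed
      then show "good (arcs n s3) M \<and> (Suc j \<le> card (arcs n s3) \<or> (\<forall>X. closed_set n (arcs n s3) X \<longrightarrow> f X = f M))"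
        using g by (simp add: grown_def)
    qed
  next
    case (7 s2)
    let ?A = "arcs n s2"
    have s2: "fst s2 ''n'' [] = n" "\<And>as. fst s2 ''U'' as = 0" using 7(1) s1 by (simp_all add: agree_def)
    \<comment> \<open>There are at most (n + 2)^2 < m arcs, so after m rounds the other alternative
      of the invariant must hold; the program needs no test for termination.\<close>
    have "card ?A \<le> card ({..<n+2} \<times> {..<n+2})" by (rule card_mono) (auto simp: arcs_def)
    then have "card ?A < m" using m(3) by (simp add: card_cartesian_product power2_eq_square)
    then have "\<not> m \<le> card ?A" by simp
    then have const: "\<forall>X. closed_set n ?A X \<longrightarrow> f X = f M" using 7(2) by blast
    have g: "valid_arcs n ?A" "closed_set n ?A M" using 7(2) by (simp_all add: good_def)
    have "n + 1 \<notin> insert n M" using g(2) by (auto simp: closed_set_def)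
    then have "(n, n + 1) \<notin> ?A" using g(2) unfolding closed_set_def by blast
    \<comment> \<open>As \<open>f\<close> is constant on closed sets, the least one is as good as
      \<open>M\<close>.\<close>
    then have "closed_set n ?A (reach n ?A n)" by (intro closed_reach[OF g(1)]) auto
    then have "f (reach n ?A n) = f M" using const by blast
    moreover have "reach n ?A n \<subseteq> {..<n}" by (auto simp: reach_def)
    moreover from calculation have "\<forall>Y\<subseteq>{..<n}. f (reach n ?A n) \<le> f Y" using min by simp
    ultimately show ?case
      by (intro run_conseq[OF run_output2[OF s2]]) (intro exI[of _ "reach n ?A n"] conjI, simp_all)
  next
    case 4
    then show ?case using A1 initial_arcs_good[OF M(1)] arcs_cong[of "set_scalar ''y9'' 0 s1" s1] by (simp add: set_scalar_def upd_def)
  next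
    case (5 j s' v)
    then show ?case using arcs_cong[of "set_scalar ''y9'' v s'" s'] by (simp add: set_scalar_def upd_def)
  qed (use s1 mZ in \<open>auto simp: agree_def\<close>)
qed

end

section \<open>Rounding program\<close>

abbreviation suc_ix :: "string \<Rightarrow> nexp" where "suc_ix x \<equiv> NAdd (ix x) (NConst 1)"

definition c_singleton :: com where
  "c_singleton = For ''a2'' (ix ''n'') (If (BAnd (BNot (NLess (ix ''a1'') (ix ''a2''))) (BNot (NLess (ix ''a2'') (ix ''a1''))))
     (NAssign ''S'' [ix ''a2''] (NConst 1)) (NAssign ''S'' [ix ''a2''] (NConst 0)))"

text \<open>\<open>mi\<close> is the cheapest singleton value of the current element, starting from
  function 1, and \<open>be\<close> the maximum of these. The singleton values stay in
  \<open>sv\<close> for the later test of admissibility.\<close>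

definition c_beta :: com where
  "c_beta = RAssign ''be'' [] (RNat (NConst 0)) ;; For ''a1'' (ix ''n'') (c_singleton ;; Query ''mi'' [] (NConst 1) ''S'' [] ;;
     For ''a3'' (ix ''k'') (Query ''sv'' [suc_ix ''a3'', ix ''a1''] (suc_ix ''a3'') ''S'' [] ;;
       If (RLess (RCell ''sv'' [suc_ix ''a3'', ix ''a1'']) (rx ''mi'')) (RAssign ''mi'' [] (RCell ''sv'' [suc_ix ''a3'', ix ''a1''])) Skip) ;;
     If (RLess (rx ''be'') (rx ''mi'')) (RAssign ''be'' [] (rx ''mi'')) Skip)"

definition c_allowed :: com where
  "c_allowed = For ''a4'' (ix ''n'') (NAssign ''E'' [ix ''a4''] (NConst 1) ;; For ''a5'' (ix ''k'')
     (If (RLess (rx ''G'') (RCell ''sv'' [suc_ix ''a5'', ix ''a4''])) (RAssign ''w'' [suc_ix ''a5'', ix ''a4''] (RNat (NConst 0)))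
       (RAssign ''w'' [suc_ix ''a5'', ix ''a4''] (RNat (NConst 1)))))"

definition c_query :: com where
  "c_query = Query ''val'' [] (ix ''fi'') ''S'' []"

definition c_levels :: com where
  "c_levels = For ''b1'' (ix ''k'') (For ''b2'' (suc_ix ''kH'') (
     For ''b3'' (ix ''n'') (If (RLess (RMul (RNat (ix ''b2'')) (RNat (ix ''T''))) (RMul (RNat (suc_ix ''kH'')) (RCell ''X'' [suc_ix ''b1'', ix ''b3''])))
       (NAssign ''S'' [ix ''b3''] (NConst 1)) (NAssign ''S'' [ix ''b3''] (NConst 0))) ;;
     Query ''lv'' [suc_ix ''b1'', ix ''b2''] (suc_ix ''b1'') ''S'' []))"

text \<open>\<open>best[i, r]\<close> is the least total level cost of the first i functions for
  thresholds of sum at most r, and \<open>arg\<close> the last threshold attaining it. The row for i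
  = 0 is 0 for every r, so budget may remain unspent.\<close>

definition c_dp :: com where
  "c_dp = For ''d1'' (suc_ix ''kH'') (RAssign ''best'' [NConst 0, ix ''d1''] (RNat (NConst 0))) ;;
     For ''d2'' (ix ''k'') (For ''d3'' (suc_ix ''kH'') (
       RAssign ''best'' [suc_ix ''d2'', ix ''d3''] (RAdd (RCell ''best'' [ix ''d2'', ix ''d3'']) (RCell ''lv'' [suc_ix ''d2'', NConst 0])) ;;
       NAssign ''arg'' [suc_ix ''d2'', ix ''d3''] (NConst 0) ;;
       For ''d4'' (suc_ix ''d3'') (If (RLess (RAdd (RCell ''best'' [ix ''d2'', NSub (ix ''d3'') (ix ''d4'')]) (RCell ''lv'' [suc_ix ''d2'', ix ''d4'']))
           (RCell ''best'' [suc_ix ''d2'', ix ''d3'']))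
         (RAssign ''best'' [suc_ix ''d2'', ix ''d3''] (RAdd (RCell ''best'' [ix ''d2'', NSub (ix ''d3'') (ix ''d4'')]) (RCell ''lv'' [suc_ix ''d2'', ix ''d4''])) ;;
          NAssign ''arg'' [suc_ix ''d2'', ix ''d3''] (ix ''d4'')) Skip)))"

definition c_back :: com where
  "c_back = NAssign ''rem'' [] (ix ''kH'') ;; For ''d5'' (ix ''k'') (
     NAssign ''th'' [NSub (ix ''k'') (ix ''d5'')] (NCell ''arg'' [NSub (ix ''k'') (ix ''d5''), ix ''rem'']) ;;
     NAssign ''rem'' [] (NSub (ix ''rem'') (NCell ''th'' [NSub (ix ''k'') (ix ''d5'')])))"

text \<open>Level sets may overlap. Each element goes to the first one that contains it, which by
  monotonicity makes no part more expensive than its level set.\<close>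

definition c_assign :: com where
  "c_assign = For ''e1'' (ix ''n'') (NAssign ''done'' [] (NConst 0) ;; For ''e2'' (ix ''k'')
     (If (BAnd (NLess (ix ''done'') (NConst 1)) (RLess (RMul (RNat (NCell ''th'' [suc_ix ''e2''])) (RNat (ix ''T'')))
          (RMul (RNat (suc_ix ''kH'')) (RCell ''X'' [suc_ix ''e2'', ix ''e1'']))))
       (NAssign ''U'' [suc_ix ''e2'', ix ''e1''] (NConst 1) ;; NAssign ''done'' [] (NConst 1)) Skip))"

lemma wr_alloc_parts [simp]:
  "wr c_singleton = {''a2'', ''S''}"
  "wr c_beta = {''be'', ''a1'', ''a2'', ''S'', ''mi'', ''a3'', ''sv''}"
  "wr c_allowed = {''a4'', ''E'', ''a5'', ''w''}"
  "wr c_query = {''val''}"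
  "wr c_levels = {''b1'', ''b2'', ''b3'', ''S'', ''lv''}"
  "wr c_dp = {''d1'', ''d2'', ''d3'', ''d4'', ''best'', ''arg''}"
  "wr c_back = {''rem'', ''d5'', ''th''}"
  "wr c_assign = {''e1'', ''e2'', ''done'', ''U''}"
  by (auto simp: c_singleton_def c_beta_def c_allowed_def c_query_def c_levels_def c_dp_def c_back_def c_assign_def)

locale alloc_program =
  fixes Fo :: eval_oracle and n k Z :: nat
  assumes local: "\<And>i J. Fo i (J \<inter> {..<n}) = Fo i J" and nZ: "n \<le> Z" "k \<le> Z" and k: "k \<ge> 1"
begin

lemma local_cong: "J \<inter> {..<n} = J' \<inter> {..<n} \<Longrightarrow> Fo i J = Fo i J'"
  using local[of i J] local[of i J'] by simp

lemma run_singleton: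
  assumes n: "fst s ''n'' [] = n" and a: "fst s ''a1'' [] = a" "a < n"
  shows "run Fo Z c_singleton s (\<lambda>s'. \<forall>i. Fo i {j. fst s' ''S'' [j] \<noteq> 0} = Fo i {a})"
  unfolding c_singleton_def
proof (rule run_For_conseq[where B = n and I = "\<lambda>j s'. \<forall>v<j. fst s' ''S'' [v] \<noteq> 0 \<longleftrightarrow> v = a"], goal_cases)
  case (6 j s')
  then have "fst s' ''a1'' [] = a" using a by (simp add: agree_def)
  then show ?case using 6 by (intro run_If run_NAssign) (auto simp: upd_apply less_Suc_eq)
next
  case (7 s')
  then show ?case using a by (intro allI local_cong) auto
qed (use n nZ in \<open>auto simp: agree_def set_scalar_def upd_apply\<close>)

lemma run_beta:
  assumes n: "fst s ''n'' [] = n" "fst s ''k'' [] = k"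
  shows "run Fo Z c_beta s (\<lambda>s'. (\<forall>i\<in>{1..k}. \<forall>v<n. snd s' ''sv'' [i, v] = Fo i {v}) \<and>
    (\<forall>v<n. \<exists>i\<in>{1..k}. Fo i {v} \<le> snd s' ''be'' []) \<and>
    (snd s' ''be'' [] = 0 \<or> (\<exists>v<n. \<forall>i\<in>{1..k}. snd s' ''be'' [] \<le> Fo i {v})))"
  unfolding c_beta_def
proof (intro run_Seq run_RAssign, rule run_For_conseq[where B = n and I = "\<lambda>j s'. (\<forall>i\<in>{1..k}. \<forall>v<j. snd s' ''sv'' [i, v] = Fo i {v}) \<and>
    (\<forall>v<j. \<exists>i\<in>{1..k}. Fo i {v} \<le> snd s' ''be'' []) \<and>
    (snd s' ''be'' [] = 0 \<or> (\<exists>v<n. \<forall>i\<in>{1..k}. snd s' ''be'' [] \<le> Fo i {v}))"], goal_cases)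
  case (6 j s')
  note body = 6
  have s': "fst s' ''n'' [] = n" "fst s' ''k'' [] = k" using body(2) n by (simp_all add: agree_def upd_def)
  show ?case
  proof (rule run_Seq, rule run_conseq[OF run_singleton[OF s'(1) body(3,1)]], rule run_Seq, rule run_Query, rule run_Seq)
    fix s1 assume ag1: "agree (wr c_singleton) s' s1" and S1: "\<forall>i. Fo i {ja. fst s1 ''S'' [ja] \<noteq> 0} = Fo i {j}"
    let ?s2 = "(fst s1, upd (snd s1) ''mi'' (map (nval (fst s1)) []) (Fo (nval (fst s1) (NConst 1)) {j. fst s1 ''S'' (map (nval (fst s1)) [] @ [j]) \<noteq> 0}))"
    have s1: "fst s1 ''k'' [] = k" "fst s1 ''a1'' [] = j" "snd s1 ''sv'' = snd s' ''sv''" "snd s1 ''be'' = snd s' ''be''"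
      using ag1 s' body(3) by (simp_all add: agree_def)
    show "run Fo Z (For ''a3'' (ix ''k'') (Query ''sv'' [suc_ix ''a3'', ix ''a1''] (suc_ix ''a3'') ''S'' [] ;;
       If (RLess (RCell ''sv'' [suc_ix ''a3'', ix ''a1'']) (rx ''mi'')) (RAssign ''mi'' [] (RCell ''sv'' [suc_ix ''a3'', ix ''a1''])) Skip)) ?s2
       (\<lambda>s'. run Fo Z (If (RLess (rx ''be'') (rx ''mi'')) (RAssign ''be'' [] (rx ''mi'')) Skip) s' (\<lambda>s'. (\<forall>i\<in>{1..k}. \<forall>v<Suc j. snd s' ''sv'' [i, v] = Fo i {v}) \<and>
    (\<forall>v<Suc j. \<exists>i\<in>{1..k}. Fo i {v} \<le> snd s' ''be'' []) \<and>
    (snd s' ''be'' [] = 0 \<or> (\<exists>v<n. \<forall>i\<in>{1..k}. snd s' ''be'' [] \<le> Fo i {v}))))"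
    proof (rule run_For_conseq[where B = k and I = "\<lambda>i' s''. (\<forall>i\<in>{1..i'}. snd s'' ''sv'' [i, j] = Fo i {j} \<and> snd s'' ''mi'' [] \<le> Fo i {j}) \<and>
        (\<exists>i\<in>{1..k}. Fo i {j} = snd s'' ''mi'' []) \<and> (\<forall>i v. v \<noteq> j \<longrightarrow> snd s'' ''sv'' [i, v] = snd s' ''sv'' [i, v])"], goal_cases)
      case (6 i' s3)
      have s3: "fst s3 ''a1'' [] = j" "\<forall>i. Fo i {ja. fst s3 ''S'' [ja] \<noteq> 0} = Fo i {j}"
        using 6(2) s1 S1 by (simp_all add: agree_def upd_def)
      have "Suc i' \<in> {1..k}" using 6(1) by simp
      show ?case
      proof (rule run_Seq, rule run_Query)
        let ?s4 = "(fst s3, upd (snd s3) ''sv'' (map (nval (fst s3)) [suc_ix ''a3'', ix ''a1'']) (Fo (nval (fst s3) (suc_ix ''a3'')) {j. fst s3 ''S'' (map (nval (fst s3)) [] @ [j]) \<noteq> 0}))"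
        have v4: "rval ?s4 (RCell ''sv'' [suc_ix ''a3'', ix ''a1'']) = Fo (Suc i') {j}" using s3 6(3) by (simp add: upd_apply)
        have sv4: "snd ?s4 ''sv'' = (snd s3 ''sv'')([Suc i', j] := Fo (Suc i') {j})" using s3 6(3) by (simp add: upd_def)
        have mi4: "snd ?s4 ''mi'' [] = snd s3 ''mi'' []" by (simp add: upd_apply)
        have others: "\<forall>i\<in>{1..i'}. snd s3 ''sv'' [i, j] = Fo i {j} \<and> snd s3 ''mi'' [] \<le> Fo i {j}"
          "\<exists>i\<in>{1..k}. Fo i {j} = snd s3 ''mi'' []" "\<forall>i v. v \<noteq> j \<longrightarrow> snd s3 ''sv'' [i, v] = snd s' ''sv'' [i, v]"
          using 6(4) by blast+
        let ?post = "\<lambda>s''. (\<forall>i\<in>{1..Suc i'}. snd s'' ''sv'' [i, j] = Fo i {j} \<and> snd s'' ''mi'' [] \<le> Fo i {j}) \<and>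
          (\<exists>i\<in>{1..k}. Fo i {j} = snd s'' ''mi'' []) \<and> (\<forall>i v. v \<noteq> j \<longrightarrow> snd s'' ''sv'' [i, v] = snd s' ''sv'' [i, v])"
        have post: "?post s''" if "snd s'' ''sv'' = snd ?s4 ''sv''" "snd s'' ''mi'' [] = min (snd s3 ''mi'' []) (Fo (Suc i') {j})" for s'' :: state
        proof (intro conjI ballI allI impI)
          show "\<exists>i\<in>{1..k}. Fo i {j} = snd s'' ''mi'' []"
            using that(2) others(2) \<open>Suc i' \<in> {1..k}\<close> unfolding min_def by metis
          fix i assume "i \<in> {1..Suc i'}"
          then show "snd s'' ''sv'' [i, j] = Fo i {j}" "snd s'' ''mi'' [] \<le> Fo i {j}"
            using that sv4 others(1) by (auto simp: le_Suc_eq min_le_iff_disj)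
        next
          show "snd s'' ''sv'' [i, v] = snd s' ''sv'' [i, v]" if "v \<noteq> j" for i v using \<open>snd s'' ''sv'' = snd ?s4 ''sv''\<close> sv4 others(3) that by simp
        qed
        show "run Fo Z (If (RLess (RCell ''sv'' [suc_ix ''a3'', ix ''a1'']) (rx ''mi'')) (RAssign ''mi'' [] (RCell ''sv'' [suc_ix ''a3'', ix ''a1''])) Skip) ?s4 ?post"
        proof (rule run_If)
          assume lt: "bval ?s4 (RLess (RCell ''sv'' [suc_ix ''a3'', ix ''a1'']) (rx ''mi''))"
          have "Fo (Suc i') {j} < snd s3 ''mi'' []" using lt v4 mi4 by (simp only: bval.simps rval.simps list.map)
          then show "run Fo Z (RAssign ''mi'' [] (RCell ''sv'' [suc_ix ''a3'', ix ''a1''])) ?s4 ?post"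
            using s3(2)[rule_format, of "Suc i'"] by (intro run_RAssign post) (simp_all add: upd_def s3(1) 6(3))
        next
          assume lt: "\<not> bval ?s4 (RLess (RCell ''sv'' [suc_ix ''a3'', ix ''a1'']) (rx ''mi''))"
          have "\<not> Fo (Suc i') {j} < snd s3 ''mi'' []" using lt v4 mi4 by (simp only: bval.simps rval.simps list.map) simp
          then show "run Fo Z Skip ?s4 ?post" by (intro run_Skip post) (simp_all add: upd_def)
        qed
      qed
    next
      case (7 s3)
      have be: "snd s3 ''be'' [] = snd s' ''be'' []" using 7(1) s1 by (simp add: agree_def upd_def)
      have sv: "\<forall>i\<in>{1..k}. \<forall>v<Suc j. snd s3 ''sv'' [i, v] = Fo i {v}" using 7(2) body(4) by (auto simp: less_Suc_eq)
      obtain i where i: "i \<in> {1..k}" "Fo i {j} = snd s3 ''mi'' []" using 7(2) by blast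
      have mi: "\<forall>i\<in>{1..k}. snd s3 ''mi'' [] \<le> Fo i {j}" using 7(2) by blast
      let ?post = "\<lambda>s'. (\<forall>i\<in>{1..k}. \<forall>v<Suc j. snd s' ''sv'' [i, v] = Fo i {v}) \<and>
        (\<forall>v<Suc j. \<exists>i\<in>{1..k}. Fo i {v} \<le> snd s' ''be'' []) \<and>
        (snd s' ''be'' [] = 0 \<or> (\<exists>v<n. \<forall>i\<in>{1..k}. snd s' ''be'' [] \<le> Fo i {v}))"
      show ?case
      proof (rule run_If)
        assume "bval s3 (RLess (rx ''be'') (rx ''mi''))"
        then have lt: "snd s' ''be'' [] < snd s3 ''mi'' []" using be by simp
        let ?s4 = "(fst s3, upd (snd s3) ''be'' (map (nval (fst s3)) []) (rval s3 (rx ''mi'')))"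
        have be4: "snd ?s4 ''be'' [] = snd s3 ''mi'' []" "snd ?s4 ''sv'' = snd s3 ''sv''" by (simp_all add: upd_def)
        have "\<forall>v<Suc j. \<exists>i\<in>{1..k}. Fo i {v} \<le> snd s3 ''mi'' []"
          using body(4) lt i by (metis less_Suc_eq less_imp_le order_trans order_refl)
        then have "?post ?s4" unfolding be4 using sv mi body(1) by blast
        then show "run Fo Z (RAssign ''be'' [] (rx ''mi'')) s3 ?post" by (rule run_RAssign)
      next
        assume "\<not> bval s3 (RLess (rx ''be'') (rx ''mi''))"
        then have ge: "snd s3 ''mi'' [] \<le> snd s' ''be'' []" using be by simp
        have "\<forall>v<Suc j. \<exists>i\<in>{1..k}. Fo i {v} \<le> snd s' ''be'' []"
          using body(4) ge i by (metis less_Suc_eq)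
        then have "?post s3" unfolding be using sv body(4) by blast
        then show "run Fo Z Skip s3 ?post" by (rule run_Skip)
      qed
    next
      case 4
      have "Fo 1 {ja. fst s1 ''S'' [ja] \<noteq> 0} = Fo 1 {j}" using S1 by blast
      then show ?case using s1 k by (auto simp: set_scalar_def upd_apply)
    qed (use s1 nZ in \<open>auto simp: agree_def set_scalar_def upd_apply\<close>)
  qed
qed (use n nZ in \<open>auto simp: agree_def set_scalar_def upd_apply\<close>)

lemma run_allowed:
  assumes n: "fst s ''n'' [] = n" "fst s ''k'' [] = k"
  shows "run Fo Z c_allowed s (\<lambda>s'. (\<forall>v<n. fst s' ''E'' [v] \<noteq> 0) \<and>
    (\<forall>i\<in>{1..k}. \<forall>v<n. snd s' ''w'' [i, v] = (if snd s ''sv'' [i, v] \<le> snd s ''G'' [] then 1 else 0)))"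
  unfolding c_allowed_def
proof (rule run_For_conseq[where B = n and I = "\<lambda>j s'. (\<forall>v<j. fst s' ''E'' [v] \<noteq> 0) \<and>
    (\<forall>i\<in>{1..k}. \<forall>v<j. snd s' ''w'' [i, v] = (if snd s ''sv'' [i, v] \<le> snd s ''G'' [] then 1 else 0))"], goal_cases)
  case (6 j s')
  note body = 6
  have s': "fst s' ''k'' [] = k" "snd s' ''sv'' = snd s ''sv''" "snd s' ''G'' = snd s ''G''" using body(2) n by (simp_all add: agree_def)
  show ?case
  proof (rule run_Seq, rule run_NAssign, rule run_For_conseq[where B = k and I = "\<lambda>i' s''.
      (\<forall>i\<in>{1..i'}. snd s'' ''w'' [i, j] = (if snd s ''sv'' [i, j] \<le> snd s ''G'' [] then 1 else 0)) \<and>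
      (\<forall>i v. v \<noteq> j \<longrightarrow> snd s'' ''w'' [i, v] = snd s' ''w'' [i, v])"], goal_cases)
    case (6 i' s2)
    have "fst s2 ''a4'' [] = j" "snd s2 ''sv'' = snd s ''sv''" "snd s2 ''G'' = snd s ''G''"
      using 6(2) s' body(3) by (simp_all add: agree_def upd_def)
    then show ?case using 6(3,4) by (intro run_If run_RAssign) (auto simp: upd_apply le_Suc_eq)
  next
    case (7 s2)
    have "fst s2 ''E'' = (fst s' ''E'')([j] := 1)" using 7(1) body(3) by (simp add: agree_def upd_def)
    then show ?case using 7(2) body(4) by (auto simp: less_Suc_eq)
  qed (use s' nZ in \<open>auto simp: agree_def set_scalar_def upd_apply\<close>)
qed (use n nZ in \<open>auto simp: agree_def set_scalar_def upd_apply\<close>)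

lemma oracle_code_query: "oracle_code Fo Z c_query (\<lambda>_. True) n k Fo"
proof
  fix s :: state and i :: nat assume "fst s ''fi'' [] = i"
  moreover have "Fo i {j. fst s ''S'' [j] \<noteq> 0} = Fo i {u. u < n \<and> fst s ''S'' [u] \<noteq> 0}" by (rule local_cong) auto
  ultimately show "run Fo Z c_query s (\<lambda>s'. snd s' ''val'' [] = Fo i {u. u < n \<and> fst s ''S'' [u] \<noteq> 0})"
    unfolding c_query_def by (intro run_Query) (simp add: upd_apply)
qed (use nZ in auto)

lemma run_levels:
  assumes n: "fst s ''n'' [] = n" "fst s ''k'' [] = k" and kH: "fst s ''kH'' [] = kH" "kH + 1 \<le> Z" and T: "fst s ''T'' [] = T"
  shows "run Fo Z c_levels s (\<lambda>s'. \<forall>i\<in>{1..k}. \<forall>r\<le>kH.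
    snd s' ''lv'' [i, r] = Fo i (level_set n (\<lambda>v. real (kH + 1) * snd s ''X'' [i, v]) (real r * real T)))"
  unfolding c_levels_def
proof (rule run_For_conseq[where B = k and I = "\<lambda>j s'. \<forall>i\<in>{1..j}. \<forall>r\<le>kH.
    snd s' ''lv'' [i, r] = Fo i (level_set n (\<lambda>v. real (kH + 1) * snd s ''X'' [i, v]) (real r * real T))"], goal_cases)
  case (6 j s')
  note body = 6
  have s': "fst s' ''n'' [] = n" "fst s' ''kH'' [] = kH" "fst s' ''T'' [] = T" "snd s' ''X'' = snd s ''X''"
    using body(2) n kH T by (simp_all add: agree_def)
  show ?case
  proof (rule run_For_conseq[where B = "kH + 1" and I = "\<lambda>r' s''. (\<forall>r<r'.
      snd s'' ''lv'' [Suc j, r] = Fo (Suc j) (level_set n (\<lambda>v. real (kH + 1) * snd s ''X'' [Suc j, v]) (real r * real T))) \<and>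
      (\<forall>i r. i \<noteq> Suc j \<longrightarrow> snd s'' ''lv'' [i, r] = snd s' ''lv'' [i, r])"], goal_cases)
    case (6 r s2)
    note mid = 6
    have s2: "fst s2 ''n'' [] = n" "fst s2 ''kH'' [] = kH" "fst s2 ''T'' [] = T" "snd s2 ''X'' = snd s ''X''" "fst s2 ''b1'' [] = j"
      using mid(2) s' body(3) by (simp_all add: agree_def)
    let ?D = "level_set n (\<lambda>v. real (kH + 1) * snd s ''X'' [Suc j, v]) (real r * real T)"
    show ?case
    proof (rule run_Seq, rule run_For_conseq[where B = n and I = "\<lambda>v' s''. \<forall>v<v'. fst s'' ''S'' [v] \<noteq> 0 \<longleftrightarrow> v \<in> ?D"], goal_cases)
      case (6 v s3)
      have "fst s3 ''kH'' [] = kH" "fst s3 ''T'' [] = T" "snd s3 ''X'' = snd s ''X''" "fst s3 ''b1'' [] = j" "fst s3 ''b2'' [] = r"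
        using 6(2) s2 mid(3) by (simp_all add: agree_def)
      then show ?case using 6(1,3,4) by (intro run_If run_NAssign) (auto simp: upd_apply less_Suc_eq level_set_def)
    next
      case (7 s3)
      have s3: "fst s3 ''b1'' [] = j" "fst s3 ''b2'' [] = r" "snd s3 ''lv'' = snd s2 ''lv''"
        using 7(1) s2 mid(3) by (simp_all add: agree_def)
      have "?D \<subseteq> {..<n}" by (auto simp: level_set_def)
      then have "Fo (Suc j) {u. fst s3 ''S'' [u] \<noteq> 0} = Fo (Suc j) ?D" using 7(2) by (intro local_cong) auto
      then show ?case using s3 mid(4) by (intro run_Query) (auto simp: upd_apply less_Suc_eq)
    qed (use s2 nZ in \<open>auto simp: agree_def set_scalar_def upd_apply\<close>)
  next
    case (7 s2)
    then show ?case using body(4) by (auto simp: le_Suc_eq less_Suc_eq_le)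
  qed (use s' kH in \<open>auto simp: agree_def set_scalar_def upd_apply\<close>)
qed (use n nZ in \<open>auto simp: agree_def set_scalar_def upd_apply\<close>)

text \<open>Bellman's equation for one entry, split into attainment by \<open>arg\<close> and
  minimality over all last thresholds.\<close>

definition dp_entry :: "state \<Rightarrow> nat \<Rightarrow> nat \<Rightarrow> bool" where
  "dp_entry s i r \<longleftrightarrow> fst s ''arg'' [Suc i, r] \<le> r \<and>
    snd s ''best'' [Suc i, r] = snd s ''best'' [i, r - fst s ''arg'' [Suc i, r]] + snd s ''lv'' [Suc i, fst s ''arg'' [Suc i, r]] \<and>
    (\<forall>x\<le>r. snd s ''best'' [Suc i, r] \<le> snd s ''best'' [i, r - x] + snd s ''lv'' [Suc i, x])"

lemma dp_entry_cong:
  assumes "dp_entry s i r" "fst s' ''arg'' [Suc i, r] = fst s ''arg'' [Suc i, r]" "snd s' ''best'' [Suc i, r] = snd s ''best'' [Suc i, r]"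
    "\<And>r. snd s' ''best'' [i, r] = snd s ''best'' [i, r]" "snd s' ''lv'' = snd s ''lv''"
  shows "dp_entry s' i r"
  using assms(1) unfolding dp_entry_def assms(2-5) .

lemma dp_entry_set_scalar: "x \<noteq> ''arg'' \<Longrightarrow> dp_entry (set_scalar x v s) i r \<longleftrightarrow> dp_entry s i r"
  by (simp add: dp_entry_def set_scalar_def upd_apply)

lemma set_scalar_cells: "snd (set_scalar x v s) = snd s" "y \<noteq> x \<Longrightarrow> fst (set_scalar x v s) y = fst s y"
  by (simp_all add: set_scalar_def upd_def)

lemma run_dp:
  assumes n: "fst s ''k'' [] = k" and kH: "fst s ''kH'' [] = kH" "kH + 1 \<le> Z"
  shows "run Fo Z c_dp s (\<lambda>s'. (\<forall>r\<le>kH. snd s' ''best'' [0, r] = 0) \<and> (\<forall>i<k. \<forall>r\<le>kH. dp_entry s' i r))"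
  unfolding c_dp_def
proof (rule run_Seq, rule run_For_conseq[where B = "kH + 1" and I = "\<lambda>j s'. \<forall>r<j. snd s' ''best'' [0, r] = 0"], goal_cases)
  case (6 j s')
  then show ?case by (intro run_RAssign) (auto simp: upd_apply less_Suc_eq)
next
  case (7 s1)
  have s1: "fst s1 ''k'' [] = k" "fst s1 ''kH'' [] = kH" using 7(1) n kH by (simp_all add: agree_def)
  have b1: "\<forall>r\<le>kH. snd s1 ''best'' [0, r] = 0" using 7(2) by auto
  show ?case
  proof (rule run_For_conseq[where B = k and I = "\<lambda>j s'. (\<forall>r\<le>kH. snd s' ''best'' [0, r] = 0) \<and> (\<forall>i<j. \<forall>r\<le>kH. dp_entry s' i r)"], goal_cases)
    case (6 j s2)
    note rowj = 6
    have s2: "fst s2 ''k'' [] = k" "fst s2 ''kH'' [] = kH" using rowj(2) s1 by (simp_all add: agree_def)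
    show ?case
    proof (rule run_For_conseq[where B = "kH + 1" and I = "\<lambda>r' s3. (\<forall>r<r'. dp_entry s3 j r) \<and>
        (\<forall>i r. i \<noteq> Suc j \<longrightarrow> snd s3 ''best'' [i, r] = snd s2 ''best'' [i, r] \<and> fst s3 ''arg'' [i, r] = fst s2 ''arg'' [i, r])"], goal_cases)
      case (6 r s3)
      note entry = 6
      have s3: "fst s3 ''d2'' [] = j" "fst s3 ''d3'' [] = r" using entry(2,3) rowj(3) by (simp_all add: agree_def)
      have old: "\<And>i r. i \<noteq> Suc j \<Longrightarrow> snd s3 ''best'' [i, r] = snd s2 ''best'' [i, r] \<and> fst s3 ''arg'' [i, r] = fst s2 ''arg'' [i, r]"
        using entry(4) by blast
      let ?val = "\<lambda>x. snd s3 ''best'' [j, r - x] + snd s3 ''lv'' [Suc j, x]"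
      show ?case
      proof (rule run_Seq, rule run_RAssign, rule run_Seq, rule run_NAssign,
          rule run_For_conseq[where B = "Suc r" and I = "\<lambda>x s'. fst s' ''arg'' [Suc j, r] \<le> r \<and>
             snd s' ''best'' [Suc j, r] = ?val (fst s' ''arg'' [Suc j, r]) \<and> (\<forall>y<x. snd s' ''best'' [Suc j, r] \<le> ?val y) \<and>
             (\<forall>i y. (i, y) \<noteq> (Suc j, r) \<longrightarrow> snd s' ''best'' [i, y] = snd s3 ''best'' [i, y] \<and> fst s' ''arg'' [i, y] = fst s3 ''arg'' [i, y])"], goal_cases)
        case (6 x s4)
        have s4: "fst s4 ''d2'' [] = j" "fst s4 ''d3'' [] = r" "snd s4 ''lv'' = snd s3 ''lv''"
          using 6(2) s3 by (simp_all add: agree_def upd_def)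
        have v4: "snd s4 ''best'' [j, r - x] + snd s4 ''lv'' [Suc j, x] = ?val x" using 6(4) s4 by simp
        show ?case
        proof (rule run_If)
          assume "bval s4 (RLess (RAdd (RCell ''best'' [ix ''d2'', NSub (ix ''d3'') (ix ''d4'')]) (RCell ''lv'' [suc_ix ''d2'', ix ''d4'']))
           (RCell ''best'' [suc_ix ''d2'', ix ''d3'']))"
          then have lt: "?val x < snd s4 ''best'' [Suc j, r]" using s4 6(3) v4 by simp
          then have "\<forall>y<Suc x. ?val x \<le> ?val y" using 6(4) by (auto simp: less_Suc_eq intro: order_trans less_imp_le)
          then show "run Fo Z (RAssign ''best'' [suc_ix ''d2'', ix ''d3''] (RAdd (RCell ''best'' [ix ''d2'', NSub (ix ''d3'') (ix ''d4'')]) (RCell ''lv'' [suc_ix ''d2'', ix ''d4''])) ;;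
            NAssign ''arg'' [suc_ix ''d2'', ix ''d3''] (ix ''d4'')) s4 (\<lambda>s'. fst s' ''arg'' [Suc j, r] \<le> r \<and>
             snd s' ''best'' [Suc j, r] = ?val (fst s' ''arg'' [Suc j, r]) \<and> (\<forall>y<Suc x. snd s' ''best'' [Suc j, r] \<le> ?val y) \<and>
             (\<forall>i y. (i, y) \<noteq> (Suc j, r) \<longrightarrow> snd s' ''best'' [i, y] = snd s3 ''best'' [i, y] \<and> fst s' ''arg'' [i, y] = fst s3 ''arg'' [i, y]))"
            using 6(1,3,4) s4 v4 by (intro run_Seq run_RAssign run_NAssign) (simp add: upd_apply)
        next
          assume "\<not> bval s4 (RLess (RAdd (RCell ''best'' [ix ''d2'', NSub (ix ''d3'') (ix ''d4'')]) (RCell ''lv'' [suc_ix ''d2'', ix ''d4'']))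
           (RCell ''best'' [suc_ix ''d2'', ix ''d3'']))"
          then have "snd s4 ''best'' [Suc j, r] \<le> ?val x" using s4 6(3) v4 by simp
          then show "run Fo Z Skip s4 (\<lambda>s'. fst s' ''arg'' [Suc j, r] \<le> r \<and>
             snd s' ''best'' [Suc j, r] = ?val (fst s' ''arg'' [Suc j, r]) \<and> (\<forall>y<Suc x. snd s' ''best'' [Suc j, r] \<le> ?val y) \<and>
             (\<forall>i y. (i, y) \<noteq> (Suc j, r) \<longrightarrow> snd s' ''best'' [i, y] = snd s3 ''best'' [i, y] \<and> fst s' ''arg'' [i, y] = fst s3 ''arg'' [i, y]))"
            using 6(4) by (intro run_Skip) (auto simp: less_Suc_eq)
        qed
      next
        case (7 s4)
        have lv: "snd s4 ''lv'' = snd s3 ''lv''" using 7(1) by (simp add: agree_def upd_def)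
        have same: "\<And>i y. (i, y) \<noteq> (Suc j, r) \<Longrightarrow> snd s4 ''best'' [i, y] = snd s3 ''best'' [i, y] \<and> fst s4 ''arg'' [i, y] = fst s3 ''arg'' [i, y]"
          using 7(2) by blast
        have bj: "snd s4 ''best'' [j, y] = snd s3 ''best'' [j, y]" for y using same[of j y] by simp
        have "dp_entry s4 j r" unfolding dp_entry_def bj lv using 7(2) by (auto simp: less_Suc_eq_le)
        moreover have "dp_entry s4 j y" if "y < r" for y
        proof (rule dp_entry_cong[OF _ _ _ bj lv])
          show "dp_entry s3 j y" using entry(4) that by blast
        qed (use same[of "Suc j" y] that in simp_all)
        moreover have "snd s4 ''best'' [i, y] = snd s2 ''best'' [i, y] \<and> fst s4 ''arg'' [i, y] = fst s2 ''arg'' [i, y]" if "i \<noteq> Suc j" for i y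
          using same[of i y] old[OF that, of y] that by simp
        ultimately show ?case unfolding less_Suc_eq by blast
      next
        case (3 s4)
        then show ?case using s3 by (simp add: agree_def upd_def)
      next
        case 2
        then show ?case using entry(1) kH by simp
      qed (use s3 in \<open>auto simp: agree_def set_scalar_def upd_apply\<close>)
    next
      case (7 s3)
      have lv: "snd s3 ''lv'' = snd s2 ''lv''" using 7(1) by (simp add: agree_def)
      have "dp_entry s3 i r" if "i < j" "r \<le> kH" for i r
      proof (rule dp_entry_cong[OF _ _ _ _ lv])
        show "dp_entry s2 i r" using rowj(4) that by blast
      qed (use 7(2) that in simp_all)
      moreover have "dp_entry s3 j r" if "r \<le> kH" for r using 7(2) that by simp
      moreover have "\<forall>r\<le>kH. snd s3 ''best'' [0, r] = 0" using 7(2) rowj(4) by simp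
      ultimately show ?case unfolding less_Suc_eq by blast
    next
      case (5 r' s' v)
      then show ?case by (simp add: dp_entry_set_scalar set_scalar_cells)
    qed (use s2 kH in \<open>auto simp: agree_def set_scalar_def upd_apply\<close>)
  next
    case (5 j s' v)
    then show ?case by (simp add: dp_entry_set_scalar set_scalar_cells)
  qed (use s1 b1 nZ in \<open>auto simp: agree_def set_scalar_def upd_apply\<close>)
qed (use kH in \<open>auto simp: agree_def set_scalar_def upd_apply\<close>)

text \<open>Without the last threshold, the others use at most the budget
  \<open>r - x (Suc j)\<close>; minimality of the entry and induction do the rest.\<close>

lemma dp_optimal:
  assumes "\<forall>r\<le>kH. snd s ''best'' [0, r] = 0" "\<forall>i<k. \<forall>r\<le>kH. dp_entry s i r" "j \<le> k" "(\<Sum>i=1..j. x i) \<le> r" "r \<le> kH"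
  shows "snd s ''best'' [j, r] \<le> (\<Sum>i=1..j. snd s ''lv'' [i, x i])"
  using assms(3-)
proof (induction j arbitrary: r)
  case 0
  then show ?case using assms(1) by simp
next
  case (Suc j)
  have "dp_entry s j r" using assms(2) Suc.prems by simp
  moreover have "x (Suc j) \<le> r" using Suc.prems by simp
  ultimately have "snd s ''best'' [Suc j, r] \<le> snd s ''best'' [j, r - x (Suc j)] + snd s ''lv'' [Suc j, x (Suc j)]"
    unfolding dp_entry_def by blast
  moreover have "snd s ''best'' [j, r - x (Suc j)] \<le> (\<Sum>i=1..j. snd s ''lv'' [i, x i])" using Suc by (intro Suc.IH) auto
  ultimately show ?case by simp
qed

text \<open>Backtracking through \<open>arg\<close> from function k downwards. The invariant splits
  the optimal value into the entry still to be traced, for the remaining budget \<open>rem\<close>,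
  and the costs of the thresholds already fixed.\<close>

lemma run_back:
  assumes n: "fst s ''k'' [] = k" and kH: "fst s ''kH'' [] = kH"
    and dp: "\<forall>r\<le>kH. snd s ''best'' [0, r] = 0" "\<forall>i<k. \<forall>r\<le>kH. dp_entry s i r"
  shows "run Fo Z c_back s (\<lambda>s'. (\<Sum>i=1..k. fst s' ''th'' [i]) \<le> kH \<and>
    (\<Sum>i=1..k. snd s ''lv'' [i, fst s' ''th'' [i]]) = snd s ''best'' [k, kH])"
  unfolding c_back_def
proof (intro run_Seq run_NAssign, rule run_For_conseq[where B = k and I = "\<lambda>j s'. fst s' ''rem'' [] + (\<Sum>i\<in>{k-j<..k}. fst s' ''th'' [i]) = kH \<and>
    snd s ''best'' [k - j, fst s' ''rem'' []] + (\<Sum>i\<in>{k-j<..k}. snd s ''lv'' [i, fst s' ''th'' [i]]) = snd s ''best'' [k, kH]"], goal_cases)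
  case (6 j s')
  have s': "fst s' ''k'' [] = k" "fst s' ''arg'' = fst s ''arg''" using 6(2) n by (simp_all add: agree_def upd_def)
  define i where "i = k - Suc j"
  have i: "k - j = Suc i" "i < k" using 6(1) by (auto simp: i_def)
  let ?r = "fst s' ''rem'' []"
  let ?a = "fst s ''arg'' [Suc i, ?r]"
  have "?r \<le> kH" using 6(4) by linarith
  then have "dp_entry s i ?r" using dp(2) i(2) by simp
  then have e: "?a \<le> ?r" "snd s ''best'' [Suc i, ?r] = snd s ''best'' [i, ?r - ?a] + snd s ''lv'' [Suc i, ?a]"
    unfolding dp_entry_def by blast+
  have set: "{k - Suc j<..k} = insert (Suc i) {Suc i<..k}" using i by (auto simp: i_def)
  show ?case
  proof (intro run_Seq run_NAssign)
    let ?s1 = "(upd (fst s') ''th'' (map (nval (fst s')) [NSub (ix ''k'') (ix ''d5'')]) (nval (fst s') (NCell ''arg'' [NSub (ix ''k'') (ix ''d5''), ix ''rem''])), snd s')"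
    let ?s2 = "(upd (fst ?s1) ''rem'' (map (nval (fst ?s1)) []) (nval (fst ?s1) (NSub (ix ''rem'') (NCell ''th'' [NSub (ix ''k'') (ix ''d5'')]))), snd ?s1)"
    have th: "fst ?s2 ''th'' = (fst s' ''th'')([Suc i] := ?a)" and rem: "fst ?s2 ''rem'' [] = ?r - ?a"
      using s' 6(3) i by (simp_all add: upd_def)
    have "(\<Sum>x\<in>{Suc i<..k}. fst ?s2 ''th'' [x]) = (\<Sum>x\<in>{Suc i<..k}. fst s' ''th'' [x])" unfolding th by (intro sum.cong) auto
    moreover have "(\<Sum>x\<in>{Suc i<..k}. snd s ''lv'' [x, fst ?s2 ''th'' [x]]) = (\<Sum>x\<in>{Suc i<..k}. snd s ''lv'' [x, fst s' ''th'' [x]])"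
      unfolding th by (intro sum.cong) auto
    moreover have "fst ?s2 ''th'' [Suc i] = ?a" unfolding th by simp
    moreover have "k - Suc j = i" by (simp add: i_def)
    ultimately show "fst ?s2 ''rem'' [] + (\<Sum>i\<in>{k - Suc j<..k}. fst ?s2 ''th'' [i]) = kH \<and>
      snd s ''best'' [k - Suc j, fst ?s2 ''rem'' []] + (\<Sum>i\<in>{k - Suc j<..k}. snd s ''lv'' [i, fst ?s2 ''th'' [i]]) = snd s ''best'' [k, kH]"
      unfolding set rem using 6(4) e unfolding i(1) by (simp del: upd_def)
  qed
next
  case (7 s')
  have r: "{k - k<..k} = {1..k}" by auto
  have "fst s' ''rem'' [] \<le> kH" using 7(2) by linarith
  then have "snd s ''best'' [k - k, fst s' ''rem'' []] = 0" using dp(1) by simp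
  then show ?case using 7(2) unfolding r by linarith
qed (use n kH nZ in \<open>auto simp: agree_def set_scalar_def upd_apply\<close>)

lemma run_assign:
  assumes n: "fst s ''n'' [] = n" "fst s ''k'' [] = k" and kH: "fst s ''kH'' [] = kH" and T: "fst s ''T'' [] = T"
    and U: "\<And>as. fst s ''U'' as = 0"
  defines "D \<equiv> (\<lambda>i. level_set n (\<lambda>v. real (kH + 1) * snd s ''X'' [i, v]) (real (fst s ''th'' [i]) * real T))"
  shows "run Fo Z c_assign s (\<lambda>s'. \<forall>i\<in>{1..k}. {v. v < n \<and> fst s' ''U'' [i, v] \<noteq> 0} = D i - (\<Union>j\<in>{1..<i}. D j))"
  unfolding c_assign_def
proof (rule run_For_conseq[where B = n and I = "\<lambda>v' s'. \<forall>i\<in>{1..k}. \<forall>v. fst s' ''U'' [i, v] \<noteq> 0 \<longleftrightarrow> v < v' \<and> v \<in> D i \<and> (\<forall>j\<in>{1..<i}. v \<notin> D j)"], goal_cases)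
  case (6 v s')
  note body = 6
  have s': "fst s' ''k'' [] = k" "fst s' ''kH'' [] = kH" "fst s' ''T'' [] = T" "snd s' ''X'' = snd s ''X''" "fst s' ''th'' = fst s ''th''"
    using body(2) n kH T by (simp_all add: agree_def)
  show ?case
  proof (rule run_Seq, rule run_NAssign, rule run_For_conseq[where B = k and I = "\<lambda>i' s''.
      (\<forall>i\<in>{1..i'}. fst s'' ''U'' [i, v] \<noteq> 0 \<longleftrightarrow> v \<in> D i \<and> (\<forall>j\<in>{1..<i}. v \<notin> D j)) \<and>
      (fst s'' ''done'' [] = 0 \<longleftrightarrow> (\<forall>i\<in>{1..i'}. v \<notin> D i)) \<and>
      (\<forall>i u. u \<noteq> v \<or> i' < i \<longrightarrow> fst s'' ''U'' [i, u] = fst s' ''U'' [i, u])"], goal_cases)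
    case (6 i' s2)
    have s2: "fst s2 ''kH'' [] = kH" "fst s2 ''T'' [] = T" "snd s2 ''X'' = snd s ''X''" "fst s2 ''th'' = fst s ''th''" "fst s2 ''e1'' [] = v"
      using 6(2) s' body(3) by (simp_all add: agree_def upd_def)
    have cond: "bval s2 (BAnd (NLess (ix ''done'') (NConst 1)) (RLess (RMul (RNat (NCell ''th'' [suc_ix ''e2''])) (RNat (ix ''T'')))
          (RMul (RNat (suc_ix ''kH'')) (RCell ''X'' [suc_ix ''e2'', ix ''e1''])))) \<longleftrightarrow> fst s2 ''done'' [] = 0 \<and> v \<in> D (Suc i')"
      using s2 6(3) body(1) by (simp add: D_def level_set_def)
    have "Suc i' \<in> {1..k}" using 6(1) by simp
    then have "fst s' ''U'' [Suc i', v] = 0" using body(4) by blast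
    then have old: "fst s2 ''U'' [Suc i', v] = 0" using 6(4) by simp
    have dn: "fst s2 ''done'' [] = 0 \<longleftrightarrow> (\<forall>i\<in>{1..i'}. v \<notin> D i)" using 6(4) by blast
    have range: "{1..<Suc i'} = {1..i'}" by auto
    show ?case
    proof (rule run_If, goal_cases)
      case 1
      then have c: "fst s2 ''done'' [] = 0" "v \<in> D (Suc i')" unfolding cond by blast+
      let ?s3 = "(upd (fst s2) ''U'' (map (nval (fst s2)) [suc_ix ''e2'', ix ''e1'']) (nval (fst s2) (NConst 1)), snd s2)"
      let ?s4 = "(upd (fst ?s3) ''done'' (map (nval (fst ?s3)) []) (nval (fst ?s3) (NConst 1)), snd ?s3)"
      have U4: "fst ?s4 ''U'' = (fst s2 ''U'')([Suc i', v] := 1)" and d4: "fst ?s4 ''done'' [] = 1"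
        using s2 6(3) by (simp_all add: upd_def)
      show ?case
      proof (intro run_Seq run_NAssign conjI ballI allI impI)
        fix i assume i: "i \<in> {1..Suc i'}"
        show "fst ?s4 ''U'' [i, v] \<noteq> 0 \<longleftrightarrow> v \<in> D i \<and> (\<forall>j\<in>{1..<i}. v \<notin> D j)"
        proof (cases "i = Suc i'")
          case True
          then show ?thesis unfolding U4 using c dn range by simp
        next
          case False
          then have "i \<in> {1..i'}" using i by auto
          then show ?thesis unfolding U4 using 6(4) False by auto
        qed
      next
        show "fst ?s4 ''done'' [] = 0 \<longleftrightarrow> (\<forall>i\<in>{1..Suc i'}. v \<notin> D i)" unfolding d4 using c by auto
      next
        show "fst ?s4 ''U'' [i, u] = fst s' ''U'' [i, u]" if "u \<noteq> v \<or> Suc i' < i" for i u unfolding U4 using 6(4) that by auto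
      qed
    next
      case 2
      then have c: "\<not> (fst s2 ''done'' [] = 0 \<and> v \<in> D (Suc i'))" by (simp only: cond not_False_eq_True)
      show ?case
      proof (intro run_Skip conjI ballI allI impI)
        fix i assume i: "i \<in> {1..Suc i'}"
        show "fst s2 ''U'' [i, v] \<noteq> 0 \<longleftrightarrow> v \<in> D i \<and> (\<forall>j\<in>{1..<i}. v \<notin> D j)"
        proof (cases "i = Suc i'")
          case True
          then show ?thesis using c dn old unfolding True range by blast
        next
          case False
          then have "i \<in> {1..i'}" using i by auto
          then show ?thesis using 6(4) by blast
        qed
      next
        have "{1..Suc i'} = insert (Suc i') {1..i'}" by auto
        then show "fst s2 ''done'' [] = 0 \<longleftrightarrow> (\<forall>i\<in>{1..Suc i'}. v \<notin> D i)" using c dn by auto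
      next
        show "fst s2 ''U'' [i, u] = fst s' ''U'' [i, u]" if "u \<noteq> v \<or> Suc i' < i" for i u using 6(4) that by auto
      qed
    qed
  next
    case (7 s2)
    show ?case
    proof (intro ballI allI)
      fix i u assume i: "i \<in> {1..k}"
      show "fst s2 ''U'' [i, u] \<noteq> 0 \<longleftrightarrow> u < Suc v \<and> u \<in> D i \<and> (\<forall>j\<in>{1..<i}. u \<notin> D j)"
      proof (cases "u = v")
        case True
        then show ?thesis using 7(2) i by simp
      next
        case False
        then have "fst s2 ''U'' [i, u] = fst s' ''U'' [i, u]" using 7(2) by blast
        then show ?thesis using body(4) i False by (auto simp: less_Suc_eq)
      qed
    qed
  qed (use s' nZ in \<open>auto simp: agree_def set_scalar_def upd_apply\<close>)
next
  case (7 s')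
  show ?case
  proof
    fix i assume i: "i \<in> {1..k}"
    have "D i \<subseteq> {..<n}" by (auto simp: D_def level_set_def)
    then show "{v. v < n \<and> fst s' ''U'' [i, v] \<noteq> 0} = D i - (\<Union>j\<in>{1..<i}. D j)" using 7(2) i by blast
  qed
qed (use n U nZ in \<open>auto simp: agree_def set_scalar_def upd_apply\<close>)

end

section \<open>The allocation program\<close>

text \<open>Expressions on naturals offer no multiplication, so a product is a loop of additions.
  The second factor is the number of iterations and has to be at most \<open>Z\<close>.\<close>

definition c_mul :: "string \<Rightarrow> nexp \<Rightarrow> nexp \<Rightarrow> com" where
  "c_mul d x y = NAssign d [] (NConst 0) ;; For ''mc'' y (NAssign d [] (NAdd (ix d) x))"

lemma wr_mul [simp]: "wr (c_mul d x y) = {d, ''mc''}"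
  by (auto simp: c_mul_def)

lemma run_mul:
  assumes "\<And>s'. agree {d, ''mc''} s s' \<Longrightarrow> nval (fst s') x = a \<and> nval (fst s') y = b" "b \<le> Z" "d \<noteq> ''mc''"
  shows "run Fo Z (c_mul d x y) s (\<lambda>s'. fst s' d [] = a * b)"
  unfolding c_mul_def
proof (rule run_Seq, rule run_NAssign, rule run_For_conseq[where B = b and I = "\<lambda>j s'. fst s' d [] = a * j"], goal_cases)
  case (3 s')
  then have "agree {d, ''mc''} s s'" using assms(3) by (auto simp: agree_def upd_def)
  then show ?case using assms(1) by blast
next
  case (6 j s')
  then have "agree {d, ''mc''} s s'" using assms(3) by (auto simp: agree_def upd_def)
  then show ?case using assms(1) 6(4) by (intro run_NAssign) (simp add: upd_apply)
qed (use assms(2,3) in \<open>auto simp: set_scalar_def upd_apply\<close>)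

definition c_products :: com where
  "c_products = c_mul ''z2'' (ix ''z'') (ix ''z'') ;; c_mul ''z4'' (ix ''z2'') (ix ''z2'') ;; c_mul ''z5'' (ix ''z4'') (ix ''z'') ;;
     c_mul ''mm'' (ix ''z5'') (NConst 262144) ;; c_mul ''m2'' (ix ''mm'') (ix ''mm'') ;; c_mul ''T'' (ix ''m2'') (ix ''k'') ;;
     c_mul ''l'' (ix ''z4'') (NConst 4096) ;; c_mul ''lN'' (ix ''l'') (suc_ix ''n'') ;; c_mul ''H'' (ix ''lN'') (NConst 16) ;;
     c_mul ''kH'' (ix ''H'') (ix ''k'') ;; Skip"

definition c_params :: com where
  "c_params = NAssign ''K'' [] (ix ''k'') ;; NAssign ''z'' [] (NAdd (ix ''n'') (ix ''k'')) ;; c_products"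

definition c_alloc :: com where
  "c_alloc = c_beta ;; RAssign ''G'' [] (RMul (RNat (ix ''n'')) (rx ''be'')) ;; c_allowed ;; c_solve c_query ;; c_levels ;; c_dp ;; c_back ;; c_assign"

definition msca_program :: com where
  "msca_program = c_params ;; If (NLess (ix ''k'') (NConst 3)) c_sfm c_alloc"

text \<open>A list of known scalar values, which carries all earlier products through a chain of
  multiplications in one hypothesis.\<close>

definition scalars :: "(string \<times> nat) list \<Rightarrow> state \<Rightarrow> bool" where
  "scalars ps s \<longleftrightarrow> (\<forall>(x, v)\<in>set ps. fst s x [] = v)"

lemma run_mul_scalars:
  assumes "scalars ps s" "\<And>s'. scalars ps s' \<Longrightarrow> nval (fst s') x = a \<and> nval (fst s') y = b" "b \<le> Z"
    "d \<notin> fst ` set ps" "''mc'' \<notin> fst ` set ps" "d \<noteq> ''mc''"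
    and rest: "\<And>s'. scalars ((d, a * b) # ps) s' \<Longrightarrow> run Fo Z c s' Q"
  shows "run Fo Z (c_mul d x y ;; c) s Q"
proof -
  have ps: "scalars ps s'" if "agree {d, ''mc''} s s'" for s'
    unfolding scalars_def
  proof
    fix xv assume xv: "xv \<in> set ps"
    then have "fst xv \<noteq> d" "fst xv \<noteq> ''mc''" using assms(4,5) by (metis imageI)+
    then show "case xv of (x, v) \<Rightarrow> fst s' x [] = v" using that assms(1) xv by (auto simp: agree_def scalars_def)
  qed
  have "run Fo Z (c_mul d x y) s (\<lambda>s'. fst s' d [] = a * b)"
    using ps assms(2,3,6) by (intro run_mul) blast+
  then show ?thesis
    by (intro run_Seq) (rule run_conseq, assumption, rule rest, use ps in \<open>simp add: scalars_def\<close>)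
qed

lemma run_params:
  assumes n: "fst s ''n'' [] = n" "fst s ''k'' [] = k" and Z: "262144 * (n + k) ^ 5 \<le> Z" "k \<ge> 1"
  shows "run Fo Z c_params s (\<lambda>s'. fst s' ''n'' [] = n \<and> fst s' ''k'' [] = k \<and>
    fst s' ''K'' [] = k \<and> fst s' ''mm'' [] = 262144 * (n + k) ^ 5 \<and> fst s' ''T'' [] = k * (262144 * (n + k) ^ 5)\<^sup>2 \<and>
    fst s' ''kH'' [] = k * (16 * (4096 * (n + k) ^ 4 * (n + 1))))"
proof -
  define z where "z = n + k"
  have z1: "1 \<le> z" "n \<le> z" "k \<le> z" "n + 1 \<le> z" using Z(2) by (auto simp: z_def)
  have "z * 1 \<le> z * z ^ 4" "z * z * 1 \<le> z * z * z ^ 3" using z1 by (intro mult_left_mono; simp)+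
  moreover have "z * z ^ 4 = z ^ 5" "z * z * z ^ 3 = z ^ 5" by (simp_all add: power_numeral_reduce mult.assoc)
  ultimately have pw: "z \<le> z ^ 5" "z * z \<le> z ^ 5" "1 \<le> z ^ 5" using z1 by simp_all
  have Z5: "262144 * z ^ 5 \<le> Z" using Z by (simp add: z_def)
  have b: "z \<le> Z" "z * z \<le> Z" "k \<le> Z" "n + 1 \<le> Z" "262144 \<le> Z" "4096 \<le> Z" "16 \<le> Z" using pw Z5 z1 by linarith+
  \<comment> \<open>The largest number of additions occurs when m is squared, so m itself has to be
    at most \<open>Z\<close>.\<close>
  have b': "z * z * (z * z) * z * 262144 \<le> Z" using Z5 by (simp add: power_numeral_reduce mult.commute mult.left_commute)
  have products: "run Fo Z c_products s2 (scalars [(''kH'', z * z * (z * z) * 4096 * (n + 1) * 16 * k), (''H'', z * z * (z * z) * 4096 * (n + 1) * 16),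
      (''lN'', z * z * (z * z) * 4096 * (n + 1)), (''l'', z * z * (z * z) * 4096),
      (''T'', z * z * (z * z) * z * 262144 * (z * z * (z * z) * z * 262144) * k), (''m2'', z * z * (z * z) * z * 262144 * (z * z * (z * z) * z * 262144)),
      (''mm'', z * z * (z * z) * z * 262144), (''z5'', z * z * (z * z) * z), (''z4'', z * z * (z * z)), (''z2'', z * z),
      (''z'', z), (''K'', k), (''n'', n), (''k'', k)])"
    if "scalars [(''z'', z), (''K'', k), (''n'', n), (''k'', k)] s2" for s2
    using that unfolding c_products_def
    apply -
    apply (rule run_mul_scalars[where a = z and b = z], assumption, simp add: scalars_def, rule b b', simp, simp, simp)
    apply (rule run_mul_scalars[where a = "z * z" and b = "z * z"], assumption, simp add: scalars_def, rule b b', simp, simp, simp)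
    apply (rule run_mul_scalars[where a = "z * z * (z * z)" and b = z], assumption, simp add: scalars_def, rule b b', simp, simp, simp)
    apply (rule run_mul_scalars[where a = "z * z * (z * z) * z" and b = 262144], assumption, simp add: scalars_def, rule b b', simp, simp, simp)
    apply (rule run_mul_scalars[where a = "z * z * (z * z) * z * 262144" and b = "z * z * (z * z) * z * 262144"], assumption, simp add: scalars_def, rule b b', simp, simp, simp)
    apply (rule run_mul_scalars[where a = "z * z * (z * z) * z * 262144 * (z * z * (z * z) * z * 262144)" and b = k], assumption, simp add: scalars_def, rule b b', simp, simp, simp)
    apply (rule run_mul_scalars[where a = "z * z * (z * z)" and b = 4096], assumption, simp add: scalars_def, rule b b', simp, simp, simp)
    apply (rule run_mul_scalars[where a = "z * z * (z * z) * 4096" and b = "n + 1"], assumption, simp add: scalars_def, rule b b', simp, simp, simp)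
    apply (rule run_mul_scalars[where a = "z * z * (z * z) * 4096 * (n + 1)" and b = 16], assumption, simp add: scalars_def, rule b b', simp, simp, simp)
    apply (rule run_mul_scalars[where a = "z * z * (z * z) * 4096 * (n + 1) * 16" and b = k], assumption, simp add: scalars_def, rule b b', simp, simp, simp)
    apply (rule run_Skip, assumption)
    done
  let ?m = "z * z * (z * z) * z * 262144" and ?h = "z * z * (z * z) * 4096 * (n + 1) * 16 * k"
  have eqs: "?m = 262144 * z ^ 5" "?m * ?m * k = k * (262144 * z ^ 5)\<^sup>2" "?h = k * (16 * (4096 * z ^ 4 * (n + 1)))"
    by (simp_all add: power_numeral_reduce mult.commute mult.left_commute)
  show ?thesis unfolding c_params_def
  proof (rule run_Seq, rule run_NAssign, rule run_Seq, rule run_NAssign, rule run_conseq[OF products], goal_cases)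
    case 1
    then show ?case using n by (simp add: scalars_def upd_apply z_def)
  next
    case (2 s')
    then have "fst s' ''mm'' [] = ?m" "fst s' ''T'' [] = ?m * ?m * k" "fst s' ''kH'' [] = ?h"
      "fst s' ''n'' [] = n" "fst s' ''k'' [] = k" "fst s' ''K'' [] = k" by (simp_all add: scalars_def)
    then show ?case unfolding eqs unfolding z_def by (simp add: power2_eq_square mult.commute)
  qed
qed

section \<open>Correctness of the program on index sets\<close>

lemma split_cost_submodular:
  assumes "submodular_on {..<n} (Fo 1)" "submodular_on {..<n} (Fo 2)"
  shows "submodular_on {..<n} (split_cost Fo n)"
  unfolding submodular_on_def
proof (intro allI impI, elim conjE)
  fix S T :: "nat set" assume ST: "S \<subseteq> {..<n}" "T \<subseteq> {..<n}"
  let ?c = "\<lambda>X. {..<n} - X"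
  have "Fo 1 (S \<union> T) + Fo 1 (S \<inter> T) \<le> Fo 1 S + Fo 1 T" using assms(1) ST unfolding submodular_on_def by blast
  moreover have "Fo 2 (?c S \<union> ?c T) + Fo 2 (?c S \<inter> ?c T) \<le> Fo 2 (?c S) + Fo 2 (?c T)"
    by (rule assms(2)[unfolded submodular_on_def, rule_format]) auto
  moreover have "?c S \<union> ?c T = ?c (S \<inter> T)" "?c S \<inter> ?c T = ?c (S \<union> T)" by auto
  ultimately show "split_cost Fo n S + split_cost Fo n T \<ge> split_cost Fo n (S \<union> T) + split_cost Fo n (S \<inter> T)"
    by (simp add: split_cost_def)
qed

text \<open>Each element goes to its cheapest function, and subadditivity bounds the total by n
  \<beta> = G.\<close>

lemma (in allocation_game) cheap_allocation:
  obtains \<tau> where "\<And>v. v < n \<Longrightarrow> \<tau> v \<in> {1..k}" "(\<Sum>i=1..k. F i {v. v < n \<and> \<tau> v = i}) \<le> G"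
proof -
  obtain \<tau> where \<tau>: "\<And>v. v < n \<Longrightarrow> \<tau> v \<in> {1..k} \<and> F (\<tau> v) {v} \<le> \<beta>" using \<beta>_upper by metis
  have "(\<Sum>i=1..k. F i {v. v < n \<and> \<tau> v = i}) \<le> (\<Sum>i=1..k. \<Sum>v\<in>{v\<in>{..<n}. \<tau> v = i}. F (\<tau> v) {v})"
  proof (rule sum_mono)
    fix i assume i: "i \<in> {1..k}"
    have "F i {v. v < n \<and> \<tau> v = i} \<le> (\<Sum>v\<in>{v. v < n \<and> \<tau> v = i}. F i {v})"
      by (rule submodular_subadditive[OF submod[OF i] empty[OF i]]) auto
    also have "\<dots> = (\<Sum>v\<in>{v\<in>{..<n}. \<tau> v = i}. F (\<tau> v) {v})" by (intro sum.cong) auto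
    finally show "F i {v. v < n \<and> \<tau> v = i} \<le> (\<Sum>v\<in>{v\<in>{..<n}. \<tau> v = i}. F (\<tau> v) {v})" .
  qed
  also have "\<dots> = (\<Sum>v<n. F (\<tau> v) {v})" using \<tau> by (intro sum.group) auto
  also have "\<dots> \<le> (\<Sum>v<n. \<beta>)" using \<tau> by (intro sum_mono) auto
  finally have "(\<Sum>i=1..k. F i {v. v < n \<and> \<tau> v = i}) \<le> G" by (simp add: G_def)
  then show thesis using that \<tau> by blast
qed

text \<open>The guarantee for index sets, with partitions to compare with given as assignments
  \<sigma> of indices to functions.\<close>

definition half_k_optimal :: "eval_oracle \<Rightarrow> nat \<Rightarrow> nat \<Rightarrow> state \<Rightarrow> bool" where
  "half_k_optimal Fo n k s \<longleftrightarrow> (let U = (\<lambda>i. {v. v < n \<and> fst s ''U'' [i, v] \<noteq> 0}) in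
     (\<Union>i\<in>{1..k}. U i) = {..<n} \<and> disjoint_family_on U {1..k} \<and>
     (\<forall>\<sigma>. (\<forall>v<n. \<sigma> v \<in> {1..k}) \<longrightarrow> (\<Sum>i=1..k. Fo i (U i)) \<le> real k / 2 * (\<Sum>i=1..k. Fo i {v. v < n \<and> \<sigma> v = i})))"

lemma level_set_cong: "(\<And>v. v < n \<Longrightarrow> x v = y v) \<Longrightarrow> level_set n x c = level_set n y c"
  by (auto simp: level_set_def)

text \<open>The dynamic program yields a value that the computed thresholds attain and that is a
  lower bound for all admissible thresholds, as \<open>best_thresholds\<close> requires.\<close>

theorem run_alloc:
  assumes k3: "k \<ge> 3" and local: "\<And>i J. Fo i (J \<inter> {..<n}) = Fo i J"
    and submod: "\<And>i. i \<in> {1..k} \<Longrightarrow> submodular_on {..<n} (Fo i)"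
    and mono: "\<And>i. i \<in> {1..k} \<Longrightarrow> mono_on (Pow {..<n}) (Fo i)"
    and empty: "\<And>i. i \<in> {1..k} \<Longrightarrow> Fo i {} = 0"
    and m: "m = 262144 * (n + k) ^ 5" and l: "l = 4096 * (n + k) ^ 4" and H: "H = 16 * (l * (n + 1))" and T: "T = k * m\<^sup>2"
    and Z: "n \<le> Z" "k \<le> Z" "T \<le> Z" "k * H + 1 \<le> Z"
    and st: "fst s ''n'' [] = n" "fst s ''k'' [] = k" "fst s ''K'' [] = k" "fst s ''T'' [] = T" "fst s ''mm'' [] = m" "fst s ''kH'' [] = k * H"
      "\<And>as. fst s ''U'' as = 0"
  shows "run Fo Z c_alloc s (half_k_optimal Fo n k)"
proof -
  interpret alloc_program Fo n k Z using local Z k3 by unfold_locales auto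
  show ?thesis unfolding c_alloc_def
  proof (rule run_Seq, rule run_conseq[OF run_beta[OF st(1,2)]], rule run_Seq, rule run_RAssign, goal_cases)
    case (1 s1)
    define \<beta> where "\<beta> = snd s1 ''be'' []"
    let ?s2 = "(fst s1, upd (snd s1) ''G'' (map (nval (fst s1)) []) (rval s1 (RMul (RNat (ix ''n'')) (rx ''be''))))"
    interpret A: allocation_game n k Fo \<beta> m l "n + 1" H "k * H + 1" T
      using k3 submod mono empty 1(2) m l H T by unfold_locales (auto simp: \<beta>_def)
    have s1: "fst s1 ''n'' [] = n" using 1(1) st by (simp add: agree_def)
    have s2: "fst ?s2 ''n'' [] = n" "fst ?s2 ''k'' [] = k" "snd ?s2 ''G'' [] = A.G" "snd ?s2 ''sv'' = snd s1 ''sv''"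
      using 1(1) st s1 by (simp_all add: agree_def upd_def A.G_def) (simp add: \<beta>_def)
    show ?case
    proof (rule run_Seq, rule run_conseq[OF run_allowed[OF s2(1,2)]], goal_cases)
      case (1 s3)
      note sv = \<open>(\<forall>i\<in>{1..k}. \<forall>v<n. snd s1 ''sv'' [i, v] = Fo i {v}) \<and> (\<forall>v<n. \<exists>i\<in>{1..k}. Fo i {v} \<le> snd s1 ''be'' []) \<and>
        (snd s1 ''be'' [] = 0 \<or> (\<exists>v<n. \<forall>i\<in>{1..k}. snd s1 ''be'' [] \<le> Fo i {v}))\<close>
      interpret O: oracle_code Fo Z c_query "\<lambda>_. True" n k Fo by (rule oracle_code_query)
      have s3: "fst s3 ''n'' [] = n" "fst s3 ''k'' [] = k" "fst s3 ''K'' [] = k" "fst s3 ''T'' [] = T" "fst s3 ''mm'' [] = m"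
        "fst s3 ''kH'' [] = k * H" "\<And>as. fst s3 ''U'' as = 0" "snd s3 ''G'' [] = A.G"
        using 1(1) \<open>agree (wr c_beta) s s1\<close> st s2 by (simp_all add: agree_def upd_def)
      have mG: "real (fst s3 ''mm'' []) * snd s3 ''G'' [] = real m * A.G" using s3 by simp
      have w: "snd s3 ''w'' [i, v] = A.w0 i v" if "i \<in> {1..k}" "v < n" for i v
        using 1(2) that s2(3,4) sv by (simp add: A.w0_def)
      have E: "{..<n} = {u. u < n \<and> fst s3 ''E'' [u] \<noteq> 0}" using 1(2) by auto
      show ?case
      proof (rule run_Seq, rule run_conseq[OF O.run_solve[OF TrueI s3(1,3,4) Z(3) mG w E]], goal_cases)
        case (3 s4)
        have s4: "fst s4 ''n'' [] = n" "fst s4 ''k'' [] = k" "fst s4 ''T'' [] = T" "fst s4 ''kH'' [] = k * H" "\<And>as. fst s4 ''U'' as = 0"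
          using 3(1) s3 by (simp_all add: agree_def)
        have X4: "snd s4 ''X'' [i, v] = A.X i v" if "i \<in> {1..k}" "v < n" for i v using 3(2) that by (simp add: A.X_def)
        let ?D = "\<lambda>i c. level_set n (\<lambda>v. real (k * H + 1) * snd s4 ''X'' [i, v]) c"
        have D: "?D i c = level_set n (\<lambda>v. real (k * H + 1) * A.X i v) c" if "i \<in> {1..k}" for i c
          using X4[OF that] by (intro level_set_cong) simp
        show ?case
        proof (rule run_Seq, rule run_conseq[OF run_levels[OF s4(1,2,4) Z(4) s4(3)]], goal_cases)
          case (1 s5)
          have s5: "fst s5 ''n'' [] = n" "fst s5 ''k'' [] = k" "fst s5 ''T'' [] = T" "fst s5 ''kH'' [] = k * H" "\<And>as. fst s5 ''U'' as = 0"
            "snd s5 ''X'' = snd s4 ''X''" using 1(1) s4 by (simp_all add: agree_def)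
          have lv5: "snd s5 ''lv'' [i, r] = A.lev i r" if "i \<in> {1..k}" "r \<le> k * H" for i r
            using 1(2) that D unfolding A.lev_def by simp
          show ?case
          proof (rule run_Seq, rule run_conseq[OF run_dp[OF s5(2,4) Z(4)]], goal_cases)
            case (1 s6)
            have s6: "fst s6 ''n'' [] = n" "fst s6 ''k'' [] = k" "fst s6 ''T'' [] = T" "fst s6 ''kH'' [] = k * H" "\<And>as. fst s6 ''U'' as = 0"
              "snd s6 ''X'' = snd s4 ''X''" "snd s6 ''lv'' = snd s5 ''lv''" using 1(1) s5 by (simp_all add: agree_def)
            have dp: "\<forall>r\<le>k * H. snd s6 ''best'' [0, r] = 0" "\<forall>i<k. \<forall>r\<le>k * H. dp_entry s6 i r" using 1(2) by blast+
            define C where "C = snd s6 ''best'' [k, k * H]"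
            have range: "x i \<le> k * H" if "(\<Sum>i=1..k. x i) \<le> k * H" "i \<in> {1..k}" for x :: "nat \<Rightarrow> nat" and i
              using that member_le_sum[of i "{1..k}" x] by fastforce
            have C_le: "C \<le> (\<Sum>i=1..k. A.lev i (x i))" if x: "(\<Sum>i=1..k. x i) \<le> k * H" for x
            proof -
              have "C \<le> (\<Sum>i=1..k. snd s6 ''lv'' [i, x i])" unfolding C_def by (rule dp_optimal[OF dp order_refl x order_refl])
              also have "\<dots> = (\<Sum>i=1..k. A.lev i (x i))" using s6(7) lv5 range[OF x] by (intro sum.cong) auto
              finally show ?thesis .
            qed
            show ?case
            proof (rule run_Seq, rule run_conseq[OF run_back[OF s6(2,4) dp]], goal_cases)
              case (1 s7)
              have s7: "fst s7 ''n'' [] = n" "fst s7 ''k'' [] = k" "fst s7 ''T'' [] = T" "fst s7 ''kH'' [] = k * H" "\<And>as. fst s7 ''U'' as = 0"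
                "snd s7 ''X'' = snd s4 ''X''" using 1(1) s6 by (simp_all add: agree_def)
              let ?x = "\<lambda>i. fst s7 ''th'' [i]"
              have x: "(\<Sum>i=1..k. ?x i) \<le> k * H" using 1(2) by blast
              have cost: "(\<Sum>i=1..k. A.lev i (?x i)) = C"
              proof -
                have "(\<Sum>i=1..k. A.lev i (?x i)) = (\<Sum>i=1..k. snd s6 ''lv'' [i, ?x i])" using s6(7) lv5 range[OF x] by (intro sum.cong) auto
                then show ?thesis using 1(2) by (simp add: C_def)
              qed
              define L where "L i = level_set n (\<lambda>v. real (k * H + 1) * A.X i v) (real (?x i) * real T)" for i
              have L: "level_set n (\<lambda>v. real (k * H + 1) * snd s7 ''X'' [i, v]) (real (?x i) * real T) = L i" if "i \<in> {1..k}" for i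
                using D[OF that] s7(6) by (simp add: L_def)
              have Ln: "L i \<subseteq> {..<n}" for i by (auto simp: L_def level_set_def)
              show ?case
              proof (rule run_conseq[OF run_assign[OF s7(1,2,4,3,5)]], goal_cases)
                case (1 s8)
                define U where "U i = {v. v < n \<and> fst s8 ''U'' [i, v] \<noteq> 0}" for i
                have U: "U i = L i - (\<Union>j\<in>{1..<i}. L j)" if i: "i \<in> {1..k}" for i
                proof -
                  have "(\<Union>j\<in>{1..<i}. level_set n (\<lambda>v. real (k * H + 1) * snd s7 ''X'' [j, v]) (real (?x j) * real T)) = (\<Union>j\<in>{1..<i}. L j)"
                    using L i by (intro SUP_cong) auto
                  then show ?thesis using 1(2) i L[OF i] unfolding U_def by simp
                qed
                have cover: "(\<Union>i\<in>{1..k}. U i) = {..<n}"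
                proof
                  show "(\<Union>i\<in>{1..k}. U i) \<subseteq> {..<n}" by (auto simp: U_def)
                  show "{..<n} \<subseteq> (\<Union>i\<in>{1..k}. U i)"
                  proof
                    fix v assume "v \<in> {..<n}"
                    then have "\<exists>i. i \<in> {1..k} \<and> v \<in> L i" using A.cover[OF x, of v] by (auto simp: L_def)
                    then obtain i where i: "i \<in> {1..k} \<and> v \<in> L i" "\<And>j. j < i \<Longrightarrow> \<not> (j \<in> {1..k} \<and> v \<in> L j)"
                      using exists_least_iff[of "\<lambda>i. i \<in> {1..k} \<and> v \<in> L i"] by blast
                    then have "v \<in> U i" using U[of i] by auto
                    then show "v \<in> (\<Union>i\<in>{1..k}. U i)" using i by blast
                  qed
                qed
                have disj: "disjoint_family_on U {1..k}"
                  unfolding disjoint_family_on_def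
                proof (intro ballI impI)
                  fix i j assume ij: "i \<in> {1..k}" "j \<in> {1..k}" "i \<noteq> j"
                  then consider "i < j" | "j < i" by linarith
                  then show "U i \<inter> U j = {}" using U[OF ij(1)] U[OF ij(2)] ij by cases auto
                qed
                have "(\<Sum>i=1..k. Fo i (U i)) \<le> (\<Sum>i=1..k. A.lev i (?x i))"
                proof (rule sum_mono)
                  fix i assume i: "i \<in> {1..k}"
                  have "Fo i (U i) \<le> Fo i (L i)" using U[OF i] Ln[of i] by (intro mono_onD[OF mono[OF i]]) auto
                  then show "Fo i (U i) \<le> A.lev i (?x i)" by (simp only: A.lev_def L_def)
                qed
                then have UC: "(\<Sum>i=1..k. Fo i (U i)) \<le> C" using cost by simp
                have C0: "C \<ge> 0" unfolding cost[symmetric] by (intro sum_nonneg A.lev_nonneg)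
                have "(\<Sum>i=1..k. Fo i (U i)) \<le> real k / 2 * (\<Sum>i=1..k. Fo i {v. v < n \<and> \<sigma> v = i})" if \<sigma>: "\<forall>v<n. \<sigma> v \<in> {1..k}" for \<sigma>
                proof (cases "(\<Sum>i=1..k. Fo i {v. v < n \<and> \<sigma> v = i}) \<le> A.G")
                  case True
                  have "C \<le> real k / 2 * (\<Sum>i=1..k. Fo i {v. v < n \<and> \<sigma> v = i})"
                    using \<sigma> by (intro A.best_thresholds[OF _ refl True C0 C_le]) auto
                  then show ?thesis using UC by simp
                next
                  \<comment> \<open>An allocation of cost above G may use pairs that are not
                    admissible in the game. The cheap allocation is covered by the analysis and
                    costs less.\<close>
                  case False
                  obtain \<tau> where \<tau>: "\<And>v. v < n \<Longrightarrow> \<tau> v \<in> {1..k}" "(\<Sum>i=1..k. Fo i {v. v < n \<and> \<tau> v = i}) \<le> A.G"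
                    using A.cheap_allocation by metis
                  have "C \<le> real k / 2 * (\<Sum>i=1..k. Fo i {v. v < n \<and> \<tau> v = i})"
                    by (rule A.best_thresholds[OF \<tau>(1) refl \<tau>(2) C0 C_le])
                  also have "\<dots> \<le> real k / 2 * (\<Sum>i=1..k. Fo i {v. v < n \<and> \<sigma> v = i})"
                    using \<tau>(2) False by (intro mult_left_mono) auto
                  finally show ?thesis using UC by simp
                qed
                then show ?case using cover disj unfolding half_k_optimal_def U_def Let_def by blast
              qed
            qed
          qed
        qed
      qed
    qed
  qed
qed

text \<open>For k = 2 the factor k / 2 is 1, and a minimizer of \<open>split_cost\<close> together
  with its complement is an optimal allocation.\<close>

theorem run_pair:
  assumes local: "\<And>i J. Fo i (J \<inter> {..<n}) = Fo i J"
    and submod: "\<And>i. i \<in> {1..2} \<Longrightarrow> submodular_on {..<n} (Fo i)"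
    and m: "m = 262144 * (n + 2) ^ 5" and Z: "n + 2 \<le> Z" "2 * m\<^sup>2 \<le> Z"
    and st: "fst s ''n'' [] = n" "fst s ''K'' [] = 2" "fst s ''T'' [] = 2 * m\<^sup>2" "fst s ''mm'' [] = m" "\<And>as. fst s ''U'' as = 0"
  shows "run Fo Z c_sfm s (half_k_optimal Fo n 2)"
proof -
  interpret sfm_program Fo n Z using local Z by unfold_locales
  have pw: "(n + 2) ^ 3 \<le> (n + 2) ^ 5" "(n + 2)\<^sup>2 \<le> (n + 2) ^ 5" "n ^ 3 \<le> (n + 2) ^ 3" "1 \<le> (n + 2) ^ 5"
    by (intro power_increasing power_mono one_le_power; simp)+
  then have m_ge: "m \<ge> 2" "18 * n ^ 3 < m" "(n + 2)\<^sup>2 < m" unfolding m by linarith+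
  have sm: "submodular_on {..<n} f" by (intro split_cost_submodular submod) auto
  show ?thesis
  proof (rule run_conseq[OF run_sfm[OF st Z(2) m_ge sm]])
    fix s' :: state assume "\<exists>X\<subseteq>{..<n}. (\<forall>Y\<subseteq>{..<n}. f X \<le> f Y) \<and> {v. v < n \<and> fst s' ''U'' [1, v] \<noteq> 0} = X
      \<and> {v. v < n \<and> fst s' ''U'' [2, v] \<noteq> 0} = {..<n} - X"
    then obtain X where X: "X \<subseteq> {..<n}" "\<And>Y. Y \<subseteq> {..<n} \<Longrightarrow> f X \<le> f Y" "{v. v < n \<and> fst s' ''U'' [1, v] \<noteq> 0} = X"
      "{v. v < n \<and> fst s' ''U'' [2, v] \<noteq> 0} = {..<n} - X" by blast
    define U where "U i = {v. v < n \<and> fst s' ''U'' [i, v] \<noteq> 0}" for i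
    have U: "U 1 = X" "U 2 = {..<n} - X" using X by (simp_all only: U_def)
    have two: "{1..2} = {1, 2 :: nat}" by auto
    have "(\<Sum>i=1..2. Fo i (U i)) \<le> (\<Sum>i=1..2. Fo i {v. v < n \<and> \<sigma> v = i})" if \<sigma>: "\<forall>v<n. \<sigma> v \<in> {1..2}" for \<sigma>
    proof -
      have "{..<n} - {v. v < n \<and> \<sigma> v = 1} = {v. v < n \<and> \<sigma> v = 2}" using \<sigma> unfolding two by force
      then show ?thesis using X(2)[of "{v. v < n \<and> \<sigma> v = 1}"] U unfolding two by (auto simp: split_cost_def)
    qed
    moreover have "(\<Union>i\<in>{1..2}. U i) = {..<n}" "disjoint_family_on U {1..2}"
      using X(1) U unfolding two by (auto simp: disjoint_family_on_def)
    ultimately show "half_k_optimal Fo n 2 s'" unfolding half_k_optimal_def U_def Let_def by simp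
  qed
qed

text \<open>\<open>Z\<close> has to exceed all loop bounds at once. The decisive ones are the number
  of rounds k m^2 = 2^36 k (n + k)^10 and the size k H + 1 of the threshold grid.\<close>

lemma run_msca_program:
  assumes k: "k \<ge> 2" and local: "\<And>i J. Fo i (J \<inter> {..<n}) = Fo i J"
    and submod: "\<And>i. i \<in> {1..k} \<Longrightarrow> submodular_on {..<n} (Fo i)"
    and mono: "\<And>i. i \<in> {1..k} \<Longrightarrow> mono_on (Pow {..<n}) (Fo i)"
    and empty: "\<And>i. i \<in> {1..k} \<Longrightarrow> Fo i {} = 0"
    and Z: "Z = 2 ^ 40 * (n + k) ^ 12"
  shows "run Fo Z msca_program (input_state n k) (half_k_optimal Fo n k)"
  unfolding msca_program_def
proof (rule run_Seq, rule run_conseq[OF run_params[of _ n k]], goal_cases)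
  define z where "z = n + k"
  have z: "n + 2 \<le> z" "k \<le> z" "n + 1 \<le> z" "1 \<le> z" using k by (auto simp: z_def)
  have "z ^ 1 \<le> z ^ 12" "z ^ 5 \<le> z ^ 12" "z ^ 6 \<le> z ^ 12" "z ^ 11 \<le> z ^ 12" using z(4) by (intro power_increasing; simp)+
  then have pw: "z \<le> z ^ 12" "z ^ 5 \<le> z ^ 12" "z ^ 6 \<le> z ^ 12" "z ^ 11 \<le> z ^ 12" "1 \<le> z ^ 12" using z(4) by auto
  have Z': "Z = 1099511627776 * z ^ 12" by (simp add: Z z_def)
  {
    case 1
    show ?case by (simp add: input_state_def upd_apply)
  next
    case 2
    show ?case by (simp add: input_state_def upd_apply)
  next
    case 3
    show ?case using pw Z' unfolding z_def[symmetric] by linarith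
  next
    case 4
    show ?case using k by simp
  next
    case (5 s1)
    have "fst s1 ''U'' = fst (input_state n k) ''U''" using 5(1) by (simp add: agree_def c_params_def c_products_def)
    then have U: "fst s1 ''U'' as = 0" for as by (simp add: input_state_def upd_apply)
    define m where "m = 262144 * (n + k) ^ 5"
    have s1: "fst s1 ''n'' [] = n" "fst s1 ''k'' [] = k" "fst s1 ''K'' [] = k" "fst s1 ''mm'' [] = m" "fst s1 ''T'' [] = k * m\<^sup>2"
      "fst s1 ''kH'' [] = k * (16 * (4096 * (n + k) ^ 4 * (n + 1)))" using 5(2) unfolding m_def by blast+
    have kz: "k * z ^ 10 \<le> z ^ 11" using z(2) mult_right_mono[of k z "z ^ 10"] by (simp add: power_numeral_reduce)
    have "k * m\<^sup>2 = 68719476736 * (k * z ^ 10)" by (simp add: m_def z_def power_mult_distrib flip: power_mult)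
    then have TZ: "k * m\<^sup>2 \<le> Z" using kz pw Z' by linarith
    have "k * (n + 1) * z ^ 4 \<le> z * z * z ^ 4" using z by (intro mult_mono) auto
    then have "k * (n + 1) * z ^ 4 \<le> z ^ 6" by (simp add: power_numeral_reduce mult.assoc)
    moreover have "k * (16 * (4096 * (n + k) ^ 4 * (n + 1))) = 65536 * (k * (n + 1) * z ^ 4)" by (simp add: z_def algebra_simps)
    ultimately have HZ: "k * (16 * (4096 * (n + k) ^ 4 * (n + 1))) + 1 \<le> Z" using pw Z' by linarith
    show ?case
    proof (rule run_If)
      assume "bval s1 (NLess (ix ''k'') (NConst 3))"
      then have k2: "k = 2" using s1 k by simp
      have "n + 2 \<le> Z" using z pw Z' by linarith
      then show "run Fo Z c_sfm s1 (half_k_optimal Fo n k)"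
        unfolding k2 using local submod s1 U TZ m_def unfolding k2 by (intro run_pair[where m = m]) auto
    next
      assume "\<not> bval s1 (NLess (ix ''k'') (NConst 3))"
      then have k3: "k \<ge> 3" using s1 by simp
      have "n \<le> Z" "k \<le> Z" using z pw Z' by linarith+
      then show "run Fo Z c_alloc s1 (half_k_optimal Fo n k)"
        by (intro run_alloc[OF k3 local submod mono empty m_def refl refl refl _ _ TZ HZ s1(1,2,3,5,4,6) U]) auto
    qed
  }
qed

section \<open>Transfer to the given ground set\<close>

text \<open>Allocations are functions on all naturals, but their cost depends only on the
  restriction to 1, ..., k. Hence there are finitely many costs and \<open>Min\<close> is
  attained.\<close>

lemma msca_opt_attained:
  assumes "mono_msca_instance N k f"
  obtains X where "allocation N k X" "msca_opt N k f = allocation_cost k f X"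
proof -
  let ?C = "{allocation_cost k f X | X. allocation N k X}"
  have fin: "finite N" and k: "k \<ge> 2" using assms by (auto simp: mono_msca_instance_def)
  have "?C \<subseteq> allocation_cost k f ` ({1..k} \<rightarrow>\<^sub>E Pow N)"
  proof
    fix c assume "c \<in> ?C"
    then obtain X where X: "c = allocation_cost k f X" "allocation N k X" by blast
    then have "restrict X {1..k} \<in> {1..k} \<rightarrow>\<^sub>E Pow N" by (auto simp: allocation_def)
    moreover have "c = allocation_cost k f (restrict X {1..k})" using X by (simp add: allocation_cost_def)
    ultimately show "c \<in> allocation_cost k f ` ({1..k} \<rightarrow>\<^sub>E Pow N)" by blast
  qed
  moreover have "finite ({1..k} \<rightarrow>\<^sub>E Pow N)" using fin by (intro finite_PiE) auto
  ultimately have "finite ?C" using finite_subset by blast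
  moreover have "allocation N k (\<lambda>i. if i = 1 then N else {})"
    using k by (auto simp: allocation_def disjoint_family_on_def split: if_splits)
  then have "?C \<noteq> {}" by blast
  ultimately have "msca_opt N k f \<in> ?C" unfolding msca_opt_def by (rule Min_in)
  then show thesis using that by blast
qed

theorem theorem2:
  "\<exists>(prog :: com) (p :: nat poly).
     \<forall>(N :: 'a set) (e :: nat \<Rightarrow> 'a) (k :: nat) (f :: nat \<Rightarrow> 'a set \<Rightarrow> real) (n :: nat).
       mono_msca_instance N k f \<and> card N = n \<and> bij_betw e {..<n} N \<longrightarrow>
       (\<exists>t s U. exec (instance_oracle n e f) prog (input_state n k) t s \<and>
          t \<le> poly p (n + k) \<and>
          U = output_sets n e s \<and>
          allocation N k U \<and>
          (\<Sum>i=1..k. f i (U i)) \<le> real k / 2 * msca_opt N k f)"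
proof -
  \<comment> \<open>One polynomial for all instances: \<open>Z\<close> is a monomial in n + k, and
    the step bound of the fixed program is polynomial in \<open>Z\<close>.\<close>
  obtain p :: "nat poly" where p: "\<And>z. steps_bound (poly (monom (2 ^ 40) 12) z) msca_program \<le> poly p z"
    using steps_bound_polynomial by blast
  show ?thesis
  proof (rule exI[of _ msca_program], rule exI[of _ p], intro allI impI, elim conjE)
    fix N :: "'a set" and e :: "nat \<Rightarrow> 'a" and k :: nat and f :: "nat \<Rightarrow> 'a set \<Rightarrow> real" and n :: nat
    assume inst: "mono_msca_instance N k f" and e: "bij_betw e {..<n} N"
    let ?F = "instance_oracle n e f"
    have k: "k \<ge> 2" and f: "\<And>i. i \<in> {1..k} \<Longrightarrow> f i {} = 0 \<and> mono_on (Pow N) (f i) \<and> submodular_on N (f i)"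
      using inst by (auto simp: mono_msca_instance_def)
    have inj: "inj_on e {..<n}" and img: "e ` {..<n} = N" using e by (auto simp: bij_betw_def)
    have F: "?F i S = f i (e ` S)" if "S \<subseteq> {..<n}" for i S using that by (simp add: instance_oracle_def Int_absorb2)
    have sub: "e ` S \<subseteq> N" if "S \<subseteq> {..<n}" for S using that img by blast
    have "submodular_on {..<n} (?F i)" if i: "i \<in> {1..k}" for i
      unfolding submodular_on_def
    proof (intro allI impI, elim conjE)
      fix S T assume ST: "S \<subseteq> {..<n}" "T \<subseteq> {..<n}"
      have "f i (e ` S \<union> e ` T) + f i (e ` S \<inter> e ` T) \<le> f i (e ` S) + f i (e ` T)"
        using f[OF i] sub ST unfolding submodular_on_def by blast
      moreover have "e ` S \<inter> e ` T = e ` (S \<inter> T)" using inj_on_image_Int[OF inj ST] by simp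
      ultimately show "?F i S + ?F i T \<ge> ?F i (S \<union> T) + ?F i (S \<inter> T)"
        using ST F[of S] F[of T] F[of "S \<union> T"] F[of "S \<inter> T"] by (simp add: image_Un le_infI1)
    qed
    moreover have "mono_on (Pow {..<n}) (?F i)" if i: "i \<in> {1..k}" for i
    proof (rule mono_onI)
      fix S T assume ST: "S \<in> Pow {..<n}" "T \<in> Pow {..<n}" "S \<subseteq> T"
      have "f i (e ` S) \<le> f i (e ` T)" using f[OF i] ST sub[of S] sub[of T] by (intro mono_onD[of "Pow N" "f i"]) auto
      then show "?F i S \<le> ?F i T" using F[of S] F[of T] ST by simp
    qed
    moreover have "?F i {} = 0" if "i \<in> {1..k}" for i using f[OF that] by (simp add: instance_oracle_def)
    moreover have "?F i (J \<inter> {..<n}) = ?F i J" for i J by (simp add: instance_oracle_def Int_assoc)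
    ultimately have "run ?F (2 ^ 40 * (n + k) ^ 12) msca_program (input_state n k) (half_k_optimal ?F n k)"
      using k by (intro run_msca_program) auto
    then obtain t s where ex: "exec ?F msca_program (input_state n k) t s"
      and t: "t \<le> steps_bound (2 ^ 40 * (n + k) ^ 12) msca_program" and opt: "half_k_optimal ?F n k s"
      unfolding run_def by blast
    define V where "V i = {v. v < n \<and> fst s ''U'' [i, v] \<noteq> 0}" for i
    have V: "(\<Union>i\<in>{1..k}. V i) = {..<n}" "disjoint_family_on V {1..k}"
      and best: "\<And>\<sigma>. \<forall>v<n. \<sigma> v \<in> {1..k} \<Longrightarrow> (\<Sum>i=1..k. ?F i (V i)) \<le> real k / 2 * (\<Sum>i=1..k. ?F i {v. v < n \<and> \<sigma> v = i})"
      using opt unfolding half_k_optimal_def Let_def V_def by blast+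
    have Vn: "V i \<subseteq> {..<n}" for i by (auto simp: V_def)
    have out: "output_sets n e s i = e ` V i" for i by (simp add: output_sets_def V_def)
    have "allocation N k (output_sets n e s)"
      unfolding allocation_def
    proof
      show "(\<Union>i\<in>{1..k}. output_sets n e s i) = N" unfolding out img[symmetric] V(1)[symmetric] by blast
      show "disjoint_family_on (output_sets n e s) {1..k}"
        unfolding disjoint_family_on_def out
      proof (intro ballI impI)
        fix i j assume "i \<in> {1..k}" "j \<in> {1..k}" "i \<noteq> j"
        then have "V i \<inter> V j = {}" using V(2) by (auto simp: disjoint_family_on_def)
        then show "e ` V i \<inter> e ` V j = {}" using inj_on_image_Int[OF inj Vn Vn, of i j] by simp
      qed
    qed
    moreover have "(\<Sum>i=1..k. f i (output_sets n e s i)) \<le> real k / 2 * msca_opt N k f"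
    proof -
      obtain X where X: "allocation N k X" "msca_opt N k f = allocation_cost k f X" using msca_opt_attained[OF inst] by blast
      have "\<exists>i\<in>{1..k}. e v \<in> X i" if "v < n" for v using X(1) img that unfolding allocation_def by blast
      \<comment> \<open>An optimal partition of \<open>N\<close> is turned into an assignment of
        indices; disjointness ensures that its classes are mapped back onto the parts.\<close>
      then obtain \<sigma> where \<sigma>: "\<And>v. v < n \<Longrightarrow> \<sigma> v \<in> {1..k} \<and> e v \<in> X (\<sigma> v)" by metis
      have part: "e ` {v. v < n \<and> \<sigma> v = i} = X i" if i: "i \<in> {1..k}" for i
      proof
        show "e ` {v. v < n \<and> \<sigma> v = i} \<subseteq> X i" using \<sigma> by auto
        show "X i \<subseteq> e ` {v. v < n \<and> \<sigma> v = i}"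
        proof
          fix x assume x: "x \<in> X i"
          then have "x \<in> N" using X(1) i unfolding allocation_def by blast
          then obtain v where v: "v < n" "x = e v" using img by blast
          have "\<sigma> v = i"
          proof (rule ccontr)
            assume "\<sigma> v \<noteq> i"
            then have "X (\<sigma> v) \<inter> X i = {}" using X(1) \<sigma>[OF v(1)] i unfolding allocation_def disjoint_family_on_def by blast
            then show False using \<sigma>[OF v(1)] x v(2) by blast
          qed
          then show "x \<in> e ` {v. v < n \<and> \<sigma> v = i}" using v by blast
        qed
      qed
      have "(\<Sum>i=1..k. f i (output_sets n e s i)) = (\<Sum>i=1..k. ?F i (V i))" by (simp add: out F[OF Vn])
      also have "\<dots> \<le> real k / 2 * (\<Sum>i=1..k. ?F i {v. v < n \<and> \<sigma> v = i})" using \<sigma> by (intro best) blast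
      also have "(\<Sum>i=1..k. ?F i {v. v < n \<and> \<sigma> v = i}) = (\<Sum>i=1..k. f i (X i))"
      proof (rule sum.cong[OF refl])
        fix i assume i: "i \<in> {1..k}"
        have "?F i {v. v < n \<and> \<sigma> v = i} = f i (e ` {v. v < n \<and> \<sigma> v = i})" by (rule F) auto
        then show "?F i {v. v < n \<and> \<sigma> v = i} = f i (X i)" by (simp only: part[OF i])
      qed
      finally show ?thesis using X(2) by (simp add: allocation_cost_def)
    qed
    moreover have "t \<le> poly p (n + k)" using t p[of "n + k"] by (simp add: poly_monom)
    ultimately show "\<exists>t s U. exec ?F msca_program (input_state n k) t s \<and> t \<le> poly p (n + k) \<and> U = output_sets n e s \<and>
        allocation N k U \<and> (\<Sum>i=1..k. f i (U i)) \<le> real k / 2 * msca_opt N k f" using ex by blast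
  qed
qed

end
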